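(* Assume Assumptions A and C, and for each $\gamma\in(0,1]$ let $u^\gamma$ be the value of the approximating game (which exists, i.e. $\underline u^\gamma=\overline u^\gamma=u^\gamma$). Then the pointwise limit $u:=\lim_{\gamma\to0}u^\gamma$ exists on $\mathbb R^{d+1}_{0,T}$, the constrained game admits a value and $u=\overline v=\underline v=:v$, and there is $C>0$ such that $|u^\gamma(t,x)-v(t,x)|\le C(1+|x|_d)\gamma^{1/2}$ for all $(t,x)\in\mathbb R^{d+1}_{0,T}$ and $\gamma\in(0,1)$.
   Context: Setting: Let $(\Omega,\mathcal F,\mathsf P)$ be a complete probability space with a right-continuous filtration $\mathbb F=(\mathcal F_s)_{s\ge0}$ completed by the $\mathsf P$-null sets, and let $W$ be an $\mathbb F$-adapted $d'$-dimensional Brownian motion. Fix $T\in(0,\infty)$ and integers $d_0,d_1\ge1$ with $d=d_0+d_1\le d'$. For $x\in\mathbb R^d$ write $x=(x_{[d_0]},x_{[d_1]})$ with $x_{[d_0]}=(x_1,\dots,x_{d_0})$, $x_{[d_1]}=(x_{d_0+1},\dots,x_d)$; $|x|_d$ is the Euclidean norm and $|x_{[d_0]}|_{d_0}$ the Euclidean norm of the first $d_0$ coordinates. Set $\mathbb R^{d+1}_{0,T}=[0,T]\times\mathbb R^d$; for a function $\varphi$ of $(t,x)$ let $\nabla^0\varphi=(\partial_{x_1}\varphi,\dots,\partial_{x_{d_0}}\varphi)$. For $t\in[0,T]$, $\mathcal T_t$ is the set of $\mathbb F$-stopping times with values in $[0,T-t]$. $\mathcal A^d$ is the set of pairs $(n,\nu)$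 with $n=(n_s)_{s\in[0,T]}$ progressively measurable, $\mathbb R^d$-valued, $|n_s|_d=1$ for all $s$ a.s., and $\nu=(\nu_s)_{s\in[0,T]}$ $\mathbb F$-adapted, real-valued, non-decreasing, right-continuous, $\nu_{0-}=0$, $\mathsf E[\nu_T^2]<\infty$; $\mathcal A^{d_0}$ is the subset of pairs in $\mathcal A^d$ with $n_s=(n^1_s,\dots,n^{d_0}_s,0,\dots,0)$ for all $s$. For $x\in\mathbb R^d$, $(n,\nu)\in\mathcal A^d$, $\gamma\in[0,1]$, $X^{[n,\nu],\gamma}$ is the unique strong solution of $\mathrm dX_s=b(X_s)\mathrm ds+\kappa(X_s)\mathrm dW_s+n^\gamma_s\mathrm d\nu_s$, $X_{0-}=x$, where $n^\gamma_s=(n^1_s,\dots,n^{d_0}_s,\gamma n^{d_0+1}_s,\dots,\gamma n^d_s)$; $X^{[n,\nu]}:=X^{[n,\nu],1}$ (for $(n,\nu)\in\mathcal A^{d_0}$, $X^{[n,\nu],\gamma}=X^{[n,\nu]}$ for all $\gamma$). $\mathsf P_x,\mathsf E_x$ denote probability/expectation with initial state $X_{0-}=x$. Assumption A: $b:\mathbb R^d\to\mathbb R^d$, $\kappa:\mathbb R^d\to\mathbb R^{d\times d'}$ satisfy (i) $b,\kappa$ are $C^1$ with derivatives bounded by a constant $D_1>0$; (ii) for each $i$, the $i$-th row $\kappa^i$ of $\kappa$ depends on $x$ only through $x_i$; (iii) for every bounded $B\subset\mathbb R^d$ there is $\theta_B>0$ with $\langle\zeta,\kappa\kappa^\top(x)\zeta\rangle\ge\theta_B|\zeta|_d^2$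 for all $\zeta\in\mathbb R^d$, $x\in\overline B$. Generator: $\mathcal L\varphi(t,x)=\frac12\mathrm{tr}(\kappa\kappa^\top(x)D^2\varphi(t,x))+\langle b(x),\nabla\varphi(t,x)\rangle$. Assumption C: fix $r\ge0$; $g,h\in C^\infty(\mathbb R^{d+1}_{0,T})$ are non-negative with compact support in the spatial variable (there is $R$ with $g(t,x)=h(t,x)=0$ for all $t$ and $|x|_d\ge R$); $f\in C^\infty([0,T])$ is strictly positive and non-increasing; $|\nabla^0 g(t,x)|_{d_0}\le f(t)$ for all $(t,x)$. Moreover $K>0$ is a constant with $|g(t,x)-g(s,y)|+|h(t,x)-h(s,y)|\le K(|x-y|_d+|t-s|)$ for all $s,t,x,y$ and $(h+\partial_tg+\mathcal Lg-rg)(t,x)\ge-K$ for all $(t,x)$. Constrained game: for $(t,x)$, $(n,\nu)\in\mathcal A^{d_0}$, $\tau\in\mathcal T_t$: $\mathcal J_{t,x}(n,\nu,\tau)=\mathsf E_x\big[e^{-r\tau}g(t+\tau,X^{[n,\nu]}_\tau)+\int_0^\tau e^{-rs}h(t+s,X^{[n,\nu]}_s)\mathrm ds+\int_{[0,\tau]}e^{-rs}f(t+s)\mathrm d\nu_s\big]$; $\underline v(t,x)=\sup_{\tau\in\mathcal T_t}\inf_{(n,\nu)\in\mathcal A^{d_0}}\mathcal J_{t,x}(n,\nu,\tau)$, $\overline v(t,x)=\inf_{(n,\nu)\in\mathcal A^{d_0}}\sup_{\tau\in\mathcal T_t}\mathcal J_{t,x}(n,\nu,\tau)$. Approximating games: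 for $\gamma\in(0,1]$ set $f^\gamma(t)=\sqrt{f(t)^2+\gamma K^2}$ (with the $K$ of Assumption C) and, for $(n,\nu)\in\mathcal A^d$, $\tau\in\mathcal T_t$: $\mathcal J^\gamma_{t,x}(n,\nu,\tau)=\mathsf E_x\big[e^{-r\tau}g(t+\tau,X^{[n,\nu],\gamma}_\tau)+\int_0^\tau e^{-rs}h(t+s,X^{[n,\nu],\gamma}_s)\mathrm ds+\int_{[0,\tau]}e^{-rs}f^\gamma(t+s)\mathrm d\nu_s\big]$, $\underline u^\gamma(t,x)=\sup_{\tau\in\mathcal T_t}\inf_{(n,\nu)\in\mathcal A^d}\mathcal J^\gamma_{t,x}(n,\nu,\tau)$, $\overline u^\gamma(t,x)=\inf_{(n,\nu)\in\mathcal A^d}\sup_{\tau\in\mathcal T_t}\mathcal J^\gamma_{t,x}(n,\nu,\tau)$; their common value is $u^\gamma$. *)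

theory Defs
  imports "HOL-Probability.Probability"
begin

definition usual_filtered_space :: "'a measure \<Rightarrow> (real \<Rightarrow> 'a measure) \<Rightarrow> bool" where
  "usual_filtered_space M F \<longleftrightarrow>
     prob_space M \<and>
     (\<forall>A B. A \<subseteq> B \<longrightarrow> B \<in> null_sets M \<longrightarrow> A \<in> sets M) \<and>
     (\<forall>s. space (F s) = space M \<and> sets (F s) \<subseteq> sets M) \<and>
     (\<forall>s t. s \<le> t \<longrightarrow> sets (F s) \<subseteq> sets (F t)) \<and>
     (\<forall>s. sets (F s) = (\<Inter>t\<in>{s<..}. sets (F t))) \<and>
     (\<forall>s. null_sets M \<subseteq> sets (F s))"

text \<open>F-adapted Brownian motion with values in R^d' (index type 'e).  The last clause
  (E[1_A exp(i<u,W_t-W_s>)] = P(A) exp(-(t-s)|u|^2/2) for A in F_s) says exactly that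
  W_t - W_s is independent of F_s and N(0,(t-s) I)-distributed.\<close>
definition brownian_motion ::
  "'a measure \<Rightarrow> (real \<Rightarrow> 'a measure) \<Rightarrow> (real \<Rightarrow> 'a \<Rightarrow> real^'e) \<Rightarrow> bool" where
  "brownian_motion M F W \<longleftrightarrow>
     (\<forall>s\<ge>0. W s \<in> borel_measurable (F s)) \<and>
     (\<forall>\<omega>\<in>space M. W 0 \<omega> = 0) \<and>
     (AE \<omega> in M. continuous_on {0..} (\<lambda>s. W s \<omega>)) \<and>
     (\<forall>s t A u. 0 \<le> s \<longrightarrow> s \<le> t \<longrightarrow> A \<in> sets (F s) \<longrightarrow>
        integral\<^sup>L M (\<lambda>\<omega>. indicator A \<omega> * cis (u \<bullet> (W t \<omega> - W s \<omega>)))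
          = complex_of_real (measure M A * exp (- (t - s) * (norm u)\<^sup>2 / 2)))"

definition stop_times :: "'a measure \<Rightarrow> (real \<Rightarrow> 'a measure) \<Rightarrow> real \<Rightarrow> real \<Rightarrow> ('a \<Rightarrow> real) set" where
  "stop_times M F T t = {\<tau>. stopping_time F \<tau> \<and> (\<forall>\<omega>\<in>space M. 0 \<le> \<tau> \<omega> \<and> \<tau> \<omega> \<le> T - t)}"

definition progressive :: "(real \<Rightarrow> 'a measure) \<Rightarrow> real \<Rightarrow> (real \<Rightarrow> 'a \<Rightarrow> 'b::topological_space) \<Rightarrow> bool" where
  "progressive F T n \<longleftrightarrow>
     (\<forall>t\<in>{0..T}. (\<lambda>(s, \<omega>). n s \<omega>) \<in> borel_measurable (restrict_space borel {0..t} \<Otimes>\<^sub>M F t))"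

definition controls :: "'a measure \<Rightarrow> (real \<Rightarrow> 'a measure) \<Rightarrow> real
    \<Rightarrow> ((real \<Rightarrow> 'a \<Rightarrow> real^'d) \<times> (real \<Rightarrow> 'a \<Rightarrow> real)) set" where
  "controls M F T = {(n, \<nu>).
     progressive F T n \<and>
     (AE \<omega> in M. \<forall>s\<in>{0..T}. norm (n s \<omega>) = 1) \<and>
     (\<forall>s\<in>{0..T}. \<nu> s \<in> borel_measurable (F s)) \<and>
     (\<forall>\<omega>\<in>space M. 0 \<le> \<nu> 0 \<omega> \<and> mono_on {0..T} (\<lambda>s. \<nu> s \<omega>) \<and>
        (\<forall>s\<in>{0..<T}. continuous (at_right s) (\<lambda>r. \<nu> r \<omega>))) \<and>
     integrable M (\<lambda>\<omega>. (\<nu> T \<omega>)\<^sup>2)}"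

text \<open>The subclass A^{d_0}: only the coordinates in D0 (the first d_0 ones) may be nonzero.\<close>
definition constrained_controls :: "'a measure \<Rightarrow> (real \<Rightarrow> 'a measure) \<Rightarrow> real \<Rightarrow> 'd set
    \<Rightarrow> ((real \<Rightarrow> 'a \<Rightarrow> real^'d) \<times> (real \<Rightarrow> 'a \<Rightarrow> real)) set" where
  "constrained_controls M F T D0 =
     {(n, \<nu>) \<in> controls M F T. \<forall>s \<omega> i. i \<notin> D0 \<longrightarrow> n s \<omega> $ i = 0}"

definition gscale :: "'d set \<Rightarrow> real \<Rightarrow> real^'d \<Rightarrow> real^'d" where
  "gscale D0 \<gamma> v = (\<chi> i. if i \<in> D0 then v $ i else \<gamma> * v $ i)"

text \<open>Distribution function of the (pathwise) Lebesgue-Stieltjes measure d nu on [0,T],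
  with the convention nu_{0-} = 0 (so there is an atom nu_0 at time 0).\<close>
definition nu_dist :: "real \<Rightarrow> (real \<Rightarrow> 'a \<Rightarrow> real) \<Rightarrow> 'a \<Rightarrow> real \<Rightarrow> real" where
  "nu_dist T \<nu> \<omega> = (\<lambda>r. if r < 0 then 0 else \<nu> (min r T) \<omega>)"

definition ito_sum :: "(real \<Rightarrow> 'a \<Rightarrow> real^'e) \<Rightarrow> (real^'d \<Rightarrow> real^'e^'d)
    \<Rightarrow> (real \<Rightarrow> 'a \<Rightarrow> real^'d) \<Rightarrow> real \<Rightarrow> nat \<Rightarrow> 'a \<Rightarrow> real^'d" where
  "ito_sum W \<kappa> X s m \<omega> =
     (\<Sum>k<2^m. \<kappa> (X (s * real k / 2^m) \<omega>) *v
        (W (s * real (Suc k) / 2^m) \<omega> - W (s * real k / 2^m) \<omega>))"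

text \<open>X is a (cadlag, adapted) strong solution on [0,T] of
  dX = b(X) ds + kappa(X) dW + n^gamma d nu, X_{0-} = x.  The Ito integral is the limit in
  probability of the left-point Riemann sums (valid for cadlag adapted integrands).\<close>
definition is_solution :: "'a measure \<Rightarrow> (real \<Rightarrow> 'a measure) \<Rightarrow> (real \<Rightarrow> 'a \<Rightarrow> real^'e) \<Rightarrow> real
    \<Rightarrow> 'd set \<Rightarrow> (real^'d \<Rightarrow> real^'d) \<Rightarrow> (real^'d \<Rightarrow> real^'e^'d) \<Rightarrow> real^'d
    \<Rightarrow> (real \<Rightarrow> 'a \<Rightarrow> real^'d) \<Rightarrow> (real \<Rightarrow> 'a \<Rightarrow> real) \<Rightarrow> real
    \<Rightarrow> (real \<Rightarrow> 'a \<Rightarrow> real^'d) \<Rightarrow> bool" where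
  "is_solution M F W T D0 b \<kappa> x n \<nu> \<gamma> X \<longleftrightarrow>
     (\<forall>s\<in>{0..T}. X s \<in> borel_measurable (F s)) \<and>
     (\<forall>\<omega>\<in>space M. (\<forall>s\<in>{0..<T}. continuous (at_right s) (\<lambda>r. X r \<omega>)) \<and>
                  (\<forall>s\<in>{0<..T}. \<exists>l. ((\<lambda>r. X r \<omega>) \<longlongrightarrow> l) (at_left s))) \<and>
     (\<forall>s\<in>{0..T}. \<exists>I. I \<in> borel_measurable M \<and>
        (\<forall>\<epsilon>>0. ((\<lambda>m. measure M {\<omega>\<in>space M. norm (ito_sum W \<kappa> X s m \<omega> - I \<omega>) > \<epsilon>})
                    \<longlongrightarrow> 0) sequentially) \<and>
        (AE \<omega> in M. X s \<omega> = x + integral {0..s} (\<lambda>r. b (X r \<omega>)) + I \<omega>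
            + set_lebesgue_integral (interval_measure (nu_dist T \<nu> \<omega>)) {0..s}
                (\<lambda>r. gscale D0 \<gamma> (n r \<omega>))))"

text \<open>X^{[n,nu],gamma} started at X_{0-} = x (the unique strong solution).\<close>
definition state :: "'a measure \<Rightarrow> (real \<Rightarrow> 'a measure) \<Rightarrow> (real \<Rightarrow> 'a \<Rightarrow> real^'e) \<Rightarrow> real
    \<Rightarrow> 'd set \<Rightarrow> (real^'d \<Rightarrow> real^'d) \<Rightarrow> (real^'d \<Rightarrow> real^'e^'d) \<Rightarrow> real^'d
    \<Rightarrow> (real \<Rightarrow> 'a \<Rightarrow> real^'d) \<Rightarrow> (real \<Rightarrow> 'a \<Rightarrow> real) \<Rightarrow> real
    \<Rightarrow> real \<Rightarrow> 'a \<Rightarrow> real^'d" where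
  "state M F W T D0 b \<kappa> x n \<nu> \<gamma> = (SOME X. is_solution M F W T D0 b \<kappa> x n \<nu> \<gamma> X)"

definition payoff :: "'a measure \<Rightarrow> (real \<Rightarrow> 'a measure) \<Rightarrow> (real \<Rightarrow> 'a \<Rightarrow> real^'e) \<Rightarrow> real
    \<Rightarrow> 'd set \<Rightarrow> (real^'d \<Rightarrow> real^'d) \<Rightarrow> (real^'d \<Rightarrow> real^'e^'d) \<Rightarrow> real
    \<Rightarrow> (real \<times> (real^'d) \<Rightarrow> real) \<Rightarrow> (real \<times> (real^'d) \<Rightarrow> real) \<Rightarrow> (real \<Rightarrow> real) \<Rightarrow> real
    \<Rightarrow> real \<Rightarrow> real^'d \<Rightarrow> (real \<Rightarrow> 'a \<Rightarrow> real^'d) \<Rightarrow> (real \<Rightarrow> 'a \<Rightarrow> real) \<Rightarrow> ('a \<Rightarrow> real) \<Rightarrow> real" where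
  "payoff M F W T D0 b \<kappa> r g h c \<gamma> t x n \<nu> \<tau> =
     (let X = state M F W T D0 b \<kappa> x n \<nu> \<gamma> in
      integral\<^sup>L M (\<lambda>\<omega>.
         exp (- r * \<tau> \<omega>) * g (t + \<tau> \<omega>, X (\<tau> \<omega>) \<omega>)
       + integral {0..\<tau> \<omega>} (\<lambda>s. exp (- r * s) * h (t + s, X s \<omega>))
       + set_lebesgue_integral (interval_measure (nu_dist T \<nu> \<omega>)) {0..\<tau> \<omega>}
           (\<lambda>s. exp (- r * s) * c (t + s))))"

definition v_lower where
  "v_lower M F W T D0 b \<kappa> r g h f t x =
     (SUP \<tau>\<in>stop_times M F T t. INF c\<in>constrained_controls M F T D0.
        payoff M F W T D0 b \<kappa> r g h f 1 t x (fst c) (snd c) \<tau>)"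

definition v_upper where
  "v_upper M F W T D0 b \<kappa> r g h f t x =
     (INF c\<in>constrained_controls M F T D0. SUP \<tau>\<in>stop_times M F T t.
        payoff M F W T D0 b \<kappa> r g h f 1 t x (fst c) (snd c) \<tau>)"

definition f_gamma :: "(real \<Rightarrow> real) \<Rightarrow> real \<Rightarrow> real \<Rightarrow> real \<Rightarrow> real" where
  "f_gamma f K \<gamma> s = sqrt ((f s)\<^sup>2 + \<gamma> * K\<^sup>2)"

definition u_lower where
  "u_lower M F W T D0 b \<kappa> r g h f K \<gamma> t x =
     (SUP \<tau>\<in>stop_times M F T t. INF c\<in>controls M F T.
        payoff M F W T D0 b \<kappa> r g h (f_gamma f K \<gamma>) \<gamma> t x (fst c) (snd c) \<tau>)"

definition u_upper where
  "u_upper M F W T D0 b \<kappa> r g h f K \<gamma> t x =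
     (INF c\<in>controls M F T. SUP \<tau>\<in>stop_times M F T t.
        payoff M F W T D0 b \<kappa> r g h (f_gamma f K \<gamma>) \<gamma> t x (fst c) (snd c) \<tau>)"

definition dirD :: "'v::real_normed_vector \<Rightarrow> ('v \<Rightarrow> real) \<Rightarrow> 'v \<Rightarrow> real" where
  "dirD v \<phi> z = deriv (\<lambda>s. \<phi> (z + s *\<^sub>R v)) 0"

definition iterD :: "'v::real_normed_vector list \<Rightarrow> ('v \<Rightarrow> real) \<Rightarrow> 'v \<Rightarrow> real" where
  "iterD vs \<phi> = foldr dirD vs \<phi>"

definition smooth :: "('v::real_normed_vector \<Rightarrow> real) \<Rightarrow> bool" where
  "smooth \<phi> \<longleftrightarrow> (\<forall>vs. continuous_on UNIV (iterD vs \<phi>) \<and>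
      (\<forall>z v. (\<lambda>s. iterD vs \<phi> (z + s *\<^sub>R v)) differentiable (at 0)))"

definition smooth_on_set :: "'v::real_normed_vector set \<Rightarrow> ('v \<Rightarrow> real) \<Rightarrow> bool" where
  "smooth_on_set S \<phi> \<longleftrightarrow> (\<exists>\<Phi>. smooth \<Phi> \<and> (\<forall>z\<in>S. \<Phi> z = \<phi> z))"

definition dx :: "'d::finite \<Rightarrow> (real \<times> (real^'d) \<Rightarrow> real) \<Rightarrow> real \<times> (real^'d) \<Rightarrow> real" where
  "dx i \<phi> = dirD (0, axis i 1) \<phi>"

definition dt :: "(real \<times> (real^'d) \<Rightarrow> real) \<Rightarrow> real \<times> (real^'d) \<Rightarrow> real" where
  "dt \<phi> = dirD (1, 0) \<phi>"

definition dxx :: "'d::finite \<Rightarrow> 'd \<Rightarrow> (real \<times> (real^'d) \<Rightarrow> real) \<Rightarrow> real \<times> (real^'d) \<Rightarrow> real" where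
  "dxx i j \<phi> = iterD [(0, axis i 1), (0, axis j 1)] \<phi>"

definition generator :: "(real^'d \<Rightarrow> real^'d) \<Rightarrow> (real^'d \<Rightarrow> real^'e^'d)
    \<Rightarrow> (real \<times> (real^'d) \<Rightarrow> real) \<Rightarrow> real \<times> (real^'d) \<Rightarrow> real" where
  "generator b \<kappa> \<phi> z =
     (let x = snd z; a = \<kappa> x ** transpose (\<kappa> x) in
       (1/2) * (\<Sum>i\<in>UNIV. \<Sum>j\<in>UNIV. a $ i $ j * dxx i j \<phi> z)
       + (\<Sum>i\<in>UNIV. b x $ i * dx i \<phi> z))"

definition grad0_norm :: "'d::finite set \<Rightarrow> (real \<times> (real^'d) \<Rightarrow> real) \<Rightarrow> real \<times> (real^'d) \<Rightarrow> real" where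
  "grad0_norm D0 \<phi> z = sqrt (\<Sum>i\<in>D0. (dx i \<phi> z)\<^sup>2)"

end

theory Submission
  imports Defs
begin

text \<open>
  For the lower bound, the state of a control in the constrained class does not depend on \<open>\<gamma>\<close>,
  and \<open>f\<^sup>\<gamma> \<le> (1 + \<surd>\<gamma> K / f(T)) f\<close>; since the zero control keeps the relevant values below a constant
  \<open>C\<^sub>0\<close>, this gives \<open>u \<le> v + C \<surd>\<gamma>\<close> for the lower values. For the upper values, a control \<open>(n, \<nu>)\<close> that
  costs more than \<open>C\<^sub>0\<close> is beaten by the zero control, so \<open>E \<nu>\<close> may be assumed bounded. Its projection
  \<open>(P n / |P n|, |P n| d\<nu>)\<close> onto the first block of coordinates is admissible in the constrained game,
  costs no more, and its forcing differs from that of \<open>(n, \<nu>)\<close> by at most \<open>\<gamma> \<nu>\<close>. An \<open>L\<^sup>2\<close> estimate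
  localised on \<open>{\<nu> \<le> 1/\<surd>\<gamma>}\<close>, combined with a maximal inequality, shows that the two states stay within
  \<open>5 \<surd>\<gamma>\<close> of each other off an event of probability \<open>O(\<surd>\<gamma>)\<close>, hence \<open>v \<le> u + C \<surd>\<gamma>\<close>. The two bounds and
  the existence of a value for every \<open>\<gamma>\<close> squeeze all the values together.

  Strong solutions are limits of dyadic Euler schemes driven by the pathwise forcing \<open>\<integral> n d\<nu>\<close>.
\<close>

section \<open>Brownian increments and the isometry for elementary integrands\<close>

text \<open>Uniformly over controls the payoff bounds only the first moment of \<nu>, because the
  discounted cost density is at least \<open>exp (- r * T) * f T\<close>. Second moments are finite
  but not uniformly bounded, so a plain quadratic estimate for the states fails. Cutting at \<nu>
  \<le> N turns the squared forcing gap \<gamma>^2 \<nu>^2 into \<gamma>^2 N \<nu>, while Markov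
  gives up probability of order 1/N. After Chebyshev at level sqrt \<gamma> the two errors are
  \<gamma> N and 1/N; N = 1/sqrt \<gamma> balances them and fixes the rate. The second obstacle is
  that the forcing may jump and that the stochastic integral is given only as a limit in probability
  of left-point sums over dyadic partitions of \<open>{0..s}\<close>, a different family for each
  \<open>s\<close>. Estimates are therefore made on finite sums, with an isometry that covers common
  refinements, and are passed to the limit by Fatou or in probability. Jumps destroy smallness on
  single cells, but the squared cell increments of \<nu> have bounded total, so errors averaged over
  time are of the order of the mesh.\<close>

lemma borel_measurable_vec_nth:
  fixes f :: "'b \<Rightarrow> 'c::topological_space^'n::finite"
  assumes "f \<in> borel_measurable N" shows "(\<lambda>\<omega>. f \<omega> $ i) \<in> borel_measurable N"
  by (rule measurable_compose[OF assms borel_measurable_continuous_onI]) (intro continuous_intros)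

locale bm_space =
  fixes M :: "'a measure" and F :: "real \<Rightarrow> 'a measure" and W :: "real \<Rightarrow> 'a \<Rightarrow> real^'e::finite"
  assumes filt: "usual_filtered_space M F" and BM: "brownian_motion M F W"
begin

sublocale prob_space M
  using filt by (simp add: usual_filtered_space_def)

lemma space_F [simp]: "space (F s) = space M"
  and sets_F: "A \<in> sets (F s) \<Longrightarrow> A \<in> sets M"
  and sets_F_mono: "s \<le> t \<Longrightarrow> A \<in> sets (F s) \<Longrightarrow> A \<in> sets (F t)"
  and null_in_F: "N \<in> null_sets M \<Longrightarrow> N \<in> sets (F s)"
proof -
  from filt have 1: "\<forall>s. space (F s) = space M \<and> sets (F s) \<subseteq> sets M"
    and 2: "\<forall>s t. s \<le> t \<longrightarrow> sets (F s) \<subseteq> sets (F t)" and 3: "\<forall>s. null_sets M \<subseteq> sets (F s)"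
    unfolding usual_filtered_space_def by - (elim conjE, assumption)+
  show "space (F s) = space M" using 1 by simp
  show "A \<in> sets (F s) \<Longrightarrow> A \<in> sets M" using 1 by blast
  show "s \<le> t \<Longrightarrow> A \<in> sets (F s) \<Longrightarrow> A \<in> sets (F t)" using 2 by blast
  show "N \<in> null_sets M \<Longrightarrow> N \<in> sets (F s)" using 3 by blast
qed

lemma subalgebra_F: "subalgebra M (F s)"
  by (auto simp: subalgebra_def sets_F)

lemma measurable_F: "f \<in> measurable (F s) N \<Longrightarrow> f \<in> measurable M N"
  by (rule measurable_from_subalg[OF subalgebra_F])

lemma measurable_F_mono: "s \<le> t \<Longrightarrow> f \<in> measurable (F s) N \<Longrightarrow> f \<in> measurable (F t) N"
  by (rule measurable_from_subalg[of "F t" "F s"]) (auto simp: subalgebra_def sets_F_mono)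

lemma measurable_W: "0 \<le> s \<Longrightarrow> W s \<in> borel_measurable (F s)"
  using BM by (simp add: brownian_motion_def)

lemma measurable_W_mono: "0 \<le> s \<Longrightarrow> s \<le> t \<Longrightarrow> W s \<in> borel_measurable (F t)"
  using measurable_W measurable_F_mono by blast

lemma measurable_W_M: "0 \<le> s \<Longrightarrow> W s \<in> borel_measurable M"
  using measurable_W measurable_F by blast

text \<open>Testing against an event of \<open>F s\<close> amounts to conditioning on it. Under the
  conditioned measure the defining identity of Brownian motion, taken at
  \<open>(y / c) *\<^sub>R u\<close>, is the standard normal characteristic function at
  \<open>y\<close>, and Levy's uniqueness theorem identifies the law.\<close>

lemma increment_law:
  assumes st: "0 \<le> s" "s < t" and u: "u \<noteq> 0" and A: "A \<in> sets (F s)" "prob A > 0"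
  shows "distr (uniform_measure M A) borel
           (\<lambda>\<omega>. (u \<bullet> (W t \<omega> - W s \<omega>)) / (sqrt (t - s) * norm u)) = std_normal_distribution"
proof -
  have [measurable]: "W s \<in> borel_measurable M" "W t \<in> borel_measurable M" "A \<in> sets M"
    using st A measurable_W_M sets_F by auto
  define c where "c = sqrt (t - s) * norm u"
  have c: "c > 0" using st u by (simp add: c_def)
  let ?U = "uniform_measure M A"
  have U: "?U = density M (\<lambda>x. ennreal (indicator A x / prob A))"
    unfolding uniform_measure_def
    by (intro density_cong AE_I2)
       (auto simp: emeasure_eq_measure ennreal_divide_numeral divide_ennreal[symmetric] A(2) split: split_indicator)
  interpret U: prob_space ?U
    using A(2) by (intro prob_space_uniform_measure) (auto simp: emeasure_eq_measure)
  have char: "char (distr ?U borel (\<lambda>\<omega>. (u \<bullet> (W t \<omega> - W s \<omega>)) / c)) y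
      = complex_of_real (exp (- (y^2) / 2))" for y
  proof -
    have "char (distr ?U borel (\<lambda>\<omega>. (u \<bullet> (W t \<omega> - W s \<omega>)) / c)) y
       = (CLINT \<omega>|?U. iexp (y * ((u \<bullet> (W t \<omega> - W s \<omega>)) / c)))"
      unfolding char_def by (subst integral_distr) auto
    also have "\<dots> = (CLINT \<omega>|M. (indicator A \<omega> / prob A) *\<^sub>R iexp (y * ((u \<bullet> (W t \<omega> - W s \<omega>)) / c)))"
      unfolding U by (subst integral_density) auto
    also have "\<dots> = (CLINT \<omega>|M. complex_of_real (1 / prob A) * (indicator A \<omega> * cis (((y / c) *\<^sub>R u) \<bullet> (W t \<omega> - W s \<omega>))))"
      by (subst inner_scaleR_left, intro Bochner_Integration.integral_cong)
         (auto simp: cis_conv_exp scaleR_conv_of_real split: split_indicator)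
    also have "\<dots> = complex_of_real (1 / prob A) * (complex_of_real (prob A * exp (- (t - s) * (norm ((y / c) *\<^sub>R u))\<^sup>2 / 2)))"
    proof -
      have "(CLINT \<omega>|M. indicator A \<omega> * cis (((y / c) *\<^sub>R u) \<bullet> (W t \<omega> - W s \<omega>)))
          = complex_of_real (prob A * exp (- (t - s) * (norm ((y / c) *\<^sub>R u))\<^sup>2 / 2))"
        using BM st A(1) unfolding brownian_motion_def by (meson less_imp_le)
      then show ?thesis by (simp only: integral_mult_right_zero)
    qed
    also have "\<dots> = complex_of_real (exp (- (t - s) * (norm ((y / c) *\<^sub>R u))\<^sup>2 / 2))"
      using A(2) by simp
    also have "- (t - s) * (norm ((y / c) *\<^sub>R u))\<^sup>2 / 2 = - (y^2) / 2"
      using st u by (simp add: c_def power_mult_distrib power_divide field_simps)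
    finally show ?thesis .
  qed
  have "distr ?U borel (\<lambda>\<omega>. (u \<bullet> (W t \<omega> - W s \<omega>)) / c) = std_normal_distribution"
  proof (rule Levy_uniqueness)
    show "real_distribution (distr ?U borel (\<lambda>\<omega>. (u \<bullet> (W t \<omega> - W s \<omega>)) / c))"
      by (intro U.real_distribution_distr) auto
    show "real_distribution std_normal_distribution"
      using real_dist_normal_dist .
    show "char (distr ?U borel (\<lambda>\<omega>. (u \<bullet> (W t \<omega> - W s \<omega>)) / c)) = char std_normal_distribution"
      by (simp add: char_std_normal_distribution char fun_eq_iff)
  qed
  then show ?thesis by (simp add: c_def)
qed

text \<open>These are the moments of the conditioned standard normal law, multiplied back by
  \<open>prob A\<close>. In the cases where the normalisation by \<open>c\<close> or by
  \<open>prob A\<close> would divide by zero, both integrands vanish almost surely.\<close>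

lemma increment_moments_on:
  assumes st: "0 \<le> s" "s \<le> t" and A: "A \<in> sets (F s)"
  shows "integrable M (\<lambda>\<omega>. indicator A \<omega> * (u \<bullet> (W t \<omega> - W s \<omega>))\<^sup>2)"
    and "(\<integral>\<omega>. indicator A \<omega> * (u \<bullet> (W t \<omega> - W s \<omega>))\<^sup>2 \<partial>M) = prob A * ((t - s) * (norm u)\<^sup>2)"
    and "(\<integral>\<omega>. indicator A \<omega> * (u \<bullet> (W t \<omega> - W s \<omega>)) \<partial>M) = 0"
proof -
  have [measurable]: "W s \<in> borel_measurable M" "W t \<in> borel_measurable M" "A \<in> sets M"
    using st A measurable_W_M sets_F by auto
  have "integrable M (\<lambda>\<omega>. indicator A \<omega> * (u \<bullet> (W t \<omega> - W s \<omega>))\<^sup>2) \<and>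
    (\<integral>\<omega>. indicator A \<omega> * (u \<bullet> (W t \<omega> - W s \<omega>))\<^sup>2 \<partial>M) = prob A * ((t - s) * (norm u)\<^sup>2) \<and>
    (\<integral>\<omega>. indicator A \<omega> * (u \<bullet> (W t \<omega> - W s \<omega>)) \<partial>M) = 0"
  proof (cases "s = t \<or> u = 0 \<or> prob A = 0")
    case True
    have "AE \<omega> in M. indicator A \<omega> * (u \<bullet> (W t \<omega> - W s \<omega>))\<^sup>2 = 0 \<and> indicator A \<omega> * (u \<bullet> (W t \<omega> - W s \<omega>)) = 0"
    proof (cases "prob A = 0")
      case True
      then have "A \<in> null_sets M" by (auto simp: null_sets_def emeasure_eq_measure)
      then have "AE \<omega> in M. \<omega> \<notin> A" by (rule AE_not_in)
      then show ?thesis by eventually_elim auto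
    qed (use True in auto)
    then have 1: "AE \<omega> in M. indicator A \<omega> * (u \<bullet> (W t \<omega> - W s \<omega>))\<^sup>2 = 0" 
      and 2: "AE \<omega> in M. indicator A \<omega> * (u \<bullet> (W t \<omega> - W s \<omega>)) = 0" by auto
    have "integrable M (\<lambda>\<omega>. indicator A \<omega> * (u \<bullet> (W t \<omega> - W s \<omega>))\<^sup>2)"
      by (subst integrable_cong_AE[OF _ _ 1]) auto
    moreover have "(\<integral>\<omega>. indicator A \<omega> * (u \<bullet> (W t \<omega> - W s \<omega>))\<^sup>2 \<partial>M) = 0"
      by (subst integral_cong_AE[OF _ _ 1]) auto
    moreover have "(\<integral>\<omega>. indicator A \<omega> * (u \<bullet> (W t \<omega> - W s \<omega>)) \<partial>M) = 0"
      by (subst integral_cong_AE[OF _ _ 2]) auto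
    ultimately show ?thesis using True by auto
  next
    case False
    then have "s < t" "u \<noteq> 0" "prob A > 0" using st by (auto simp: zero_less_measure_iff)
    note law = increment_law[OF st(1) \<open>s < t\<close> \<open>u \<noteq> 0\<close> A \<open>prob A > 0\<close>]
    define c where "c = sqrt (t - s) * norm u"
    have c: "c > 0" "c\<^sup>2 = (t - s) * (norm u)\<^sup>2" using \<open>s < t\<close> \<open>u \<noteq> 0\<close> by (auto simp: c_def power_mult_distrib)
    define Z where "Z = (\<lambda>\<omega>. (u \<bullet> (W t \<omega> - W s \<omega>)) / c)"
    have [measurable]: "Z \<in> borel_measurable M" unfolding Z_def by measurable
    have Zu: "u \<bullet> (W t \<omega> - W s \<omega>) = c * Z \<omega>" for \<omega> using c by (simp add: Z_def)
    let ?U = "uniform_measure M A"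
    have U: "?U = density M (\<lambda>x. ennreal (indicator A x / prob A))"
      unfolding uniform_measure_def
      by (intro density_cong AE_I2)
         (auto simp: emeasure_eq_measure divide_ennreal[symmetric] \<open>prob A > 0\<close> split: split_indicator)
    have law': "distr ?U borel Z = std_normal_distribution" using law by (simp add: Z_def c_def)
    have "integrable std_normal_distribution (\<lambda>x::real. x^2)" 
      using std_normal_distribution_even_moments(2)[of 1] by simp
    then have i2: "integrable ?U (\<lambda>\<omega>. (Z \<omega>)\<^sup>2)"
      unfolding law'[symmetric] by (subst (asm) integrable_distr_eq) auto
    have e2: "(\<integral>\<omega>. (Z \<omega>)\<^sup>2 \<partial>?U) = 1"
      using std_normal_distribution_even_moments(1)[of 1] unfolding law'[symmetric]
      by (subst (asm) integral_distr) auto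
    have e1: "(\<integral>\<omega>. Z \<omega> \<partial>?U) = 0"
      using integral_std_normal_distribution_moment_odd[of 1, simplified] unfolding law'[symmetric]
      by (subst (asm) integral_distr) auto
    have i2': "integrable M (\<lambda>\<omega>. indicator A \<omega> / prob A * (Z \<omega>)\<^sup>2)"
      using i2 unfolding U by (subst (asm) integrable_density) (auto simp: )
    have e2': "(\<integral>\<omega>. indicator A \<omega> / prob A * (Z \<omega>)\<^sup>2 \<partial>M) = 1"
      using e2 unfolding U by (subst (asm) integral_density) auto
    have e1': "(\<integral>\<omega>. indicator A \<omega> / prob A * Z \<omega> \<partial>M) = 0"
      using e1 unfolding U by (subst (asm) integral_density) auto
    have eq2: "indicator A \<omega> * (u \<bullet> (W t \<omega> - W s \<omega>))\<^sup>2 = (prob A * c\<^sup>2) * (indicator A \<omega> / prob A * (Z \<omega>)\<^sup>2)" for \<omega>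
      using \<open>prob A > 0\<close> by (simp add: Zu power_mult_distrib)
    have eq1: "indicator A \<omega> * (u \<bullet> (W t \<omega> - W s \<omega>)) = (prob A * c) * (indicator A \<omega> / prob A * Z \<omega>)" for \<omega>
      using \<open>prob A > 0\<close> by (simp add: Zu)
    show ?thesis
      unfolding eq1 eq2 integral_mult_right_zero e2' e1' 
      using integrable_mult_right[OF i2', of "prob A * c\<^sup>2"] c(2) by simp
  qed
  then show "integrable M (\<lambda>\<omega>. indicator A \<omega> * (u \<bullet> (W t \<omega> - W s \<omega>))\<^sup>2)"
    and "(\<integral>\<omega>. indicator A \<omega> * (u \<bullet> (W t \<omega> - W s \<omega>))\<^sup>2 \<partial>M) = prob A * ((t - s) * (norm u)\<^sup>2)"
    and "(\<integral>\<omega>. indicator A \<omega> * (u \<bullet> (W t \<omega> - W s \<omega>)) \<partial>M) = 0" by auto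
qed

lemma integrable_increment_sq:
  assumes "0 \<le> s" "s \<le> t" shows "integrable M (\<lambda>\<omega>. (u \<bullet> (W t \<omega> - W s \<omega>))\<^sup>2)"
proof -
  have "integrable M (\<lambda>\<omega>. indicator (space M) \<omega> * (u \<bullet> (W t \<omega> - W s \<omega>))\<^sup>2)"
    by (rule increment_moments_on[OF assms]) (metis sets.top space_F)
  then show ?thesis by (rule Bochner_Integration.integrable_cong[THEN iffD1, rotated 2]) auto
qed

lemma integrable_increment:
  assumes "0 \<le> s" "s \<le> t" shows "integrable M (\<lambda>\<omega>. u \<bullet> (W t \<omega> - W s \<omega>))"
proof (rule square_integrable_imp_integrable[OF _ integrable_increment_sq[OF assms]])
  have [measurable]: "W s \<in> borel_measurable M" "W t \<in> borel_measurable M"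
    using assms measurable_W_M by auto
  show "(\<lambda>\<omega>. u \<bullet> (W t \<omega> - W s \<omega>)) \<in> borel_measurable M" by measurable
qed

abbreviation dW :: "real \<Rightarrow> real \<Rightarrow> 'e \<Rightarrow> 'a \<Rightarrow> real" where
  "dW s t j \<equiv> (\<lambda>\<omega>. W t \<omega> $ j - W s \<omega> $ j)"

lemma measurable_dW: "0 \<le> s \<Longrightarrow> s \<le> t \<Longrightarrow> dW s t j \<in> borel_measurable (F t)"
  by (intro borel_measurable_diff borel_measurable_vec_nth measurable_W_mono) auto

lemma cond_exp_dW:
  assumes "0 \<le> s" "s \<le> t"
  shows "AE \<omega> in M. real_cond_exp M (F s) (dW s t j) \<omega> = 0"
proof -
  interpret S: finite_measure_subalgebra M "F s" 
    by unfold_locales (rule subalgebra_F)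
  show ?thesis
    by (rule S.real_cond_exp_charact)
       (use increment_moments_on(3)[OF assms, of _ "axis j 1"] integrable_increment[OF assms, of "axis j 1"] in
         \<open>auto simp: set_lebesgue_integral_def inner_axis'\<close>)
qed

section \<open>Second-moment calculus for random vectors\<close>

definition L2 :: "('a \<Rightarrow> 'b::euclidean_space) \<Rightarrow> bool" where
  "L2 f \<longleftrightarrow> f \<in> borel_measurable M \<and> integrable M (\<lambda>\<omega>. (norm (f \<omega>))\<^sup>2)"

definition E2 :: "('a \<Rightarrow> 'b::euclidean_space) \<Rightarrow> real" where
  "E2 f = (\<integral>\<omega>. (norm (f \<omega>))\<^sup>2 \<partial>M)"

lemma L2_measurable: "L2 f \<Longrightarrow> f \<in> borel_measurable M"
  and L2_integrable: "L2 f \<Longrightarrow> integrable M (\<lambda>\<omega>. (norm (f \<omega>))\<^sup>2)"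
  by (simp_all add: L2_def)

lemma E2_nonneg [simp]: "0 \<le> E2 f"
  by (simp add: E2_def)

lemma L2_mono:
  assumes "L2 g" "f \<in> borel_measurable M" "\<And>\<omega>. \<omega> \<in> space M \<Longrightarrow> norm (f \<omega>) \<le> norm (g \<omega>)"
  shows "L2 f"
  unfolding L2_def
proof
  have [measurable]: "f \<in> borel_measurable M" by fact
  show "integrable M (\<lambda>\<omega>. (norm (f \<omega>))\<^sup>2)"
    by (rule Bochner_Integration.integrable_bound[OF L2_integrable[OF assms(1)]])
       (auto intro!: AE_I2 power_mono assms(3))
qed fact

lemma E2_mono:
  assumes "L2 g" "f \<in> borel_measurable M" "\<And>\<omega>. \<omega> \<in> space M \<Longrightarrow> norm (f \<omega>) \<le> norm (g \<omega>)"
  shows "E2 f \<le> E2 g"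
  unfolding E2_def
  by (rule integral_mono) (use L2_mono[OF assms] assms(1,3) in \<open>auto simp: L2_def intro: power_mono\<close>)

lemma L2_const [simp]: "L2 (\<lambda>\<omega>. c)"
  by (simp add: L2_def)

lemma E2_const [simp]: "E2 (\<lambda>\<omega>. c) = (norm c)\<^sup>2"
  by (simp add: E2_def prob_space)

lemma L2_scaleR:
  assumes "L2 f" shows "L2 (\<lambda>\<omega>. c *\<^sub>R f \<omega>)"
  using assms by (auto simp: L2_def power_mult_distrib)

lemma E2_scaleR: "E2 (\<lambda>\<omega>. c *\<^sub>R f \<omega>) = c\<^sup>2 * E2 f"
  by (simp add: E2_def power_mult_distrib)

lemma norm_add_sq_le: "(norm (x + y))\<^sup>2 \<le> 2 * (norm x)\<^sup>2 + 2 * (norm (y::'b::real_normed_vector))\<^sup>2"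
proof -
  have "(norm (x + y))\<^sup>2 \<le> (norm x + norm y)\<^sup>2" by (intro power_mono norm_triangle_ineq) auto
  also have "\<dots> \<le> 2 * (norm x)\<^sup>2 + 2 * (norm y)\<^sup>2"
    using sum_squares_bound[of "norm x" "norm y"] by (simp add: power2_sum)
  finally show ?thesis .
qed

lemma L2_add:
  assumes "L2 f" "L2 g" shows "L2 (\<lambda>\<omega>. f \<omega> + g \<omega>)"
  unfolding L2_def
proof
  have [measurable]: "f \<in> borel_measurable M" "g \<in> borel_measurable M" using assms L2_measurable by auto
  show "(\<lambda>\<omega>. f \<omega> + g \<omega>) \<in> borel_measurable M" by measurable
  show "integrable M (\<lambda>\<omega>. (norm (f \<omega> + g \<omega>))\<^sup>2)"
    by (rule Bochner_Integration.integrable_bound[of _ "\<lambda>\<omega>. 2 * (norm (f \<omega>))\<^sup>2 + 2 * (norm (g \<omega>))\<^sup>2"])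
       (use assms in \<open>auto intro!: AE_I2 norm_add_sq_le simp: L2_def\<close>)
qed

lemma E2_add:
  assumes "L2 f" "L2 g" shows "E2 (\<lambda>\<omega>. f \<omega> + g \<omega>) \<le> 2 * E2 f + 2 * E2 g"
proof -
  have "E2 (\<lambda>\<omega>. f \<omega> + g \<omega>) \<le> (\<integral>\<omega>. 2 * (norm (f \<omega>))\<^sup>2 + 2 * (norm (g \<omega>))\<^sup>2 \<partial>M)"
    unfolding E2_def
    by (rule integral_mono) (use L2_add[OF assms] assms in \<open>auto simp: L2_def intro: norm_add_sq_le\<close>)
  also have "\<dots> = 2 * E2 f + 2 * E2 g" using assms by (simp add: L2_def E2_def)
  finally show ?thesis .
qed

lemma L2_uminus: "L2 f \<Longrightarrow> L2 (\<lambda>\<omega>. - f \<omega>)"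
  using L2_scaleR[of f "-1"] by simp

lemma L2_diff: "L2 f \<Longrightarrow> L2 g \<Longrightarrow> L2 (\<lambda>\<omega>. f \<omega> - g \<omega>)"
  using L2_add[OF _ L2_uminus, of f g] by simp

lemma E2_add3:
  assumes "L2 f" "L2 g" "L2 h"
  shows "E2 (\<lambda>\<omega>. f \<omega> + g \<omega> + h \<omega>) \<le> 4 * E2 f + 4 * E2 g + 2 * E2 h"
  using E2_add[OF L2_add[OF assms(1,2)] assms(3)] E2_add[OF assms(1,2)] by simp

lemma L2_sum: "(\<And>i. i \<in> I \<Longrightarrow> L2 (f i)) \<Longrightarrow> L2 (\<lambda>\<omega>. \<Sum>i\<in>I. f i \<omega>)"
  by (induction I rule: infinite_finite_induct) (auto intro: L2_add)

lemma L2_indicator: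
  assumes "L2 f" "A \<in> sets M" shows "L2 (\<lambda>\<omega>. indicator A \<omega> *\<^sub>R f \<omega>)"
proof (rule L2_mono[OF assms(1)])
  have [measurable]: "f \<in> borel_measurable M" "A \<in> sets M" using assms L2_measurable by auto
  show "(\<lambda>\<omega>. indicator A \<omega> *\<^sub>R f \<omega>) \<in> borel_measurable M" by measurable
qed (auto split: split_indicator)

lemma L2_lip:
  assumes "L2 g" "f \<in> borel_measurable M" "\<And>\<omega>. \<omega> \<in> space M \<Longrightarrow> norm (f \<omega>) \<le> a + c * norm (g \<omega>)" "0 \<le> a" "0 \<le> c"
  shows "L2 f" and "E2 f \<le> 2 * a\<^sup>2 + 2 * c\<^sup>2 * E2 g"
proof -
  have [measurable]: "g \<in> borel_measurable M" using assms(1) by (simp add: L2_def)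
  have n: "L2 (\<lambda>\<omega>. c * norm (g \<omega>))" using assms(1) by (auto simp: L2_def power_mult_distrib)
  have L: "L2 (\<lambda>\<omega>. a + c * norm (g \<omega>))" by (rule L2_add[OF L2_const n])
  show "L2 f" by (rule L2_mono[OF L assms(2)]) (use assms(3) in force)
  have "E2 f \<le> E2 (\<lambda>\<omega>. a + c * norm (g \<omega>))" by (rule E2_mono[OF L assms(2)]) (use assms(3) in force)
  also have "\<dots> \<le> 2 * E2 (\<lambda>\<omega>. a) + 2 * E2 (\<lambda>\<omega>. c * norm (g \<omega>))" by (rule E2_add[OF L2_const n])
  also have "\<dots> = 2 * a\<^sup>2 + 2 * c\<^sup>2 * E2 g" by (simp add: E2_def power_mult_distrib prob_space)
  finally show "E2 f \<le> 2 * a\<^sup>2 + 2 * c\<^sup>2 * E2 g" .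
qed

lemma E2_lip:
  assumes "L2 g" "f \<in> borel_measurable M" "\<And>\<omega>. \<omega> \<in> space M \<Longrightarrow> norm (f \<omega>) \<le> c * norm (g \<omega>)" "0 \<le> c"
  shows "E2 f \<le> c\<^sup>2 * E2 g"
proof -
  have "E2 f \<le> E2 (\<lambda>\<omega>. c *\<^sub>R g \<omega>)"
    by (rule E2_mono[OF L2_scaleR[OF assms(1)] assms(2)]) (use assms(3,4) in auto)
  then show ?thesis by (simp add: E2_scaleR)
qed

text \<open>Cauchy-Schwarz after splitting each weight as \<open>sqrt (d i) * sqrt (d i)\<close>.
  With interval lengths as weights it estimates drift sums, with geometric weights it sums
  differences of consecutive approximations.\<close>

lemma weighted_sum_sq_le:
  assumes "finite I" "\<And>i. i \<in> I \<Longrightarrow> 0 \<le> d i"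
  shows "(norm (\<Sum>i\<in>I. d i *\<^sub>R (v i :: 'b::real_normed_vector)))\<^sup>2 \<le> (\<Sum>i\<in>I. d i) * (\<Sum>i\<in>I. d i * (norm (v i))\<^sup>2)"
proof -
  have "norm (\<Sum>i\<in>I. d i *\<^sub>R v i) \<le> (\<Sum>i\<in>I. sqrt (d i) * (sqrt (d i) * norm (v i)))"
    by (rule norm_sum[THEN order_trans]) (rule sum_mono, simp add: assms abs_of_nonneg flip: mult.assoc)
  then have "(norm (\<Sum>i\<in>I. d i *\<^sub>R v i))\<^sup>2 \<le> (\<Sum>i\<in>I. sqrt (d i) * (sqrt (d i) * norm (v i)))\<^sup>2"
    by (intro power_mono) auto
  also have "\<dots> \<le> (\<Sum>i\<in>I. (sqrt (d i))\<^sup>2) * (\<Sum>i\<in>I. (sqrt (d i) * norm (v i))\<^sup>2)"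
    by (rule Cauchy_Schwarz_ineq_sum)
  also have "\<dots> = (\<Sum>i\<in>I. d i) * (\<Sum>i\<in>I. d i * (norm (v i))\<^sup>2)"
    by (intro arg_cong2[where f="(*)"] sum.cong) (auto simp: assms power_mult_distrib)
  finally show ?thesis .
qed

lemma E2_weighted_sum:
  assumes "finite I" "\<And>i. i \<in> I \<Longrightarrow> 0 \<le> d i" "\<And>i. i \<in> I \<Longrightarrow> L2 (f i)"
  shows "E2 (\<lambda>\<omega>. \<Sum>i\<in>I. d i *\<^sub>R f i \<omega>) \<le> (\<Sum>i\<in>I. d i) * (\<Sum>i\<in>I. d i * E2 (f i))"
proof -
  have "E2 (\<lambda>\<omega>. \<Sum>i\<in>I. d i *\<^sub>R f i \<omega>) \<le> (\<integral>\<omega>. (\<Sum>i\<in>I. d i) * (\<Sum>i\<in>I. d i * (norm (f i \<omega>))\<^sup>2) \<partial>M)"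
    unfolding E2_def
  proof (rule integral_mono)
    show "integrable M (\<lambda>\<omega>. (norm (\<Sum>i\<in>I. d i *\<^sub>R f i \<omega>))\<^sup>2)"
      by (rule L2_integrable) (auto intro!: L2_sum L2_scaleR assms)
    show "integrable M (\<lambda>\<omega>. (\<Sum>i\<in>I. d i) * (\<Sum>i\<in>I. d i * (norm (f i \<omega>))\<^sup>2))"
      by (auto intro!: integrable_mult_right Bochner_Integration.integrable_sum L2_integrable assms)
  qed (auto intro!: weighted_sum_sq_le assms)
  also have "\<dots> = (\<Sum>i\<in>I. d i) * (\<Sum>i\<in>I. d i * E2 (f i))"
    by (simp add: E2_def, subst Bochner_Integration.integral_sum)
       (auto intro!: integrable_mult_right L2_integrable assms)
  finally show ?thesis .
qed

lemma integrable_L2_mult: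
  fixes f g :: "'a \<Rightarrow> real"
  assumes "L2 f" "L2 g" shows "integrable M (\<lambda>\<omega>. f \<omega> * g \<omega>)"
proof (rule Bochner_Integration.integrable_bound)
  show "integrable M (\<lambda>\<omega>. (norm (f \<omega>))\<^sup>2 + (norm (g \<omega>))\<^sup>2)" using assms by (auto simp: L2_def)
  show "(\<lambda>\<omega>. f \<omega> * g \<omega>) \<in> borel_measurable M" using assms by (auto simp: L2_def)
  show "AE \<omega> in M. norm (f \<omega> * g \<omega>) \<le> norm ((norm (f \<omega>))\<^sup>2 + (norm (g \<omega>))\<^sup>2)"
  proof (rule AE_I2)
    fix \<omega>
    have "2 * \<bar>f \<omega>\<bar> * \<bar>g \<omega>\<bar> \<le> \<bar>f \<omega>\<bar>\<^sup>2 + \<bar>g \<omega>\<bar>\<^sup>2" by (rule sum_squares_bound)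
    moreover have "0 \<le> \<bar>f \<omega>\<bar> * \<bar>g \<omega>\<bar>" by simp
    ultimately have "\<bar>f \<omega>\<bar> * \<bar>g \<omega>\<bar> \<le> \<bar>f \<omega>\<bar>\<^sup>2 + \<bar>g \<omega>\<bar>\<^sup>2" by linarith
    then show "norm (f \<omega> * g \<omega>) \<le> norm ((norm (f \<omega>))\<^sup>2 + (norm (g \<omega>))\<^sup>2)"
      by (simp add: abs_mult)
  qed
qed

lemma L2_vec_nth:
  assumes "L2 f" shows "L2 (\<lambda>\<omega>. f \<omega> $ i)"
proof (rule L2_mono[OF assms])
  have [measurable]: "f \<in> borel_measurable M" using assms L2_measurable by auto
  show "(\<lambda>\<omega>. f \<omega> $ i) \<in> borel_measurable M" by (rule borel_measurable_vec_nth) fact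
qed (rule Finite_Cartesian_Product.norm_nth_le)

lemma dW_L2: "0 \<le> s \<Longrightarrow> s \<le> t \<Longrightarrow> L2 (dW s t j)"
proof -
  assume st: "0 \<le> s" "s \<le> t"
  have "integrable M (\<lambda>\<omega>. (norm (dW s t j \<omega>))\<^sup>2)"
    using integrable_increment_sq[OF st, of "axis j 1"] by (simp add: inner_axis')
  then show ?thesis using measurable_F[OF measurable_dW[OF st]] by (auto simp: L2_def)
qed

lemma expectation_mult_dW:
  assumes "0 \<le> s" "s \<le> t" "f \<in> borel_measurable (F s)" "integrable M (\<lambda>\<omega>. f \<omega> * dW s t j \<omega>)"
  shows "(\<integral>\<omega>. f \<omega> * dW s t j \<omega> \<partial>M) = 0"
proof -
  interpret S: finite_measure_subalgebra M "F s"
    by unfold_locales (rule subalgebra_F)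
  have [measurable]: "dW s t j \<in> borel_measurable M" using measurable_F[OF measurable_dW] assms by auto
  have "(\<integral>\<omega>. f \<omega> * dW s t j \<omega> \<partial>M) = (\<integral>\<omega>. f \<omega> * real_cond_exp M (F s) (dW s t j) \<omega> \<partial>M)"
    by (rule S.real_cond_exp_intg(2)[symmetric]) (use assms in auto)
  also have "\<dots> = (\<integral>\<omega>. 0 \<partial>M)"
    by (rule integral_cong_AE)
       (use cond_exp_dW[OF assms(1,2), of j] measurable_F[OF assms(3)] in auto)
  finally show ?thesis by simp
qed

text \<open>Polarisation: the product of two coordinates of the increment is half of the square
  along \<open>axis i 1 + axis j 1\<close> minus the two single squares. The squared norm of that
  direction is 4 for equal indices and 2 otherwise.\<close>

lemma cond_exp_dW_mult:
  assumes "0 \<le> s" "s \<le> t"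
  shows "AE \<omega> in M. real_cond_exp M (F s) (\<lambda>\<omega>. dW s t i \<omega> * dW s t j \<omega>) \<omega> = (if i = j then t - s else 0)"
proof -
  interpret S: finite_measure_subalgebra M "F s"
    by unfold_locales (rule subalgebra_F)
  note dint = integrable_L2_mult[OF dW_L2[OF assms] dW_L2[OF assms]]
  show ?thesis
  proof (rule S.real_cond_exp_charact)
    fix A assume A: "A \<in> sets (F s)"
    note m = increment_moments_on(1,2)[OF assms A]
    define I where "I u \<omega> = indicator A \<omega> * (u \<bullet> (W t \<omega> - W s \<omega>))\<^sup>2" for u \<omega>
    have eq: "indicator A \<omega> *\<^sub>R (dW s t i \<omega> * dW s t j \<omega>)
        = (1/2) * (I (axis i 1 + axis j 1) \<omega> - I (axis i 1) \<omega> - I (axis j 1) \<omega>)" for \<omega>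
      by (simp add: I_def inner_axis' inner_add_left power2_eq_square algebra_simps)
    have "(\<integral>\<omega>. indicator A \<omega> *\<^sub>R (dW s t i \<omega> * dW s t j \<omega>) \<partial>M)
       = (1/2) * (prob A * ((t - s) * (norm (axis i 1 + axis j 1 :: real^'e))\<^sup>2) - prob A * ((t - s) * 1) - prob A * ((t - s) * 1))"
      unfolding eq using m unfolding I_def by simp
    also have "(norm (axis i 1 + axis j 1 :: real^'e))\<^sup>2 = (if i = j then 4 else 2)"
      by (simp add: power2_norm_eq_inner inner_add_left inner_add_right inner_axis_axis)
    also have "(1/2) * (prob A * ((t - s) * (if i = j then 4 else 2)) - prob A * ((t - s) * 1) - prob A * ((t - s) * 1))
       = (if i = j then prob A * (t - s) else 0)"
      by (simp add: algebra_simps)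
    finally show "(LINT x:A|M. dW s t i x * dW s t j x) = (LINT x:A|M. if i = j then t - s else 0)"
      using sets_F[OF A] by (cases "i = j") (auto simp: set_lebesgue_integral_def)
  qed (use dint in auto)
qed

lemma expectation_mult_dW_dW:
  assumes "0 \<le> s" "s \<le> t" "f \<in> borel_measurable (F s)"
    "integrable M (\<lambda>\<omega>. f \<omega> * (dW s t i \<omega> * dW s t j \<omega>))"
  shows "(\<integral>\<omega>. f \<omega> * (dW s t i \<omega> * dW s t j \<omega>) \<partial>M) = (if i = j then (t - s) * (\<integral>\<omega>. f \<omega> \<partial>M) else 0)"
proof -
  interpret S: finite_measure_subalgebra M "F s"
    by unfold_locales (rule subalgebra_F)
  have [measurable]: "dW s t j \<in> borel_measurable M" "dW s t i \<in> borel_measurable M"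
    using measurable_F[OF measurable_dW] assms by auto
  have "(\<integral>\<omega>. f \<omega> * (dW s t i \<omega> * dW s t j \<omega>) \<partial>M)
      = (\<integral>\<omega>. f \<omega> * real_cond_exp M (F s) (\<lambda>\<omega>. dW s t i \<omega> * dW s t j \<omega>) \<omega> \<partial>M)"
    by (rule S.real_cond_exp_intg(2)[symmetric]) (use assms in auto)
  also have "\<dots> = (\<integral>\<omega>. f \<omega> * (if i = j then t - s else 0) \<partial>M)"
    by (rule integral_cong_AE)
       (use cond_exp_dW_mult[OF assms(1,2), of i j] measurable_F[OF assms(3)] in auto)
  finally show ?thesis by simp
qed

text \<open>As \<open>f\<close> may be unbounded, pulling it out of a conditional expectation would
  presuppose the integrability that is to be proved. Instead the measure with density
  \<open>(dW s t j)\<^sup>2\<close> is shown to agree on \<open>F s\<close> with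
  \<open>t - s\<close> times \<open>M\<close>, and the nonnegative integral of the
  \<open>F s\<close>-measurable function \<open>f\<^sup>2\<close> is compared under the two.\<close>

lemma L2_mult_dW:
  assumes "0 \<le> s" "s \<le> t" "f \<in> borel_measurable (F s)" "L2 f"
  shows "L2 (\<lambda>\<omega>. f \<omega> * dW s t j \<omega>)"
proof -
  have [measurable]: "dW s t j \<in> borel_measurable M" "f \<in> borel_measurable M"
    using measurable_F[OF measurable_dW] assms measurable_F by auto
  let ?N = "density M (\<lambda>\<omega>. ennreal ((dW s t j \<omega>)\<^sup>2))"
  let ?c = "ennreal (t - s)"
  \<comment> \<open>Pushing forward along the identity into \<open>F s\<close> restricts a measure
    to the smaller sigma-algebra.\<close>
  have "distr ?N (F s) (\<lambda>x. x) = distr (scale_measure ?c M) (F s) (\<lambda>x. x)"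
  proof (rule measure_eqI)
    fix A assume "A \<in> sets (distr ?N (F s) (\<lambda>x. x))"
    then have A: "A \<in> sets (F s)" by simp
    have [measurable]: "A \<in> sets M" by (rule sets_F[OF A])
    have id: "(\<lambda>x. x) \<in> ?N \<rightarrow>\<^sub>M F s" "(\<lambda>x. x) \<in> scale_measure ?c M \<rightarrow>\<^sub>M F s"
      by (auto intro!: measurableI simp: sets_F sets.Int_space_eq2 space_scale_measure)
    have sp: "A \<inter> space M = A" by (simp add: sets.Int_space_eq2)
    note m = increment_moments_on[OF assms(1,2) A, of "axis j 1"]
    have "emeasure ?N A = (\<integral>\<^sup>+ \<omega>. ennreal ((dW s t j \<omega>)\<^sup>2) * indicator A \<omega> \<partial>M)"
      by (rule emeasure_density) auto
    also have "\<dots> = (\<integral>\<^sup>+ \<omega>. ennreal (indicator A \<omega> * (axis j 1 \<bullet> (W t \<omega> - W s \<omega>))\<^sup>2) \<partial>M)"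
      by (intro nn_integral_cong) (auto simp: inner_axis' split: split_indicator)
    also have "\<dots> = ennreal (prob A * (t - s))"
      using m by (subst nn_integral_eq_integral) auto
    also have "\<dots> = ?c * emeasure M A"
      using assms by (simp add: emeasure_eq_measure ennreal_mult' mult.commute)
    finally show "emeasure (distr ?N (F s) (\<lambda>x. x)) A = emeasure (distr (scale_measure ?c M) (F s) (\<lambda>x. x)) A"
      by (subst emeasure_distr[OF id(1) A], subst emeasure_distr[OF id(2) A]) (simp add: sp space_scale_measure)
  qed simp
  note eq = this
  have id: "(\<lambda>x. x) \<in> ?N \<rightarrow>\<^sub>M F s" "(\<lambda>x. x) \<in> scale_measure ?c M \<rightarrow>\<^sub>M F s"
    by (auto intro!: measurableI simp: sets_F sets.Int_space_eq2 space_scale_measure)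
  have fm: "(\<lambda>\<omega>. ennreal ((f \<omega>)\<^sup>2)) \<in> borel_measurable (F s)" using assms(3) by measurable
  have "(\<integral>\<^sup>+ \<omega>. ennreal ((f \<omega>)\<^sup>2) \<partial>?N) = (\<integral>\<^sup>+ \<omega>. ennreal ((f \<omega>)\<^sup>2) \<partial>(scale_measure ?c M))"
    using nn_integral_distr[OF id(1), of "\<lambda>\<omega>. ennreal ((f \<omega>)\<^sup>2)"]
      nn_integral_distr[OF id(2), of "\<lambda>\<omega>. ennreal ((f \<omega>)\<^sup>2)"] eq fm by simp
  then have "(\<integral>\<^sup>+ \<omega>. ennreal ((dW s t j \<omega>)\<^sup>2) * ennreal ((f \<omega>)\<^sup>2) \<partial>M) = ?c * (\<integral>\<^sup>+ \<omega>. ennreal ((f \<omega>)\<^sup>2) \<partial>M)"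
    by (subst (asm) nn_integral_density) (auto simp: nn_integral_scale_measure)
  also have "(\<integral>\<^sup>+ \<omega>. ennreal ((f \<omega>)\<^sup>2) \<partial>M) = ennreal (E2 f)"
    using L2_integrable[OF assms(4)] by (subst nn_integral_eq_integral) (auto simp: E2_def)
  finally have "(\<integral>\<^sup>+ \<omega>. ennreal ((dW s t j \<omega>)\<^sup>2 * (f \<omega>)\<^sup>2) \<partial>M) < \<infinity>"
    by (simp add: ennreal_mult'[symmetric] ennreal_mult_less_top)
  then have "integrable M (\<lambda>\<omega>. (dW s t j \<omega>)\<^sup>2 * (f \<omega>)\<^sup>2)"
    by (intro integrableI_nonneg) auto
  then show ?thesis by (auto simp: L2_def power_mult_distrib mult.commute)
qed

lemma measurable_matrix_nth: "H \<in> borel_measurable N \<Longrightarrow> (\<lambda>\<omega>. H \<omega> $ i $ j) \<in> borel_measurable N"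
  by (intro borel_measurable_vec_nth)

lemma norm_sq_vec: "(norm (v::real^'n::finite))\<^sup>2 = (\<Sum>i\<in>UNIV. (v $ i)\<^sup>2)"
  by (simp add: norm_vec_def L2_set_def sum_nonneg)

lemma norm_sq_matrix: "(norm (A::real^'n::finite^'m::finite))\<^sup>2 = (\<Sum>i\<in>UNIV. \<Sum>j\<in>UNIV. (A $ i $ j)\<^sup>2)"
proof -
  have "(norm A)\<^sup>2 = (\<Sum>i\<in>UNIV. (norm (A $ i))\<^sup>2)" by (simp add: norm_vec_def L2_set_def sum_nonneg)
  then show ?thesis by (simp add: norm_sq_vec)
qed

text \<open>Expanding the squared norm in coordinates leaves products of two increments of
  \<open>W\<close>. Conditioning on \<open>F s\<close> kills those with different indices and turns
  the others into \<open>t - s\<close>.\<close>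

lemma step_isometry:
  fixes H :: "'a \<Rightarrow> real^'e^'d::finite"
  assumes st: "0 \<le> s" "s \<le> t" and H: "H \<in> borel_measurable (F s)" "L2 H"
  shows "L2 (\<lambda>\<omega>. H \<omega> *v (W t \<omega> - W s \<omega>))"
    and "E2 (\<lambda>\<omega>. H \<omega> *v (W t \<omega> - W s \<omega>)) = (t - s) * E2 H"
proof -
  have Hij: "L2 (\<lambda>\<omega>. H \<omega> $ i $ j)" for i j using H(2) by (intro L2_vec_nth)
  have HijF: "(\<lambda>\<omega>. H \<omega> $ i $ j) \<in> borel_measurable (F s)" for i j using H(1) by (rule measurable_matrix_nth)
  have HW: "L2 (\<lambda>\<omega>. H \<omega> $ i $ j * dW s t j \<omega>)" for i j by (rule L2_mult_dW[OF st HijF Hij])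
  have mW: "W t \<in> borel_measurable M" "W s \<in> borel_measurable M" using st by (auto intro: measurable_W_M)
  have Hm: "H \<in> borel_measurable M" using H by (simp add: L2_def)
  have sq: "(norm (H \<omega> *v (W t \<omega> - W s \<omega>)))\<^sup>2
      = (\<Sum>i\<in>UNIV. \<Sum>j\<in>UNIV. \<Sum>k\<in>UNIV. (H \<omega> $ i $ j * dW s t j \<omega>) * (H \<omega> $ i $ k * dW s t k \<omega>))" for \<omega>
    unfolding norm_sq_vec matrix_vector_mult_def by (simp add: power2_eq_square sum_product)
  have meas: "(\<lambda>\<omega>. H \<omega> *v (W t \<omega> - W s \<omega>)) \<in> borel_measurable M"
    by (intro borel_measurable_continuous_Pair[OF Hm borel_measurable_diff[OF mW]])
       (auto intro!: continuous_intros simp: matrix_vector_mult_def)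
  show "L2 (\<lambda>\<omega>. H \<omega> *v (W t \<omega> - W s \<omega>))"
    unfolding L2_def sq using meas by (auto intro!: Bochner_Integration.integrable_sum integrable_L2_mult HW)
  have tm: "(\<integral>\<omega>. (H \<omega> $ i $ j * dW s t j \<omega>) * (H \<omega> $ i $ k * dW s t k \<omega>) \<partial>M)
      = (if j = k then (t - s) * (\<integral>\<omega>. (H \<omega> $ i $ j)\<^sup>2 \<partial>M) else 0)" for i j k
  proof -
    have eq: "(H \<omega> $ i $ j * dW s t j \<omega>) * (H \<omega> $ i $ k * dW s t k \<omega>)
      = (H \<omega> $ i $ j * H \<omega> $ i $ k) * (dW s t j \<omega> * dW s t k \<omega>)" for \<omega> by (simp add: mult_ac)
    have i: "integrable M (\<lambda>\<omega>. (H \<omega> $ i $ j * H \<omega> $ i $ k) * (dW s t j \<omega> * dW s t k \<omega>))"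
      using integrable_L2_mult[OF HW[of i j] HW[of i k]] unfolding eq .
    show ?thesis unfolding eq
      using expectation_mult_dW_dW[OF st _ i] HijF by (auto simp: power2_eq_square)
  qed
  have "E2 (\<lambda>\<omega>. H \<omega> *v (W t \<omega> - W s \<omega>)) = (\<Sum>i\<in>UNIV. \<Sum>j\<in>UNIV. \<Sum>k\<in>UNIV. (\<integral>\<omega>. (H \<omega> $ i $ j * dW s t j \<omega>) * (H \<omega> $ i $ k * dW s t k \<omega>) \<partial>M))"
    unfolding E2_def sq
    by (simp add: Bochner_Integration.integral_sum Bochner_Integration.integrable_sum integrable_L2_mult HW)
  also have "\<dots> = (\<Sum>i\<in>UNIV. \<Sum>j\<in>UNIV. (t - s) * (\<integral>\<omega>. (H \<omega> $ i $ j)\<^sup>2 \<partial>M))"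
    unfolding tm by simp
  also have "\<dots> = (t - s) * E2 H"
    unfolding E2_def norm_sq_matrix using Hij
    by (simp add: Bochner_Integration.integral_sum Bochner_Integration.integrable_sum L2_def sum_distrib_left)
  finally show "E2 (\<lambda>\<omega>. H \<omega> *v (W t \<omega> - W s \<omega>)) = (t - s) * E2 H" .
qed

lemma measurable_matrix_vector_mult:
  fixes H :: "'b \<Rightarrow> real^'n::finite^'m::finite"
  assumes "H \<in> borel_measurable N" "v \<in> borel_measurable N"
  shows "(\<lambda>\<omega>. H \<omega> *v v \<omega>) \<in> borel_measurable N"
  by (intro borel_measurable_continuous_Pair[OF assms])
     (auto intro!: continuous_intros simp: matrix_vector_mult_def)

lemma integrable_inner_L2:
  fixes f g :: "'a \<Rightarrow> real^'d::finite"
  assumes "L2 f" "L2 g" shows "integrable M (\<lambda>\<omega>. f \<omega> \<bullet> g \<omega>)"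
  unfolding inner_vec_def by (auto intro!: Bochner_Integration.integrable_sum integrable_L2_mult L2_vec_nth assms)

lemma step_orthogonal:
  fixes H :: "'a \<Rightarrow> real^'e^'d::finite"
  assumes st: "0 \<le> s" "s \<le> t" and H: "H \<in> borel_measurable (F s)" "L2 H"
    and V: "V \<in> borel_measurable (F s)" "L2 V"
  shows "(\<integral>\<omega>. V \<omega> \<bullet> (H \<omega> *v (W t \<omega> - W s \<omega>)) \<partial>M) = 0"
proof -
  have Hij: "L2 (\<lambda>\<omega>. H \<omega> $ i $ j)" for i j using H(2) by (intro L2_vec_nth)
  have HijF: "(\<lambda>\<omega>. H \<omega> $ i $ j) \<in> borel_measurable (F s)" for i j using H(1) by (rule measurable_matrix_nth)
  have HW: "L2 (\<lambda>\<omega>. H \<omega> $ i $ j * dW s t j \<omega>)" for i j by (rule L2_mult_dW[OF st HijF Hij])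
  have Vi: "L2 (\<lambda>\<omega>. V \<omega> $ i)" "(\<lambda>\<omega>. V \<omega> $ i) \<in> borel_measurable (F s)" for i
    using V by (auto intro: L2_vec_nth borel_measurable_vec_nth)
  have int: "integrable M (\<lambda>\<omega>. (V \<omega> $ i * H \<omega> $ i $ j) * dW s t j \<omega>)" for i j
    using integrable_L2_mult[OF Vi(1) HW, of i i j] by (simp add: mult.assoc)
  have eq: "V \<omega> \<bullet> (H \<omega> *v (W t \<omega> - W s \<omega>)) = (\<Sum>i\<in>UNIV. \<Sum>j\<in>UNIV. (V \<omega> $ i * H \<omega> $ i $ j) * dW s t j \<omega>)" for \<omega>
    unfolding inner_vec_def matrix_vector_mult_def by (simp add: sum_distrib_left mult.assoc)
  have "(\<integral>\<omega>. V \<omega> \<bullet> (H \<omega> *v (W t \<omega> - W s \<omega>)) \<partial>M) = (\<Sum>i\<in>UNIV. \<Sum>j\<in>UNIV. (\<integral>\<omega>. (V \<omega> $ i * H \<omega> $ i $ j) * dW s t j \<omega> \<partial>M))"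
    unfolding eq by (simp add: Bochner_Integration.integral_sum Bochner_Integration.integrable_sum int)
  also have "\<dots> = 0"
    by (intro sum.neutral ballI expectation_mult_dW[OF st _ int] borel_measurable_times Vi HijF)
  finally show ?thesis .
qed

text \<open>No order on the index set is assumed: this allows families of intervals indexed by pairs,
  as they arise from the common refinement of two partitions.\<close>
lemma family_isometry:
  fixes H :: "'i \<Rightarrow> 'a \<Rightarrow> real^'e^'d::finite"
  assumes fin: "finite I" and lu: "\<And>i. i \<in> I \<Longrightarrow> 0 \<le> l i \<and> l i \<le> u i"
    and disj: "\<And>i j. i \<in> I \<Longrightarrow> j \<in> I \<Longrightarrow> i \<noteq> j \<Longrightarrow> u i \<le> l j \<or> u j \<le> l i"
    and H: "\<And>i. i \<in> I \<Longrightarrow> H i \<in> borel_measurable (F (l i))" "\<And>i. i \<in> I \<Longrightarrow> L2 (H i)"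
  shows "L2 (\<lambda>\<omega>. \<Sum>i\<in>I. H i \<omega> *v (W (u i) \<omega> - W (l i) \<omega>))"
    and "E2 (\<lambda>\<omega>. \<Sum>i\<in>I. H i \<omega> *v (W (u i) \<omega> - W (l i) \<omega>)) = (\<Sum>i\<in>I. (u i - l i) * E2 (H i))"
proof -
  define V where "V i \<omega> = H i \<omega> *v (W (u i) \<omega> - W (l i) \<omega>)" for i \<omega>
  have V: "L2 (V i)" "E2 (V i) = (u i - l i) * E2 (H i)" if "i \<in> I" for i
    unfolding V_def using step_isometry[of "l i" "u i" "H i"] lu[OF that] H[OF that] by auto
  have VF: "V i \<in> borel_measurable (F (u i))" if "i \<in> I" for i
    unfolding V_def using lu[OF that] H(1)[OF that]
    by (intro measurable_matrix_vector_mult borel_measurable_diff measurable_W_mono) (auto intro: measurable_F_mono)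
  \<comment> \<open>The term of the earlier interval is known at the left endpoint of the later one
    and can serve as \<open>V\<close> in \<open>step_orthogonal\<close>.\<close>
  have orth': "(\<integral>\<omega>. V i \<omega> \<bullet> V j \<omega> \<partial>M) = 0" if "i \<in> I" "j \<in> I" "u i \<le> l j" for i j
    unfolding V_def[of j] using that lu[OF that(2)] H[OF that(2)] V(1)[OF that(1)] measurable_F_mono[OF that(3) VF[OF that(1)]]
    by (intro step_orthogonal) auto
  have orth: "(\<integral>\<omega>. V i \<omega> \<bullet> V j \<omega> \<partial>M) = 0" if "i \<in> I" "j \<in> I" "i \<noteq> j" for i j
    using disj[OF that] orth'[OF that(1,2)] orth'[OF that(2,1)] by (auto simp: inner_commute)
  show "L2 (\<lambda>\<omega>. \<Sum>i\<in>I. H i \<omega> *v (W (u i) \<omega> - W (l i) \<omega>))"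
    using L2_sum[of I V] V by (simp add: V_def)
  have "E2 (\<lambda>\<omega>. \<Sum>i\<in>I. V i \<omega>) = (\<integral>\<omega>. (\<Sum>i\<in>I. \<Sum>j\<in>I. V i \<omega> \<bullet> V j \<omega>) \<partial>M)"
    unfolding E2_def power2_norm_eq_inner by (simp add: inner_sum_left inner_sum_right inner_commute)
  also have "\<dots> = (\<Sum>i\<in>I. \<Sum>j\<in>I. (\<integral>\<omega>. V i \<omega> \<bullet> V j \<omega> \<partial>M))"
    by (simp add: Bochner_Integration.integral_sum Bochner_Integration.integrable_sum integrable_inner_L2 V)
  also have "\<dots> = (\<Sum>i\<in>I. \<Sum>j\<in>I. if j = i then E2 (V i) else 0)"
    by (intro sum.cong refl) (auto simp: orth E2_def power2_norm_eq_inner)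
  also have "\<dots> = (\<Sum>i\<in>I. (u i - l i) * E2 (H i))"
    using fin V by simp
  finally show "E2 (\<lambda>\<omega>. \<Sum>i\<in>I. H i \<omega> *v (W (u i) \<omega> - W (l i) \<omega>)) = (\<Sum>i\<in>I. (u i - l i) * E2 (H i))"
    by (simp add: V_def)
qed

end

text \<open>For \<open>a \<le> b\<close> the number \<open>clip a b s - a\<close> is the length of
  the part of the cell from \<open>a\<close> to \<open>b\<close> that lies before \<open>s\<close>.
  An integral up to \<open>s\<close> thus becomes a sum over a fixed set of cells, those after
  \<open>s\<close> contributing zero, and \<open>s\<close> can vary without case
  distinctions.\<close>

definition clip :: "real \<Rightarrow> real \<Rightarrow> real \<Rightarrow> real" where
  "clip a b s = min (max s a) b"

lemma clip_bounds: "a \<le> b \<Longrightarrow> a \<le> clip a b s \<and> clip a b s \<le> b"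
  by (auto simp: clip_def)

lemma clip_mono: "s \<le> s' \<Longrightarrow> clip a b s \<le> clip a b s'"
  by (auto simp: clip_def)

lemma clip_lower: "s \<le> a \<Longrightarrow> a \<le> b \<Longrightarrow> clip a b s = a"
  by (auto simp: clip_def)

lemma clip_upper: "b \<le> s \<Longrightarrow> a \<le> b \<Longrightarrow> clip a b s = b"
  by (auto simp: clip_def)

lemma clip_mid: "a \<le> s \<Longrightarrow> s \<le> b \<Longrightarrow> clip a b s = s"
  by (auto simp: clip_def)

text \<open>The recursion with equality is solved by \<open>\<alpha> * (1 + \<delta>) ^ j\<close>,
  and \<open>1 + \<delta> \<le> exp \<delta>\<close>. In the applications
  \<open>\<delta> * n\<close> is a constant times \<open>T\<close>, so the bound does not see the
  mesh.\<close>

lemma discrete_gronwall: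
  fixes a :: "nat \<Rightarrow> real"
  assumes "\<And>j. j \<le> n \<Longrightarrow> a j \<le> \<alpha> + (\<Sum>i<j. \<delta> * a i)" "0 \<le> \<delta>" "0 \<le> \<alpha>" "j \<le> n"
  shows "a j \<le> \<alpha> * exp (\<delta> * n)"
proof -
  have *: "a j \<le> \<alpha> * (1 + \<delta>) ^ j" if "j \<le> n" for j
    using that
  proof (induction j rule: less_induct)
    case (less j)
    have "a j \<le> \<alpha> + (\<Sum>i<j. \<delta> * a i)" by (rule assms(1)) (use less in auto)
    also have "\<dots> \<le> \<alpha> + (\<Sum>i<j. \<delta> * (\<alpha> * (1 + \<delta>) ^ i))"
      by (intro add_left_mono sum_mono mult_left_mono less) (use less assms in auto)
    also have "\<dots> = \<alpha> * (1 + \<delta>) ^ j"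
    proof -
      have "(\<Sum>i<j. \<delta> * (\<alpha> * (1 + \<delta>) ^ i)) = \<alpha> * ((1 + \<delta>) ^ j - 1)" for j
        by (induction j) (auto simp: algebra_simps)
      then show ?thesis by (simp add: algebra_simps)
    qed
    finally show ?case .
  qed
  have "(1 + \<delta>) ^ j \<le> (1 + \<delta>) ^ n" using assms by (intro power_increasing) auto
  also have "\<dots> \<le> (exp \<delta>) ^ n" using assms by (intro power_mono) auto
  also have "\<dots> = exp (\<delta> * n)" by (simp add: exp_of_nat_mult[symmetric] mult.commute)
  finally show ?thesis using *[OF assms(4)] assms(3) by (meson mult_left_mono order_trans)
qed

section \<open>Elementary stochastic integrals and their maximal inequality\<close>

context bm_space
begin

lemma L2_chebyshev:
  assumes "L2 f" "0 < \<eta>"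
  shows "{\<omega>\<in>space M. \<eta> < norm (f \<omega>)} \<in> sets M" "prob {\<omega>\<in>space M. \<eta> < norm (f \<omega>)} \<le> E2 f / \<eta>\<^sup>2"
proof -
  have [measurable]: "f \<in> borel_measurable M" using assms by (simp add: L2_def)
  show s: "{\<omega>\<in>space M. \<eta> < norm (f \<omega>)} \<in> sets M" by measurable
  have "{\<omega>\<in>space M. \<eta> < norm (f \<omega>)} \<subseteq> {\<omega>\<in>space M. \<eta>\<^sup>2 \<le> (norm (f \<omega>))\<^sup>2}"
    using assms by (auto intro!: power_mono)
  then have "prob {\<omega>\<in>space M. \<eta> < norm (f \<omega>)} \<le> prob {\<omega>\<in>space M. \<eta>\<^sup>2 \<le> (norm (f \<omega>))\<^sup>2}"
    by (intro finite_measure_mono) auto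
  also have "\<dots> \<le> E2 f / \<eta>\<^sup>2"
    unfolding E2_def using assms L2_integrable[OF assms(1)]
    by (intro integral_Markov_inequality_measure[where A="space M"]) auto
  finally show "prob {\<omega>\<in>space M. \<eta> < norm (f \<omega>)} \<le> E2 f / \<eta>\<^sup>2" .
qed

text \<open>The stochastic integral up to \<open>s\<close> of the step process that equals
  \<open>H k\<close> on the cell from \<open>t k\<close> to \<open>t (Suc k)\<close>, as a process
  in continuous time.\<close>

definition eint :: "(nat \<Rightarrow> real) \<Rightarrow> nat \<Rightarrow> (nat \<Rightarrow> 'a \<Rightarrow> real^'e^'d::finite) \<Rightarrow> real \<Rightarrow> 'a \<Rightarrow> real^'d" where
  "eint t n H s \<omega> = (\<Sum>k<n. H k \<omega> *v (W (clip (t k) (t (Suc k)) s) \<omega> - W (t k) \<omega>))"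

lemma eint_at_grid:
  assumes "mono t" "j \<le> n"
  shows "eint t n H (t j) \<omega> = (\<Sum>k<j. H k \<omega> *v (W (t (Suc k)) \<omega> - W (t k) \<omega>))"
proof -
  have "eint t n H (t j) \<omega> = (\<Sum>k<n. if k < j then H k \<omega> *v (W (t (Suc k)) \<omega> - W (t k) \<omega>) else 0)"
    unfolding eint_def
  proof (intro sum.cong refl)
    fix k
    have le: "t k \<le> t (Suc k)" using assms(1) by (simp add: monoD)
    show "H k \<omega> *v (W (clip (t k) (t (Suc k)) (t j)) \<omega> - W (t k) \<omega>)
      = (if k < j then H k \<omega> *v (W (t (Suc k)) \<omega> - W (t k) \<omega>) else 0)"
    proof (cases "k < j")
      case True
      then have "t (Suc k) \<le> t j" using assms(1) by (simp add: monoD)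
      then show ?thesis using True le by (simp add: clip_upper)
    next
      case False
      then have "t j \<le> t k" using assms(1) by (simp add: monoD)
      then show ?thesis using False le by (simp add: clip_lower)
    qed
  qed
  also have "\<dots> = (\<Sum>k<j. H k \<omega> *v (W (t (Suc k)) \<omega> - W (t k) \<omega>))"
    using assms(2) by (intro sum.mono_neutral_cong_right) auto
  finally show ?thesis .
qed

lemma eint_L2:
  fixes H :: "nat \<Rightarrow> 'a \<Rightarrow> real^'e^'d::finite"
  assumes t: "mono t" "0 \<le> t 0"
    and H: "\<And>k. k < n \<Longrightarrow> H k \<in> borel_measurable (F (t k))" "\<And>k. k < n \<Longrightarrow> L2 (H k)"
  shows "L2 (eint t n H s)" "E2 (eint t n H s) \<le> (\<Sum>k<n. (t (Suc k) - t k) * E2 (H k))"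
proof -
  have le: "t k \<le> t (Suc k)" "0 \<le> t k" for k using t by (auto simp: monoD order_trans[OF t(2)])
  have disj: "clip (t i) (t (Suc i)) s \<le> t j" if "i < j" for i j
    using clip_bounds[OF le(1), of i s] monoD[OF t(1), of "Suc i" j] that by auto
  have "L2 (\<lambda>\<omega>. \<Sum>k\<in>{..<n}. H k \<omega> *v (W (clip (t k) (t (Suc k)) s) \<omega> - W (t k) \<omega>)) \<and>
     E2 (\<lambda>\<omega>. \<Sum>k\<in>{..<n}. H k \<omega> *v (W (clip (t k) (t (Suc k)) s) \<omega> - W (t k) \<omega>))
       = (\<Sum>k\<in>{..<n}. (clip (t k) (t (Suc k)) s - t k) * E2 (H k))"
  proof -
    have d: "clip (t i) (t (Suc i)) s \<le> t j \<or> clip (t j) (t (Suc j)) s \<le> t i" if "i \<noteq> j" for i j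
      using disj that by (meson linorder_neqE_nat)
    show ?thesis
      by (intro conjI family_isometry d) (use H le clip_bounds[OF le(1)] in auto)
  qed
  note * = this
  show "L2 (eint t n H s)" using * by (simp add: eint_def[abs_def])
  have "E2 (eint t n H s) = (\<Sum>k<n. (clip (t k) (t (Suc k)) s - t k) * E2 (H k))"
    using * by (simp add: eint_def[abs_def])
  also have "\<dots> \<le> (\<Sum>k<n. (t (Suc k) - t k) * E2 (H k))"
    using clip_bounds[OF le(1)] by (intro sum_mono mult_right_mono) auto
  finally show "E2 (eint t n H s) \<le> (\<Sum>k<n. (t (Suc k) - t k) * E2 (H k))" .
qed

lemma eint_measurable:
  fixes H :: "nat \<Rightarrow> 'a \<Rightarrow> real^'e^'d::finite"
  assumes t: "mono t" "0 \<le> t 0" and H: "\<And>k. k < n \<Longrightarrow> H k \<in> borel_measurable (F (t k))"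
  shows "eint t n H s \<in> borel_measurable (F s)"
  unfolding eint_def[abs_def]
proof (intro borel_measurable_sum)
  fix k assume "k \<in> {..<n}"
  then have k: "k < n" by simp
  have le: "t k \<le> t (Suc k)" "0 \<le> t k" using t by (auto simp: monoD order_trans[OF t(2)])
  show "(\<lambda>\<omega>. H k \<omega> *v (W (clip (t k) (t (Suc k)) s) \<omega> - W (t k) \<omega>)) \<in> borel_measurable (F s)"
  proof (cases "t k \<le> s")
    case True
    then have "clip (t k) (t (Suc k)) s \<le> s" "0 \<le> clip (t k) (t (Suc k)) s" using le by (auto simp: clip_def)
    then show ?thesis using True H[OF k] le
      by (intro measurable_matrix_vector_mult borel_measurable_diff measurable_W_mono) (auto intro: measurable_F_mono)
  next
    case False
    then show ?thesis using le by (simp add: clip_lower)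
  qed
qed

text \<open>Kolmogorov's argument: the integral is stopped at the first time of the grid
  \<open>s\<close> where it exceeds \<open>\<eta>\<close>. The stopped value \<open>S\<close> is
  again an elementary integral, over the common refinement of both grids with integrands cut off by
  the events \<open>A i\<close>. The isometry bounds its second moment by the full sum, and
  Chebyshev finishes.\<close>

lemma maximal_ineq_grid:
  fixes H :: "nat \<Rightarrow> 'a \<Rightarrow> real^'e^'d::finite" and s :: "nat \<Rightarrow> real"
  assumes t: "mono t" "0 \<le> t 0" and s: "mono s" "s 0 = t 0"
    and H: "\<And>k. k < n \<Longrightarrow> H k \<in> borel_measurable (F (t k))" "\<And>k. k < n \<Longrightarrow> L2 (H k)"
    and "0 < \<eta>"
  shows "prob {\<omega>\<in>space M. \<exists>i\<le>q. \<eta> < norm (eint t n H (s i) \<omega>)} \<le> (\<Sum>k<n. (t (Suc k) - t k) * E2 (H k)) / \<eta>\<^sup>2"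
proof -
  have le: "t k \<le> t (Suc k)" "0 \<le> t k" for k using t by (auto simp: monoD order_trans[OF t(2)])
  define A where "A i = {\<omega>\<in>space M. \<forall>i'\<le>i. norm (eint t n H (s i') \<omega>) \<le> \<eta>}" for i
  have AF: "A i \<in> sets (F (s i))" for i
  proof -
    have "eint t n H (s i') \<in> borel_measurable (F (s i))" if "i' \<le> i" for i'
      using eint_measurable[OF t H(1), of n "s i'"] measurable_F_mono[OF monoD[OF s(1) that]] by blast
    then have "{\<omega>\<in>space (F (s i)). \<forall>i'\<in>{..i}. norm (eint t n H (s i') \<omega>) \<le> \<eta>} \<in> sets (F (s i))"
      by (intro sets.sets_Collect_finite_All borel_measurable_le borel_measurable_norm) auto
    moreover have "A i = {\<omega>\<in>space (F (s i)). \<forall>i'\<in>{..i}. norm (eint t n H (s i') \<omega>) \<le> \<eta>}" by (auto simp: A_def)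
    ultimately show ?thesis by simp
  qed
  \<comment> \<open>Pairs whose cell \<open>k\<close> has ended by \<open>s i\<close> are left out.
    For the others the refined interval starts no earlier than \<open>s i\<close> and
    \<open>t k\<close>, so that \<open>A i\<close> and \<open>H k\<close> are known at its left
    endpoint. The omitted intervals have length zero.\<close>
  define I where "I = {(i, k). i < q \<and> k < n \<and> s i < t (Suc k)}"
  have finI: "finite I" by (rule finite_subset[of _ "{..<q} \<times> {..<n}"]) (auto simp: I_def)
  define l where "l = (\<lambda>(i, k). clip (t k) (t (Suc k)) (s i))"
  define u where "u = (\<lambda>(i, k). clip (t k) (t (Suc k)) (s (Suc i)))"
  define G where "G = (\<lambda>(i, k) \<omega>. indicator (A i) \<omega> *\<^sub>R H k \<omega>)"
  have lu: "0 \<le> l p \<and> l p \<le> u p" for p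
  proof -
    obtain i k where p: "p = (i, k)" by (cases p)
    have "s i \<le> s (Suc i)" using s by (simp add: monoD)
    then show ?thesis using clip_bounds[OF le(1)[of k], of "s i"] le(2)[of k]
      by (auto simp: p l_def u_def intro: clip_mono)
  qed
  have disj': "u p \<le> l p'" if "snd p < snd p' \<or> snd p = snd p' \<and> fst p < fst p'" for p p'
  proof -
    obtain i k i' k' where p: "p = (i, k)" "p' = (i', k')" by (cases p, cases p') blast
    have "clip (t k) (t (Suc k)) (s (Suc i)) \<le> clip (t k') (t (Suc k')) (s i')"
    proof (cases "k < k'")
      case True
      then have "t (Suc k) \<le> t k'" using t by (simp add: monoD)
      then show ?thesis using clip_bounds[OF le(1)[of k], of "s (Suc i)"] clip_bounds[OF le(1)[of k'], of "s i'"] by linarith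
    next
      case False
      then have "k = k'" "i < i'" using that by (auto simp: p)
      then show ?thesis using monoD[OF s(1), of "Suc i" i'] by (auto intro: clip_mono)
    qed
    then show ?thesis by (simp add: p l_def u_def)
  qed
  have GF: "G p \<in> borel_measurable (F (l p))" "L2 (G p)" "E2 (G p) \<le> E2 (H (snd p))" if "p \<in> I" for p
  proof -
    obtain i k where p: "p = (i, k)" by (cases p)
    have ik: "i < q" "k < n" "s i < t (Suc k)" using that by (auto simp: p I_def)
    have ls: "s i \<le> l p" "t k \<le> l p" using ik le[of k] by (auto simp: p l_def clip_def)
    have "(\<lambda>\<omega>. indicator (A i) \<omega> *\<^sub>R H k \<omega>) \<in> borel_measurable (F (l p))"
      using sets_F_mono[OF ls(1) AF] measurable_F_mono[OF ls(2) H(1)[OF ik(2)]]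
      by (intro borel_measurable_scaleR borel_measurable_indicator)
    then show 1: "G p \<in> borel_measurable (F (l p))" by (simp add: p G_def)
    show 2: "L2 (G p)" using L2_indicator[OF H(2)[OF ik(2)] sets_F[OF AF]] by (simp add: p G_def)
    show "E2 (G p) \<le> E2 (H (snd p))"
      by (rule E2_mono) (use H(2)[OF ik(2)] 2 in \<open>auto simp: p G_def L2_def split: split_indicator\<close>)
  qed
  define S where "S \<omega> = (\<Sum>p\<in>I. G p \<omega> *v (W (u p) \<omega> - W (l p) \<omega>))" for \<omega>
  have S: "L2 S" "E2 S = (\<Sum>p\<in>I. (u p - l p) * E2 (G p))"
  proof -
    have d: "u p \<le> l p' \<or> u p' \<le> l p" if "p \<noteq> p'" for p p'
      using disj'[of p p'] disj'[of p' p] that by (metis linorder_neqE_nat prod_eqI)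
    show "L2 S" "E2 S = (\<Sum>p\<in>I. (u p - l p) * E2 (G p))"
      unfolding S_def[abs_def] by (rule family_isometry[OF finI lu d GF(1,2)]; assumption)+
  qed
  have "E2 S \<le> (\<Sum>p\<in>I. (u p - l p) * E2 (H (snd p)))"
    unfolding S(2) using lu GF(3) by (intro sum_mono mult_left_mono) auto
  also have "\<dots> \<le> (\<Sum>p\<in>{..<q} \<times> {..<n}. (u p - l p) * E2 (H (snd p)))"
    using lu by (intro sum_mono2) (auto simp: I_def)
  also have "\<dots> = (\<Sum>k<n. \<Sum>i<q. (u (i, k) - l (i, k)) * E2 (H k))"
    by (simp add: sum.cartesian_product' sum.swap[of _ "{..<n}"])
  also have "\<dots> = (\<Sum>k<n. (clip (t k) (t (Suc k)) (s q) - clip (t k) (t (Suc k)) (s 0)) * E2 (H k))"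
    unfolding sum_distrib_right[symmetric] l_def u_def prod.case
    by (subst sum_lessThan_telescope[where f="\<lambda>i. clip (t k) (t (Suc k)) (s i)" for k]) simp
  also have "\<dots> \<le> (\<Sum>k<n. (t (Suc k) - t k) * E2 (H k))"
    using clip_bounds[OF le(1)] by (intro sum_mono mult_right_mono) (auto intro!: diff_mono)
  finally have ES: "E2 S \<le> (\<Sum>k<n. (t (Suc k) - t k) * E2 (H k))" .
  have S_eq: "S \<omega> = (\<Sum>i<q. indicator (A i) \<omega> *\<^sub>R (eint t n H (s (Suc i)) \<omega> - eint t n H (s i) \<omega>))" for \<omega>
  proof -
    have "S \<omega> = (\<Sum>p\<in>{..<q} \<times> {..<n}. G p \<omega> *v (W (u p) \<omega> - W (l p) \<omega>))"
      unfolding S_def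
    proof (rule sum.mono_neutral_left)
      show "\<forall>p\<in>{..<q} \<times> {..<n} - I. G p \<omega> *v (W (u p) \<omega> - W (l p) \<omega>) = 0"
      proof
        fix p assume "p \<in> {..<q} \<times> {..<n} - I"
        then obtain i k where p: "p = (i, k)" "t (Suc k) \<le> s i" by (cases p) (auto simp: I_def not_less)
        have "s i \<le> s (Suc i)" using s by (simp add: monoD)
        then have "u p = l p" using p le by (simp add: u_def l_def clip_upper)
        then show "G p \<omega> *v (W (u p) \<omega> - W (l p) \<omega>) = 0" by simp
      qed
    qed (auto simp: I_def)
    also have "\<dots> = (\<Sum>i<q. \<Sum>k<n. G (i, k) \<omega> *v (W (u (i, k)) \<omega> - W (l (i, k)) \<omega>))"
      by (simp add: sum.cartesian_product')
    also have "\<dots> = (\<Sum>i<q. indicator (A i) \<omega> *\<^sub>R (eint t n H (s (Suc i)) \<omega> - eint t n H (s i) \<omega>))"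
      by (intro sum.cong refl)
         (simp add: eint_def G_def u_def l_def sum_subtractf[symmetric] scaleR_sum_right
            matrix_vector_mult_diff_distrib[symmetric] scaleR_matrix_vector_assoc)
    finally show ?thesis .
  qed
  have eint0: "eint t n H (s 0) \<omega> = 0" for \<omega>
    unfolding s(2) using eint_at_grid[OF t(1), of 0] by simp
  have "{\<omega>\<in>space M. \<exists>i\<le>q. \<eta> < norm (eint t n H (s i) \<omega>)} \<subseteq> {\<omega>\<in>space M. \<eta> < norm (S \<omega>)}"
  proof safe
    fix \<omega> i assume \<omega>: "\<omega> \<in> space M" and i: "i \<le> q" "\<eta> < norm (eint t n H (s i) \<omega>)"
    define j where "j = (LEAST i. \<eta> < norm (eint t n H (s i) \<omega>))"
    have j: "\<eta> < norm (eint t n H (s j) \<omega>)" unfolding j_def by (rule LeastI[of "\<lambda>i. \<eta> < norm (eint t n H (s i) \<omega>)" i]) (rule i(2))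
    have jmin: "norm (eint t n H (s i') \<omega>) \<le> \<eta>" if "i' < j" for i'
      using not_less_Least[of i' "\<lambda>i. \<eta> < norm (eint t n H (s i) \<omega>)"] that by (simp add: j_def)
    have jq: "j \<le> q" using Least_le[of "\<lambda>i. \<eta> < norm (eint t n H (s i) \<omega>)", OF i(2)] i(1) by (simp add: j_def)
    have ind: "indicator (A i') \<omega> = (if i' < j then 1 else 0::real)" for i'
    proof (cases "i' < j")
      case True then show ?thesis using jmin \<omega> by (auto simp: A_def)
    next
      case False
      then have "\<omega> \<notin> A i'" using j by (auto simp: A_def intro!: exI[of _ j])
      then show ?thesis using False by simp
    qed
    \<comment> \<open>With \<open>j\<close> the first index of exceedance, exactly the increments
      before \<open>j\<close> are switched on, so \<open>S\<close> telescopes to the value at that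
      time.\<close>
    have "S \<omega> = (\<Sum>i'<j. eint t n H (s (Suc i')) \<omega> - eint t n H (s i') \<omega>)"
      unfolding S_eq ind using jq by (intro sum.mono_neutral_cong_right) auto
    also have "\<dots> = eint t n H (s j) \<omega>" using sum_lessThan_telescope[of "\<lambda>i. eint t n H (s i) \<omega>" j] by (simp add: eint0)
    finally show "\<eta> < norm (S \<omega>)" using j by simp
  qed
  then have "prob {\<omega>\<in>space M. \<exists>i\<le>q. \<eta> < norm (eint t n H (s i) \<omega>)} \<le> prob {\<omega>\<in>space M. \<eta> < norm (S \<omega>)}"
    using L2_chebyshev(1)[OF S(1) \<open>0 < \<eta>\<close>] by (intro finite_measure_mono)
  also have "\<dots> \<le> E2 S / \<eta>\<^sup>2" by (rule L2_chebyshev(2)[OF S(1) \<open>0 < \<eta>\<close>])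
  also have "\<dots> \<le> (\<Sum>k<n. (t (Suc k) - t k) * E2 (H k)) / \<eta>\<^sup>2" using ES by (intro divide_right_mono) auto
  finally show ?thesis .
qed

lemma continuous_paths: "AE \<omega> in M. continuous_on {0..} (\<lambda>s. W s \<omega>)"
  using BM unfolding brownian_motion_def by (elim conjE)

lemma eint_continuous:
  fixes H :: "nat \<Rightarrow> 'a \<Rightarrow> real^'e^'d::finite"
  assumes "continuous_on {0..} (\<lambda>s. W s \<omega>)" "mono t" "0 \<le> t 0"
  shows "continuous_on UNIV (\<lambda>s. eint t n H s \<omega>)"
  unfolding eint_def
proof (intro continuous_on_sum)
  fix k
  have le: "t k \<le> t (Suc k)" "0 \<le> t k" for k using assms by (auto simp: monoD order_trans[OF assms(3)])
  have "continuous_on UNIV (\<lambda>s. W (clip (t k) (t (Suc k)) s) \<omega>)"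
  proof (rule continuous_on_compose2[OF assms(1)])
    show "continuous_on UNIV (clip (t k) (t (Suc k)))" unfolding clip_def by (intro continuous_intros)
    show "clip (t k) (t (Suc k)) ` UNIV \<subseteq> {0..}" using clip_bounds[OF le(1)[of k]] le(2)[of k] by (auto intro: order_trans)
  qed
  then show "continuous_on UNIV (\<lambda>s. H k \<omega> *v (W (clip (t k) (t (Suc k)) s) \<omega> - W (t k) \<omega>))"
    unfolding matrix_vector_mult_def by (intro continuous_intros)
qed

lemma dyadic_floor_tendsto:
  fixes s T :: real
  assumes "0 < T"
  shows "(\<lambda>q. T * real_of_int \<lfloor>s * 2 ^ q / T\<rfloor> / 2 ^ q) \<longlonglongrightarrow> s"
proof (rule tendsto_sandwich)
  have p: "(\<lambda>q. T / 2 ^ q :: real) \<longlonglongrightarrow> 0"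
    using LIMSEQ_realpow_zero[of "1/2::real", THEN tendsto_mult_left, of T] by (simp add: power_divide)
  show "(\<lambda>q. s - T / 2 ^ q) \<longlonglongrightarrow> s" using tendsto_diff[OF tendsto_const p, of s] by simp
  show "(\<lambda>q. s) \<longlonglongrightarrow> s" by simp
  show "\<forall>\<^sub>F q in sequentially. T * real_of_int \<lfloor>s * 2 ^ q / T\<rfloor> / 2 ^ q \<le> s"
  proof (intro always_eventually allI)
    fix q
    have "real_of_int \<lfloor>s * 2 ^ q / T\<rfloor> \<le> s * 2 ^ q / T" by linarith
    then have "T * real_of_int \<lfloor>s * 2 ^ q / T\<rfloor> \<le> T * (s * 2 ^ q / T)" using assms by (intro mult_left_mono) auto
    then show "T * real_of_int \<lfloor>s * 2 ^ q / T\<rfloor> / 2 ^ q \<le> s" using assms by (simp add: pos_divide_le_eq)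
  qed
  show "\<forall>\<^sub>F q in sequentially. s - T / 2 ^ q \<le> T * real_of_int \<lfloor>s * 2 ^ q / T\<rfloor> / 2 ^ q"
  proof (intro always_eventually allI)
    fix q
    have "s * 2 ^ q / T - 1 \<le> real_of_int \<lfloor>s * 2 ^ q / T\<rfloor>" by linarith
    then have "T * (s * 2 ^ q / T - 1) \<le> T * real_of_int \<lfloor>s * 2 ^ q / T\<rfloor>" using assms by (intro mult_left_mono) auto
    then have "s * 2 ^ q - T \<le> T * real_of_int \<lfloor>s * 2 ^ q / T\<rfloor>" using assms by (simp add: right_diff_distrib)
    then have "(s * 2 ^ q - T) / 2 ^ q \<le> T * real_of_int \<lfloor>s * 2 ^ q / T\<rfloor> / 2 ^ q" by (intro divide_right_mono) auto
    then show "s - T / 2 ^ q \<le> T * real_of_int \<lfloor>s * 2 ^ q / T\<rfloor> / 2 ^ q" by (simp add: diff_divide_distrib)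
  qed
qed

text \<open>The exceedance events on the dyadic grids of \<open>{0..T}\<close> increase with the
  level and all obey the bound of the grid inequality, hence so does their union. Continuity of the
  paths, valid off a null set, passes from dyadic times to all times.\<close>

lemma maximal_ineq:
  fixes H :: "nat \<Rightarrow> 'a \<Rightarrow> real^'e^'d::finite"
  assumes t: "mono t" "t 0 = 0" and T: "0 < T"
    and H: "\<And>k. k < n \<Longrightarrow> H k \<in> borel_measurable (F (t k))" "\<And>k. k < n \<Longrightarrow> L2 (H k)"
    and "0 < \<eta>"
  obtains B where "B \<in> sets M" "prob B \<le> (\<Sum>k<n. (t (Suc k) - t k) * E2 (H k)) / \<eta>\<^sup>2"
    "\<And>\<omega> s. \<omega> \<in> space M - B \<Longrightarrow> 0 \<le> s \<Longrightarrow> s \<le> T \<Longrightarrow> norm (eint t n H s \<omega>) \<le> \<eta>"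
proof -
  let ?C = "(\<Sum>k<n. (t (Suc k) - t k) * E2 (H k)) / \<eta>\<^sup>2"
  have t0: "0 \<le> t 0" using t by simp
  obtain N where N: "N \<in> null_sets M" "{\<omega>\<in>space M. \<not> continuous_on {0..} (\<lambda>s. W s \<omega>)} \<subseteq> N"
    using continuous_paths by (auto elim: AE_E simp: null_sets_def)
  define B where "B q = {\<omega>\<in>space M. \<exists>i\<le>2^q. \<eta> < norm (eint t n H (T * real i / 2 ^ q) \<omega>)}" for q :: nat
  have em: "eint t n H s \<in> borel_measurable M" for s using eint_measurable[OF t(1) t0 H(1)] measurable_F by blast
  have Bm: "B q \<in> sets M" for q
  proof -
    have "{\<omega>\<in>space M. \<exists>i\<in>{..2^q}. \<eta> < norm (eint t n H (T * real i / 2 ^ q) \<omega>)} \<in> sets M"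
      using em by (intro sets.sets_Collect_finite_Ex borel_measurable_less borel_measurable_norm) auto
    moreover have "B q = {\<omega>\<in>space M. \<exists>i\<in>{..2^q}. \<eta> < norm (eint t n H (T * real i / 2 ^ q) \<omega>)}" by (auto simp: B_def)
    ultimately show ?thesis by simp
  qed
  have inc: "incseq B"
  proof (rule incseq_SucI)
    fix q show "B q \<subseteq> B (Suc q)"
    proof
      fix \<omega> assume "\<omega> \<in> B q"
      then obtain i where "\<omega> \<in> space M" "i \<le> 2^q" "\<eta> < norm (eint t n H (T * real i / 2 ^ q) \<omega>)" by (auto simp: B_def)
      then show "\<omega> \<in> B (Suc q)" by (auto simp: B_def intro!: exI[of _ "2 * i"])
    qed
  qed
  have "prob (B q) \<le> ?C" for q
    unfolding B_def
    by (rule maximal_ineq_grid[OF t(1) t0 _ _ H \<open>0 < \<eta>\<close>])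
       (use T t in \<open>auto intro!: monoI divide_right_mono mult_left_mono\<close>)
  then have "prob (\<Union>q. B q) \<le> ?C"
    using Bm by (intro LIMSEQ_le_const2[OF finite_Lim_measure_incseq[OF _ inc]]) auto
  moreover have "prob ((\<Union>q. B q) \<union> N) = prob (\<Union>q. B q)"
    using N(1) Bm by (intro measure_Un_null_set) auto
  ultimately have P: "prob ((\<Union>q. B q) \<union> N) \<le> ?C" by simp
  show thesis
  proof (rule that[OF _ P])
    show "(\<Union>q. B q) \<union> N \<in> sets M" using Bm N by auto
    fix \<omega> s assume \<omega>: "\<omega> \<in> space M - ((\<Union>q. B q) \<union> N)" and s: "0 \<le> s" "s \<le> T"
    have c: "continuous_on UNIV (\<lambda>s. eint t n H s \<omega>)"
      by (rule eint_continuous[OF _ t(1) t0]) (use \<omega> N in auto)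
    have "(\<lambda>q. norm (eint t n H (T * real_of_int \<lfloor>s * 2 ^ q / T\<rfloor> / 2 ^ q) \<omega>)) \<longlonglongrightarrow> norm (eint t n H s \<omega>)"
      by (intro tendsto_norm continuous_on_tendsto_compose[OF c dyadic_floor_tendsto[OF T]]) auto
    moreover have "norm (eint t n H (T * real_of_int \<lfloor>s * 2 ^ q / T\<rfloor> / 2 ^ q) \<omega>) \<le> \<eta>" for q
    proof -
      define i where "i = nat \<lfloor>s * 2 ^ q / T\<rfloor>"
      have "0 \<le> \<lfloor>s * 2 ^ q / T\<rfloor>" using s T by simp
      then have i: "real_of_int \<lfloor>s * 2 ^ q / T\<rfloor> = real i" by (simp add: i_def)
      have "s * 2 ^ q / T \<le> 2 ^ q" using s T by (simp add: field_simps)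
      then have "real i \<le> 2 ^ q" unfolding i[symmetric] by linarith
      then have "i \<le> 2 ^ q" by (metis of_nat_le_iff of_nat_numeral of_nat_power)
      moreover have "\<omega> \<notin> B q" "\<omega> \<in> space M" using \<omega> by auto
      ultimately show ?thesis unfolding i B_def by (auto simp: not_less)
    qed
    ultimately show "norm (eint t n H s \<omega>) \<le> \<eta>" by (intro LIMSEQ_le_const2) auto
  qed
qed

text \<open>On \<open>A j\<close> all earlier events \<open>A i\<close> hold as well, so each
  coefficient may be cut off by its own \<open>indicator (A i)\<close>. Unlike
  \<open>indicator (A j)\<close>, this cut-off is known at time \<open>t i\<close>, which keeps the
  isometry available. The factors 4, 4 and 2 are those of \<open>E2_add3\<close>.\<close>

lemma localized_L2_estimate:
  fixes H :: "nat \<Rightarrow> 'a \<Rightarrow> real^'e^'d::finite"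
  assumes t: "mono t" "0 \<le> t 0"
    and A: "\<And>i. i \<le> j \<Longrightarrow> A i \<in> sets (F (t i))" "\<And>i. i \<le> j \<Longrightarrow> A j \<subseteq> A i"
    and V: "\<And>\<omega>. \<omega> \<in> A j \<Longrightarrow> V \<omega> = a \<omega> + (\<Sum>i<j. (t (Suc i) - t i) *\<^sub>R \<beta> i \<omega>) + (\<Sum>i<j. H i \<omega> *v (W (t (Suc i)) \<omega> - W (t i) \<omega>))"
    and Vm: "V \<in> borel_measurable M"
    and a: "L2 (\<lambda>\<omega>. indicator (A j) \<omega> *\<^sub>R a \<omega>)"
    and \<beta>: "\<And>i. i < j \<Longrightarrow> L2 (\<lambda>\<omega>. indicator (A i) \<omega> *\<^sub>R \<beta> i \<omega>)"
    and H: "\<And>i. i < j \<Longrightarrow> H i \<in> borel_measurable (F (t i))" "\<And>i. i < j \<Longrightarrow> L2 (\<lambda>\<omega>. indicator (A i) \<omega> *\<^sub>R H i \<omega>)"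
  shows "L2 (\<lambda>\<omega>. indicator (A j) \<omega> *\<^sub>R V \<omega>)"
    and "E2 (\<lambda>\<omega>. indicator (A j) \<omega> *\<^sub>R V \<omega>) \<le> 4 * E2 (\<lambda>\<omega>. indicator (A j) \<omega> *\<^sub>R a \<omega>)
      + 4 * ((t j - t 0) * (\<Sum>i<j. (t (Suc i) - t i) * E2 (\<lambda>\<omega>. indicator (A i) \<omega> *\<^sub>R \<beta> i \<omega>)))
      + 2 * (\<Sum>i<j. (t (Suc i) - t i) * E2 (\<lambda>\<omega>. indicator (A i) \<omega> *\<^sub>R H i \<omega>))"
proof -
  have le: "t k \<le> t (Suc k)" "0 \<le> t k" for k using t by (auto simp: monoD order_trans[OF t(2)])
  define b where "b \<omega> = (\<Sum>i<j. (t (Suc i) - t i) *\<^sub>R (indicator (A i) \<omega> *\<^sub>R \<beta> i \<omega>))" for \<omega>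
  define c where "c \<omega> = (\<Sum>i<j. (indicator (A i) \<omega> *\<^sub>R H i \<omega>) *v (W (t (Suc i)) \<omega> - W (t i) \<omega>))" for \<omega>
  have b: "L2 b" "E2 b \<le> (t j - t 0) * (\<Sum>i<j. (t (Suc i) - t i) * E2 (\<lambda>\<omega>. indicator (A i) \<omega> *\<^sub>R \<beta> i \<omega>))"
  proof -
    show "L2 b" unfolding b_def[abs_def] by (intro L2_sum L2_scaleR \<beta>) auto
    have "E2 b \<le> (\<Sum>i<j. t (Suc i) - t i) * (\<Sum>i<j. (t (Suc i) - t i) * E2 (\<lambda>\<omega>. indicator (A i) \<omega> *\<^sub>R \<beta> i \<omega>))"
      unfolding b_def[abs_def] by (rule E2_weighted_sum) (use \<beta> le in auto)
    then show "E2 b \<le> (t j - t 0) * (\<Sum>i<j. (t (Suc i) - t i) * E2 (\<lambda>\<omega>. indicator (A i) \<omega> *\<^sub>R \<beta> i \<omega>))"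
      by (simp add: sum_lessThan_telescope)
  qed
  have c: "L2 c" "E2 c = (\<Sum>i<j. (t (Suc i) - t i) * E2 (\<lambda>\<omega>. indicator (A i) \<omega> *\<^sub>R H i \<omega>))"
  proof -
    have "L2 (\<lambda>\<omega>. \<Sum>i\<in>{..<j}. (indicator (A i) \<omega> *\<^sub>R H i \<omega>) *v (W (t (Suc i)) \<omega> - W (t i) \<omega>)) \<and>
      E2 (\<lambda>\<omega>. \<Sum>i\<in>{..<j}. (indicator (A i) \<omega> *\<^sub>R H i \<omega>) *v (W (t (Suc i)) \<omega> - W (t i) \<omega>))
       = (\<Sum>i\<in>{..<j}. (t (Suc i) - t i) * E2 (\<lambda>\<omega>. indicator (A i) \<omega> *\<^sub>R H i \<omega>))"
    proof -
      have d: "t (Suc i) \<le> t k \<or> t (Suc k) \<le> t i" if "i \<noteq> k" for i k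
        using monoD[OF t(1), of "Suc i" k] monoD[OF t(1), of "Suc k" i] that by linarith
      have m: "(\<lambda>\<omega>. indicator (A i) \<omega> *\<^sub>R H i \<omega>) \<in> borel_measurable (F (t i))" if "i < j" for i
        using H(1)[OF that] A(1)[of i] that by (intro borel_measurable_scaleR borel_measurable_indicator) auto
      show ?thesis by (intro conjI family_isometry d) (use H m le in auto)
    qed
    then show "L2 c" "E2 c = (\<Sum>i<j. (t (Suc i) - t i) * E2 (\<lambda>\<omega>. indicator (A i) \<omega> *\<^sub>R H i \<omega>))"
      by (auto simp: c_def[abs_def])
  qed
  have Aj: "A j \<in> sets M" using A(1)[of j] sets_F by blast
  have bd: "norm (indicator (A j) \<omega> *\<^sub>R V \<omega>) \<le> norm (indicator (A j) \<omega> *\<^sub>R a \<omega> + b \<omega> + c \<omega>)" for \<omega>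
  proof (cases "\<omega> \<in> A j")
    case True
    then have "indicator (A i) \<omega> = (1::real)" if "i < j" for i using A(2)[of i] that by auto
    then have "b \<omega> = (\<Sum>i<j. (t (Suc i) - t i) *\<^sub>R \<beta> i \<omega>)" "c \<omega> = (\<Sum>i<j. H i \<omega> *v (W (t (Suc i)) \<omega> - W (t i) \<omega>))"
      unfolding b_def c_def by (auto intro!: sum.cong)
    then show ?thesis using V[OF True] True by simp
  qed simp
  have m: "(\<lambda>\<omega>. indicator (A j) \<omega> *\<^sub>R V \<omega>) \<in> borel_measurable M" using Aj Vm by auto
  note L = L2_add[OF L2_add[OF a b(1)] c(1)]
  show "L2 (\<lambda>\<omega>. indicator (A j) \<omega> *\<^sub>R V \<omega>)" by (rule L2_mono[OF L m bd])
  have "E2 (\<lambda>\<omega>. indicator (A j) \<omega> *\<^sub>R V \<omega>) \<le> 4 * E2 (\<lambda>\<omega>. indicator (A j) \<omega> *\<^sub>R a \<omega>) + 4 * E2 b + 2 * E2 c"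
    by (rule order_trans[OF E2_mono[OF L m bd] E2_add3[OF a b(1) c(1)]])
  then show "E2 (\<lambda>\<omega>. indicator (A j) \<omega> *\<^sub>R V \<omega>) \<le> 4 * E2 (\<lambda>\<omega>. indicator (A j) \<omega> *\<^sub>R a \<omega>)
      + 4 * ((t j - t 0) * (\<Sum>i<j. (t (Suc i) - t i) * E2 (\<lambda>\<omega>. indicator (A i) \<omega> *\<^sub>R \<beta> i \<omega>)))
      + 2 * (\<Sum>i<j. (t (Suc i) - t i) * E2 (\<lambda>\<omega>. indicator (A i) \<omega> *\<^sub>R H i \<omega>))"
    using b(2) c(2) by linarith
qed

end

lemma sum_double: "(\<Sum>i<2 * n::nat. g i) = (\<Sum>k<n. g (2 * k) + g (Suc (2 * k)) :: 'b::comm_monoid_add)"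
  by (induction n) (auto simp: add.assoc)

lemma sum_half: "(\<Sum>i<2 * n::nat. g (i div 2)) = 2 * (\<Sum>k<n. g k :: real)"
  by (simp add: sum_double sum_distrib_left)

lemma clip_refine:
  fixes f :: "real \<Rightarrow> 'b::ab_group_add"
  assumes "a \<le> c" "c \<le> d"
  shows "f (clip a d s) - f a = (f (clip a c s) - f a) + (f (clip c d s) - f c)"
  using assms by (cases "s \<le> c") (auto simp: clip_def min_def max_def)

lemma clip_telescope:
  fixes f :: "real \<Rightarrow> 'b::ab_group_add"
  assumes "mono t" "t 0 \<le> v"
  shows "(\<Sum>k<n. f (clip (t k) (t (Suc k)) v) - f (t k)) = f (min v (t n)) - f (t 0)"
proof (induction n)
  case 0
  then show ?case using assms by (simp add: min_absorb2)
next
  case (Suc n)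
  have "t n \<le> t (Suc n)" using assms by (simp add: monoD)
  then have *: "f (clip (t n) (t (Suc n)) v) - f (t n) = f (min v (t (Suc n))) - f (min v (t n))"
    by (auto simp: clip_def min_def max_def)
  show ?case unfolding sum.lessThan_Suc Suc * by simp
qed

lemma sum_sq_le_sq_sum:
  fixes d :: "nat \<Rightarrow> real"
  assumes "\<And>i. i < n \<Longrightarrow> 0 \<le> d i" shows "(\<Sum>i<n. (d i)\<^sup>2) \<le> (\<Sum>i<n. d i)\<^sup>2"
  using assms
proof (induction n)
  case (Suc n)
  have "0 \<le> (\<Sum>i<n. d i) * d n" by (intro mult_nonneg_nonneg sum_nonneg Suc.prems) auto
  then show ?case using Suc by (simp add: power2_sum)
qed simp

section \<open>Euler schemes for forced stochastic differential equations\<close>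

locale sde = bm_space M F W
  for M :: "'a measure" and F :: "real \<Rightarrow> 'a measure" and W :: "real \<Rightarrow> 'a \<Rightarrow> real^'e::finite" +
  fixes T L :: real and b :: "real^'d::finite \<Rightarrow> real^'d" and \<kappa> :: "real^'d \<Rightarrow> real^'e^'d"
  assumes T_pos: "0 < T" and L_nonneg: "0 \<le> L"
    and b_lip: "\<And>x y. norm (b x - b y) \<le> L * norm (x - y)"
    and \<kappa>_lip: "\<And>x y. norm (\<kappa> x - \<kappa> y) \<le> L * norm (x - y)"
begin

definition gr :: "nat \<Rightarrow> nat \<Rightarrow> real" where "gr m k = T * real k / 2 ^ m"

lemma gr_simps [simp]: "gr m 0 = 0" "gr m (2 ^ m) = T"
  by (auto simp: gr_def)

lemma gr_mono: "mono (gr m)"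
  using T_pos by (auto simp: gr_def intro!: monoI divide_right_mono mult_left_mono)

lemma gr_nonneg: "0 \<le> gr m k"
  using T_pos by (simp add: gr_def)

lemma gr_le_T: "k \<le> 2 ^ m \<Longrightarrow> gr m k \<le> T"
  using monoD[OF gr_mono, of k "2 ^ m" m] by simp

lemma gr_step: "gr m (Suc k) - gr m k = T / 2 ^ m"
  by (simp add: gr_def field_simps)

lemma gr_le_Suc: "gr m k \<le> gr m (Suc k)"
  using gr_mono by (simp add: monoD)

lemma gr_double: "gr (Suc m) (2 * k) = gr m k"
  by (simp add: gr_def)

definition c0 :: real where "c0 = norm (b 0) + norm (\<kappa> 0)"

lemma c0_nonneg: "0 \<le> c0" by (simp add: c0_def)

lemma b_growth: "norm (b y) \<le> c0 + L * norm y"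
  using b_lip[of y 0] norm_triangle_ineq2[of "b y" "b 0"] norm_ge_zero[of "\<kappa> 0"]
  unfolding c0_def diff_0_right by linarith

lemma \<kappa>_growth: "norm (\<kappa> y) \<le> c0 + L * norm y"
  using \<kappa>_lip[of y 0] norm_triangle_ineq2[of "\<kappa> y" "\<kappa> 0"] norm_ge_zero[of "b 0"]
  unfolding c0_def diff_0_right by linarith

lemma lipschitz_continuous:
  fixes f :: "real^'d \<Rightarrow> 'b::real_normed_vector"
  assumes "\<And>x y. norm (f x - f y) \<le> L * norm (x - y)" shows "continuous_on UNIV f"
proof -
  have "L-lipschitz_on UNIV f" using assms L_nonneg by (auto simp: lipschitz_on_def dist_norm)
  then show ?thesis by (rule lipschitz_on_continuous_on)
qed

lemma b_measurable [measurable]: "b \<in> borel_measurable borel"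
  by (intro borel_measurable_continuous_onI lipschitz_continuous b_lip)

lemma \<kappa>_measurable [measurable]: "\<kappa> \<in> borel_measurable borel"
  by (intro borel_measurable_continuous_onI lipschitz_continuous \<kappa>_lip)

text \<open>Abstracts the pathwise integral of a control: the equation sees a control only through a
  process \<open>A\<close> whose increments are dominated by those of an adapted, increasing,
  right-continuous process \<open>\<nu>\<close> with square-integrable total. The original and the
  projected control are later dominated by one and the same \<open>\<nu>\<close>.\<close>

definition forcing :: "(real \<Rightarrow> 'a \<Rightarrow> real^'d) \<Rightarrow> (real \<Rightarrow> 'a \<Rightarrow> real) \<Rightarrow> bool" where
  "forcing A \<nu> \<longleftrightarrow>
     (\<forall>s\<in>{0..T}. A s \<in> borel_measurable (F s)) \<and> (\<forall>s\<in>{0..T}. \<nu> s \<in> borel_measurable (F s)) \<and> L2 (\<nu> T) \<and>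
     (\<forall>\<omega>\<in>space M. norm (A 0 \<omega>) \<le> \<nu> 0 \<omega> \<and>
        (\<forall>u v. 0 \<le> u \<longrightarrow> u \<le> v \<longrightarrow> v \<le> T \<longrightarrow> norm (A v \<omega> - A u \<omega>) \<le> \<nu> v \<omega> - \<nu> u \<omega>) \<and>
        (\<forall>s\<in>{0..<T}. continuous (at_right s) (\<lambda>r. \<nu> r \<omega>)))"

lemma forcingD:
  assumes "forcing A \<nu>"
  shows "0 \<le> s \<Longrightarrow> s \<le> T \<Longrightarrow> A s \<in> borel_measurable (F s)"
    and "0 \<le> s \<Longrightarrow> s \<le> T \<Longrightarrow> \<nu> s \<in> borel_measurable (F s)"
    and "L2 (\<nu> T)"
    and "\<omega> \<in> space M \<Longrightarrow> 0 \<le> u \<Longrightarrow> u \<le> v \<Longrightarrow> v \<le> T \<Longrightarrow> norm (A v \<omega> - A u \<omega>) \<le> \<nu> v \<omega> - \<nu> u \<omega>"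
    and "\<omega> \<in> space M \<Longrightarrow> 0 \<le> s \<Longrightarrow> s < T \<Longrightarrow> continuous (at_right s) (\<lambda>r. \<nu> r \<omega>)"
    and "\<omega> \<in> space M \<Longrightarrow> norm (A 0 \<omega>) \<le> \<nu> 0 \<omega>"
  using assms by (auto simp: forcing_def)

lemma forcing_mono:
  assumes "forcing A \<nu>" "\<omega> \<in> space M" "0 \<le> u" "u \<le> v" "v \<le> T"
  shows "\<nu> u \<omega> \<le> \<nu> v \<omega>"
  using forcingD(4)[OF assms] norm_ge_zero[of "A v \<omega> - A u \<omega>"] by linarith

lemma forcing_bound:
  assumes "forcing A \<nu>" "\<omega> \<in> space M" "0 \<le> v" "v \<le> T"
  shows "norm (A v \<omega>) \<le> \<nu> v \<omega>" "0 \<le> \<nu> v \<omega>" "\<nu> v \<omega> \<le> \<nu> T \<omega>"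
proof -
  have "norm (A v \<omega>) \<le> norm (A v \<omega> - A 0 \<omega>) + norm (A 0 \<omega>)"
    using norm_triangle_ineq[of "A v \<omega> - A 0 \<omega>" "A 0 \<omega>"] by simp
  then show *: "norm (A v \<omega>) \<le> \<nu> v \<omega>"
    using forcingD(4)[OF assms(1,2), of 0 v] forcingD(6)[OF assms(1,2)] assms by simp
  show "0 \<le> \<nu> v \<omega>" using order_trans[OF norm_ge_zero *] .
  show "\<nu> v \<omega> \<le> \<nu> T \<omega>" using forcing_mono[OF assms(1,2,3,4)] by simp
qed

lemma forcing_L2:
  assumes "forcing A \<nu>" "0 \<le> v" "v \<le> T"
  shows "L2 (A v)" "L2 (\<nu> v)" "E2 (A v) \<le> E2 (\<nu> T)"
proof -
  note m = measurable_F[OF forcingD(1)[OF assms]] measurable_F[OF forcingD(2)[OF assms]]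
  have 1: "norm (A v \<omega>) \<le> norm (\<nu> T \<omega>)" "norm (\<nu> v \<omega>) \<le> norm (\<nu> T \<omega>)" if "\<omega> \<in> space M" for \<omega>
    using forcing_bound[OF assms(1) that assms(2,3)] by auto
  show "L2 (A v)" "L2 (\<nu> v)" by (rule L2_mono[OF forcingD(3)[OF assms(1)]]; use m 1 in simp)+
  show "E2 (A v) \<le> E2 (\<nu> T)" by (rule E2_mono[OF forcingD(3)[OF assms(1)] m(1) 1(1)])
qed

text \<open>The forcing enters by its exact increments; only the coefficients are frozen on each
  cell.\<close>

primrec eul :: "(real \<Rightarrow> 'a \<Rightarrow> real^'d) \<Rightarrow> real^'d \<Rightarrow> nat \<Rightarrow> nat \<Rightarrow> 'a \<Rightarrow> real^'d" where
  "eul A x m 0 = (\<lambda>\<omega>. x + A 0 \<omega>)"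
| "eul A x m (Suc k) = (\<lambda>\<omega>. eul A x m k \<omega> + (gr m (Suc k) - gr m k) *\<^sub>R b (eul A x m k \<omega>)
     + \<kappa> (eul A x m k \<omega>) *v (W (gr m (Suc k)) \<omega> - W (gr m k) \<omega>) + (A (gr m (Suc k)) \<omega> - A (gr m k) \<omega>))"

lemma eul_closed_form:
  "eul A x m j \<omega> = x + A (gr m j) \<omega> + (\<Sum>k<j. (gr m (Suc k) - gr m k) *\<^sub>R b (eul A x m k \<omega>))
     + (\<Sum>k<j. \<kappa> (eul A x m k \<omega>) *v (W (gr m (Suc k)) \<omega> - W (gr m k) \<omega>))"
  by (induction j) (auto simp: algebra_simps)

definition drift :: "(real \<Rightarrow> 'a \<Rightarrow> real^'d) \<Rightarrow> real^'d \<Rightarrow> nat \<Rightarrow> real \<Rightarrow> 'a \<Rightarrow> real^'d" where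
  "drift A x m s \<omega> = (\<Sum>k<2^m. (clip (gr m k) (gr m (Suc k)) s - gr m k) *\<^sub>R b (eul A x m k \<omega>))"

text \<open>The interpolation carries \<open>A s\<close> itself, not an interpolation of its grid
  values. For continuous \<open>W\<close> all jumps of the scheme then come from \<open>A\<close>,
  and the difference of two levels is continuous.\<close>

definition eulc :: "(real \<Rightarrow> 'a \<Rightarrow> real^'d) \<Rightarrow> real^'d \<Rightarrow> nat \<Rightarrow> real \<Rightarrow> 'a \<Rightarrow> real^'d" where
  "eulc A x m s \<omega> = x + A s \<omega> + drift A x m s \<omega> + eint (gr m) (2^m) (\<lambda>k \<omega>. \<kappa> (eul A x m k \<omega>)) s \<omega>"

lemma clip_sum_grid:
  fixes f :: "real \<Rightarrow> 'b::real_vector" and v :: "nat \<Rightarrow> 'b"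
  assumes "mono t" "j \<le> n"
  shows "(\<Sum>k<n. (clip (t k) (t (Suc k)) (t j) - t k) *\<^sub>R v k) = (\<Sum>k<j. (t (Suc k) - t k) *\<^sub>R v k)"
proof -
  have "(\<Sum>k<n. (clip (t k) (t (Suc k)) (t j) - t k) *\<^sub>R v k) = (\<Sum>k<n. if k < j then (t (Suc k) - t k) *\<^sub>R v k else 0)"
  proof (intro sum.cong refl)
    fix k
    have "t k \<le> t (Suc k)" using assms(1) by (simp add: monoD)
    moreover have "k < j \<Longrightarrow> t (Suc k) \<le> t j" "\<not> k < j \<Longrightarrow> t j \<le> t k" using assms(1) by (simp_all add: monoD)
    ultimately show "(clip (t k) (t (Suc k)) (t j) - t k) *\<^sub>R v k = (if k < j then (t (Suc k) - t k) *\<^sub>R v k else 0)"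
      by (auto simp: clip_upper clip_lower)
  qed
  also have "\<dots> = (\<Sum>k<j. (t (Suc k) - t k) *\<^sub>R v k)"
    using assms(2) by (intro sum.mono_neutral_cong_right) auto
  finally show ?thesis .
qed

lemma eulc_at_grid: "j \<le> 2^m \<Longrightarrow> eulc A x m (gr m j) \<omega> = eul A x m j \<omega>"
  unfolding eulc_def drift_def eul_closed_form[of _ _ _ j]
  by (simp add: eint_at_grid[OF gr_mono] clip_sum_grid[OF gr_mono])

lemma eul_measurable:
  assumes "forcing A \<nu>" "k \<le> 2^m"
  shows "eul A x m k \<in> borel_measurable (F (gr m k))"
  using assms(2)
proof (induction k)
  case 0
  then show ?case using forcingD(1)[OF assms(1), of 0] T_pos by auto
next
  case (Suc k)
  have le: "gr m k \<le> gr m (Suc k)" by (rule gr_le_Suc)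
  have [measurable]: "eul A x m k \<in> borel_measurable (F (gr m (Suc k)))"
    using Suc measurable_F_mono[OF le] by auto
  have [measurable]: "A (gr m (Suc k)) \<in> borel_measurable (F (gr m (Suc k)))" "A (gr m k) \<in> borel_measurable (F (gr m (Suc k)))"
    using forcingD(1)[OF assms(1) gr_nonneg gr_le_T[OF Suc.prems]]
      measurable_F_mono[OF le forcingD(1)[OF assms(1) gr_nonneg gr_le_T]] Suc.prems by auto
  have [measurable]: "W (gr m (Suc k)) \<in> borel_measurable (F (gr m (Suc k)))" "W (gr m k) \<in> borel_measurable (F (gr m (Suc k)))"
    using measurable_W_mono gr_nonneg le by auto
  have [measurable]: "(\<lambda>\<omega>. \<kappa> (eul A x m k \<omega>) *v (W (gr m (Suc k)) \<omega> - W (gr m k) \<omega>)) \<in> borel_measurable (F (gr m (Suc k)))"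
    by (intro measurable_matrix_vector_mult) measurable
  show ?case by simp
qed

lemma eul_coeff:
  assumes "forcing A \<nu>" "k \<le> 2^m"
  shows "(\<lambda>\<omega>. \<kappa> (eul A x m k \<omega>)) \<in> borel_measurable (F (gr m k))"
    "(\<lambda>\<omega>. b (eul A x m k \<omega>)) \<in> borel_measurable (F (gr m k))"
  using eul_measurable[OF assms, measurable] by measurable

lemma coeff_L2:
  assumes "L2 X"
  shows "L2 (\<lambda>\<omega>. \<kappa> (X \<omega>))" "L2 (\<lambda>\<omega>. b (X \<omega>))"
    "E2 (\<lambda>\<omega>. \<kappa> (X \<omega>)) \<le> 2 * c0\<^sup>2 + 2 * L\<^sup>2 * E2 X" "E2 (\<lambda>\<omega>. b (X \<omega>)) \<le> 2 * c0\<^sup>2 + 2 * L\<^sup>2 * E2 X"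
proof -
  have [measurable]: "X \<in> borel_measurable M" using assms by (simp add: L2_def)
  show "L2 (\<lambda>\<omega>. \<kappa> (X \<omega>))" "E2 (\<lambda>\<omega>. \<kappa> (X \<omega>)) \<le> 2 * c0\<^sup>2 + 2 * L\<^sup>2 * E2 X"
    by (rule L2_lip[OF assms _ \<kappa>_growth c0_nonneg L_nonneg]; measurable)+
  show "L2 (\<lambda>\<omega>. b (X \<omega>))" "E2 (\<lambda>\<omega>. b (X \<omega>)) \<le> 2 * c0\<^sup>2 + 2 * L\<^sup>2 * E2 X"
    by (rule L2_lip[OF assms _ b_growth c0_nonneg L_nonneg]; measurable)+
qed

lemma coeff_diff_L2:
  assumes "L2 X" "L2 Y"
  shows "L2 (\<lambda>\<omega>. \<kappa> (X \<omega>) - \<kappa> (Y \<omega>))" "L2 (\<lambda>\<omega>. b (X \<omega>) - b (Y \<omega>))"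
    "E2 (\<lambda>\<omega>. \<kappa> (X \<omega>) - \<kappa> (Y \<omega>)) \<le> L\<^sup>2 * E2 (\<lambda>\<omega>. X \<omega> - Y \<omega>)" "E2 (\<lambda>\<omega>. b (X \<omega>) - b (Y \<omega>)) \<le> L\<^sup>2 * E2 (\<lambda>\<omega>. X \<omega> - Y \<omega>)"
proof -
  have [measurable]: "X \<in> borel_measurable M" "Y \<in> borel_measurable M" using assms by (simp_all add: L2_def)
  show "L2 (\<lambda>\<omega>. \<kappa> (X \<omega>) - \<kappa> (Y \<omega>))" "L2 (\<lambda>\<omega>. b (X \<omega>) - b (Y \<omega>))"
    using L2_diff[OF coeff_L2(1)[OF assms(1)] coeff_L2(1)[OF assms(2)]] L2_diff[OF coeff_L2(2)[OF assms(1)] coeff_L2(2)[OF assms(2)]] by auto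
  show "E2 (\<lambda>\<omega>. \<kappa> (X \<omega>) - \<kappa> (Y \<omega>)) \<le> L\<^sup>2 * E2 (\<lambda>\<omega>. X \<omega> - Y \<omega>)"
    by (rule E2_lip[OF L2_diff[OF assms] _ \<kappa>_lip L_nonneg]) measurable
  show "E2 (\<lambda>\<omega>. b (X \<omega>) - b (Y \<omega>)) \<le> L\<^sup>2 * E2 (\<lambda>\<omega>. X \<omega> - Y \<omega>)"
    by (rule E2_lip[OF L2_diff[OF assms] _ b_lip L_nonneg]) measurable
qed

text \<open>The localised estimate with all events equal to \<open>space M\<close>, on the dyadic
  grid. A common bound \<open>K i\<close> for drift and diffusion coefficients merges the two sums:
  \<open>4 * T\<close> stems from the drift and \<open>2\<close> from the diffusion.\<close>

lemma L2_estimate: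
  fixes H :: "nat \<Rightarrow> 'a \<Rightarrow> real^'e^'d"
  assumes j: "j \<le> 2^m"
    and V: "\<And>\<omega>. V \<omega> = a \<omega> + (\<Sum>i<j. (gr m (Suc i) - gr m i) *\<^sub>R \<beta> i \<omega>) + (\<Sum>i<j. H i \<omega> *v (W (gr m (Suc i)) \<omega> - W (gr m i) \<omega>))"
    and a: "L2 a" and \<beta>: "\<And>i. i < j \<Longrightarrow> L2 (\<beta> i)"
    and H: "\<And>i. i < j \<Longrightarrow> H i \<in> borel_measurable (F (gr m i))" "\<And>i. i < j \<Longrightarrow> L2 (H i)"
    and K: "\<And>i. i < j \<Longrightarrow> E2 (\<beta> i) \<le> K i" "\<And>i. i < j \<Longrightarrow> E2 (H i) \<le> K i"
  shows "L2 V" "E2 V \<le> 4 * E2 a + (\<Sum>i<j. (4 * T + 2) * (T / 2^m) * K i)"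
proof -
  have ind: "L2 (\<lambda>\<omega>. indicator (space M) \<omega> *\<^sub>R f \<omega>) \<longleftrightarrow> L2 f" 
    "E2 (\<lambda>\<omega>. indicator (space M) \<omega> *\<^sub>R f \<omega>) = E2 f" for f :: "'a \<Rightarrow> 'x::euclidean_space"
    unfolding L2_def E2_def
    by (auto intro!: arg_cong2[where f="(\<and>)"] measurable_cong Bochner_Integration.integrable_cong Bochner_Integration.integral_cong)
  have S: "space M \<in> sets (F s)" for s by (metis sets.top space_F)
  have VL: "L2 V"
  proof -
    have "L2 (\<lambda>\<omega>. H i \<omega> *v (W (gr m (Suc i)) \<omega> - W (gr m i) \<omega>))" if "i < j" for i
      using step_isometry(1)[OF gr_nonneg gr_le_Suc H(1)[OF that] H(2)[OF that]] .
    then show ?thesis unfolding V[abs_def] by (intro L2_add L2_sum L2_scaleR a \<beta>) auto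
  qed
  have jT: "gr m j \<le> T" by (rule gr_le_T[OF j])
  have "E2 V \<le> 4 * E2 a + 4 * ((gr m j - gr m 0) * (\<Sum>i<j. (gr m (Suc i) - gr m i) * E2 (\<beta> i)))
      + 2 * (\<Sum>i<j. (gr m (Suc i) - gr m i) * E2 (H i))"
    using localized_L2_estimate(2)[of "gr m" j "\<lambda>_. space M" V a \<beta> H, unfolded ind, OF gr_mono gr_nonneg S order_refl V L2_measurable[OF VL] a \<beta> H]
    by blast
  also have "\<dots> \<le> 4 * E2 a + 4 * (T * (\<Sum>i<j. (T / 2^m) * K i)) + 2 * (\<Sum>i<j. (T / 2^m) * K i)"
    unfolding gr_step using K jT gr_nonneg T_pos
    by (intro add_mono mult_mono sum_mono mult_left_mono order_refl) (auto intro!: sum_nonneg mult_nonneg_nonneg intro: order_trans[OF E2_nonneg])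
  also have "\<dots> = 4 * E2 a + (4 * T + 2) * (\<Sum>i<j. (T / 2^m) * K i)" by (simp only: distrib_right add.assoc mult.assoc)
  also have "(4 * T + 2) * (\<Sum>i<j. (T / 2^m) * K i) = (\<Sum>i<j. (4 * T + 2) * (T / 2^m) * K i)"
    unfolding sum_distrib_left mult.assoc ..
  finally show "E2 V \<le> 4 * E2 a + (\<Sum>i<j. (4 * T + 2) * (T / 2^m) * K i)" .
  show "L2 V" by (rule VL)
qed

lemma eul_L2:
  assumes "forcing A \<nu>" "k \<le> 2^m" shows "L2 (eul A x m k)"
  using assms(2)
proof (induction k rule: less_induct)
  case (less k)
  have IH: "L2 (eul A x m i)" if "i < k" for i using less that by auto
  show ?case
    by (rule L2_estimate(1)[OF less.prems, where a="\<lambda>\<omega>. x + A (gr m k) \<omega>" and \<beta>="\<lambda>i \<omega>. b (eul A x m i \<omega>)"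
          and H="\<lambda>i \<omega>. \<kappa> (eul A x m i \<omega>)" and K="\<lambda>i. E2 (\<lambda>\<omega>. b (eul A x m i \<omega>)) + E2 (\<lambda>\<omega>. \<kappa> (eul A x m i \<omega>))"])
       (use less.prems IH coeff_L2 eul_coeff[OF assms(1)] forcing_L2(1)[OF assms(1) gr_nonneg gr_le_T[OF less.prems]]
          in \<open>auto simp: eul_closed_form[of _ _ _ k] intro!: L2_add\<close>)
qed

text \<open>Linear growth of the coefficients turns the quadratic estimate into a Gronwall
  recursion. The point is the order of quantifiers: \<open>C\<close> is fixed before the level
  \<open>m\<close>.\<close>

lemma eul_moment_bound:
  assumes "forcing A \<nu>"
  obtains C where "0 \<le> C" "\<And>m k. k \<le> 2^m \<Longrightarrow> E2 (eul A x m k) \<le> C"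
proof -
  define \<alpha> where "\<alpha> = 4 * (2 * (norm x)\<^sup>2 + 2 * E2 (\<nu> T)) + (4 * T + 2) * T * (2 * c0\<^sup>2)"
  define \<beta> where "\<beta> = (4 * T + 2) * (2 * L\<^sup>2)"
  have pos: "0 \<le> \<alpha>" "0 \<le> \<beta>" using T_pos by (auto simp: \<alpha>_def \<beta>_def intro!: add_nonneg_nonneg mult_nonneg_nonneg)
  have "E2 (eul A x m k) \<le> \<alpha> * exp (\<beta> * T)" if k: "k \<le> 2^m" for m k
  proof -
    have step: "E2 (eul A x m j) \<le> \<alpha> + (\<Sum>i<j. (\<beta> * (T / 2^m)) * E2 (eul A x m i))" if j: "j \<le> 2^m" for j
    proof -
      have A: "L2 (A (gr m j))" "E2 (A (gr m j)) \<le> E2 (\<nu> T)"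
        using forcing_L2[OF assms gr_nonneg gr_le_T[OF j]] by auto
      have "E2 (eul A x m j) \<le> 4 * E2 (\<lambda>\<omega>. x + A (gr m j) \<omega>) + (\<Sum>i<j. (4 * T + 2) * (T / 2^m) * (2 * c0\<^sup>2 + 2 * L\<^sup>2 * E2 (eul A x m i)))"
        by (rule L2_estimate(2)[OF j, where \<beta>="\<lambda>i \<omega>. b (eul A x m i \<omega>)" and H="\<lambda>i \<omega>. \<kappa> (eul A x m i \<omega>)"])
           (use j coeff_L2 eul_L2[OF assms] eul_coeff[OF assms] A in \<open>auto simp: eul_closed_form[of _ _ _ j] intro!: L2_add\<close>)
      also have "E2 (\<lambda>\<omega>. x + A (gr m j) \<omega>) \<le> 2 * (norm x)\<^sup>2 + 2 * E2 (\<nu> T)"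
        using E2_add[OF L2_const A(1), of x] A(2) by simp
      also have "(\<Sum>i<j. (4 * T + 2) * (T / 2^m) * (2 * c0\<^sup>2 + 2 * L\<^sup>2 * E2 (eul A x m i)))
        = real j * ((4 * T + 2) * (T / 2^m) * (2 * c0\<^sup>2)) + (\<Sum>i<j. (\<beta> * (T / 2^m)) * E2 (eul A x m i))"
        by (simp add: \<beta>_def sum.distrib distrib_left mult_ac)
      also have "real j * ((4 * T + 2) * (T / 2^m) * (2 * c0\<^sup>2)) \<le> 2^m * ((4 * T + 2) * (T / 2^m) * (2 * c0\<^sup>2))"
      proof -
        have "real j \<le> 2^m" using j by (metis of_nat_le_iff of_nat_numeral of_nat_power)
        then show ?thesis using T_pos by (intro mult_right_mono mult_nonneg_nonneg) auto
      qed
      finally show ?thesis by (simp add: \<alpha>_def)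
    qed
    have "E2 (eul A x m k) \<le> \<alpha> * exp (\<beta> * (T / 2^m) * real (2^m))"
      by (rule discrete_gronwall[OF step _ pos(1) k]) (use pos T_pos in auto)
    then show ?thesis by simp
  qed
  then show thesis using that[of "\<alpha> * exp (\<beta> * T)"] pos by auto
qed

lemma eulc_increment:
  "eulc A x m v \<omega> - eulc A x m u \<omega> = (A v \<omega> - A u \<omega>)
     + (\<Sum>k<2^m. (clip (gr m k) (gr m (Suc k)) v - clip (gr m k) (gr m (Suc k)) u) *\<^sub>R b (eul A x m k \<omega>))
     + (\<Sum>k<2^m. \<kappa> (eul A x m k \<omega>) *v (W (clip (gr m k) (gr m (Suc k)) v) \<omega> - W (clip (gr m k) (gr m (Suc k)) u) \<omega>))"
  unfolding eulc_def drift_def eint_def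
  by (simp add: sum_subtractf scaleR_left_diff_distrib matrix_vector_mult_diff_distrib)

text \<open>The drift contributes the square of \<open>v - u\<close>, of which one factor is
  absorbed into \<open>T\<close>; the stochastic part contributes \<open>v - u\<close> by the
  isometry. The forcing may jump on a short interval, so it is kept as an increment of
  \<open>\<nu>\<close>.\<close>

lemma eulc_increment_L2:
  assumes "forcing A \<nu>" and C: "\<And>k. k \<le> 2^m \<Longrightarrow> E2 (eul A x m k) \<le> C" and uv: "0 \<le> u" "u \<le> v" "v \<le> T"
  shows "L2 (\<lambda>\<omega>. eulc A x m v \<omega> - eulc A x m u \<omega>)"
    "E2 (\<lambda>\<omega>. eulc A x m v \<omega> - eulc A x m u \<omega>)
      \<le> 4 * E2 (\<lambda>\<omega>. \<nu> v \<omega> - \<nu> u \<omega>) + (4 * T + 2) * (2 * c0\<^sup>2 + 2 * L\<^sup>2 * C) * (v - u)"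
proof -
  let ?K = "2 * c0\<^sup>2 + 2 * L\<^sup>2 * C"
  define l where "l k = clip (gr m k) (gr m (Suc k)) u" for k
  define r where "r k = clip (gr m k) (gr m (Suc k)) v" for k
  have lr: "0 \<le> l k \<and> l k \<le> r k" "gr m k \<le> l k" "r k \<le> gr m (Suc k)" for k
    using clip_bounds[OF gr_le_Suc, of m k u] clip_bounds[OF gr_le_Suc, of m k v] gr_nonneg[of m k]
    by (auto simp: l_def r_def intro!: clip_mono uv)
  have K: "E2 (\<lambda>\<omega>. \<kappa> (eul A x m k \<omega>)) \<le> ?K" "E2 (\<lambda>\<omega>. b (eul A x m k \<omega>)) \<le> ?K" if "k < 2^m" for k
  proof -
    have "L\<^sup>2 * E2 (eul A x m k) \<le> L\<^sup>2 * C" using C[of k] that by (intro mult_left_mono) auto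
    then show "E2 (\<lambda>\<omega>. \<kappa> (eul A x m k \<omega>)) \<le> ?K" "E2 (\<lambda>\<omega>. b (eul A x m k \<omega>)) \<le> ?K"
      using coeff_L2(3,4)[OF eul_L2[OF assms(1), of k m x]] that by auto
  qed
  have K0: "0 \<le> ?K" using K(1)[of 0] by (meson E2_nonneg order_trans zero_less_numeral zero_less_power)
  have tele: "(\<Sum>k<2^m. r k - l k) = v - u"
  proof -
    have "(\<Sum>k<2^m. r k - gr m k) = v - gr m 0" "(\<Sum>k<2^m. l k - gr m k) = u - gr m 0"
      using clip_telescope[OF gr_mono, of m v "\<lambda>z. z" "2^m"] clip_telescope[OF gr_mono, of m u "\<lambda>z. z" "2^m"] uv
      by (auto simp: r_def l_def min_def)
    then show ?thesis by (simp add: sum_subtractf)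
  qed
  define A' where "A' \<omega> = A v \<omega> - A u \<omega>" for \<omega>
  define D where "D \<omega> = (\<Sum>k<2^m. (r k - l k) *\<^sub>R b (eul A x m k \<omega>))" for \<omega>
  define Z where "Z \<omega> = (\<Sum>k<2^m. \<kappa> (eul A x m k \<omega>) *v (W (r k) \<omega> - W (l k) \<omega>))" for \<omega>
  have eq: "eulc A x m v \<omega> - eulc A x m u \<omega> = A' \<omega> + D \<omega> + Z \<omega>" for \<omega>
    unfolding eulc_increment A'_def D_def Z_def l_def r_def ..
  have \<nu>L: "L2 (\<lambda>\<omega>. \<nu> v \<omega> - \<nu> u \<omega>)" using forcing_L2(2)[OF assms(1)] uv by (intro L2_diff) auto
  have A'm: "A' \<in> borel_measurable M" unfolding A'_def[abs_def]
    using forcing_L2(1)[OF assms(1)] uv by (intro borel_measurable_diff L2_measurable) auto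
  have A'b: "norm (A' \<omega>) \<le> norm (\<nu> v \<omega> - \<nu> u \<omega>)" if "\<omega> \<in> space M" for \<omega>
    using forcingD(4)[OF assms(1) that uv] by (simp add: A'_def)
  have A': "L2 A'" "E2 A' \<le> E2 (\<lambda>\<omega>. \<nu> v \<omega> - \<nu> u \<omega>)"
    by (rule L2_mono[OF \<nu>L A'm A'b] E2_mono[OF \<nu>L A'm A'b]; assumption)+
  have D: "L2 D" "E2 D \<le> (v - u) * (?K * (v - u))"
  proof -
    show "L2 D" unfolding D_def[abs_def] using eul_L2[OF assms(1)] by (intro L2_sum L2_scaleR coeff_L2) auto
    have "E2 D \<le> (\<Sum>k<2^m. r k - l k) * (\<Sum>k<2^m. (r k - l k) * E2 (\<lambda>\<omega>. b (eul A x m k \<omega>)))"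
      unfolding D_def[abs_def] by (rule E2_weighted_sum) (use lr eul_L2[OF assms(1)] coeff_L2 in auto)
    also have "\<dots> \<le> (\<Sum>k<2^m. r k - l k) * (\<Sum>k<2^m. (r k - l k) * ?K)"
      using lr K tele uv by (intro mult_left_mono sum_mono) auto
    finally show "E2 D \<le> (v - u) * (?K * (v - u))" by (simp add: sum_distrib_right[symmetric] tele mult.commute)
  qed
  have Z: "L2 Z" "E2 Z \<le> ?K * (v - u)"
  proof -
    have d: "r i \<le> l j \<or> r j \<le> l i" if "i \<noteq> j" for i j
    proof (cases "i < j")
      case True
      then show ?thesis using lr(3)[of i] lr(2)[of j] monoD[OF gr_mono[of m], of "Suc i" j] by linarith
    next
      case False
      then show ?thesis using that lr(3)[of j] lr(2)[of i] monoD[OF gr_mono[of m], of "Suc j" i] by linarith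
    qed
    have HF: "(\<lambda>\<omega>. \<kappa> (eul A x m k \<omega>)) \<in> borel_measurable (F (l k))" "L2 (\<lambda>\<omega>. \<kappa> (eul A x m k \<omega>))" if "k \<in> {..<2^m}" for k
      using eul_coeff(1)[OF assms(1), of k m x] measurable_F_mono[OF lr(2)] that coeff_L2(1)[OF eul_L2[OF assms(1)]] by auto
    note iso = family_isometry[OF finite_lessThan lr(1) d HF]
    show "L2 Z" unfolding Z_def[abs_def] by (rule iso)
    have "E2 Z = (\<Sum>k<2^m. (r k - l k) * E2 (\<lambda>\<omega>. \<kappa> (eul A x m k \<omega>)))"
      unfolding Z_def[abs_def] by (rule iso)
    also have "\<dots> \<le> (\<Sum>k<2^m. (r k - l k) * ?K)" using lr K by (intro sum_mono mult_left_mono) auto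
    finally show "E2 Z \<le> ?K * (v - u)" by (simp add: sum_distrib_right[symmetric] tele mult.commute)
  qed
  show "L2 (\<lambda>\<omega>. eulc A x m v \<omega> - eulc A x m u \<omega>)" unfolding eq by (intro L2_add A' D Z)
  have "E2 (\<lambda>\<omega>. eulc A x m v \<omega> - eulc A x m u \<omega>) \<le> 4 * E2 A' + 4 * E2 D + 2 * E2 Z"
    unfolding eq by (rule E2_add3[OF A'(1) D(1) Z(1)])
  also have "\<dots> \<le> 4 * E2 (\<lambda>\<omega>. \<nu> v \<omega> - \<nu> u \<omega>) + 4 * (T * (?K * (v - u))) + 2 * (?K * (v - u))"
  proof -
    have "(v - u) * (?K * (v - u)) \<le> T * (?K * (v - u))" using K0 uv by (intro mult_right_mono mult_nonneg_nonneg) auto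
    then show ?thesis using A' D Z by linarith
  qed
  also have "\<dots> = 4 * E2 (\<lambda>\<omega>. \<nu> v \<omega> - \<nu> u \<omega>) + (4 * T + 2) * ?K * (v - u)" by (simp add: algebra_simps)
  finally show "E2 (\<lambda>\<omega>. eulc A x m v \<omega> - eulc A x m u \<omega>)
      \<le> 4 * E2 (\<lambda>\<omega>. \<nu> v \<omega> - \<nu> u \<omega>) + (4 * T + 2) * ?K * (v - u)" .
qed

lemma eulc_0: "eulc A x m 0 \<omega> = x + A 0 \<omega>"
  using eulc_at_grid[of 0 m A x \<omega>] by simp

lemma eulc_L2:
  assumes "forcing A \<nu>" "0 \<le> s" "s \<le> T" shows "L2 (eulc A x m s)"
proof -
  obtain C where "\<And>m k. k \<le> 2^m \<Longrightarrow> E2 (eul A x m k) \<le> C" using eul_moment_bound[OF assms(1)] by metis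
  from eulc_increment_L2(1)[OF assms(1) this order_refl assms(2,3)]
  have "L2 (\<lambda>\<omega>. (eulc A x m s \<omega> - eulc A x m 0 \<omega>) + (x + A 0 \<omega>))"
    using forcing_L2(1)[OF assms(1), of 0] T_pos by (intro L2_add) auto
  then show ?thesis by (simp add: eulc_0)
qed

lemma eulc_measurable:
  assumes "forcing A \<nu>" "0 \<le> s" "s \<le> T" shows "eulc A x m s \<in> borel_measurable (F s)"
proof -
  have "drift A x m s \<in> borel_measurable (F s)"
    unfolding drift_def[abs_def]
  proof (intro borel_measurable_sum)
    fix k :: nat assume "k \<in> {..<2^m}"
    then show "(\<lambda>\<omega>. (clip (gr m k) (gr m (Suc k)) s - gr m k) *\<^sub>R b (eul A x m k \<omega>)) \<in> borel_measurable (F s)"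
      using eul_coeff(2)[OF assms(1), of k m x] measurable_F_mono[of "gr m k" s]
      by (cases "gr m k \<le> s") (auto simp: clip_lower[OF _ gr_le_Suc] intro!: borel_measurable_scaleR)
  qed
  moreover have "eint (gr m) (2^m) (\<lambda>k \<omega>. \<kappa> (eul A x m k \<omega>)) s \<in> borel_measurable (F s)"
    by (rule eint_measurable[OF gr_mono]) (use eul_coeff(1)[OF assms(1)] in auto)
  ultimately show ?thesis
    unfolding eulc_def[abs_def] using forcingD(1)[OF assms] by (intro borel_measurable_add) auto
qed

end

context bm_space
begin

text \<open>Fatou for second moments. It also delivers square-integrability of the limit, which is
  not known beforehand.\<close>

lemma L2_fatou:
  fixes f :: "nat \<Rightarrow> 'a \<Rightarrow> 'b::euclidean_space"
  assumes "\<And>n. L2 (f n)" "\<And>n. E2 (f n) \<le> c" "AE \<omega> in M. (\<lambda>n. f n \<omega>) \<longlonglongrightarrow> g \<omega>" "g \<in> borel_measurable M"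
  shows "L2 g" "E2 g \<le> c"
proof -
  have [measurable]: "f n \<in> borel_measurable M" "g \<in> borel_measurable M" for n using assms by (auto simp: L2_def)
  have c: "0 \<le> c" using assms(2)[of 0] E2_nonneg[of "f 0"] by linarith
  have "(\<integral>\<^sup>+\<omega>. ennreal ((norm (g \<omega>))\<^sup>2) \<partial>M) = (\<integral>\<^sup>+\<omega>. liminf (\<lambda>n. ennreal ((norm (f n \<omega>))\<^sup>2)) \<partial>M)"
  proof (rule nn_integral_cong_AE)
    show "AE \<omega> in M. ennreal ((norm (g \<omega>))\<^sup>2) = liminf (\<lambda>n. ennreal ((norm (f n \<omega>))\<^sup>2))"
      using assms(3)
    proof eventually_elim
      case (elim \<omega>)
      then have "(\<lambda>n. ennreal ((norm (f n \<omega>))\<^sup>2)) \<longlonglongrightarrow> ennreal ((norm (g \<omega>))\<^sup>2)"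
        by (intro tendsto_intros) auto
      from lim_imp_Liminf[OF _ this] show ?case by simp
    qed
  qed
  also have "\<dots> \<le> liminf (\<lambda>n. (\<integral>\<^sup>+\<omega>. ennreal ((norm (f n \<omega>))\<^sup>2) \<partial>M))"
    by (rule nn_integral_liminf) auto
  also have "\<dots> \<le> liminf (\<lambda>n. ennreal c)"
  proof (intro Liminf_mono always_eventually allI)
    fix n
    have "(\<integral>\<^sup>+\<omega>. ennreal ((norm (f n \<omega>))\<^sup>2) \<partial>M) = ennreal (E2 (f n))"
      unfolding E2_def using L2_integrable[OF assms(1)] by (intro nn_integral_eq_integral) auto
    also have "\<dots> \<le> ennreal c" by (intro ennreal_leI assms)
    finally show "(\<integral>\<^sup>+\<omega>. ennreal ((norm (f n \<omega>))\<^sup>2) \<partial>M) \<le> ennreal c" .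
  qed
  also have "\<dots> = ennreal c" by (simp add: Liminf_const)
  finally have le: "(\<integral>\<^sup>+\<omega>. ennreal ((norm (g \<omega>))\<^sup>2) \<partial>M) \<le> ennreal c" .
  then have int: "integrable M (\<lambda>\<omega>. (norm (g \<omega>))\<^sup>2)"
    by (intro integrableI_nonneg) (auto intro: le_less_trans)
  then show "L2 g" by (simp add: L2_def)
  have "ennreal (E2 g) \<le> ennreal c"
    using le unfolding E2_def by (subst (asm) nn_integral_eq_integral[OF int]) auto
  then show "E2 g \<le> c" using c by simp
qed

lemma E2_commute: "E2 (\<lambda>\<omega>. f \<omega> - g \<omega>) = E2 (\<lambda>\<omega>. g \<omega> - f \<omega>)"
  by (simp add: E2_def norm_minus_commute)

end

lemma mono_left_limit:
  fixes f :: "real \<Rightarrow> real"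
  assumes "\<And>u v. 0 \<le> u \<Longrightarrow> u \<le> v \<Longrightarrow> v \<le> s \<Longrightarrow> f u \<le> f v" "0 < s"
  shows "\<exists>l. (f \<longlongrightarrow> l) (at_left s)"
proof -
  let ?S = "f ` {0..<s}"
  have bdd: "bdd_above ?S" using assms by (auto intro!: bdd_aboveI[of _ "f s"])
  have "(f \<longlongrightarrow> Sup ?S) (at_left s)"
  proof (rule order_tendstoI)
    fix a assume "a < Sup ?S"
    then obtain u where u: "0 \<le> u" "u < s" "a < f u"
      using assms(2) by (subst (asm) less_cSup_iff[OF _ bdd]) auto
    have "eventually (\<lambda>r. r \<in> {u<..<s}) (at_left s)" using u by (intro eventually_at_left_real)
    then show "eventually (\<lambda>r. a < f r) (at_left s)"
      by eventually_elim (use u assms(1)[of u] in \<open>auto intro: less_le_trans\<close>)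
  next
    fix a assume a: "Sup ?S < a"
    have "eventually (\<lambda>r. r \<in> {0<..<s}) (at_left s)" using assms by (intro eventually_at_left_real)
    then show "eventually (\<lambda>r. f r < a) (at_left s)"
    proof eventually_elim
      case (elim r)
      then have "f r \<le> Sup ?S" by (intro cSup_upper[OF _ bdd]) auto
      then show ?case using a by linarith
    qed
  qed
  then show ?thesis by blast
qed

section \<open>Path regularity of forcings and the rate of the dyadic Euler schemes\<close>

context sde
begin

text \<open>Adding \<open>\<nu>\<close> makes every coordinate of \<open>A\<close> nondecreasing,
  because its increments are dominated by those of \<open>\<nu>\<close>. Monotone functions have
  left limits, and the left limit of \<open>\<nu>\<close> is subtracted again.\<close>

lemma forcing_left_limit:
  assumes "forcing A \<nu>" "\<omega> \<in> space M" "0 < s" "s \<le> T"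
  shows "\<exists>l. ((\<lambda>r. A r \<omega>) \<longlongrightarrow> l) (at_left s)"
proof -
  obtain l0 where l0: "((\<lambda>r. \<nu> r \<omega>) \<longlongrightarrow> l0) (at_left s)"
    using mono_left_limit[of s "\<lambda>r. \<nu> r \<omega>"] forcing_mono[OF assms(1,2)] assms(3,4) by auto
  have "\<exists>l. ((\<lambda>r. \<nu> r \<omega> + A r \<omega> $ i) \<longlongrightarrow> l) (at_left s)" for i
  proof (rule mono_left_limit[OF _ assms(3)])
    fix u v assume uv: "0 \<le> u" "u \<le> v" "v \<le> s"
    have "\<bar>A v \<omega> $ i - A u \<omega> $ i\<bar> \<le> norm (A v \<omega> - A u \<omega>)"
      using component_le_norm_cart[of "A v \<omega> - A u \<omega>" i] by simp
    then show "\<nu> u \<omega> + A u \<omega> $ i \<le> \<nu> v \<omega> + A v \<omega> $ i"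
      using forcingD(4)[OF assms(1,2), of u v] uv assms(4) by (simp add: abs_le_iff)
  qed
  then obtain l where l: "((\<lambda>r. \<nu> r \<omega> + A r \<omega> $ i) \<longlongrightarrow> l i) (at_left s)" for i by metis
  have "((\<lambda>r. A r \<omega>) \<longlongrightarrow> (\<chi> i. l i - l0)) (at_left s)"
    by (rule vec_tendstoI) (use tendsto_diff[OF l l0] in simp)
  then show ?thesis by blast
qed

lemma forcing_right_continuous:
  assumes "forcing A \<nu>" "\<omega> \<in> space M" "0 \<le> s" "s < T"
  shows "continuous (at_right s) (\<lambda>r. A r \<omega>)"
proof -
  have "((\<lambda>r. \<nu> r \<omega>) \<longlongrightarrow> \<nu> s \<omega>) (at_right s)"
    using forcingD(5)[OF assms] by (simp add: continuous_within)
  then have "((\<lambda>r. \<nu> r \<omega> - \<nu> s \<omega>) \<longlongrightarrow> 0) (at_right s)" using LIM_zero by blast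
  moreover have "eventually (\<lambda>r. norm (A r \<omega> - A s \<omega>) \<le> \<nu> r \<omega> - \<nu> s \<omega>) (at_right s)"
  proof -
    have "eventually (\<lambda>r. r \<in> {s<..<T}) (at_right s)" using assms by (intro eventually_at_right_real)
    then show ?thesis by eventually_elim (use forcingD(4)[OF assms(1,2,3)] in auto)
  qed
  ultimately have "((\<lambda>r. A r \<omega> - A s \<omega>) \<longlongrightarrow> 0) (at_right s)"
    by (rule Lim_null_comparison[rotated])
  then have "((\<lambda>r. A r \<omega>) \<longlongrightarrow> A s \<omega>) (at_right s)" by (rule LIM_zero_cancel)
  then show ?thesis by (simp add: continuous_within)
qed

text \<open>Nonnegative increments have squares summing to at most the square of their sum. This
  bound, uniform in \<open>m\<close>, stands in for continuity of \<open>\<nu>\<close>: a single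
  cell may carry a jump, but the total over all cells stays bounded.\<close>

lemma forcing_cells:
  assumes "forcing A \<nu>"
  shows "(\<Sum>k<2^m. E2 (\<lambda>\<omega>. \<nu> (gr m (Suc k)) \<omega> - \<nu> (gr m k) \<omega>)) \<le> E2 (\<nu> T)"
proof -
  have L: "L2 (\<lambda>\<omega>. \<nu> (gr m (Suc k)) \<omega> - \<nu> (gr m k) \<omega>)" if "k < 2^m" for k
    using forcing_L2(2)[OF assms gr_nonneg gr_le_T] that by (intro L2_diff) auto
  have "(\<Sum>k<2^m. E2 (\<lambda>\<omega>. \<nu> (gr m (Suc k)) \<omega> - \<nu> (gr m k) \<omega>))
     = (\<integral>\<omega>. (\<Sum>k<2^m. (\<nu> (gr m (Suc k)) \<omega> - \<nu> (gr m k) \<omega>)\<^sup>2) \<partial>M)"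
    unfolding E2_def by (subst Bochner_Integration.integral_sum) (use L in \<open>auto simp: L2_def\<close>)
  also have "\<dots> \<le> E2 (\<nu> T)"
    unfolding E2_def
  proof (rule integral_mono)
    show "integrable M (\<lambda>\<omega>. \<Sum>k<2^m. (\<nu> (gr m (Suc k)) \<omega> - \<nu> (gr m k) \<omega>)\<^sup>2)"
      by (intro Bochner_Integration.integrable_sum) (use L in \<open>auto simp: L2_def\<close>)
    show "integrable M (\<lambda>\<omega>. (norm (\<nu> T \<omega>))\<^sup>2)" using forcingD(3)[OF assms] by (simp add: L2_def)
    fix \<omega> assume \<omega>: "\<omega> \<in> space M"
    have "(\<Sum>k<2^m. (\<nu> (gr m (Suc k)) \<omega> - \<nu> (gr m k) \<omega>)\<^sup>2) \<le> (\<Sum>k<2^m. \<nu> (gr m (Suc k)) \<omega> - \<nu> (gr m k) \<omega>)\<^sup>2"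
    proof (rule sum_sq_le_sq_sum)
      fix k :: nat assume "k < 2^m"
      then show "0 \<le> \<nu> (gr m (Suc k)) \<omega> - \<nu> (gr m k) \<omega>"
        using forcing_mono[OF assms \<omega> gr_nonneg gr_le_Suc gr_le_T, of k m] by simp
    qed
    also have "(\<Sum>k<2^m. \<nu> (gr m (Suc k)) \<omega> - \<nu> (gr m k) \<omega>) = \<nu> T \<omega> - \<nu> 0 \<omega>"
      using sum_lessThan_telescope[of "\<lambda>k. \<nu> (gr m k) \<omega>" "2^m"] by simp
    also have "(\<nu> T \<omega> - \<nu> 0 \<omega>)\<^sup>2 \<le> (norm (\<nu> T \<omega>))\<^sup>2"
      using forcing_bound[OF assms \<omega>, of 0] forcing_bound[OF assms \<omega>, of T] T_pos by (intro power_mono) auto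
    finally show "(\<Sum>k<2^m. (\<nu> (gr m (Suc k)) \<omega> - \<nu> (gr m k) \<omega>)\<^sup>2) \<le> (norm (\<nu> T \<omega>))\<^sup>2" .
  qed
  finally show ?thesis .
qed

lemma gr_half: "gr (Suc m) (2 * k) = gr m k" "gr (Suc m) (Suc (Suc (2 * k))) = gr m (Suc k)"
  using gr_double[of m k] gr_double[of m "Suc k"] by simp_all

lemma gr_half_bounds: "gr m (i div 2) \<le> gr (Suc m) i" "gr (Suc m) i \<le> gr m (Suc (i div 2))"
proof -
  have "2 * (i div 2) \<le> i" "i \<le> 2 * Suc (i div 2)" by auto
  from this[THEN monoD[OF gr_mono[of "Suc m"]], unfolded gr_double]
  show "gr m (i div 2) \<le> gr (Suc m) i" "gr (Suc m) i \<le> gr m (Suc (i div 2))" by auto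
qed

text \<open>The fine cell \<open>i\<close> lies in the coarse cell \<open>i div 2\<close>, whose
  frozen state it keeps. Writing both levels over the same cells is what makes their difference a
  single sum.\<close>

lemma drift_refine:
  "drift A x m s \<omega> = (\<Sum>i<2^Suc m. (clip (gr (Suc m) i) (gr (Suc m) (Suc i)) s - gr (Suc m) i) *\<^sub>R b (eul A x m (i div 2) \<omega>))"
  unfolding drift_def power_Suc sum_double
proof (intro sum.cong refl)
  fix k
  let ?c = "gr (Suc m) (Suc (2 * k))"
  have "gr m k \<le> ?c" "?c \<le> gr m (Suc k)" using gr_half_bounds[of m "Suc (2 * k)"] by auto
  from clip_refine[OF this, of "\<lambda>z. z" s]
  show "(clip (gr m k) (gr m (Suc k)) s - gr m k) *\<^sub>R b (eul A x m k \<omega>) =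
    (clip (gr (Suc m) (2 * k)) (gr (Suc m) (Suc (2 * k))) s - gr (Suc m) (2 * k)) *\<^sub>R b (eul A x m (2 * k div 2) \<omega>) +
    (clip (gr (Suc m) (Suc (2 * k))) (gr (Suc m) (Suc (Suc (2 * k)))) s - gr (Suc m) (Suc (2 * k))) *\<^sub>R
       b (eul A x m (Suc (2 * k) div 2) \<omega>)"
    by (simp add: gr_half scaleR_left_distrib[symmetric])
qed

lemma eint_refine:
  "eint (gr m) (2^m) (\<lambda>k \<omega>. \<kappa> (eul A x m k \<omega>)) s \<omega>
     = eint (gr (Suc m)) (2^Suc m) (\<lambda>i \<omega>. \<kappa> (eul A x m (i div 2) \<omega>)) s \<omega>"
  unfolding eint_def power_Suc sum_double
proof (intro sum.cong refl)
  fix k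
  let ?c = "gr (Suc m) (Suc (2 * k))"
  have "gr m k \<le> ?c" "?c \<le> gr m (Suc k)" using gr_half_bounds[of m "Suc (2 * k)"] by auto
  note eq = clip_refine[OF this, of "\<lambda>z. W z \<omega>" s]
  have d: "2 * k div 2 = k" "Suc (2 * k) div 2 = k" by auto
  show "\<kappa> (eul A x m k \<omega>) *v (W (clip (gr m k) (gr m (Suc k)) s) \<omega> - W (gr m k) \<omega>) =
    \<kappa> (eul A x m (2 * k div 2) \<omega>) *v (W (clip (gr (Suc m) (2 * k)) (gr (Suc m) (Suc (2 * k))) s) \<omega> - W (gr (Suc m) (2 * k)) \<omega>) +
    \<kappa> (eul A x m (Suc (2 * k) div 2) \<omega>) *v
      (W (clip (gr (Suc m) (Suc (2 * k))) (gr (Suc m) (Suc (Suc (2 * k)))) s) \<omega> - W (gr (Suc m) (Suc (2 * k))) \<omega>)"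
    unfolding d gr_half matrix_vector_right_distrib[symmetric] eq ..
qed

lemma eulc_diff_refine:
  "eulc A x m s \<omega> - eulc A x (Suc m) s \<omega>
    = (\<Sum>i<2^Suc m. (clip (gr (Suc m) i) (gr (Suc m) (Suc i)) s - gr (Suc m) i) *\<^sub>R
          (b (eul A x m (i div 2) \<omega>) - b (eul A x (Suc m) i \<omega>)))
     + eint (gr (Suc m)) (2^Suc m) (\<lambda>i \<omega>. \<kappa> (eul A x m (i div 2) \<omega>) - \<kappa> (eul A x (Suc m) i \<omega>)) s \<omega>"
  unfolding eulc_def drift_refine[of A x m] eint_refine[of m] drift_def[of _ _ "Suc m"]
  unfolding eint_def
  by (simp add: sum_subtractf scaleR_right_diff_distrib matrix_vector_mult_diff_rdistrib del: power_Suc)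

lemma euler_rate:
  assumes "forcing A \<nu>"
  obtains C where "0 \<le> C"
    "\<And>m. (\<Sum>i<2^Suc m. (T / 2^Suc m) * E2 (\<lambda>\<omega>. eul A x m (i div 2) \<omega> - eul A x (Suc m) i \<omega>)) \<le> C / 2^m"
proof -
  obtain C0 where C0: "0 \<le> C0" "\<And>m k. k \<le> 2^m \<Longrightarrow> E2 (eul A x m k) \<le> C0" using eul_moment_bound[OF assms] by blast
  define K where "K = (4 * T + 2) * (2 * c0\<^sup>2 + 2 * L\<^sup>2 * C0)"
  have K: "0 \<le> K" using T_pos C0 by (auto simp: K_def)
  define C1 where "C1 = T * (4 * E2 (\<nu> T)) + T * (K * T)"
  have C1: "0 \<le> C1" using T_pos K by (auto simp: C1_def)
  define \<beta> where "\<beta> = (4 * T + 2) * (2 * L\<^sup>2)"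
  have \<beta>: "0 \<le> \<beta>" using T_pos by (auto simp: \<beta>_def)
  define C where "C = 2 * (T * (\<beta> * C1 * exp (\<beta> * T))) + 2 * C1"
  have C: "0 \<le> C" using C1 \<beta> T_pos by (auto simp: C_def intro!: add_nonneg_nonneg mult_nonneg_nonneg)
  have "(\<Sum>i<2^Suc m. (T / 2^Suc m) * E2 (\<lambda>\<omega>. eul A x m (i div 2) \<omega> - eul A x (Suc m) i \<omega>)) \<le> C / 2^m" for m
  proof -
    define p where "p i = eul A x m (i div 2)" for i
    define q where "q i = eul A x (Suc m) i" for i
    define \<delta> where "\<delta> = T / 2^Suc m"
    have \<delta>: "0 \<le> \<delta>" using T_pos by (simp add: \<delta>_def)
    define e where "e j = E2 (\<lambda>\<omega>. eulc A x m (gr (Suc m) j) \<omega> - q j \<omega>)" for j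
    define c where "c i = E2 (\<lambda>\<omega>. p i \<omega> - eulc A x m (gr (Suc m) i) \<omega>)" for i
    have half: "i div 2 \<le> 2^m" if "i \<le> 2^Suc m" for i :: nat using that by simp
    have half': "i div 2 < 2^m" if "i < 2^Suc m" for i :: nat using that by auto
    have pL: "L2 (p i)" "p i \<in> borel_measurable (F (gr (Suc m) i))" if "i \<le> 2^Suc m" for i
      using eul_L2[OF assms half[OF that]] measurable_F_mono[OF gr_half_bounds(1) eul_measurable[OF assms half[OF that]]]
      by (auto simp: p_def)
    have qL: "L2 (q i)" "q i \<in> borel_measurable (F (gr (Suc m) i))" if "i \<le> 2^Suc m" for i
      using eul_L2[OF assms that] eul_measurable[OF assms that] by (auto simp: q_def)
    have eL: "L2 (eulc A x m (gr (Suc m) i))" if "i \<le> 2^Suc m" for i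
      using eulc_L2[OF assms gr_nonneg gr_le_T[OF that]] .
    have pq: "E2 (\<lambda>\<omega>. p i \<omega> - q i \<omega>) \<le> 2 * c i + 2 * e i" if "i \<le> 2^Suc m" for i
      using E2_add[OF L2_diff[OF pL(1)[OF that] eL[OF that]] L2_diff[OF eL[OF that] qL(1)[OF that]]]
      by (simp add: c_def e_def)
    have c: "c i \<le> 4 * E2 (\<lambda>\<omega>. \<nu> (gr m (Suc (i div 2))) \<omega> - \<nu> (gr m (i div 2)) \<omega>) + K * (T / 2^m)" if i: "i < 2^Suc m" for i
    proof -
      have iT: "gr (Suc m) i \<le> T" using gr_le_T[of i "Suc m"] i by simp
      have sT: "gr m (Suc (i div 2)) \<le> T" using gr_le_T[of "Suc (i div 2)" m] half'[OF i] by simp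
      have "c i = E2 (\<lambda>\<omega>. eulc A x m (gr (Suc m) i) \<omega> - eulc A x m (gr m (i div 2)) \<omega>)"
        unfolding c_def p_def by (subst E2_commute) (use half[of i] i in \<open>simp add: eulc_at_grid\<close>)
      also have "\<dots> \<le> 4 * E2 (\<lambda>\<omega>. \<nu> (gr (Suc m) i) \<omega> - \<nu> (gr m (i div 2)) \<omega>) + K * (gr (Suc m) i - gr m (i div 2))"
        unfolding K_def by (rule eulc_increment_L2(2)[OF assms C0(2) gr_nonneg gr_half_bounds(1) iT]) auto
      also have "\<dots> \<le> 4 * E2 (\<lambda>\<omega>. \<nu> (gr m (Suc (i div 2))) \<omega> - \<nu> (gr m (i div 2)) \<omega>) + K * (T / 2^m)"
      proof (intro add_mono mult_left_mono K)
        show "E2 (\<lambda>\<omega>. \<nu> (gr (Suc m) i) \<omega> - \<nu> (gr m (i div 2)) \<omega>) \<le> E2 (\<lambda>\<omega>. \<nu> (gr m (Suc (i div 2))) \<omega> - \<nu> (gr m (i div 2)) \<omega>)"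
        proof (rule E2_mono)
          show "L2 (\<lambda>\<omega>. \<nu> (gr m (Suc (i div 2))) \<omega> - \<nu> (gr m (i div 2)) \<omega>)"
            using forcing_L2(2)[OF assms gr_nonneg] sT order_trans[OF gr_le_Suc sT] by (intro L2_diff) auto
          show "(\<lambda>\<omega>. \<nu> (gr (Suc m) i) \<omega> - \<nu> (gr m (i div 2)) \<omega>) \<in> borel_measurable M"
            using forcing_L2(2)[OF assms gr_nonneg] iT order_trans[OF gr_le_Suc sT] by (intro borel_measurable_diff L2_measurable) auto
          fix \<omega> assume \<omega>: "\<omega> \<in> space M"
          show "norm (\<nu> (gr (Suc m) i) \<omega> - \<nu> (gr m (i div 2)) \<omega>) \<le> norm (\<nu> (gr m (Suc (i div 2))) \<omega> - \<nu> (gr m (i div 2)) \<omega>)"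
            using forcing_mono[OF assms \<omega> gr_nonneg gr_half_bounds(1) iT] forcing_mono[OF assms \<omega> gr_nonneg gr_half_bounds(2) sT]
            by simp
        qed
        show "gr (Suc m) i - gr m (i div 2) \<le> T / 2^m"
          using gr_half_bounds(2)[of m i] gr_step[of m "i div 2"] by linarith
      qed auto
      finally show ?thesis .
    qed
    have csum: "(\<Sum>i<2^Suc m. \<delta> * c i) \<le> C1 / 2^m"
    proof -
      have "(\<Sum>i<2^Suc m. \<delta> * c i) \<le> (\<Sum>i<2^Suc m. \<delta> * (4 * E2 (\<lambda>\<omega>. \<nu> (gr m (Suc (i div 2))) \<omega> - \<nu> (gr m (i div 2)) \<omega>) + K * (T / 2^m)))"
        using c \<delta> by (intro sum_mono mult_left_mono) auto
      also have "\<dots> = 2 * (\<Sum>k<2^m. \<delta> * (4 * E2 (\<lambda>\<omega>. \<nu> (gr m (Suc k)) \<omega> - \<nu> (gr m k) \<omega>) + K * (T / 2^m)))"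
        unfolding power_Suc by (rule sum_half)
      also have "\<dots> = (2 * \<delta>) * (4 * (\<Sum>k<2^m. E2 (\<lambda>\<omega>. \<nu> (gr m (Suc k)) \<omega> - \<nu> (gr m k) \<omega>)) + K * T)"
        by (simp add: sum_distrib_left[symmetric] sum.distrib)
      also have "\<dots> \<le> (2 * \<delta>) * (4 * E2 (\<nu> T) + K * T)"
        using forcing_cells[OF assms, of m] \<delta> by (intro mult_left_mono) auto
      also have "\<dots> = C1 / 2^m" by (simp add: C1_def \<delta>_def field_simps)
      finally show ?thesis .
    qed
    have step: "e j \<le> \<beta> * (C1 / 2^m) + (\<Sum>i<j. (\<beta> * \<delta>) * e i)" if j: "j \<le> 2^Suc m" for j
    proof -
      \<comment> \<open>The leading term is 0 because both schemes contain the same \<open>A\<close>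
        at the same time.\<close>
      have V: "eulc A x m (gr (Suc m) j) \<omega> - q j \<omega> = 0
         + (\<Sum>i<j. (gr (Suc m) (Suc i) - gr (Suc m) i) *\<^sub>R (b (p i \<omega>) - b (q i \<omega>)))
         + (\<Sum>i<j. (\<kappa> (p i \<omega>) - \<kappa> (q i \<omega>)) *v (W (gr (Suc m) (Suc i)) \<omega> - W (gr (Suc m) i) \<omega>))" for \<omega>
        using eulc_diff_refine[of A x m "gr (Suc m) j" \<omega>] j
        unfolding eint_at_grid[OF gr_mono j] clip_sum_grid[OF gr_mono j] eulc_at_grid[OF j]
        by (simp add: p_def q_def)
      have "e j \<le> 4 * E2 (\<lambda>\<omega>. 0::real^'d) + (\<Sum>i<j. (4 * T + 2) * (T / 2^Suc m) * (L\<^sup>2 * E2 (\<lambda>\<omega>. p i \<omega> - q i \<omega>)))"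
        unfolding e_def
      proof (rule L2_estimate(2)[OF j V])
        fix i assume "i < j"
        then have i: "i \<le> 2^Suc m" using j by simp
        have [measurable]: "p i \<in> borel_measurable (F (gr (Suc m) i))" "q i \<in> borel_measurable (F (gr (Suc m) i))"
          using pL qL i by auto
        show "(\<lambda>\<omega>. \<kappa> (p i \<omega>) - \<kappa> (q i \<omega>)) \<in> borel_measurable (F (gr (Suc m) i))" by measurable
      qed (use pL qL coeff_diff_L2 j in auto)
      also have "\<dots> \<le> (\<Sum>i<j. (4 * T + 2) * \<delta> * (L\<^sup>2 * (2 * c i + 2 * e i)))"
        unfolding \<delta>_def[symmetric] using pq j \<delta> T_pos by (auto intro!: sum_mono mult_left_mono)
      also have "\<dots> = \<beta> * (\<Sum>i<j. \<delta> * c i) + (\<Sum>i<j. (\<beta> * \<delta>) * e i)"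
        by (simp add: \<beta>_def sum.distrib[symmetric] sum_distrib_left distrib_left mult_ac)
      also have "(\<Sum>i<j. \<delta> * c i) \<le> (\<Sum>i<2^Suc m. \<delta> * c i)"
        using j \<delta> by (intro sum_mono2) (auto simp: c_def)
      also note csum
      finally show ?thesis using \<beta> by (simp add: mult_left_mono)
    qed
    have ebound: "e j \<le> \<beta> * (C1 / 2^m) * exp (\<beta> * T)" if "j \<le> 2^Suc m" for j
    proof -
      have "e j \<le> \<beta> * (C1 / 2^m) * exp (\<beta> * \<delta> * real (2^Suc m))"
        by (rule discrete_gronwall[OF step _ _ that]) (use \<beta> \<delta> C1 in auto)
      then show ?thesis by (simp add: \<delta>_def)
    qed
    have "(\<Sum>i<2^Suc m. \<delta> * E2 (\<lambda>\<omega>. p i \<omega> - q i \<omega>)) \<le> (\<Sum>i<2^Suc m. \<delta> * (2 * c i + 2 * (\<beta> * (C1 / 2^m) * exp (\<beta> * T))))"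
    proof (intro sum_mono mult_left_mono \<delta>)
      fix i assume "i \<in> {..<2^Suc m::nat}"
      then show "E2 (\<lambda>\<omega>. p i \<omega> - q i \<omega>) \<le> 2 * c i + 2 * (\<beta> * (C1 / 2^m) * exp (\<beta> * T))"
        using pq[of i] ebound[of i] by auto
    qed
    also have "\<dots> = 2 * (\<Sum>i<2^Suc m. \<delta> * c i) + 2^Suc m * \<delta> * (2 * (\<beta> * (C1 / 2^m) * exp (\<beta> * T)))"
      by (simp add: sum.distrib distrib_left sum_distrib_left mult_ac)
    also have "\<dots> \<le> 2 * (C1 / 2^m) + T * (2 * (\<beta> * (C1 / 2^m) * exp (\<beta> * T)))"
      using csum by (simp add: \<delta>_def)
    also have "\<dots> = C / 2^m" by (simp add: C_def field_simps)
    finally show ?thesis by (simp add: p_def q_def \<delta>_def)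
  qed
  then show thesis using that C by blast
qed

text \<open>The averaged rate gives a bound of order \<open>1 / 2^m\<close> at fixed times and,
  through the maximal inequality for the stochastic part and Chebyshev for the drift, a bound
  uniform in time off a small event. The threshold \<open>(3/4)^m\<close> is summable, and
  \<open>1 / 2^m\<close> divided by its square is \<open>(8/9)^m\<close>, which is summable
  too.\<close>

lemma euler_consecutive:
  assumes "forcing A \<nu>"
  obtains C where "0 \<le> C"
    "\<And>m s. 0 \<le> s \<Longrightarrow> s \<le> T \<Longrightarrow> E2 (\<lambda>\<omega>. eulc A x m s \<omega> - eulc A x (Suc m) s \<omega>) \<le> C / 2^m"
    "\<And>m. \<exists>B\<in>sets M. prob B \<le> C * (8/9)^m \<and>
        (\<forall>\<omega>\<in>space M - B. \<forall>s\<in>{0..T}. norm (eulc A x m s \<omega> - eulc A x (Suc m) s \<omega>) \<le> 2 * (3/4)^m)"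
proof -
  obtain C0 where C0: "0 \<le> C0"
    "\<And>m. (\<Sum>i<2^Suc m. (T / 2^Suc m) * E2 (\<lambda>\<omega>. eul A x m (i div 2) \<omega> - eul A x (Suc m) i \<omega>)) \<le> C0 / 2^m"
    using euler_rate[OF assms] by blast
  define C where "C = (2 * T + 2) * L\<^sup>2 * C0"
  have C: "0 \<le> C" using C0 T_pos by (auto simp: C_def)
  have main: "(\<forall>s. 0 \<le> s \<longrightarrow> s \<le> T \<longrightarrow> E2 (\<lambda>\<omega>. eulc A x m s \<omega> - eulc A x (Suc m) s \<omega>) \<le> C / 2^m) \<and>
     (\<exists>B\<in>sets M. prob B \<le> C * (8/9)^m \<and>
        (\<forall>\<omega>\<in>space M - B. \<forall>s\<in>{0..T}. norm (eulc A x m s \<omega> - eulc A x (Suc m) s \<omega>) \<le> 2 * (3/4)^m))" for m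
  proof -
    let ?n = "2^Suc m :: nat"
    define p where "p i = eul A x m (i div 2)" for i
    define q where "q i = eul A x (Suc m) i" for i
    define \<delta> where "\<delta> = T / 2^Suc m"
    have \<delta>: "0 \<le> \<delta>" using T_pos by (simp add: \<delta>_def)
    have half: "i div 2 \<le> 2^m" if "i \<le> 2^Suc m" for i :: nat using that by simp
    have pL: "L2 (p i)" "p i \<in> borel_measurable (F (gr (Suc m) i))" if "i < 2^Suc m" for i
      using eul_L2[OF assms half] measurable_F_mono[OF gr_half_bounds(1) eul_measurable[OF assms half]] that
      by (auto simp: p_def)
    have qL: "L2 (q i)" "q i \<in> borel_measurable (F (gr (Suc m) i))" if "i < 2^Suc m" for i
      using eul_L2[OF assms] eul_measurable[OF assms] that by (auto simp: q_def)
    define S where "S = (\<Sum>i<?n. \<delta> * E2 (\<lambda>\<omega>. p i \<omega> - q i \<omega>))"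
    have S: "S \<le> C0 / 2^m" using C0(2)[of m] by (simp add: S_def p_def q_def \<delta>_def)
    have S0: "0 \<le> S" unfolding S_def using \<delta> by (intro sum_nonneg) auto
    define H where "H i \<omega> = \<kappa> (p i \<omega>) - \<kappa> (q i \<omega>)" for i \<omega>
    have HL: "H i \<in> borel_measurable (F (gr (Suc m) i))" "L2 (H i)" "E2 (H i) \<le> L\<^sup>2 * E2 (\<lambda>\<omega>. p i \<omega> - q i \<omega>)" if "i < 2^Suc m" for i
    proof -
      have [measurable]: "p i \<in> borel_measurable (F (gr (Suc m) i))" "q i \<in> borel_measurable (F (gr (Suc m) i))"
        using pL qL that by auto
      show "H i \<in> borel_measurable (F (gr (Suc m) i))" unfolding H_def[abs_def] by measurable
      show "L2 (H i)" "E2 (H i) \<le> L\<^sup>2 * E2 (\<lambda>\<omega>. p i \<omega> - q i \<omega>)"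
        using coeff_diff_L2[OF pL(1)[OF that] qL(1)[OF that]] by (auto simp: H_def[abs_def])
    qed
    have HS: "(\<Sum>k<?n. (gr (Suc m) (Suc k) - gr (Suc m) k) * E2 (H k)) \<le> L\<^sup>2 * S"
    proof -
      have "(\<Sum>k<?n. (gr (Suc m) (Suc k) - gr (Suc m) k) * E2 (H k)) \<le> (\<Sum>k<?n. \<delta> * (L\<^sup>2 * E2 (\<lambda>\<omega>. p k \<omega> - q k \<omega>)))"
        unfolding gr_step \<delta>_def[symmetric] using HL \<delta> by (intro sum_mono mult_left_mono) auto
      then show ?thesis by (simp add: S_def sum_distrib_left mult_ac)
    qed
    define Z where "Z = eint (gr (Suc m)) ?n H"
    have g0: "0 \<le> gr (Suc m) 0" by simp
    have Z: "L2 (Z s)" "E2 (Z s) \<le> L\<^sup>2 * S" for s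
      using eint_L2[OF gr_mono g0 HL(1,2), of ?n s] HS by (auto simp: Z_def)
    \<comment> \<open>A random variable that dominates the drift difference at all times at once, so
      that Chebyshev suffices for the drift.\<close>
    define R where "R \<omega> = (\<Sum>i<?n. \<delta> *\<^sub>R (L * norm (p i \<omega> - q i \<omega>)))" for \<omega>
    have RL: "L2 (\<lambda>\<omega>. L * norm (p i \<omega> - q i \<omega>))" "E2 (\<lambda>\<omega>. L * norm (p i \<omega> - q i \<omega>)) = L\<^sup>2 * E2 (\<lambda>\<omega>. p i \<omega> - q i \<omega>)" if "i < ?n" for i
      using L2_diff[OF pL(1)[OF that] qL(1)[OF that]] by (auto simp: L2_def E2_def power_mult_distrib)
    have R: "L2 R" "E2 R \<le> T * (L\<^sup>2 * S)"
    proof -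
      show "L2 R" unfolding R_def[abs_def] by (intro L2_sum L2_scaleR RL) auto
      have "E2 R \<le> (\<Sum>i<?n. \<delta>) * (\<Sum>i<?n. \<delta> * E2 (\<lambda>\<omega>. L * norm (p i \<omega> - q i \<omega>)))"
        unfolding R_def[abs_def] by (rule E2_weighted_sum) (use \<delta> RL in auto)
      also have "\<dots> = T * (\<Sum>i<?n. \<delta> * (L\<^sup>2 * E2 (\<lambda>\<omega>. p i \<omega> - q i \<omega>)))" using RL by (simp add: \<delta>_def)
      also have "\<dots> = T * (L\<^sup>2 * S)" by (simp add: S_def sum_distrib_left mult_ac)
      finally show "E2 R \<le> T * (L\<^sup>2 * S)" .
    qed
    define D where "D s \<omega> = (\<Sum>i<?n. (clip (gr (Suc m) i) (gr (Suc m) (Suc i)) s - gr (Suc m) i) *\<^sub>R (b (p i \<omega>) - b (q i \<omega>)))" for s \<omega>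
    have eq: "eulc A x m s \<omega> - eulc A x (Suc m) s \<omega> = D s \<omega> + Z s \<omega>" for s \<omega>
      unfolding eulc_diff_refine D_def Z_def H_def p_def q_def ..
    have DR: "norm (D s \<omega>) \<le> norm (R \<omega>)" for s \<omega>
    proof -
      have "norm (D s \<omega>) \<le> (\<Sum>i<?n. \<delta> * (L * norm (p i \<omega> - q i \<omega>)))"
        unfolding D_def
      proof (rule order_trans[OF norm_sum], rule sum_mono)
        fix i
        have "\<bar>clip (gr (Suc m) i) (gr (Suc m) (Suc i)) s - gr (Suc m) i\<bar> \<le> \<delta>"
          using clip_bounds[OF gr_le_Suc, of "Suc m" i s] gr_step[of "Suc m" i] by (simp add: \<delta>_def)
        then show "norm ((clip (gr (Suc m) i) (gr (Suc m) (Suc i)) s - gr (Suc m) i) *\<^sub>R (b (p i \<omega>) - b (q i \<omega>))) \<le> \<delta> * (L * norm (p i \<omega> - q i \<omega>))"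
          unfolding norm_scaleR using \<delta> b_lip by (intro mult_mono) auto
      qed
      then show ?thesis by (simp add: R_def)
    qed
    have DL: "L2 (D s)" "E2 (D s) \<le> T * (L\<^sup>2 * S)" for s
    proof -
      have m: "D s \<in> borel_measurable M" unfolding D_def[abs_def]
        using coeff_diff_L2(2)[OF pL(1) qL(1)] by (intro borel_measurable_sum borel_measurable_scaleR L2_measurable) auto
      show "L2 (D s)" by (rule L2_mono[OF R(1) m DR])
      show "E2 (D s) \<le> T * (L\<^sup>2 * S)" using E2_mono[OF R(1) m DR] R(2) by linarith
    qed
    have LS: "L\<^sup>2 * S \<le> L\<^sup>2 * (C0 / 2^m)" using S by (intro mult_left_mono) auto
    have TLS: "T * (L\<^sup>2 * S) \<le> T * (L\<^sup>2 * (C0 / 2^m))" using mult_left_mono[OF LS, of T] T_pos by simp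
    have "E2 (\<lambda>\<omega>. eulc A x m s \<omega> - eulc A x (Suc m) s \<omega>) \<le> C / 2^m" for s
    proof -
      have "E2 (\<lambda>\<omega>. eulc A x m s \<omega> - eulc A x (Suc m) s \<omega>) \<le> 2 * E2 (D s) + 2 * E2 (Z s)"
        unfolding eq by (rule E2_add[OF DL(1) Z(1)])
      also have "\<dots> \<le> 2 * (T * (L\<^sup>2 * (C0 / 2^m))) + 2 * (L\<^sup>2 * (C0 / 2^m))"
        using DL(2)[of s] Z(2)[of s] LS TLS by linarith
      also have "\<dots> = C / 2^m" by (simp add: C_def field_simps)
      finally show ?thesis .
    qed
    moreover have "\<exists>B\<in>sets M. prob B \<le> C * (8/9)^m \<and>
        (\<forall>\<omega>\<in>space M - B. \<forall>s\<in>{0..T}. norm (eulc A x m s \<omega> - eulc A x (Suc m) s \<omega>) \<le> 2 * (3/4)^m)"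
    proof -
      define \<eta> :: real where "\<eta> = (3/4)^m"
      have \<eta>: "0 < \<eta>" by (simp add: \<eta>_def)
      obtain B where B: "B \<in> sets M" "prob B \<le> (\<Sum>k<?n. (gr (Suc m) (Suc k) - gr (Suc m) k) * E2 (H k)) / \<eta>\<^sup>2"
        "\<And>\<omega> s. \<omega> \<in> space M - B \<Longrightarrow> 0 \<le> s \<Longrightarrow> s \<le> T \<Longrightarrow> norm (Z s \<omega>) \<le> \<eta>"
        unfolding Z_def by (rule maximal_ineq[OF gr_mono gr_simps(1) T_pos HL(1,2) \<eta>, where n="?n"]; blast)
      let ?B' = "{\<omega>\<in>space M. \<eta> < norm (R \<omega>)}"
      note B' = L2_chebyshev[OF R(1) \<eta>]
      have "prob (B \<union> ?B') \<le> prob B + prob ?B'" by (rule measure_Un_le[OF B(1) B'(1)])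
      also have "\<dots> \<le> L\<^sup>2 * (C0 / 2^m) / \<eta>\<^sup>2 + T * (L\<^sup>2 * (C0 / 2^m)) / \<eta>\<^sup>2"
      proof (rule add_mono)
        show "prob B \<le> L\<^sup>2 * (C0 / 2^m) / \<eta>\<^sup>2" using B(2) HS LS \<eta> by (meson divide_right_mono order_trans zero_le_power2)
        show "prob ?B' \<le> T * (L\<^sup>2 * (C0 / 2^m)) / \<eta>\<^sup>2" using B'(2) R(2) TLS \<eta> by (meson divide_right_mono order_trans zero_le_power2)
      qed
      also have "\<dots> = (T + 1) * L\<^sup>2 * C0 * (1 / (2^m * \<eta>\<^sup>2))"
        by (simp add: distrib_right distrib_left add_divide_distrib mult_ac)
      also have "1 / (2^m * \<eta>\<^sup>2) = (8/9)^m"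
      proof -
        have "2^m * \<eta>\<^sup>2 = (2 * (3/4 * (3/4)))^m" by (simp only: \<eta>_def power2_eq_square power_mult_distrib)
        also have "\<dots> = (9/8)^m" by simp
        finally show ?thesis by (simp add: power_divide)
      qed
      also have "(T + 1) * L\<^sup>2 * C0 * (8/9)^m \<le> C * (8/9)^m"
        using C0 T_pos by (intro mult_right_mono) (auto simp: C_def intro!: mult_right_mono)
      finally have P: "prob (B \<union> ?B') \<le> C * (8/9)^m" .
      show ?thesis
      proof (intro bexI[of _ "B \<union> ?B'"] conjI P ballI)
        fix \<omega> s assume \<omega>: "\<omega> \<in> space M - (B \<union> ?B')" and s: "s \<in> {0..T}"
        have "norm (Z s \<omega>) \<le> \<eta>" using B(3)[of \<omega> s] \<omega> s by auto
        moreover have "norm (D s \<omega>) \<le> \<eta>" using DR[of s \<omega>] \<omega> by auto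
        ultimately show "norm (eulc A x m s \<omega> - eulc A x (Suc m) s \<omega>) \<le> 2 * (3/4)^m"
          unfolding eq using norm_triangle_ineq[of "D s \<omega>" "Z s \<omega>"] by (simp add: \<eta>_def)
      qed (use B(1) B'(1) in auto)
    qed
    ultimately show ?thesis by blast
  qed
  show thesis by (rule that[OF C]) (use main in blast)+
qed

text \<open>Consecutive differences are summed by the weighted Cauchy-Schwarz inequality with
  weights \<open>(3/4)^i\<close>. The weights add up to at most 4; dividing the second moments by
  them leaves the ratio \<open>2/3\<close>, hence a sum of at most 3. The product is the factor
  12.\<close>

lemma euler_L2_cauchy:
  assumes "forcing A \<nu>" "0 \<le> C" "0 \<le> s" "s \<le> T"
    and C: "\<And>m. E2 (\<lambda>\<omega>. eulc A x m s \<omega> - eulc A x (Suc m) s \<omega>) \<le> C / 2^m"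
  shows "E2 (\<lambda>\<omega>. eulc A x m s \<omega> - eulc A x (m + N) s \<omega>) \<le> 12 * C / 2^m"
proof -
  define w :: "nat \<Rightarrow> real" where "w i = (3/4)^i" for i
  have w: "0 < w i" for i by (simp add: w_def)
  define d where "d i \<omega> = eulc A x (m + i) s \<omega> - eulc A x (Suc (m + i)) s \<omega>" for i \<omega>
  have dL: "L2 (d i)" for i unfolding d_def[abs_def] using eulc_L2[OF assms(1,3,4)] by (intro L2_diff)
  have "(\<lambda>\<omega>. eulc A x m s \<omega> - eulc A x (m + N) s \<omega>) = (\<lambda>\<omega>. \<Sum>i<N. w i *\<^sub>R ((1 / w i) *\<^sub>R d i \<omega>))"
  proof
    fix \<omega>
    have "(\<Sum>i<N. w i *\<^sub>R ((1 / w i) *\<^sub>R d i \<omega>)) = (\<Sum>i<N. d i \<omega>)"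
      using w by (intro sum.cong) (auto simp: less_imp_neq[symmetric])
    also have "\<dots> = eulc A x m s \<omega> - eulc A x (m + N) s \<omega>"
      unfolding d_def using sum_lessThan_telescope'[of "\<lambda>i. eulc A x (m + i) s \<omega>" N] by simp
    finally show "eulc A x m s \<omega> - eulc A x (m + N) s \<omega> = (\<Sum>i<N. w i *\<^sub>R ((1 / w i) *\<^sub>R d i \<omega>))" ..
  qed
  then have "E2 (\<lambda>\<omega>. eulc A x m s \<omega> - eulc A x (m + N) s \<omega>) = E2 (\<lambda>\<omega>. \<Sum>i<N. w i *\<^sub>R ((1 / w i) *\<^sub>R d i \<omega>))" by simp
  also have "\<dots> \<le> (\<Sum>i<N. w i) * (\<Sum>i<N. w i * E2 (\<lambda>\<omega>. (1 / w i) *\<^sub>R d i \<omega>))"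
    by (rule E2_weighted_sum) (use w dL in \<open>auto intro!: L2_scaleR less_imp_le\<close>)
  also have "\<dots> \<le> 4 * (3 * (C / 2^m))"
  proof (intro mult_mono)
    have "(\<Sum>i<N. w i) \<le> suminf w" unfolding w_def
      by (intro sum_le_suminf summable_geometric) auto
    also have "\<dots> = 4" unfolding w_def by (subst suminf_geometric) auto
    finally show "(\<Sum>i<N. w i) \<le> 4" .
    have "(\<Sum>i<N. w i * E2 (\<lambda>\<omega>. (1 / w i) *\<^sub>R d i \<omega>)) \<le> (\<Sum>i<N. (C / 2^m) * (2/3)^i)"
    proof (rule sum_mono)
      fix i
      have "w i * E2 (\<lambda>\<omega>. (1 / w i) *\<^sub>R d i \<omega>) = E2 (d i) / w i"
        using w[of i] by (simp add: E2_scaleR power2_eq_square)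
      also have "\<dots> \<le> (C / 2^(m + i)) / w i" using C[of "m + i"] w[of i] by (intro divide_right_mono) (auto simp: d_def[abs_def])
      also have "\<dots> = (C / 2^m) * (2/3)^i"
      proof -
        have "2^i * w i = (2 * (3/4))^i" by (simp only: w_def power_mult_distrib)
        also have "\<dots> = (3/2)^i" by simp
        finally have *: "2^i * w i = (3/2)^i" .
        have "(C / 2^(m + i)) / w i = C / 2^m * (1 / (2^i * w i))" by (simp add: power_add)
        then show ?thesis unfolding * by (simp add: power_divide)
      qed
      finally show "w i * E2 (\<lambda>\<omega>. (1 / w i) *\<^sub>R d i \<omega>) \<le> (C / 2^m) * (2/3)^i" .
    qed
    also have "\<dots> = (C / 2^m) * (\<Sum>i<N. (2/3)^i)" by (simp add: sum_distrib_left)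
    also have "\<dots> \<le> (C / 2^m) * 3"
    proof (intro mult_left_mono)
      have "(\<Sum>i<N. (2/3)^i) \<le> suminf (\<lambda>i. (2/3::real)^i)" by (intro sum_le_suminf summable_geometric) auto
      also have "\<dots> = 3" by (subst suminf_geometric) auto
      finally show "(\<Sum>i<N. (2/3::real)^i) \<le> 3" .
    qed (use assms in auto)
    finally show "(\<Sum>i<N. w i * E2 (\<lambda>\<omega>. (1 / w i) *\<^sub>R d i \<omega>)) \<le> 3 * (C / 2^m)" by (simp add: mult.commute)
  qed (auto intro!: sum_nonneg mult_nonneg_nonneg less_imp_le[OF w])
  finally show ?thesis by simp
qed

lemma eulc_minus_forcing_continuous:
  assumes "continuous_on {0..} (\<lambda>s. W s \<omega>)"
  shows "continuous_on UNIV (\<lambda>s. eulc A x m s \<omega> - A s \<omega>)"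
proof -
  have "continuous_on UNIV (\<lambda>s. drift A x m s \<omega>)"
    unfolding drift_def clip_def by (intro continuous_intros)
  moreover have "continuous_on UNIV (\<lambda>s. eint (gr m) (2^m) (\<lambda>k \<omega>. \<kappa> (eul A x m k \<omega>)) s \<omega>)"
    by (rule eint_continuous[OF assms gr_mono]) simp
  ultimately have "continuous_on UNIV (\<lambda>s. x + drift A x m s \<omega> + eint (gr m) (2^m) (\<lambda>k \<omega>. \<kappa> (eul A x m k \<omega>)) s \<omega>)"
    by (intro continuous_intros)
  then show ?thesis by (simp add: eulc_def algebra_simps)
qed

text \<open>The geometric series of ratio \<open>3/4\<close> sums to 4, which turns the factor 2
  into 8.\<close>

lemma geometric_tail_sum:
  fixes v :: "nat \<Rightarrow> 'b::real_normed_vector"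
  assumes "\<And>n. m \<le> n \<Longrightarrow> norm (v n - v (Suc n)) \<le> 2 * (3/4)^n"
  shows "m \<le> n \<Longrightarrow> norm (v n - v (n + N)) \<le> 8 * (3/4)^n"
proof -
  assume n: "m \<le> n"
  have "norm (v n - v (n + N)) = norm (\<Sum>i<N. v (n + i) - v (Suc (n + i)))"
    using sum_lessThan_telescope'[of "\<lambda>i. v (n + i)" N] by simp
  also have "\<dots> \<le> (\<Sum>i<N. norm (v (n + i) - v (Suc (n + i))))" by (rule norm_sum)
  also have "\<dots> \<le> (\<Sum>i<N. 2 * (3/4)^n * (3/4)^i)"
  proof (rule sum_mono)
    fix i show "norm (v (n + i) - v (Suc (n + i))) \<le> 2 * (3/4)^n * (3/4)^i"
      using assms[of "n + i"] n by (simp add: power_add mult.assoc)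
  qed
  also have "\<dots> = 2 * (3/4)^n * (\<Sum>i<N. (3/4)^i)" by (simp add: sum_distrib_left)
  also have "\<dots> \<le> 2 * (3/4)^n * 4"
  proof (intro mult_left_mono)
    have "(\<Sum>i<N. (3/4)^i) \<le> suminf (\<lambda>i. (3/4::real)^i)" by (intro sum_le_suminf summable_geometric) auto
    also have "\<dots> = 4" by (subst suminf_geometric) auto
    finally show "(\<Sum>i<N. (3/4::real)^i) \<le> 4" .
  qed auto
  finally show ?thesis by simp
qed

definition cadlag_adapted :: "(real \<Rightarrow> 'a \<Rightarrow> real^'d) \<Rightarrow> bool" where
  "cadlag_adapted X \<longleftrightarrow> (\<forall>s\<in>{0..T}. X s \<in> borel_measurable (F s)) \<and>
     (\<forall>\<omega>\<in>space M. (\<forall>s\<in>{0..<T}. continuous (at_right s) (\<lambda>r. X r \<omega>)) \<and>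
                  (\<forall>s\<in>{0<..T}. \<exists>l. ((\<lambda>r. X r \<omega>) \<longlongrightarrow> l) (at_left s)))"

text \<open>Borel-Cantelli by hand: \<open>B m\<close> collects the exceptional events from level
  \<open>m\<close> on together with the discontinuous paths of \<open>W\<close>. Off
  \<open>B m\<close> the schemes are uniformly Cauchy from level \<open>m\<close>, and the
  intersection \<open>N0\<close> of all \<open>B m\<close> is null.\<close>

lemma euler_limit:
  assumes "forcing A \<nu>"
  obtains Y C B where "cadlag_adapted Y" "0 \<le> C"
    "\<And>m. B m \<in> sets M" "\<And>m. prob (B m) \<le> C * (8/9)^m"
    "\<And>m \<omega> s. \<omega> \<in> space M - B m \<Longrightarrow> 0 \<le> s \<Longrightarrow> s \<le> T \<Longrightarrow> norm (eulc A x m s \<omega> - Y s \<omega>) \<le> 8 * (3/4)^m"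
    "\<And>s. 0 \<le> s \<Longrightarrow> s \<le> T \<Longrightarrow> L2 (Y s)"
    "\<And>m s. 0 \<le> s \<Longrightarrow> s \<le> T \<Longrightarrow> E2 (\<lambda>\<omega>. eulc A x m s \<omega> - Y s \<omega>) \<le> C / 2^m"
proof -
  obtain C0 where C0: "0 \<le> C0"
    "\<And>m s. 0 \<le> s \<Longrightarrow> s \<le> T \<Longrightarrow> E2 (\<lambda>\<omega>. eulc A x m s \<omega> - eulc A x (Suc m) s \<omega>) \<le> C0 / 2^m"
    "\<And>m. \<exists>B\<in>sets M. prob B \<le> C0 * (8/9)^m \<and>
        (\<forall>\<omega>\<in>space M - B. \<forall>s\<in>{0..T}. norm (eulc A x m s \<omega> - eulc A x (Suc m) s \<omega>) \<le> 2 * (3/4)^m)"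
    using euler_consecutive[OF assms, of x] by blast
  from C0(3) obtain B0 where B0: "\<And>m. B0 m \<in> sets M" "\<And>m. prob (B0 m) \<le> C0 * (8/9)^m"
    "\<And>m \<omega> s. \<omega> \<in> space M - B0 m \<Longrightarrow> s \<in> {0..T} \<Longrightarrow> norm (eulc A x m s \<omega> - eulc A x (Suc m) s \<omega>) \<le> 2 * (3/4)^m"
    by metis
  obtain N where N: "N \<in> null_sets M" "{\<omega>\<in>space M. \<not> continuous_on {0..} (\<lambda>s. W s \<omega>)} \<subseteq> N"
    using continuous_paths by (auto elim: AE_E simp: null_sets_def)
  define B where "B m = (\<Union>i. B0 (m + i)) \<union> N" for m
  have Bs: "B m \<in> sets M" for m unfolding B_def using B0(1) N by auto
  have Bdec: "B n \<subseteq> B m" if "m \<le> n" for m n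
  proof -
    have "B0 (n + i) \<subseteq> (\<Union>i. B0 (m + i))" for i
    proof -
      have "n + i = m + (n - m + i)" using that by simp
      then show ?thesis by (metis UN_upper UNIV_I)
    qed
    then show ?thesis by (auto simp: B_def)
  qed
  \<comment> \<open>One constant for two purposes: 12 is the factor of the L2 Cauchy bound, while
    the exceptional probabilities ask for 9, the sum of the powers of \<open>8/9\<close>.\<close>
  define C where "C = 12 * C0"
  have BP: "prob (B m) \<le> C * (8/9)^m" for m
  proof -
    have sm: "summable (\<lambda>i. C0 * (8/9)^m * (8/9::real)^i)" by (intro summable_mult summable_geometric) auto
    have le: "prob (B0 (m + i)) \<le> C0 * (8/9)^m * (8/9)^i" for i using B0(2)[of "m + i"] by (simp add: power_add mult.assoc)
    have sm': "summable (\<lambda>i. prob (B0 (m + i)))"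
      by (rule summable_comparison_test'[OF sm, of 0]) (use le in auto)
    have "prob (B m) = prob (\<Union>i. B0 (m + i))" unfolding B_def using N(1) B0(1) by (intro measure_Un_null_set) auto
    also have "\<dots> \<le> (\<Sum>i. prob (B0 (m + i)))" using B0(1) sm' by (intro finite_measure_subadditive_countably) auto
    also have "\<dots> \<le> (\<Sum>i. C0 * (8/9)^m * (8/9)^i)" by (rule suminf_le[OF le sm' sm])
    also have "\<dots> = C0 * (8/9)^m * 9"
      by (subst suminf_mult) (auto simp: suminf_geometric intro!: summable_geometric)
    also have "\<dots> \<le> C * (8/9)^m" using C0(1) by (simp add: C_def)
    finally show ?thesis .
  qed
  define N0 where "N0 = (\<Inter>m. B m)"
  have N0: "N0 \<in> null_sets M"
  proof -
    have s: "N0 \<in> sets M" unfolding N0_def using Bs by auto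
    have "prob N0 \<le> C * (8/9)^m" for m
      using BP[of m] finite_measure_mono[of N0 "B m"] Bs[of m] by (force simp: N0_def)
    moreover have "(\<lambda>m. C * (8/9::real)^m) \<longlonglongrightarrow> C * 0" by (intro tendsto_mult_left LIMSEQ_realpow_zero) auto
    ultimately have "prob N0 \<le> 0" by (intro LIMSEQ_le_const[of _ "0::real"]) auto
    then show ?thesis using s by (auto simp: null_sets_def emeasure_eq_measure measure_le_0_iff)
  qed
  \<comment> \<open>The value 0 on \<open>N0\<close> makes every path cadlag, as the notion of
    solution demands for all \<open>\<omega>\<close>. Adaptedness survives because
    \<open>F s\<close> contains the null sets.\<close>
  define Y where "Y s \<omega> = (if \<omega> \<in> N0 then 0 else lim (\<lambda>m. eulc A x m s \<omega>))" for s \<omega>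
  have tail: "norm (eulc A x n s \<omega> - eulc A x (n + k) s \<omega>) \<le> 8 * (3/4)^n"
    if "\<omega> \<in> space M - B m" "0 \<le> s" "s \<le> T" "m \<le> n" for m \<omega> s n k
  proof (rule geometric_tail_sum[of m "\<lambda>n. eulc A x n s \<omega>" n k])
    fix n assume "m \<le> n"
    then have "\<omega> \<in> space M - B n" using that(1) Bdec by blast
    then have "\<omega> \<in> space M - B0 n" using UN_upper[of 0 UNIV "\<lambda>i. B0 (n + i)"] by (auto simp: B_def)
    then show "norm (eulc A x n s \<omega> - eulc A x (Suc n) s \<omega>) \<le> 2 * (3/4)^n" using B0(3) that by auto
  qed fact
  have pow0: "(\<lambda>n. 8 * (3/4::real)^n) \<longlonglongrightarrow> 0"
    using tendsto_mult_left[OF LIMSEQ_realpow_zero[of "3/4::real"], of 8] by simp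
  have conv: "(\<lambda>n. eulc A x n s \<omega>) \<longlonglongrightarrow> Y s \<omega>" if \<omega>: "\<omega> \<in> space M - B m" and s: "0 \<le> s" "s \<le> T" for m \<omega> s
  proof -
    have "Cauchy (\<lambda>n. eulc A x n s \<omega>)"
    proof (rule CauchyI')
      fix e :: real assume "0 < e"
      then obtain n0 where n0: "\<And>n. n \<ge> n0 \<Longrightarrow> 8 * (3/4::real)^n < e"
        using order_tendstoD(2)[OF pow0, of e] by (auto simp: eventually_sequentially)
      show "\<exists>M. \<forall>n\<ge>M. \<forall>n'>n. dist (eulc A x n s \<omega>) (eulc A x n' s \<omega>) < e"
      proof (intro exI[of _ "max m n0"] allI impI)
        fix n n' assume n: "max m n0 \<le> n" "n < n'"
        then obtain k where k: "n' = n + k" using less_imp_add_positive by blast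
        show "dist (eulc A x n s \<omega>) (eulc A x n' s \<omega>) < e"
          using tail[OF \<omega> s, of n k] n0[of n] n unfolding k by (simp add: dist_norm)
      qed
    qed
    then have "convergent (\<lambda>n. eulc A x n s \<omega>)" by (rule Cauchy_convergent)
    moreover have "\<omega> \<notin> N0" using \<omega> by (auto simp: N0_def)
    ultimately show ?thesis by (simp add: Y_def convergent_LIMSEQ_iff)
  qed
  have unif: "norm (eulc A x n s \<omega> - Y s \<omega>) \<le> 8 * (3/4)^n" if \<omega>: "\<omega> \<in> space M - B m" and s: "0 \<le> s" "s \<le> T" and n: "m \<le> n" for m n \<omega> s
  proof (rule LIMSEQ_le_const2)
    show "(\<lambda>k. norm (eulc A x n s \<omega> - eulc A x (n + k) s \<omega>)) \<longlonglongrightarrow> norm (eulc A x n s \<omega> - Y s \<omega>)"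
      using conv[OF \<omega> s] by (intro tendsto_norm tendsto_diff tendsto_const LIMSEQ_ignore_initial_segment[of "\<lambda>k. eulc A x k s \<omega>" _ n, unfolded add.commute[of _ n]])
  qed (use tail[OF \<omega> s n] in auto)
  have adapt: "Y s \<in> borel_measurable (F s)" if s: "0 \<le> s" "s \<le> T" for s
    unfolding Y_def[abs_def]
    using eulc_measurable[OF assms s] sets.Int[OF null_in_F[OF N0, of s] sets.top[of "F s"]]
    by (intro measurable_If_set borel_measurable_lim_metric) auto
  have cad: "(\<forall>s\<in>{0..<T}. continuous (at_right s) (\<lambda>r. Y r \<omega>)) \<and> (\<forall>s\<in>{0<..T}. \<exists>l. ((\<lambda>r. Y r \<omega>) \<longlongrightarrow> l) (at_left s))"
    if \<omega>: "\<omega> \<in> space M" for \<omega>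
  proof (cases "\<omega> \<in> N0")
    case True
    then show ?thesis by (auto simp: Y_def)
  next
    case False
    then obtain m where m: "\<omega> \<in> space M - B m" using \<omega> by (auto simp: N0_def)
    have Wc: "continuous_on {0..} (\<lambda>s. W s \<omega>)" using m N(2) by (auto simp: B_def)
    \<comment> \<open>Without the forcing the schemes have continuous paths, so the uniform limit
      \<open>Z\<close> is continuous, and \<open>Y\<close> inherits one-sided limits from
      \<open>A\<close>.\<close>
    define Z where "Z s = Y s \<omega> - A s \<omega>" for s
    have Zc: "continuous_on {0..T} Z"
    proof (rule uniform_limit_theorem)
      show "\<forall>\<^sub>F n in sequentially. continuous_on {0..T} (\<lambda>s. eulc A x n s \<omega> - A s \<omega>)"
        using continuous_on_subset[OF eulc_minus_forcing_continuous[OF Wc]] by (intro always_eventually) auto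
      show "uniform_limit {0..T} (\<lambda>n s. eulc A x n s \<omega> - A s \<omega>) Z sequentially"
      proof (rule uniform_limitI)
        fix e :: real assume "0 < e"
        from order_tendstoD(2)[OF pow0 this] eventually_ge_at_top[of m]
        show "\<forall>\<^sub>F n in sequentially. \<forall>s\<in>{0..T}. dist (eulc A x n s \<omega> - A s \<omega>) (Z s) < e"
        proof eventually_elim
          case (elim n)
          have "norm (eulc A x n s \<omega> - Y s \<omega>) < e" if "s \<in> {0..T}" for s
            using unif[OF m _ _ elim(2), of s] elim(1) that by auto
          then show ?case by (simp add: Z_def dist_norm)
        qed
      qed
    qed auto
    have YZ: "Y s \<omega> = Z s + A s \<omega>" for s by (simp add: Z_def)
    show ?thesis
    proof (intro conjI ballI)
      fix s assume s: "s \<in> {0..<T}"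
      have "(Z \<longlongrightarrow> Z s) (at s within {0..T})" using Zc s by (auto simp: continuous_on_def)
      then have "(Z \<longlongrightarrow> Z s) (at s within {s..T})" by (rule tendsto_within_subset) (use s in auto)
      then have "(Z \<longlongrightarrow> Z s) (at_right s)" using s by (subst (asm) at_within_Icc_at_right) auto
      then show "continuous (at_right s) (\<lambda>r. Y r \<omega>)"
        using forcing_right_continuous[OF assms \<omega>, of s] s unfolding YZ continuous_within by (auto intro!: tendsto_add)
    next
      fix s assume s: "s \<in> {0<..T}"
      have "(Z \<longlongrightarrow> Z s) (at s within {0..T})" using Zc s by (auto simp: continuous_on_def)
      then have "(Z \<longlongrightarrow> Z s) (at s within {0..s})" by (rule tendsto_within_subset) (use s in auto)
      then have "(Z \<longlongrightarrow> Z s) (at_left s)" using s by (subst (asm) at_within_Icc_at_left) auto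
      moreover obtain l where "((\<lambda>r. A r \<omega>) \<longlongrightarrow> l) (at_left s)"
        using forcing_left_limit[OF assms \<omega>, of s] s by auto
      ultimately have "((\<lambda>r. Z r + A r \<omega>) \<longlongrightarrow> Z s + l) (at_left s)" by (rule tendsto_add)
      then show "\<exists>l. ((\<lambda>r. Y r \<omega>) \<longlongrightarrow> l) (at_left s)" unfolding YZ by blast
    qed
  qed
  have diffL: "L2 (\<lambda>\<omega>. eulc A x m s \<omega> - Y s \<omega>) \<and> E2 (\<lambda>\<omega>. eulc A x m s \<omega> - Y s \<omega>) \<le> C / 2^m" if s: "0 \<le> s" "s \<le> T" for m s
  proof -
    have L: "L2 (\<lambda>\<omega>. eulc A x m s \<omega> - eulc A x (m + k) s \<omega>)" for k using eulc_L2[OF assms s] by (intro L2_diff)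
    have E: "E2 (\<lambda>\<omega>. eulc A x m s \<omega> - eulc A x (m + k) s \<omega>) \<le> C / 2^m" for k
      unfolding C_def by (rule euler_L2_cauchy[OF assms C0(1) s C0(2)[OF s]])
    have ae: "AE \<omega> in M. (\<lambda>k. eulc A x m s \<omega> - eulc A x (m + k) s \<omega>) \<longlonglongrightarrow> eulc A x m s \<omega> - Y s \<omega>"
      using AE_not_in[OF N0] AE_space
    proof eventually_elim
      case (elim \<omega>)
      then obtain m' where "\<omega> \<in> space M - B m'" by (auto simp: N0_def)
      from conv[OF this s] show ?case
        by (intro tendsto_diff tendsto_const LIMSEQ_ignore_initial_segment[of "\<lambda>k. eulc A x k s \<omega>" _ m, unfolded add.commute[of _ m]])
    qed
    have m: "(\<lambda>\<omega>. eulc A x m s \<omega> - Y s \<omega>) \<in> borel_measurable M"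
      using measurable_F[OF adapt[OF s]] L2_measurable[OF eulc_L2[OF assms s]] by (intro borel_measurable_diff)
    show ?thesis using L2_fatou[OF L E ae m] by blast
  qed
  show thesis
  proof (rule that[of Y C B])
    show "cadlag_adapted Y" using adapt cad by (auto simp: cadlag_adapted_def)
    show "0 \<le> C" using C0 by (simp add: C_def)
    show "L2 (Y s)" if s: "0 \<le> s" "s \<le> T" for s
    proof -
      have "L2 (\<lambda>\<omega>. eulc A x 0 s \<omega> - (eulc A x 0 s \<omega> - Y s \<omega>))"
        by (rule L2_diff[OF eulc_L2[OF assms s] conjunct1[OF diffL[OF s]]])
      then show ?thesis by simp
    qed
  qed (use Bs BP unif[OF _ _ _ order_refl] diffL in auto)
qed

end

section \<open>Cadlag paths and convergence of left Riemann sums\<close>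

definition cadlag :: "real \<Rightarrow> (real \<Rightarrow> 'b::real_normed_vector) \<Rightarrow> bool" where
  "cadlag T g \<longleftrightarrow> (\<forall>s\<in>{0..<T}. continuous (at_right s) g) \<and> (\<forall>s\<in>{0<..T}. \<exists>l. (g \<longlongrightarrow> l) (at_left s))"

text \<open>The one-sided limits bound the path on a neighbourhood of each time, and compactness of
  \<open>{0..T}\<close> leaves finitely many neighbourhoods.\<close>

lemma cadlag_bounded:
  fixes g :: "real \<Rightarrow> 'b::real_normed_vector"
  assumes "cadlag T g"
  obtains C where "0 \<le> C" "\<And>r. 0 \<le> r \<Longrightarrow> r \<le> T \<Longrightarrow> norm (g r) \<le> C"
proof -
  have "\<exists>U C. open U \<and> s \<in> U \<and> (\<forall>r\<in>U \<inter> {0..T}. norm (g r) \<le> C)" if s: "s \<in> {0..T}" for s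
  proof -
    have R: "\<exists>b C. s < b \<and> (\<forall>r. s < r \<longrightarrow> r < b \<longrightarrow> r \<le> T \<longrightarrow> norm (g r) \<le> C)"
    proof (cases "s < T")
      case True
      then have "(g \<longlongrightarrow> g s) (at_right s)" using assms s by (auto simp: cadlag_def continuous_within)
      then have "eventually (\<lambda>r. norm (g r) < norm (g s) + 1) (at_right s)"
        by (intro order_tendstoD(2)[OF tendsto_norm]) auto
      then obtain b where "s < b" "\<And>y. s < y \<Longrightarrow> y < b \<Longrightarrow> norm (g y) < norm (g s) + 1"
        using True by (auto simp: eventually_at_right[OF True])
      then show ?thesis by (metis less_imp_le)
    next
      case False
      then show ?thesis by (intro exI[of _ "s + 1"]) auto
    qed
    have L: "\<exists>b C. b < s \<and> (\<forall>r. b < r \<longrightarrow> r < s \<longrightarrow> 0 \<le> r \<longrightarrow> norm (g r) \<le> C)"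
    proof (cases "0 < s")
      case True
      then have "s \<in> {0<..T}" using s by simp
      then obtain l where "(g \<longlongrightarrow> l) (at_left s)" using assms unfolding cadlag_def by blast
      then have "eventually (\<lambda>r. norm (g r) < norm l + 1) (at_left s)"
        by (intro order_tendstoD(2)[OF tendsto_norm]) auto
      then obtain b where "b < s" "\<And>y. b < y \<Longrightarrow> y < s \<Longrightarrow> norm (g y) < norm l + 1"
        using True by (auto simp: eventually_at_left[OF True])
      then show ?thesis by (metis less_imp_le)
    next
      case False
      then show ?thesis by (intro exI[of _ "s - 1"]) auto
    qed
    obtain b C b' C' where b: "s < b" "\<And>r. s < r \<Longrightarrow> r < b \<Longrightarrow> r \<le> T \<Longrightarrow> norm (g r) \<le> C"
      and b': "b' < s" "\<And>r. b' < r \<Longrightarrow> r < s \<Longrightarrow> 0 \<le> r \<Longrightarrow> norm (g r) \<le> C'" using R L by blast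
    have "norm (g r) \<le> max (max C C') (norm (g s))" if "r \<in> {b'<..<b} \<inter> {0..T}" for r
      using b(2)[of r] b'(2)[of r] that by (cases r s rule: linorder_cases) auto
    then show ?thesis using b b' by (intro exI[of _ "{b'<..<b}"] exI[of _ "max (max C C') (norm (g s))"]) auto
  qed
  then obtain U C where U: "\<And>s. s \<in> {0..T} \<Longrightarrow> open (U s) \<and> s \<in> U s \<and> (\<forall>r\<in>U s \<inter> {0..T}. norm (g r) \<le> C s)"
    by metis
  obtain S where S: "S \<subseteq> {0..T}" "finite S" "{0..T} \<subseteq> (\<Union>s\<in>S. U s)"
    using compactE_image[of "{0..T}" "{0..T}" U] U by (metis UN_I compact_Icc subsetI)
  show thesis
  proof (rule that[of "\<Sum>s\<in>S. \<bar>C s\<bar>"])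
    fix r assume "0 \<le> r" "r \<le> T"
    then obtain s where s: "s \<in> S" "r \<in> U s" using S by force
    then have "norm (g r) \<le> C s" using U[of s] S \<open>0 \<le> r\<close> \<open>r \<le> T\<close> by auto
    also have "\<dots> \<le> \<bar>C s\<bar>" by simp
    also have "\<dots> \<le> (\<Sum>s\<in>S. \<bar>C s\<bar>)" using s S by (intro member_le_sum) auto
    finally show "norm (g r) \<le> (\<Sum>s\<in>S. \<bar>C s\<bar>)" .
  qed (auto intro: sum_nonneg)
qed

lemma right_continuous_sequentially:
  fixes g :: "real \<Rightarrow> 'b::real_normed_vector"
  assumes "continuous (at_right r) g" "\<And>m. r < y m" "y \<longlonglongrightarrow> r"
  shows "(\<lambda>m. g (y m)) \<longlonglongrightarrow> g r"
proof -
  have "(g \<longlongrightarrow> g r) (at_right r)" using assms(1) by (simp add: continuous_within)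
  moreover have "filterlim y (at_right r) sequentially"
    using assms by (auto simp: filterlim_at intro!: always_eventually)
  ultimately show ?thesis by (rule filterlim_compose)
qed

text \<open>Right-continuity gives convergence of the right-endpoint sums by dominated convergence; the
  left-endpoint sums differ from them only by the mesh times the total increment.\<close>
lemma left_riemann_sums:
  fixes g :: "real \<Rightarrow> 'b::euclidean_space"
  assumes s: "0 \<le> s" and rc: "\<And>r. 0 \<le> r \<Longrightarrow> r < s \<Longrightarrow> continuous (at_right r) g"
    and bd: "\<And>r. 0 \<le> r \<Longrightarrow> r \<le> s \<Longrightarrow> norm (g r) \<le> C"
  shows "set_integrable lborel {0..s} g"
    and "(\<lambda>m. \<Sum>k<2^m. (s / 2^m) *\<^sub>R g (s * real k / 2^m)) \<longlonglongrightarrow> integral {0..s} g"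
proof -
  define u where "u m k = s * real k / 2^m" for m k :: nat
  have u_mono: "mono (u m)" for m using s by (auto simp: u_def intro!: monoI divide_right_mono mult_left_mono)
  have u_bd: "0 \<le> u m k" "k \<le> 2^m \<Longrightarrow> u m k \<le> s" for m k
    using s monoD[OF u_mono[of m], of k "2^m"] by (auto simp: u_def)
  have u_step: "u m (Suc k) - u m k = s / 2^m" for m k by (simp add: u_def field_simps)
  define f where "f m r = (\<Sum>k<2^m. indicator {u m k..<u m (Suc k)} r *\<^sub>R g (u m (Suc k)))" for m r
  have f_cell: "\<exists>y. f m r = g y \<and> r < y \<and> y \<le> r + s / 2^m \<and> 0 \<le> y \<and> y \<le> s" if r: "0 \<le> r" "r < s" for m r
  proof -
    define k where "k = nat \<lfloor>r * 2^m / s\<rfloor>"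
    have s0: "0 < s" using r by simp
    have "0 \<le> \<lfloor>r * 2^m / s\<rfloor>" using r s0 by simp
    then have rk: "real k = real_of_int \<lfloor>r * 2^m / s\<rfloor>" by (simp add: k_def)
    have 1: "real k \<le> r * 2^m / s" "r * 2^m / s < real k + 1" unfolding rk by linarith+
    have 2: "u m k \<le> r" "r < u m (Suc k)"
      using 1 s0 by (auto simp: u_def pos_divide_le_eq pos_less_divide_eq pos_le_divide_eq pos_divide_less_eq algebra_simps)
    have "r * 2^m / s < 2^m" using r s0 by (simp add: pos_divide_less_eq)
    then have "real k < 2^m" using 1 by linarith
    then have k: "k < 2^m" by (metis of_nat_less_iff of_nat_numeral of_nat_power)
    have uniq: "indicator {u m j..<u m (Suc j)} r = (if j = k then 1 else 0::real)" for j
    proof (cases j k rule: linorder_cases)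
      case less
      then have "u m (Suc j) \<le> u m k" using monoD[OF u_mono] by auto
      then show ?thesis using less 2 by auto
    next
      case greater
      then have "u m (Suc k) \<le> u m j" using monoD[OF u_mono] by auto
      then show ?thesis using greater 2 by auto
    qed (use 2 in auto)
    have "f m r = (\<Sum>j<2^m. if j = k then g (u m (Suc k)) else 0)"
      unfolding f_def uniq by (intro sum.cong) auto
    also have "\<dots> = g (u m (Suc k))" using k by simp
    finally show ?thesis using 2 u_step[of m k] u_bd[of m "Suc k"] u_bd(2)[of "Suc k" m] k
      by (intro exI[of _ "u m (Suc k)"]) auto
  qed
  have f_out: "f m r = 0" if "\<not> (0 \<le> r \<and> r < s)" for m r
    unfolding f_def
  proof (intro sum.neutral ballI)
    fix k :: nat assume "k \<in> {..<2^m}"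
    then have "0 \<le> u m k" "u m (Suc k) \<le> s" using u_bd[of m k] u_bd(2)[of "Suc k" m] by auto
    then show "indicator {u m k..<u m (Suc k)} r *\<^sub>R g (u m (Suc k)) = 0" using that by (auto split: split_indicator)
  qed
  have f_meas [measurable]: "f m \<in> borel_measurable borel" for m unfolding f_def[abs_def] by measurable
  have lim: "(\<lambda>m. f m r) \<longlonglongrightarrow> indicator {0..<s} r *\<^sub>R g r" for r
  proof (cases "0 \<le> r \<and> r < s")
    case True
    then obtain y where y: "\<And>m. f m r = g (y m) \<and> r < y m \<and> y m \<le> r + s / 2^m \<and> 0 \<le> y m \<and> y m \<le> s"
      using f_cell[of r] by metis
    have p: "(\<lambda>m. r + s / 2 ^ m :: real) \<longlonglongrightarrow> r + 0"
      using LIMSEQ_realpow_zero[of "1/2::real", THEN tendsto_mult_left, of s] by (intro tendsto_intros) (simp add: power_divide)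
    have "y \<longlonglongrightarrow> r"
      by (rule tendsto_sandwich[OF _ _ tendsto_const p[simplified]]) (use y in \<open>auto intro!: always_eventually less_imp_le\<close>)
    then show ?thesis using right_continuous_sequentially[OF rc, of r y] y True by simp
  qed (use f_out in \<open>auto simp: not_less not_le\<close>)
  have lim_meas [measurable]: "(\<lambda>r. indicator {0..<s} r *\<^sub>R g r) \<in> borel_measurable borel"
    by (rule borel_measurable_LIMSEQ_metric[OF _ lim]) auto
  have C0: "0 \<le> C" using bd[of 0] s norm_ge_zero[of "g 0"] by (meson order_refl order_trans)
  have f_bd: "norm (f m r) \<le> indicator {0..<s} r *\<^sub>R C" for m r
  proof (cases "0 \<le> r \<and> r < s")
    case True
    then obtain y where "f m r = g y" "0 \<le> y" "y \<le> s" using f_cell[of r m] by auto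
    then show ?thesis using bd[of y] True by auto
  qed (use f_out C0 in auto)
  have dom: "integrable lborel (\<lambda>r. indicator {0..<s} r *\<^sub>R C)" using s by simp
  have DCT: "integrable lborel (\<lambda>r. indicator {0..<s} r *\<^sub>R g r)"
     "(\<lambda>m. integral\<^sup>L lborel (f m)) \<longlonglongrightarrow> integral\<^sup>L lborel (\<lambda>r. indicator {0..<s} r *\<^sub>R g r)"
    using integrable_dominated_convergence[of "\<lambda>r. indicator {0..<s} r *\<^sub>R g r" lborel f "\<lambda>r. indicator {0..<s} r *\<^sub>R C"]
      integral_dominated_convergence[of "\<lambda>r. indicator {0..<s} r *\<^sub>R g r" lborel f "\<lambda>r. indicator {0..<s} r *\<^sub>R C"]
      lim f_bd dom lim_meas f_meas by auto
  have intf: "integral\<^sup>L lborel (f m) = (\<Sum>k<2^m. (s / 2^m) *\<^sub>R g (u m (Suc k)))" for m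
  proof -
    have "integrable lborel (\<lambda>r. indicator {u m k..<u m (Suc k)} r *\<^sub>R g (u m (Suc k)))" for k
      by (intro integrable_scaleR_left integrable_real_indicator) (auto simp: emeasure_lborel_Ico monoD[OF u_mono])
    then have "integral\<^sup>L lborel (f m) = (\<Sum>k<2^m. integral\<^sup>L lborel (\<lambda>r. indicator {u m k..<u m (Suc k)} r *\<^sub>R g (u m (Suc k))))"
      unfolding f_def[abs_def] by (intro Bochner_Integration.integral_sum) auto
    also have "\<dots> = (\<Sum>k<2^m. (s / 2^m) *\<^sub>R g (u m (Suc k)))"
      by (intro sum.cong refl) (simp add: monoD[OF u_mono] u_step)
    finally show ?thesis .
  qed
  have ae: "AE r in lborel. indicator {0..s} r *\<^sub>R g r = indicator {0..<s} r *\<^sub>R g r"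
    using AE_lborel_singleton[of s] by eventually_elim (auto split: split_indicator)
  have "(\<lambda>r. indicator {0..s} r *\<^sub>R g r) = (\<lambda>r. indicator {0..<s} r *\<^sub>R g r + indicator {s} r *\<^sub>R g s)"
    using s by (auto split: split_indicator)
  then have m2 [measurable]: "(\<lambda>r. indicator {0..s} r *\<^sub>R g r) \<in> borel_measurable borel" by simp
  show si: "set_integrable lborel {0..s} g"
    unfolding set_integrable_def using DCT(1) integrable_cong_AE[OF _ _ ae] by auto
  have "integral {0..s} g = integral\<^sup>L lborel (\<lambda>r. indicator {0..s} r *\<^sub>R g r)"
    using set_borel_integral_eq_integral(2)[OF si] by (simp add: set_lebesgue_integral_def)
  also have "\<dots> = integral\<^sup>L lborel (\<lambda>r. indicator {0..<s} r *\<^sub>R g r)"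
    by (rule integral_cong_AE[OF _ _ ae]) auto
  finally have eqI: "integral\<^sup>L lborel (\<lambda>r. indicator {0..<s} r *\<^sub>R g r) = integral {0..s} g" ..
  have shift: "(\<Sum>k<2^m. (s / 2^m) *\<^sub>R g (u m k)) = integral\<^sup>L lborel (f m) - (s / 2^m) *\<^sub>R (g s - g 0)" for m
  proof -
    have "(\<Sum>k<2^m. (s / 2^m) *\<^sub>R g (u m (Suc k))) - (\<Sum>k<2^m. (s / 2^m) *\<^sub>R g (u m k)) = (s / 2^m) *\<^sub>R (g (u m (2^m)) - g (u m 0))"
      unfolding sum_subtractf[symmetric] scaleR_right_diff_distrib[symmetric] scaleR_sum_right[symmetric]
      using sum_lessThan_telescope[of "\<lambda>k. g (u m k)" "2^m"] by simp
    moreover have "u m (2^m) = s" "u m 0 = 0" by (auto simp: u_def)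
    ultimately show ?thesis by (simp add: intf algebra_simps)
  qed
  have "(\<lambda>m. (s / 2^m) *\<^sub>R (g s - g 0)) \<longlonglongrightarrow> 0 *\<^sub>R (g s - g 0)"
    using LIMSEQ_realpow_zero[of "1/2::real", THEN tendsto_mult_left, of s] by (intro tendsto_intros) (simp add: power_divide)
  from tendsto_diff[OF DCT(2) this]
  show "(\<lambda>m. \<Sum>k<2^m. (s / 2^m) *\<^sub>R g (s * real k / 2^m)) \<longlonglongrightarrow> integral {0..s} g"
    unfolding shift[unfolded u_def] by (simp add: eqI)
qed

section \<open>Convergence in probability\<close>

context bm_space
begin

text \<open>Convergence in probability to zero, expressed by the truncated mean. In this form sums
  follow from subadditivity of the truncation, and almost surely convergent subsequences from
  convergence in L1.\<close>

definition conv0 :: "(nat \<Rightarrow> 'a \<Rightarrow> 'b::euclidean_space) \<Rightarrow> bool" where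
  "conv0 Z \<longleftrightarrow> (\<forall>n. Z n \<in> borel_measurable M) \<and> (\<lambda>n. \<integral>\<omega>. min 1 (norm (Z n \<omega>)) \<partial>M) \<longlonglongrightarrow> 0"

lemma integrable_min1: "f \<in> borel_measurable M \<Longrightarrow> integrable M (\<lambda>\<omega>. min 1 (norm (f \<omega> :: 'b::euclidean_space)))"
  by (rule integrable_const_bound[of _ 1]) auto

lemma conv0_add:
  assumes "conv0 Z" "conv0 Z'" shows "conv0 (\<lambda>n \<omega>. Z n \<omega> + Z' n \<omega>)"
  unfolding conv0_def
proof
  have m: "Z n \<in> borel_measurable M" "Z' n \<in> borel_measurable M" for n using assms by (auto simp: conv0_def)
  then show mm: "\<forall>n. (\<lambda>\<omega>. Z n \<omega> + Z' n \<omega>) \<in> borel_measurable M" by auto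
  show "(\<lambda>n. \<integral>\<omega>. min 1 (norm (Z n \<omega> + Z' n \<omega>)) \<partial>M) \<longlonglongrightarrow> 0"
  proof (rule tendsto_sandwich[OF _ _ tendsto_const])
    show "(\<lambda>n. (\<integral>\<omega>. min 1 (norm (Z n \<omega>)) \<partial>M) + (\<integral>\<omega>. min 1 (norm (Z' n \<omega>)) \<partial>M)) \<longlonglongrightarrow> 0"
      using tendsto_add[of _ 0 _ _ 0] assms by (auto simp: conv0_def)
    show "\<forall>\<^sub>F n in sequentially. (\<integral>\<omega>. min 1 (norm (Z n \<omega> + Z' n \<omega>)) \<partial>M) \<le> (\<integral>\<omega>. min 1 (norm (Z n \<omega>)) \<partial>M) + (\<integral>\<omega>. min 1 (norm (Z' n \<omega>)) \<partial>M)"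
    proof (intro always_eventually allI)
      fix n
      have "min 1 (norm (Z n \<omega> + Z' n \<omega>)) \<le> min 1 (norm (Z n \<omega>)) + min 1 (norm (Z' n \<omega>))" for \<omega>
        by (smt (verit) min_def norm_ge_zero norm_triangle_ineq)
      then show "(\<integral>\<omega>. min 1 (norm (Z n \<omega> + Z' n \<omega>)) \<partial>M) \<le> (\<integral>\<omega>. min 1 (norm (Z n \<omega>)) \<partial>M) + (\<integral>\<omega>. min 1 (norm (Z' n \<omega>)) \<partial>M)"
        using integrable_min1 m mm by (subst Bochner_Integration.integral_add[symmetric]) (auto intro!: integral_mono Bochner_Integration.integrable_add)
    qed
  qed (auto intro!: always_eventually)
qed

lemma conv0_uminus: "conv0 Z \<Longrightarrow> conv0 (\<lambda>n \<omega>. - Z n \<omega>)"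
  by (auto simp: conv0_def)

lemma conv0_AE:
  assumes "\<And>n. Z n \<in> borel_measurable M" "AE \<omega> in M. (\<lambda>n. Z n \<omega>) \<longlonglongrightarrow> 0"
  shows "conv0 Z"
proof -
  have [measurable]: "Z n \<in> borel_measurable M" for n by fact
  have "(\<lambda>n. \<integral>\<omega>. min 1 (norm (Z n \<omega>)) \<partial>M) \<longlonglongrightarrow> (\<integral>\<omega>. 0 \<partial>M)"
  proof (rule integral_dominated_convergence[where w="\<lambda>_. 1"])
    show "AE \<omega> in M. (\<lambda>n. min 1 (norm (Z n \<omega>))) \<longlonglongrightarrow> 0"
      using assms(2)
    proof eventually_elim
      case (elim \<omega>)
      then have "(\<lambda>n. min 1 (norm (Z n \<omega>))) \<longlonglongrightarrow> min 1 (norm (0::'b))" by (intro tendsto_intros)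
      then show ?case by simp
    qed
  qed auto
  then show ?thesis by (simp add: conv0_def)
qed

lemma conv0_L2:
  assumes "\<And>n. L2 (Z n)" "(\<lambda>n. E2 (Z n)) \<longlonglongrightarrow> 0" shows "conv0 Z"
proof -
  have [measurable]: "Z n \<in> borel_measurable M" for n using assms by (simp add: L2_def)
  have bd: "(\<integral>\<omega>. min 1 (norm (Z n \<omega>)) \<partial>M) \<le> e + E2 (Z n) / e" if "0 < e" for n e
  proof -
    have "min 1 (norm (Z n \<omega>)) \<le> e + (norm (Z n \<omega>))\<^sup>2 / e" for \<omega>
    proof (cases "norm (Z n \<omega>) \<le> e")
      case True then show ?thesis using that by (simp add: min.coboundedI2 add_increasing2)
    next
      case False
      then have "norm (Z n \<omega>) * e \<le> (norm (Z n \<omega>))\<^sup>2" unfolding power2_eq_square by (intro mult_left_mono) auto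
      then have "norm (Z n \<omega>) \<le> (norm (Z n \<omega>))\<^sup>2 / e" using that by (simp add: pos_le_divide_eq)
      then show ?thesis using that by linarith
    qed
    then have "(\<integral>\<omega>. min 1 (norm (Z n \<omega>)) \<partial>M) \<le> (\<integral>\<omega>. e + (norm (Z n \<omega>))\<^sup>2 / e \<partial>M)"
      using L2_integrable[OF assms(1)] by (intro integral_mono integrable_min1) auto
    also have "\<dots> = e + E2 (Z n) / e"
      using L2_integrable[OF assms(1)] by (simp add: E2_def prob_space)
    finally show ?thesis .
  qed
  have "(\<lambda>n. \<integral>\<omega>. min 1 (norm (Z n \<omega>)) \<partial>M) \<longlonglongrightarrow> 0"
  proof (rule LIMSEQ_I)
    fix e :: real assume e: "0 < e"
    have "eventually (\<lambda>n. E2 (Z n) < e * e / 9) sequentially"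
      using e by (intro order_tendstoD(2)[OF assms(2)]) auto
    then obtain N where N: "\<And>n. n \<ge> N \<Longrightarrow> E2 (Z n) < e * e / 9" by (auto simp: eventually_sequentially)
    show "\<exists>N. \<forall>n\<ge>N. norm ((\<integral>\<omega>. min 1 (norm (Z n \<omega>)) \<partial>M) - 0) < e"
    proof (intro exI[of _ N] allI impI)
      fix n assume "N \<le> n"
      then have "E2 (Z n) / (e/3) < e * e / 9 / (e / 3)" using N[of n] e by (intro divide_strict_right_mono) auto
      then have "E2 (Z n) / (e/3) < e / 3" using e by simp
      moreover have "0 \<le> (\<integral>\<omega>. min 1 (norm (Z n \<omega>)) \<partial>M)" by (rule Bochner_Integration.integral_nonneg) simp
      ultimately show "norm ((\<integral>\<omega>. min 1 (norm (Z n \<omega>)) \<partial>M) - 0) < e"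
        using bd[of "e/3" n] e by simp
    qed
  qed
  then show ?thesis by (simp add: conv0_def)
qed

lemma conv0_imp_prob:
  assumes "conv0 Z" "0 < \<epsilon>"
  shows "(\<lambda>n. prob {\<omega>\<in>space M. norm (Z n \<omega>) > \<epsilon>}) \<longlonglongrightarrow> 0"
proof -
  have [measurable]: "Z n \<in> borel_measurable M" for n using assms by (simp add: conv0_def)
  define e where "e = min 1 \<epsilon>"
  have e: "0 < e" using assms by (simp add: e_def)
  have le: "prob {\<omega>\<in>space M. norm (Z n \<omega>) > \<epsilon>} \<le> (\<integral>\<omega>. min 1 (norm (Z n \<omega>)) \<partial>M) / e" for n
  proof -
    have "prob {\<omega>\<in>space M. norm (Z n \<omega>) > \<epsilon>} \<le> prob {\<omega>\<in>space M. e \<le> min 1 (norm (Z n \<omega>))}"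
      by (intro finite_measure_mono) (auto simp: e_def)
    also have "\<dots> \<le> (\<integral>\<omega>. min 1 (norm (Z n \<omega>)) \<partial>M) / e"
      using e by (intro integral_Markov_inequality_measure[where A="space M"] integrable_min1) auto
    finally show ?thesis .
  qed
  have lim: "(\<lambda>n. (\<integral>\<omega>. min 1 (norm (Z n \<omega>)) \<partial>M) / e) \<longlonglongrightarrow> 0 / e"
    using assms e by (intro tendsto_divide) (auto simp: conv0_def)
  show ?thesis
  proof (rule tendsto_sandwich[OF _ _ tendsto_const])
    show "(\<lambda>n. (\<integral>\<omega>. min 1 (norm (Z n \<omega>)) \<partial>M) / e) \<longlonglongrightarrow> 0" using lim by simp
    show "\<forall>\<^sub>F n in sequentially. prob {\<omega>\<in>space M. norm (Z n \<omega>) > \<epsilon>} \<le> (\<integral>\<omega>. min 1 (norm (Z n \<omega>)) \<partial>M) / e"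
      by (intro always_eventually allI le)
  qed simp
qed

lemma prob_imp_conv0:
  assumes "\<And>n. Z n \<in> borel_measurable M" "\<And>\<epsilon>. 0 < \<epsilon> \<Longrightarrow> (\<lambda>n. prob {\<omega>\<in>space M. norm (Z n \<omega>) > \<epsilon>}) \<longlonglongrightarrow> 0"
  shows "conv0 Z"
proof -
  have [measurable]: "Z n \<in> borel_measurable M" for n by fact
  have bd: "(\<integral>\<omega>. min 1 (norm (Z n \<omega>)) \<partial>M) \<le> e + prob {\<omega>\<in>space M. norm (Z n \<omega>) > e}" if "0 < e" for n e
  proof -
    have "(\<integral>\<omega>. min 1 (norm (Z n \<omega>)) \<partial>M) \<le> (\<integral>\<omega>. e + indicator {\<omega>\<in>space M. norm (Z n \<omega>) > e} \<omega> \<partial>M)"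
      using that by (intro integral_mono integrable_min1) (auto split: split_indicator simp: min_def emeasure_eq_measure)
    also have "\<dots> = e + prob {\<omega>\<in>space M. norm (Z n \<omega>) > e}"
      by (subst Bochner_Integration.integral_add) (auto simp: prob_space emeasure_eq_measure)
    finally show ?thesis .
  qed
  have "(\<lambda>n. \<integral>\<omega>. min 1 (norm (Z n \<omega>)) \<partial>M) \<longlonglongrightarrow> 0"
  proof (rule LIMSEQ_I)
    fix e :: real assume e: "0 < e"
    have "eventually (\<lambda>n. prob {\<omega>\<in>space M. norm (Z n \<omega>) > e/2} < e/2) sequentially"
      using e by (intro order_tendstoD(2)[OF assms(2)]) auto
    then obtain N where N: "\<And>n. n \<ge> N \<Longrightarrow> prob {\<omega>\<in>space M. norm (Z n \<omega>) > e/2} < e/2" by (auto simp: eventually_sequentially)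
    show "\<exists>N. \<forall>n\<ge>N. norm ((\<integral>\<omega>. min 1 (norm (Z n \<omega>)) \<partial>M) - 0) < e"
    proof (intro exI[of _ N] allI impI)
      fix n assume "N \<le> n"
      moreover have "0 \<le> (\<integral>\<omega>. min 1 (norm (Z n \<omega>)) \<partial>M)" by (rule Bochner_Integration.integral_nonneg) simp
      ultimately show "norm ((\<integral>\<omega>. min 1 (norm (Z n \<omega>)) \<partial>M) - 0) < e"
        using bd[of "e/2" n] e N[of n] by simp
    qed
  qed
  then show ?thesis by (simp add: conv0_def)
qed

lemma conv0_AE_subseq:
  assumes "conv0 Z"
  obtains r where "strict_mono r" "AE \<omega> in M. (\<lambda>n. Z (r n) \<omega>) \<longlonglongrightarrow> 0"
proof -
  have m: "Z n \<in> borel_measurable M" for n using assms by (simp add: conv0_def)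
  define u where "u n \<omega> = min 1 (norm (Z n \<omega>))" for n \<omega>
  have "(\<lambda>n. \<integral>\<omega>. norm (u n \<omega>) \<partial>M) \<longlonglongrightarrow> 0" using assms by (simp add: conv0_def u_def)
  moreover have "integrable M (u n)" for n unfolding u_def[abs_def] by (rule integrable_min1[OF m])
  ultimately obtain r where r: "strict_mono r" "AE \<omega> in M. (\<lambda>n. u (r n) \<omega>) \<longlonglongrightarrow> 0"
    using tendsto_L1_AE_subseq[of M u] by blast
  have "AE \<omega> in M. (\<lambda>n. Z (r n) \<omega>) \<longlonglongrightarrow> 0"
    using r(2)
  proof eventually_elim
    case (elim \<omega>)
    have "eventually (\<lambda>n. u (r n) \<omega> < 1) sequentially" by (rule order_tendstoD(2)[OF elim]) simp
    then have "eventually (\<lambda>n. norm (Z (r n) \<omega>) = u (r n) \<omega>) sequentially"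
      by eventually_elim (auto simp: u_def min_def split: if_splits)
    then have "(\<lambda>n. norm (Z (r n) \<omega>)) \<longlonglongrightarrow> 0" using elim tendsto_cong by fastforce
    then show ?case by (simp add: tendsto_norm_zero_iff)
  qed
  then show thesis using that r(1) by blast
qed

end

section \<open>Existence, uniqueness and stability of strong solutions\<close>

context sde
begin

text \<open>The given notion of solution with the Stieltjes integral of the control replaced by an
  arbitrary process \<open>A\<close>, so that the equation can be analysed without reference to
  controls.\<close>

definition solves :: "(real \<Rightarrow> 'a \<Rightarrow> real^'d) \<Rightarrow> real^'d \<Rightarrow> (real \<Rightarrow> 'a \<Rightarrow> real^'d) \<Rightarrow> bool" where
  "solves A x X \<longleftrightarrow> cadlag_adapted X \<and>
     (\<forall>s\<in>{0..T}. \<exists>I. I \<in> borel_measurable M \<and>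
        (\<forall>\<epsilon>>0. ((\<lambda>m. measure M {\<omega>\<in>space M. norm (ito_sum W \<kappa> X s m \<omega> - I \<omega>) > \<epsilon>}) \<longlongrightarrow> 0) sequentially) \<and>
        (AE \<omega> in M. X s \<omega> = x + integral {0..s} (\<lambda>r. b (X r \<omega>)) + I \<omega> + A s \<omega>))"

lemma cadlag_adaptedD:
  assumes "cadlag_adapted X"
  shows "0 \<le> s \<Longrightarrow> s \<le> T \<Longrightarrow> X s \<in> borel_measurable (F s)" "\<omega> \<in> space M \<Longrightarrow> cadlag T (\<lambda>r. X r \<omega>)"
  using assms by (auto simp: cadlag_adapted_def cadlag_def)

lemma cadlag_adapted_measurable:
  assumes "cadlag_adapted X" "0 \<le> s" "s \<le> T" shows "X s \<in> borel_measurable M"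
  using cadlag_adaptedD(1)[OF assms] measurable_F by blast

lemma drift_riemann:
  assumes "cadlag_adapted X" "0 \<le> s" "s \<le> T" "\<omega> \<in> space M"
  shows "(\<lambda>m. \<Sum>k<2^m. (s / 2^m) *\<^sub>R b (X (s * real k / 2^m) \<omega>)) \<longlonglongrightarrow> integral {0..s} (\<lambda>r. b (X r \<omega>))"
proof -
  note cad = cadlag_adaptedD(2)[OF assms(1,4)]
  obtain C where C: "0 \<le> C" "\<And>r. 0 \<le> r \<Longrightarrow> r \<le> T \<Longrightarrow> norm (X r \<omega>) \<le> C" using cadlag_bounded[OF cad] by blast
  show ?thesis
  proof (rule left_riemann_sums(2)[OF assms(2)])
    fix r assume "0 \<le> r" "r < s"
    then have "continuous (at_right r) (\<lambda>r. X r \<omega>)" using cad assms by (auto simp: cadlag_def)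
    moreover have "isCont b (X r \<omega>)" using lipschitz_continuous[OF b_lip] by (simp add: continuous_on_eq_continuous_at)
    ultimately show "continuous (at_right r) (\<lambda>r. b (X r \<omega>))"
      by (rule continuous_within_compose3[rotated])
  next
    fix r assume "0 \<le> r" "r \<le> s"
    then have "L * norm (X r \<omega>) \<le> L * C" using C(2)[of r] assms L_nonneg by (intro mult_left_mono) auto
    then show "norm (b (X r \<omega>)) \<le> c0 + L * C" using b_growth[of "X r \<omega>"] by linarith
  qed
qed

lemma grid_le: assumes "0 \<le> s" "k \<le> 2^m" shows "0 \<le> s * real k / 2^m" "s * real k / 2^m \<le> s"
proof -
  have "real k \<le> 2^m" using assms(2) by (metis of_nat_le_iff of_nat_numeral of_nat_power)
  then show "s * real k / 2^m \<le> s" using assms(1) by (simp add: pos_divide_le_eq mult_left_mono)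
qed (use assms in auto)

lemma grid_mono: "0 \<le> s \<Longrightarrow> mono (\<lambda>k. s * real k / 2^m)"
  by (auto intro!: monoI divide_right_mono mult_left_mono)

lemma drift_sum_measurable:
  assumes "cadlag_adapted X" "0 \<le> s" "s \<le> T"
  shows "(\<lambda>\<omega>. \<Sum>k<2^m. (s / 2^m) *\<^sub>R b (X (s * real k / 2^m) \<omega>)) \<in> borel_measurable M"
proof (intro borel_measurable_sum borel_measurable_scaleR borel_measurable_const)
  fix k :: nat assume "k \<in> {..<2^m}"
  then have [measurable]: "X (s * real k / 2^m) \<in> borel_measurable M"
    using cadlag_adapted_measurable[OF assms(1)] grid_le[OF assms(2), of k m] assms(3) by auto
  show "(\<lambda>\<omega>. b (X (s * real k / 2^m) \<omega>)) \<in> borel_measurable M" by measurable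
qed

lemma drift_integral_measurable:
  assumes "cadlag_adapted X" "0 \<le> s" "s \<le> T"
  shows "(\<lambda>\<omega>. integral {0..s} (\<lambda>r. b (X r \<omega>))) \<in> borel_measurable M"
  by (rule borel_measurable_LIMSEQ_metric[OF drift_sum_measurable[OF assms] drift_riemann[OF assms]])

lemma ito_sum_measurable:
  assumes "cadlag_adapted X" "0 \<le> s" "s \<le> T"
  shows "ito_sum W \<kappa> X s m \<in> borel_measurable M"
  unfolding ito_sum_def[abs_def]
proof (intro borel_measurable_sum measurable_matrix_vector_mult borel_measurable_diff)
  fix k :: nat assume "k \<in> {..<2^m}"
  then have k: "k \<le> 2^m" "Suc k \<le> 2^m" by auto
  have [measurable]: "X (s * real k / 2^m) \<in> borel_measurable M"
    using cadlag_adapted_measurable[OF assms(1)] grid_le[OF assms(2) k(1)] assms(3) by auto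
  show "(\<lambda>\<omega>. \<kappa> (X (s * real k / 2^m) \<omega>)) \<in> borel_measurable M" by measurable
  show "W (s * real (Suc k) / 2^m) \<in> borel_measurable M" "W (s * real k / 2^m) \<in> borel_measurable M"
    using grid_le[OF assms(2) k(1)] grid_le[OF assms(2) k(2)] by (auto intro!: measurable_W_M)
qed

text \<open>On \<open>{0..T}\<close> a deterministic nondecreasing function whose increments
  dominate the mean squares of the increments of \<open>\<nu>\<close>, because
  \<open>\<nu> v - \<nu> u \<le> \<nu> T\<close>. Its increments are additive over adjacent cells
  and telescope, which mean squares do not.\<close>

definition mu :: "(real \<Rightarrow> 'a \<Rightarrow> real) \<Rightarrow> real \<Rightarrow> real" where
  "mu \<nu> v = (\<integral>\<omega>. \<nu> T \<omega> * \<nu> v \<omega> \<partial>M)"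

lemma mu_props:
  assumes "forcing A \<nu>" "0 \<le> u" "u \<le> v" "v \<le> T"
  shows "E2 (\<lambda>\<omega>. \<nu> v \<omega> - \<nu> u \<omega>) \<le> mu \<nu> v - mu \<nu> u" "mu \<nu> u \<le> mu \<nu> v" "0 \<le> mu \<nu> u"
proof -
  have L: "L2 (\<nu> T)" "L2 (\<nu> u)" "L2 (\<nu> v)" using forcing_L2(2)[OF assms(1)] assms T_pos by auto
  have "E2 (\<lambda>\<omega>. \<nu> v \<omega> - \<nu> u \<omega>) \<le> (\<integral>\<omega>. \<nu> T \<omega> * \<nu> v \<omega> - \<nu> T \<omega> * \<nu> u \<omega> \<partial>M)"
    unfolding E2_def
  proof (rule integral_mono)
    show "integrable M (\<lambda>\<omega>. (norm (\<nu> v \<omega> - \<nu> u \<omega>))\<^sup>2)" using L2_integrable[OF L2_diff[OF L(3,2)]] .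
    show "integrable M (\<lambda>\<omega>. \<nu> T \<omega> * \<nu> v \<omega> - \<nu> T \<omega> * \<nu> u \<omega>)" using integrable_L2_mult L by auto
    fix \<omega> assume \<omega>: "\<omega> \<in> space M"
    have *: "0 \<le> \<nu> u \<omega>" "\<nu> u \<omega> \<le> \<nu> v \<omega>" "\<nu> v \<omega> \<le> \<nu> T \<omega>"
      using forcing_bound[OF assms(1) \<omega>] forcing_mono[OF assms(1) \<omega>] assms by auto
    have "(norm (\<nu> v \<omega> - \<nu> u \<omega>))\<^sup>2 = (\<nu> v \<omega> - \<nu> u \<omega>) * (\<nu> v \<omega> - \<nu> u \<omega>)" by (simp add: power2_eq_square)
    also have "\<dots> \<le> \<nu> T \<omega> * (\<nu> v \<omega> - \<nu> u \<omega>)" using * by (intro mult_right_mono) auto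
    finally show "(norm (\<nu> v \<omega> - \<nu> u \<omega>))\<^sup>2 \<le> \<nu> T \<omega> * \<nu> v \<omega> - \<nu> T \<omega> * \<nu> u \<omega>" by (simp add: algebra_simps)
  qed
  also have "\<dots> = mu \<nu> v - mu \<nu> u" unfolding mu_def using integrable_L2_mult L by (intro Bochner_Integration.integral_diff) auto
  finally show *: "E2 (\<lambda>\<omega>. \<nu> v \<omega> - \<nu> u \<omega>) \<le> mu \<nu> v - mu \<nu> u" .
  then show "mu \<nu> u \<le> mu \<nu> v" using E2_nonneg[of "\<lambda>\<omega>. \<nu> v \<omega> - \<nu> u \<omega>"] by linarith
  show "0 \<le> mu \<nu> u" unfolding mu_def
    using forcing_bound[OF assms(1)] assms by (intro integral_nonneg_AE AE_I2 mult_nonneg_nonneg) (auto intro: order_trans)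
qed

text \<open>Limit and scheme are compared at different times, as happens on the overlap of cells
  from two grids that are not nested. The intermediate point is the scheme at time
  \<open>u\<close>.\<close>

lemma euler_near_limit:
  assumes "forcing A \<nu>"
    and Y: "\<And>s. 0 \<le> s \<Longrightarrow> s \<le> T \<Longrightarrow> L2 (Y s)" "\<And>s. 0 \<le> s \<Longrightarrow> s \<le> T \<Longrightarrow> E2 (\<lambda>\<omega>. eulc A x m s \<omega> - Y s \<omega>) \<le> c"
    and C0: "\<And>k. k \<le> 2^m \<Longrightarrow> E2 (eul A x m k) \<le> C0"
    and uv: "0 \<le> u" "u \<le> T" "0 \<le> v" "v \<le> T"
  shows "E2 (\<lambda>\<omega>. Y u \<omega> - eulc A x m v \<omega>)
     \<le> 2 * c + 8 * \<bar>mu \<nu> u - mu \<nu> v\<bar> + 2 * ((4 * T + 2) * (2 * c0\<^sup>2 + 2 * L\<^sup>2 * C0) * \<bar>u - v\<bar>)"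
proof -
  let ?K = "(4 * T + 2) * (2 * c0\<^sup>2 + 2 * L\<^sup>2 * C0)"
  have EL: "L2 (eulc A x m u)" "L2 (eulc A x m v)" using eulc_L2[OF assms(1)] uv by auto
  have inc: "E2 (\<lambda>\<omega>. eulc A x m u \<omega> - eulc A x m v \<omega>) \<le> 4 * \<bar>mu \<nu> u - mu \<nu> v\<bar> + ?K * \<bar>u - v\<bar>"
  proof (cases "v \<le> u")
    case True
    then show ?thesis using eulc_increment_L2(2)[OF assms(1) C0 uv(3) True uv(2)] mu_props[OF assms(1) uv(3) True uv(2)] by simp
  next
    case False
    then have uv': "u \<le> v" by simp
    then show ?thesis using eulc_increment_L2(2)[OF assms(1) C0 uv(1) uv' uv(4)] mu_props[OF assms(1) uv(1) uv' uv(4)]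
      by (subst E2_commute) simp
  qed
  have "E2 (\<lambda>\<omega>. (Y u \<omega> - eulc A x m u \<omega>) + (eulc A x m u \<omega> - eulc A x m v \<omega>))
      \<le> 2 * E2 (\<lambda>\<omega>. Y u \<omega> - eulc A x m u \<omega>) + 2 * E2 (\<lambda>\<omega>. eulc A x m u \<omega> - eulc A x m v \<omega>)"
    using Y(1) EL uv by (intro E2_add L2_diff) auto
  moreover have "E2 (\<lambda>\<omega>. Y u \<omega> - eulc A x m u \<omega>) \<le> c" using Y(2)[OF uv(1,2)] by (subst E2_commute)
  ultimately show ?thesis using inc by simp
qed

text \<open>The sums that define the Ito integral at \<open>s\<close> use the dyadic grid of
  \<open>{0..s}\<close>, the scheme uses that of \<open>{0..T}\<close>, and in general neither
  refines the other. Both are rewritten over the overlaps of their cells, indexed by pairs, where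
  the isometry for families applies. On an overlap the gap of the integrands is controlled by the
  increments of \<open>mu\<close> over the two cells involved.\<close>

lemma ito_sum_euler_diff:
  assumes "forcing A \<nu>" and cad: "cadlag_adapted Y"
    and Y: "\<And>s. 0 \<le> s \<Longrightarrow> s \<le> T \<Longrightarrow> L2 (Y s)" "\<And>s. 0 \<le> s \<Longrightarrow> s \<le> T \<Longrightarrow> E2 (\<lambda>\<omega>. eulc A x m s \<omega> - Y s \<omega>) \<le> C / 2^m"
    and C0: "\<And>k. k \<le> 2^m \<Longrightarrow> E2 (eul A x m k) \<le> C0"
    and s: "0 \<le> s" "s \<le> T"
  defines "C' \<equiv> T * L\<^sup>2 * (2 * C + 2 * ((4 * T + 2) * (2 * c0\<^sup>2 + 2 * L\<^sup>2 * C0) * T) + 16 * mu \<nu> T)"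
  shows "L2 (\<lambda>\<omega>. ito_sum W \<kappa> Y s m \<omega> - eint (gr m) (2^m) (\<lambda>k \<omega>. \<kappa> (eul A x m k \<omega>)) s \<omega>)" (is "L2 ?D")
    and "E2 (\<lambda>\<omega>. ito_sum W \<kappa> Y s m \<omega> - eint (gr m) (2^m) (\<lambda>k \<omega>. \<kappa> (eul A x m k \<omega>)) s \<omega>) \<le> C' / 2^m"
    and "L2 (\<lambda>\<omega>. (\<Sum>k<2^m. (s / 2^m) *\<^sub>R b (Y (s * real k / 2^m) \<omega>)) - drift A x m s \<omega>)" (is "L2 ?G")
    and "E2 (\<lambda>\<omega>. (\<Sum>k<2^m. (s / 2^m) *\<^sub>R b (Y (s * real k / 2^m) \<omega>)) - drift A x m s \<omega>) \<le> T * C' / 2^m"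
proof -
  let ?n = "2^m :: nat"
  let ?K = "(4 * T + 2) * (2 * c0\<^sup>2 + 2 * L\<^sup>2 * C0)"
  define u where "u k = s * real k / 2^m" for k
  have u_mono: "mono u" unfolding u_def[abs_def] by (rule grid_mono[OF s(1)])
  have u0: "u 0 = 0" "u ?n = s" by (auto simp: u_def)
  have u_bd: "0 \<le> u k" "k \<le> ?n \<Longrightarrow> u k \<le> s" "k \<le> ?n \<Longrightarrow> u k \<le> T" for k
    using grid_le[OF s(1), of k m] s by (auto simp: u_def)
  have u_step: "u (Suc k) - u k = s / 2^m" for k by (simp add: u_def field_simps)
  have u_le: "u k \<le> u (Suc k)" for k using u_mono by (simp add: monoD)
  have "0 \<le> C0" by (rule order_trans[OF E2_nonneg C0[of 0]]) simp
  then have K0: "0 \<le> ?K" using T_pos by (auto intro!: mult_nonneg_nonneg add_nonneg_nonneg)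
  \<comment> \<open>Only pairs of cells that properly overlap: then the overlap starts no earlier
    than both left endpoints, which gives adaptedness, and these endpoints are at most one mesh
    \<open>T / 2^m\<close> apart.\<close>
  define I where "I = {(k, j). k < ?n \<and> j < ?n \<and> u k < gr m (Suc j) \<and> gr m j < u (Suc k)}"
  have finI: "finite I" by (rule finite_subset[of _ "{..<?n} \<times> {..<?n}"]) (auto simp: I_def)
  define l where "l = (\<lambda>(k, j). clip (gr m j) (gr m (Suc j)) (u k))"
  define r where "r = (\<lambda>(k, j). clip (gr m j) (gr m (Suc j)) (u (Suc k)))"
  have lr: "0 \<le> l p \<and> l p \<le> r p" for p
    using clip_bounds[OF gr_le_Suc, of m "snd p" "u (fst p)"] gr_nonneg[of m "snd p"] clip_mono[OF u_le]
    by (cases p) (auto simp: l_def r_def)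
  have disj': "r p \<le> l p'" if "snd p < snd p' \<or> snd p = snd p' \<and> fst p < fst p'" for p p'
  proof -
    obtain i k i' k' where p: "p = (i, k)" "p' = (i', k')" by (cases p, cases p') blast
    have "clip (gr m k) (gr m (Suc k)) (u (Suc i)) \<le> clip (gr m k') (gr m (Suc k')) (u i')"
    proof (cases "k < k'")
      case True
      then have "gr m (Suc k) \<le> gr m k'" using monoD[OF gr_mono] by simp
      then show ?thesis using clip_bounds[OF gr_le_Suc, of m k "u (Suc i)"] clip_bounds[OF gr_le_Suc, of m k' "u i'"] by linarith
    next
      case False
      then have "k = k'" "i < i'" using that by (auto simp: p)
      then show ?thesis using monoD[OF u_mono, of "Suc i" i'] by (auto intro: clip_mono)
    qed
    then show ?thesis by (simp add: p l_def r_def)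
  qed
  have disj: "r p \<le> l p' \<or> r p' \<le> l p" if "p \<noteq> p'" for p p'
    using disj'[of p p'] disj'[of p' p] that by (metis linorder_neqE_nat prod_eqI)
  have degenerate: "r p = l p" if "p \<in> {..<?n} \<times> {..<?n} - I" for p
  proof -
    obtain k j where p: "p = (k, j)" by (cases p)
    have "gr m (Suc j) \<le> u k \<or> u (Suc k) \<le> gr m j" using that by (auto simp: I_def p)
    then show ?thesis using u_le[of k] gr_le_Suc[of m j] by (auto simp: p l_def r_def clip_def min_def max_def)
  qed
  have sumI: "(\<Sum>p\<in>I. f p) = (\<Sum>p\<in>{..<?n} \<times> {..<?n}. f p)" if "\<And>p. r p = l p \<Longrightarrow> f p = 0" for f :: "nat \<times> nat \<Rightarrow> 'z::comm_monoid_add"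
    by (rule sum.mono_neutral_left) (use degenerate that in \<open>auto simp: I_def\<close>)
  have tele_j: "(\<Sum>j<?n. f (r (k, j)) - f (l (k, j))) = f (u (Suc k)) - f (u k)" if "k < ?n" for k and f :: "real \<Rightarrow> 'z::ab_group_add"
  proof -
    have t: "(\<Sum>j<?n. f (clip (gr m j) (gr m (Suc j)) (u i)) - f (gr m j)) = f (u i) - f 0" if "i \<le> ?n" for i
      using clip_telescope[OF gr_mono, of m "u i" f ?n] u_bd[of i] that by (simp add: min_absorb1)
    have "(\<Sum>j<?n. f (r (k, j)) - f (l (k, j)))
      = (\<Sum>j<?n. f (clip (gr m j) (gr m (Suc j)) (u (Suc k))) - f (gr m j)) - (\<Sum>j<?n. f (clip (gr m j) (gr m (Suc j)) (u k)) - f (gr m j))"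
      by (simp add: l_def r_def sum_subtractf[symmetric])
    then show ?thesis using t[of "Suc k"] t[of k] that by simp
  qed
  have tele_k: "(\<Sum>k<?n. f (r (k, j)) - f (l (k, j))) = f (clip (gr m j) (gr m (Suc j)) s) - f (gr m j)" for j and f :: "real \<Rightarrow> 'z::ab_group_add"
    using sum_lessThan_telescope[of "\<lambda>k. f (clip (gr m j) (gr m (Suc j)) (u k))" ?n] clip_lower[OF gr_nonneg gr_le_Suc, of m j]
    by (simp add: l_def r_def u0)
  define H where "H = (\<lambda>(k, j) \<omega>. \<kappa> (Y (u k) \<omega>) - \<kappa> (eul A x m j \<omega>))"
  define G where "G = (\<lambda>(k, j) \<omega>. b (Y (u k) \<omega>) - b (eul A x m j \<omega>))"
  have D_eq: "?D = (\<lambda>\<omega>. \<Sum>p\<in>I. H p \<omega> *v (W (r p) \<omega> - W (l p) \<omega>))"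
  proof
    fix \<omega>
    have "(\<Sum>p\<in>I. H p \<omega> *v (W (r p) \<omega> - W (l p) \<omega>)) = (\<Sum>p\<in>{..<?n} \<times> {..<?n}. H p \<omega> *v (W (r p) \<omega> - W (l p) \<omega>))"
      by (rule sumI) simp
    also have "\<dots> = (\<Sum>k<?n. \<Sum>j<?n. \<kappa> (Y (u k) \<omega>) *v (W (r (k, j)) \<omega> - W (l (k, j)) \<omega>))
        - (\<Sum>k<?n. \<Sum>j<?n. \<kappa> (eul A x m j \<omega>) *v (W (r (k, j)) \<omega> - W (l (k, j)) \<omega>))"
      by (simp add: sum.cartesian_product' H_def matrix_vector_mult_diff_rdistrib sum_subtractf)
    also have "(\<Sum>k<?n. \<Sum>j<?n. \<kappa> (Y (u k) \<omega>) *v (W (r (k, j)) \<omega> - W (l (k, j)) \<omega>)) = ito_sum W \<kappa> Y s m \<omega>"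
      unfolding ito_sum_def
    proof (intro sum.cong refl)
      fix k assume "k \<in> {..<?n}"
      then have "k < ?n" by simp
      have "(\<Sum>j<?n. \<kappa> (Y (u k) \<omega>) *v (W (r (k, j)) \<omega> - W (l (k, j)) \<omega>)) = \<kappa> (Y (u k) \<omega>) *v (\<Sum>j<?n. W (r (k, j)) \<omega> - W (l (k, j)) \<omega>)"
        by (simp add: matrix_vector_mult_def vec_eq_iff sum_distrib_left sum.swap[of _ UNIV])
      also have "\<dots> = \<kappa> (Y (u k) \<omega>) *v (W (u (Suc k)) \<omega> - W (u k) \<omega>)"
        using tele_j[OF \<open>k < ?n\<close>, of "\<lambda>z. W z \<omega>"] by simp
      finally show "(\<Sum>j<?n. \<kappa> (Y (u k) \<omega>) *v (W (r (k, j)) \<omega> - W (l (k, j)) \<omega>))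
         = \<kappa> (Y (s * real k / 2^m) \<omega>) *v (W (s * real (Suc k) / 2^m) \<omega> - W (s * real k / 2^m) \<omega>)"
        unfolding u_def .
    qed
    also have "(\<Sum>k<?n. \<Sum>j<?n. \<kappa> (eul A x m j \<omega>) *v (W (r (k, j)) \<omega> - W (l (k, j)) \<omega>))
       = eint (gr m) (2^m) (\<lambda>k \<omega>. \<kappa> (eul A x m k \<omega>)) s \<omega>"
      unfolding eint_def
    proof (subst sum.swap, intro sum.cong refl)
      fix j
      have "(\<Sum>k<?n. \<kappa> (eul A x m j \<omega>) *v (W (r (k, j)) \<omega> - W (l (k, j)) \<omega>)) = \<kappa> (eul A x m j \<omega>) *v (\<Sum>k<?n. W (r (k, j)) \<omega> - W (l (k, j)) \<omega>)"
        by (simp add: matrix_vector_mult_def vec_eq_iff sum_distrib_left sum.swap[of _ UNIV])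
      then show "(\<Sum>k<?n. \<kappa> (eul A x m j \<omega>) *v (W (r (k, j)) \<omega> - W (l (k, j)) \<omega>))
         = \<kappa> (eul A x m j \<omega>) *v (W (clip (gr m j) (gr m (Suc j)) s) \<omega> - W (gr m j) \<omega>)"
        using tele_k[of "\<lambda>z. W z \<omega>" j] by simp
    qed
    finally show "?D \<omega> = (\<Sum>p\<in>I. H p \<omega> *v (W (r p) \<omega> - W (l p) \<omega>))" ..
  qed
  have G_eq: "?G = (\<lambda>\<omega>. \<Sum>p\<in>I. (r p - l p) *\<^sub>R G p \<omega>)"
  proof
    fix \<omega>
    have "(\<Sum>p\<in>I. (r p - l p) *\<^sub>R G p \<omega>) = (\<Sum>p\<in>{..<?n} \<times> {..<?n}. (r p - l p) *\<^sub>R G p \<omega>)"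
      by (rule sumI) simp
    also have "\<dots> = (\<Sum>k<?n. \<Sum>j<?n. (r (k, j) - l (k, j)) *\<^sub>R b (Y (u k) \<omega>)) - (\<Sum>k<?n. \<Sum>j<?n. (r (k, j) - l (k, j)) *\<^sub>R b (eul A x m j \<omega>))"
      by (simp add: sum.cartesian_product' G_def scaleR_right_diff_distrib sum_subtractf)
    also have "(\<Sum>k<?n. \<Sum>j<?n. (r (k, j) - l (k, j)) *\<^sub>R b (Y (u k) \<omega>)) = (\<Sum>k<?n. (s / 2^m) *\<^sub>R b (Y (u k) \<omega>))"
      by (intro sum.cong refl) (simp add: scaleR_sum_left[symmetric] tele_j[of _ "\<lambda>z. z"] u_step)
    also have "(\<Sum>k<?n. \<Sum>j<?n. (r (k, j) - l (k, j)) *\<^sub>R b (eul A x m j \<omega>)) = drift A x m s \<omega>"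
      unfolding drift_def
      by (subst sum.swap, intro sum.cong refl) (simp add: scaleR_sum_left[symmetric] tele_k[of "\<lambda>z. z"])
    finally show "?G \<omega> = (\<Sum>p\<in>I. (r p - l p) *\<^sub>R G p \<omega>)" by (simp add: u_def)
  qed
  define \<alpha> where "\<alpha> k = mu \<nu> (u (Suc k)) - mu \<nu> (u k)" for k
  define \<beta> where "\<beta> j = mu \<nu> (gr m (Suc j)) - mu \<nu> (gr m j)" for j
  define c where "c = 2 * (C / 2^m) + 2 * (?K * (T / 2^m))"
  have mu_u: "0 \<le> \<alpha> k" if "k < ?n" for k
    using mu_props(2)[OF assms(1) u_bd(1) u_le u_bd(3), of k] that by (simp add: \<alpha>_def)
  have mu_g: "0 \<le> \<beta> j" if "j < ?n" for j
    using mu_props(2)[OF assms(1) gr_nonneg gr_le_Suc gr_le_T, of j m] that by (simp add: \<beta>_def)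
  have near: "E2 (\<lambda>\<omega>. Y (u k) \<omega> - eul A x m j \<omega>) \<le> c + 8 * (\<alpha> k + \<beta> j)" if "(k, j) \<in> I" for k j
  proof -
    have kj: "k < ?n" "j < ?n" "u k < gr m (Suc j)" "gr m j < u (Suc k)" using that by (auto simp: I_def)
    have bd: "u k \<le> T" "gr m j \<le> T" "u (Suc k) \<le> T" "gr m (Suc j) \<le> T" using kj u_bd gr_le_T by auto
    have "s / 2^m \<le> T / 2^m" using s by (intro divide_right_mono) auto
    then have d: "\<bar>u k - gr m j\<bar> \<le> T / 2^m" using kj u_step[of k] gr_step[of m j] by linarith
    have \<mu>: "\<bar>mu \<nu> (u k) - mu \<nu> (gr m j)\<bar> \<le> \<alpha> k + \<beta> j"
    proof (cases "u k \<le> gr m j")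
      case True
      then show ?thesis using mu_props(2)[OF assms(1) u_bd(1) True bd(2)] mu_props(2)[OF assms(1) gr_nonneg less_imp_le[OF kj(4)] bd(3)] mu_g[OF kj(2)]
        by (simp add: \<alpha>_def)
    next
      case False
      then have F': "gr m j \<le> u k" by simp
      show ?thesis using mu_props(2)[OF assms(1) gr_nonneg F' bd(1)] mu_props(2)[OF assms(1) u_bd(1) less_imp_le[OF kj(3)] bd(4)] mu_u[OF kj(1)]
        by (simp add: \<beta>_def)
    qed
    have "E2 (\<lambda>\<omega>. Y (u k) \<omega> - eulc A x m (gr m j) \<omega>) \<le> 2 * (C / 2^m) + 8 * \<bar>mu \<nu> (u k) - mu \<nu> (gr m j)\<bar> + 2 * (?K * \<bar>u k - gr m j\<bar>)"
      by (rule euler_near_limit[OF assms(1) Y C0 u_bd(1) bd(1) gr_nonneg bd(2)])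
    also have "\<dots> \<le> c + 8 * (\<alpha> k + \<beta> j)" using \<mu> mult_left_mono[OF d K0] by (simp add: c_def)
    finally show ?thesis using kj by (simp add: eulc_at_grid)
  qed
  \<comment> \<open>Summed over \<open>j\<close>, the overlap lengths give the length of cell
    \<open>k\<close>; summed over \<open>k\<close>, at most the length of cell \<open>j\<close>. So
    every increment of \<open>mu\<close> carries the weight of one mesh and the sums telescope to at
    most \<open>mu \<nu> T\<close>. The two grids account for 8 + 8 = 16 in
    \<open>C'\<close>.\<close>
  have total: "(\<Sum>p\<in>I. (r p - l p) * (L\<^sup>2 * (c + 8 * (\<alpha> (fst p) + \<beta> (snd p))))) \<le> C' / 2^m"
  proof -
    have "(\<Sum>p\<in>I. (r p - l p) * (L\<^sup>2 * (c + 8 * (\<alpha> (fst p) + \<beta> (snd p)))))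
      = (\<Sum>p\<in>{..<?n} \<times> {..<?n}. (r p - l p) * (L\<^sup>2 * (c + 8 * (\<alpha> (fst p) + \<beta> (snd p)))))"
      by (rule sumI) simp
    also have "\<dots> = (\<Sum>k<?n. \<Sum>j<?n. (r (k, j) - l (k, j)) * (L\<^sup>2 * (c + 8 * \<alpha> k))) + (\<Sum>k<?n. \<Sum>j<?n. (r (k, j) - l (k, j)) * (L\<^sup>2 * 8 * \<beta> j))"
      by (simp add: sum.cartesian_product' sum.distrib[symmetric] algebra_simps)
    also have "(\<Sum>k<?n. \<Sum>j<?n. (r (k, j) - l (k, j)) * (L\<^sup>2 * (c + 8 * \<alpha> k))) = (\<Sum>k<?n. (s / 2^m) * (L\<^sup>2 * (c + 8 * \<alpha> k)))"
      by (intro sum.cong refl) (simp only: sum_distrib_right[symmetric] tele_j[of _ "\<lambda>z. z"] u_step lessThan_iff)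
    also have "(\<Sum>k<?n. \<Sum>j<?n. (r (k, j) - l (k, j)) * (L\<^sup>2 * 8 * \<beta> j)) = (\<Sum>j<?n. (clip (gr m j) (gr m (Suc j)) s - gr m j) * (L\<^sup>2 * 8 * \<beta> j))"
      by (subst sum.swap, intro sum.cong refl) (simp only: sum_distrib_right[symmetric] tele_k[of "\<lambda>z. z"])
    also have "\<dots> \<le> (\<Sum>j<?n. (T / 2^m) * (L\<^sup>2 * 8 * \<beta> j))"
    proof (intro sum_mono mult_right_mono)
      fix j assume "j \<in> {..<?n}"
      then show "0 \<le> L\<^sup>2 * 8 * \<beta> j" using mu_g by auto
      show "clip (gr m j) (gr m (Suc j)) s - gr m j \<le> T / 2^m"
        using clip_bounds[OF gr_le_Suc, of m j s] gr_step[of m j] by linarith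
    qed
    also have "(\<Sum>k<?n. (s / 2^m) * (L\<^sup>2 * (c + 8 * \<alpha> k))) = s * (L\<^sup>2 * c) + (s / 2^m) * (L\<^sup>2 * 8) * (\<Sum>k<?n. \<alpha> k)"
      by (simp add: sum_distrib_left sum.distrib distrib_left sum_divide_distrib mult_ac)
    also have "(\<Sum>k<?n. \<alpha> k) = mu \<nu> s - mu \<nu> 0"
      unfolding \<alpha>_def using sum_lessThan_telescope[of "\<lambda>k. mu \<nu> (u k)" ?n] by (simp add: u0)
    also have "(\<Sum>j<?n. (T / 2^m) * (L\<^sup>2 * 8 * \<beta> j)) = (T / 2^m) * (L\<^sup>2 * 8) * (\<Sum>j<?n. \<beta> j)"
      by (simp add: sum_distrib_left sum_divide_distrib mult_ac)
    also have "(\<Sum>j<?n. \<beta> j) = mu \<nu> T - mu \<nu> 0"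
      unfolding \<beta>_def using sum_lessThan_telescope[of "\<lambda>j. mu \<nu> (gr m j)" ?n] by simp
    finally have "(\<Sum>p\<in>I. (r p - l p) * (L\<^sup>2 * (c + 8 * (\<alpha> (fst p) + \<beta> (snd p)))))
      \<le> s * (L\<^sup>2 * c) + (s / 2^m) * (L\<^sup>2 * 8) * (mu \<nu> s - mu \<nu> 0) + (T / 2^m) * (L\<^sup>2 * 8) * (mu \<nu> T - mu \<nu> 0)" by simp
    also have "\<dots> \<le> T * (L\<^sup>2 * c) + (T / 2^m) * (L\<^sup>2 * 8) * mu \<nu> T + (T / 2^m) * (L\<^sup>2 * 8) * mu \<nu> T"
    proof (intro add_mono mult_mono)
      have "0 \<le> C / 2^m" using Y(2)[of 0] T_pos E2_nonneg order_trans less_imp_le by (metis order_refl)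
      then show "0 \<le> c" using K0 T_pos by (auto simp: c_def)
      then show "0 \<le> L\<^sup>2 * c" by simp
      show "mu \<nu> s - mu \<nu> 0 \<le> mu \<nu> T" "mu \<nu> T - mu \<nu> 0 \<le> mu \<nu> T" "0 \<le> mu \<nu> s - mu \<nu> 0" "0 \<le> mu \<nu> T - mu \<nu> 0"
        using mu_props[OF assms(1) order_refl, of s] mu_props[OF assms(1) s(1) s(2)] mu_props[OF assms(1) order_refl, of T] s T_pos by auto
    qed (use s T_pos in \<open>auto intro!: divide_right_mono\<close>)
    also have "\<dots> = C' / 2^m" unfolding C'_def c_def by (simp add: field_simps)
    finally show ?thesis .
  qed
  have I_pL: "L2 (Y (u k))" "L2 (eul A x m j)" if "(k, j) \<in> I" for k j
    using that Y(1) u_bd eul_L2[OF assms(1)] by (auto simp: I_def)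
  have HE: "L2 (H p)" "E2 (H p) \<le> L\<^sup>2 * (c + 8 * (\<alpha> (fst p) + \<beta> (snd p)))"
    "L2 (G p)" "E2 (G p) \<le> L\<^sup>2 * (c + 8 * (\<alpha> (fst p) + \<beta> (snd p)))" if "p \<in> I" for p
  proof -
    obtain k j where p: "p = (k, j)" by (cases p)
    note d = coeff_diff_L2[OF I_pL(1,2)[OF that[unfolded p]]]
    have n: "L\<^sup>2 * E2 (\<lambda>\<omega>. Y (u k) \<omega> - eul A x m j \<omega>) \<le> L\<^sup>2 * (c + 8 * (\<alpha> k + \<beta> j))"
      using near[OF that[unfolded p]] by (intro mult_left_mono) auto
    show "L2 (H p)" "L2 (G p)" using d by (auto simp: p H_def G_def)
    show "E2 (H p) \<le> L\<^sup>2 * (c + 8 * (\<alpha> (fst p) + \<beta> (snd p)))" "E2 (G p) \<le> L\<^sup>2 * (c + 8 * (\<alpha> (fst p) + \<beta> (snd p)))"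
      using d n by (auto simp: p H_def G_def)
  qed
  have HF: "H p \<in> borel_measurable (F (l p))" if "p \<in> I" for p
  proof -
    obtain k j where p: "p = (k, j)" by (cases p)
    have kj: "k < ?n" "j < ?n" "u k < gr m (Suc j)" "gr m j < u (Suc k)" using that by (auto simp: I_def p)
    have ls: "u k \<le> l p" "gr m j \<le> l p" using kj gr_le_Suc[of m j] by (auto simp: p l_def clip_def)
    have [measurable]: "Y (u k) \<in> borel_measurable (F (l p))" "eul A x m j \<in> borel_measurable (F (l p))"
      using measurable_F_mono[OF ls(1) cadlag_adaptedD(1)[OF cad u_bd(1) u_bd(3)]]
        measurable_F_mono[OF ls(2) eul_measurable[OF assms(1)]] kj by auto
    have "H p = (\<lambda>\<omega>. \<kappa> (Y (u k) \<omega>) - \<kappa> (eul A x m j \<omega>))" by (simp add: p H_def)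
    then show ?thesis by simp
  qed
  note iso = family_isometry[OF finI lr disj HF HE(1)]
  show "L2 ?D" unfolding D_eq by (rule iso)
  have "E2 ?D = (\<Sum>p\<in>I. (r p - l p) * E2 (H p))" unfolding D_eq by (rule iso)
  also have "\<dots> \<le> (\<Sum>p\<in>I. (r p - l p) * (L\<^sup>2 * (c + 8 * (\<alpha> (fst p) + \<beta> (snd p)))))"
    using lr HE(2) by (intro sum_mono mult_left_mono) auto
  also note total
  finally show "E2 ?D \<le> C' / 2^m" .
  show "L2 ?G" unfolding G_eq by (intro L2_sum L2_scaleR HE)
  have "E2 ?G \<le> (\<Sum>p\<in>I. r p - l p) * (\<Sum>p\<in>I. (r p - l p) * E2 (G p))"
    unfolding G_eq by (rule E2_weighted_sum) (use finI lr HE in auto)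
  also have "(\<Sum>p\<in>I. r p - l p) = (\<Sum>p\<in>{..<?n} \<times> {..<?n}. r p - l p)" by (rule sumI) simp
  also have "\<dots> = (\<Sum>k<?n. \<Sum>j<?n. r (k, j) - l (k, j))" by (simp add: sum.cartesian_product')
  also have "\<dots> = (\<Sum>k<?n. u (Suc k) - u k)"
    by (intro sum.cong refl tele_j[of _ "\<lambda>z. z"]) auto
  also have "\<dots> = s" by (simp add: u_step)
  also have "s * (\<Sum>p\<in>I. (r p - l p) * E2 (G p)) \<le> T * (C' / 2^m)"
  proof (intro mult_mono)
    show "(\<Sum>p\<in>I. (r p - l p) * E2 (G p)) \<le> C' / 2^m"
      using lr HE(4) by (intro order_trans[OF _ total] sum_mono mult_left_mono) auto
  qed (use s lr in \<open>auto intro!: sum_nonneg\<close>)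
  finally show "E2 ?G \<le> T * C' / 2^m" by simp
qed

text \<open>The candidate \<open>I\<close> for the stochastic integral is whatever makes the
  equation true. What has to be shown is that the left-point sums of the limit process converge to
  it in probability.\<close>

lemma solution_exists:
  assumes "forcing A \<nu>"
  obtains Y C B where "solves A x Y" "0 \<le> C" "\<And>m. B m \<in> sets M" "\<And>m. prob (B m) \<le> C * (8/9)^m"
    "\<And>m \<omega> s. \<omega> \<in> space M - B m \<Longrightarrow> 0 \<le> s \<Longrightarrow> s \<le> T \<Longrightarrow> norm (eulc A x m s \<omega> - Y s \<omega>) \<le> 8 * (3/4)^m"
proof -
  obtain Y C B where Y: "cadlag_adapted Y" "0 \<le> C"
    "\<And>m. B m \<in> sets M" "\<And>m. prob (B m) \<le> C * (8/9)^m"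
    "\<And>m \<omega> s. \<omega> \<in> space M - B m \<Longrightarrow> 0 \<le> s \<Longrightarrow> s \<le> T \<Longrightarrow> norm (eulc A x m s \<omega> - Y s \<omega>) \<le> 8 * (3/4)^m"
    "\<And>s. 0 \<le> s \<Longrightarrow> s \<le> T \<Longrightarrow> L2 (Y s)"
    "\<And>m s. 0 \<le> s \<Longrightarrow> s \<le> T \<Longrightarrow> E2 (\<lambda>\<omega>. eulc A x m s \<omega> - Y s \<omega>) \<le> C / 2^m"
    using euler_limit[OF assms, of x] by blast
  obtain C0 where C0: "0 \<le> C0" "\<And>m k. k \<le> 2^m \<Longrightarrow> E2 (eul A x m k) \<le> C0" using eul_moment_bound[OF assms] by blast
  define C' where "C' = T * L\<^sup>2 * (2 * C + 2 * ((4 * T + 2) * (2 * c0\<^sup>2 + 2 * L\<^sup>2 * C0) * T) + 16 * mu \<nu> T)"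
  have pow: "(\<lambda>m. c / 2^m :: real) \<longlonglongrightarrow> 0" for c
    using LIMSEQ_realpow_zero[of "1/2::real", THEN tendsto_mult_left, of c] by (simp add: power_divide)
  have "solves A x Y"
    unfolding solves_def
  proof (intro conjI ballI Y(1))
    fix s assume "s \<in> {0..T}"
    then have s: "0 \<le> s" "s \<le> T" by auto
    define I where "I \<omega> = Y s \<omega> - x - A s \<omega> - integral {0..s} (\<lambda>r. b (Y r \<omega>))" for \<omega>
    have Im: "I \<in> borel_measurable M" unfolding I_def[abs_def]
      using drift_integral_measurable[OF Y(1) s] L2_measurable[OF Y(6)[OF s]] L2_measurable[OF forcing_L2(1)[OF assms s]]
      by (intro borel_measurable_diff) auto
    define R where "R m \<omega> = (\<Sum>k<2^m. (s / 2^m) *\<^sub>R b (Y (s * real k / 2^m) \<omega>))" for m \<omega>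
    have Rm: "R m \<in> borel_measurable M" for m unfolding R_def[abs_def] by (rule drift_sum_measurable[OF Y(1) s])
    define E where "E m = eint (gr m) (2^m) (\<lambda>k \<omega>. \<kappa> (eul A x m k \<omega>)) s" for m
    note dif = ito_sum_euler_diff[OF assms Y(1) Y(6) Y(7) C0(2) s, folded C'_def R_def E_def]
    have z1: "conv0 (\<lambda>m \<omega>. ito_sum W \<kappa> Y s m \<omega> - E m \<omega>)"
    proof (rule conv0_L2[OF dif(1)])
      show "(\<lambda>m. E2 (\<lambda>\<omega>. ito_sum W \<kappa> Y s m \<omega> - E m \<omega>)) \<longlonglongrightarrow> 0"
        by (rule tendsto_sandwich[OF _ _ tendsto_const pow[of C']]) (auto intro!: always_eventually dif(2))
    qed auto
    have z2: "conv0 (\<lambda>m \<omega>. R m \<omega> - drift A x m s \<omega>)"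
    proof (rule conv0_L2[OF dif(3)])
      show "(\<lambda>m. E2 (\<lambda>\<omega>. R m \<omega> - drift A x m s \<omega>)) \<longlonglongrightarrow> 0"
        by (rule tendsto_sandwich[OF _ _ tendsto_const pow[of "T * C'"]]) (auto intro!: always_eventually dif(4))
    qed auto
    have z3: "conv0 (\<lambda>m \<omega>. eulc A x m s \<omega> - Y s \<omega>)"
    proof (rule conv0_L2[OF L2_diff[OF eulc_L2[OF assms s] Y(6)[OF s]]])
      show "(\<lambda>m. E2 (\<lambda>\<omega>. eulc A x m s \<omega> - Y s \<omega>)) \<longlonglongrightarrow> 0"
        by (rule tendsto_sandwich[OF _ _ tendsto_const pow[of C]]) (auto intro!: always_eventually Y(7)[OF s])
    qed
    have z4: "conv0 (\<lambda>m \<omega>. integral {0..s} (\<lambda>r. b (Y r \<omega>)) - R m \<omega>)"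
    proof (rule conv0_AE)
      show "(\<lambda>\<omega>. integral {0..s} (\<lambda>r. b (Y r \<omega>)) - R m \<omega>) \<in> borel_measurable M" for m
        by (intro borel_measurable_diff drift_integral_measurable[OF Y(1) s] Rm)
      show "AE \<omega> in M. (\<lambda>m. integral {0..s} (\<lambda>r. b (Y r \<omega>)) - R m \<omega>) \<longlonglongrightarrow> 0"
      proof (rule AE_I2)
        fix \<omega> assume "\<omega> \<in> space M"
        from tendsto_diff[OF tendsto_const drift_riemann[OF Y(1) s this], of "integral {0..s} (\<lambda>r. b (Y r \<omega>))"]
        show "(\<lambda>m. integral {0..s} (\<lambda>r. b (Y r \<omega>)) - R m \<omega>) \<longlonglongrightarrow> 0" by (simp add: R_def)
      qed
    qed
    \<comment> \<open>Four errors, each vanishing in probability: stochastic sums against the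
      scheme, the scheme against its limit, drift sums against the drift of the scheme, and the
      Riemann approximation of the drift integral.\<close>
    have eq: "ito_sum W \<kappa> Y s m \<omega> - I \<omega> = ((ito_sum W \<kappa> Y s m \<omega> - E m \<omega>) + (eulc A x m s \<omega> - Y s \<omega>))
        + ((R m \<omega> - drift A x m s \<omega>) + (integral {0..s} (\<lambda>r. b (Y r \<omega>)) - R m \<omega>))" for m \<omega>
      by (simp add: I_def eulc_def E_def)
    have "conv0 (\<lambda>m \<omega>. ito_sum W \<kappa> Y s m \<omega> - I \<omega>)" unfolding eq
      by (intro conv0_add z1 z2 z3 z4)
    then have "\<forall>\<epsilon>>0. (\<lambda>m. prob {\<omega>\<in>space M. norm (ito_sum W \<kappa> Y s m \<omega> - I \<omega>) > \<epsilon>}) \<longlonglongrightarrow> 0"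
      using conv0_imp_prob by blast
    moreover have "AE \<omega> in M. Y s \<omega> = x + integral {0..s} (\<lambda>r. b (Y r \<omega>)) + I \<omega> + A s \<omega>" by (simp add: I_def)
    ultimately show "\<exists>I. I \<in> borel_measurable M \<and>
        (\<forall>\<epsilon>>0. (\<lambda>m. prob {\<omega>\<in>space M. norm (ito_sum W \<kappa> Y s m \<omega> - I \<omega>) > \<epsilon>}) \<longlonglongrightarrow> 0) \<and>
        (AE \<omega> in M. Y s \<omega> = x + integral {0..s} (\<lambda>r. b (Y r \<omega>)) + I \<omega> + A s \<omega>)" using Im by blast
  qed
  then show thesis using that Y(2-5) by blast
qed

text \<open>Right-continuity reduces the condition to rational times, together with the endpoint
  \<open>s\<close>, which has no admissible times to its right.\<close>

lemma exit_event:
  assumes "cadlag_adapted X" "0 \<le> s" "s \<le> T"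
  shows "{\<omega>\<in>space M. \<forall>r\<in>{0..s}. norm (X r \<omega>) \<le> N} \<in> sets (F s)"
proof -
  let ?Q = "insert s ({0..<s} \<inter> \<rat>)"
  have c: "countable ?Q" by (auto intro: countable_rat)
  have meas: "X q \<in> borel_measurable (F s)" if "q \<in> ?Q" for q
    using that assms cadlag_adaptedD(1)[OF assms(1), of q] measurable_F_mono[of q s] by auto
  have "{\<omega>\<in>space M. \<forall>r\<in>{0..s}. norm (X r \<omega>) \<le> N} = {\<omega>\<in>space (F s). \<forall>q\<in>?Q. norm (X q \<omega>) \<le> N}"
  proof (intro Collect_cong conj_cong)
    fix \<omega> assume "\<omega> \<in> space (F s)"
    then have \<omega>: "\<omega> \<in> space M" by simp
    show "(\<forall>r\<in>{0..s}. norm (X r \<omega>) \<le> N) \<longleftrightarrow> (\<forall>q\<in>?Q. norm (X q \<omega>) \<le> N)"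
    proof
      assume Q: "\<forall>q\<in>?Q. norm (X q \<omega>) \<le> N"
      show "\<forall>r\<in>{0..s}. norm (X r \<omega>) \<le> N"
      proof (rule ballI, rule ccontr)
        fix r assume r: "r \<in> {0..s}" "\<not> norm (X r \<omega>) \<le> N"
        then have rs: "r < s" using Q by (cases "r = s") auto
        have "((\<lambda>r. X r \<omega>) \<longlongrightarrow> X r \<omega>) (at_right r)"
          using cadlag_adaptedD(2)[OF assms(1) \<omega>] r rs assms by (auto simp: cadlag_def continuous_within)
        then have "eventually (\<lambda>q. N < norm (X q \<omega>)) (at_right r)"
          using r by (intro order_tendstoD(1)[OF tendsto_norm]) auto
        then obtain d where d: "r < d" "\<And>q. r < q \<Longrightarrow> q < d \<Longrightarrow> N < norm (X q \<omega>)"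
          by (auto simp: eventually_at_right[OF rs])
        obtain q where q: "q \<in> \<rat>" "r < q" "q < min d s" using Rats_dense_in_real[of r "min d s"] d rs by auto
        then have "q \<in> ?Q" using r by auto
        then have "norm (X q \<omega>) \<le> N" using Q by blast
        then show False using d(2)[of q] q by auto
      qed
    qed (use assms in auto)
  qed simp
  moreover have "{\<omega>\<in>space (F s). \<forall>q\<in>?Q. norm (X q \<omega>) \<le> N} \<in> sets (F s)"
    using meas c by (intro sets.sets_Collect_countable_All' borel_measurable_le borel_measurable_norm) auto
  ultimately show ?thesis by simp
qed

text \<open>Left-point sums of an increasing function stay below its integral, here that of
  \<open>exp (\<theta> * r)\<close> over \<open>{0..s}\<close>.\<close>

lemma exp_left_sums:
  assumes "0 < (\<theta>::real)" "0 \<le> s"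
  shows "(\<Sum>k<2^m. (s / 2^m) * exp (\<theta> * (s * real k / 2^m))) \<le> exp (\<theta> * s) / \<theta>"
proof -
  have "(s / 2^m) * exp (\<theta> * (s * real k / 2^m)) \<le> (exp (\<theta> * (s * real (Suc k) / 2^m)) - exp (\<theta> * (s * real k / 2^m))) / \<theta>" for k
  proof -
    have "\<theta> * (s / 2^m) \<le> exp (\<theta> * (s / 2^m)) - 1" using exp_ge_add_one_self[of "\<theta> * (s / 2^m)"] by linarith
    then have "\<theta> * (s / 2^m) * exp (\<theta> * (s * real k / 2^m)) \<le> (exp (\<theta> * (s / 2^m)) - 1) * exp (\<theta> * (s * real k / 2^m))"
      by (intro mult_right_mono) auto
    also have "\<dots> = exp (\<theta> * (s / 2^m) + \<theta> * (s * real k / 2^m)) - exp (\<theta> * (s * real k / 2^m))"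
      by (simp add: exp_add left_diff_distrib)
    also have "\<theta> * (s / 2^m) + \<theta> * (s * real k / 2^m) = \<theta> * (s * real (Suc k) / 2^m)" by (simp add: field_simps)
    finally show ?thesis using assms by (simp add: pos_le_divide_eq mult_ac)
  qed
  then have "(\<Sum>k<2^m. (s / 2^m) * exp (\<theta> * (s * real k / 2^m))) \<le> (\<Sum>k<2^m. (exp (\<theta> * (s * real (Suc k) / 2^m)) - exp (\<theta> * (s * real k / 2^m))) / \<theta>)"
    by (intro sum_mono)
  also have "\<dots> = (exp (\<theta> * s) - 1) / \<theta>"
    unfolding sum_divide_distrib[symmetric]
    using sum_lessThan_telescope[of "\<lambda>k. exp (\<theta> * (s * real k / 2^m))" "2^m"] by simp
  also have "\<dots> \<le> exp (\<theta> * s) / \<theta>" using assms by (intro divide_right_mono) auto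
  finally show ?thesis .
qed

text \<open>Solutions are not assumed square-integrable, and their stochastic integrals are mere
  limits of sums. Hence both paths are localised to stay below \<open>N\<close>, the difference is
  estimated on left-point sums, and Fatou along an almost surely convergent subsequence transfers
  the estimate to the solutions.\<close>

lemma solution_unique:
  assumes X: "solves A x X" and Y: "solves A x Y"
  shows "AE \<omega> in M. \<forall>s\<in>{0..T}. X s \<omega> = Y s \<omega>"
proof -
  have cX: "cadlag_adapted X" and cY: "cadlag_adapted Y" using X Y by (auto simp: solves_def)
  have fixed_time: "AE \<omega> in M. X s \<omega> = Y s \<omega>" if s: "0 \<le> s" "s \<le> T" for s
  proof -
    have "AE \<omega> in M. (\<forall>r\<in>{0..s}. norm (X r \<omega>) \<le> real N) \<and> (\<forall>r\<in>{0..s}. norm (Y r \<omega>) \<le> real N) \<longrightarrow> X s \<omega> = Y s \<omega>" for N :: nat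
    proof -
      define B where "B s = {\<omega>\<in>space M. \<forall>r\<in>{0..s}. norm (X r \<omega>) \<le> real N} \<inter> {\<omega>\<in>space M. \<forall>r\<in>{0..s}. norm (Y r \<omega>) \<le> real N}" for s
      have BF: "B s \<in> sets (F s)" if "0 \<le> s" "s \<le> T" for s
        unfolding B_def using exit_event[OF cX that] exit_event[OF cY that] by (rule sets.Int)
      have Bdec: "B s' \<subseteq> B s" if "s \<le> s'" for s s' using that by (auto simp: B_def)
      define D where "D s \<omega> = indicator (B s) \<omega> *\<^sub>R (X s \<omega> - Y s \<omega>)" for s \<omega>
      have Dm: "D s \<in> borel_measurable M" if "0 \<le> s" "s \<le> T" for s
        unfolding D_def[abs_def] using sets_F[OF BF[OF that]] cadlag_adapted_measurable[OF cX that] cadlag_adapted_measurable[OF cY that] by auto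
      have Dbd: "norm (D s \<omega>) \<le> norm (2 * real N)" if "0 \<le> s" "s \<le> T" for s \<omega>
      proof (cases "\<omega> \<in> B s")
        case True
        then have "norm (X s \<omega>) \<le> real N" "norm (Y s \<omega>) \<le> real N" using that by (auto simp: B_def)
        then have "norm (X s \<omega> - Y s \<omega>) \<le> 2 * real N" using norm_triangle_ineq4[of "X s \<omega>" "Y s \<omega>"] by linarith
        then show ?thesis using True by (simp add: D_def)
      qed (simp add: D_def)
      have DL: "L2 (D s)" "E2 (D s) \<le> (2 * real N)\<^sup>2" if "0 \<le> s" "s \<le> T" for s
        using L2_mono[OF L2_const Dm[OF that] Dbd[OF that]] E2_mono[OF L2_const Dm[OF that] Dbd[OF that]] by auto
      \<comment> \<open>Large enough that
        \<open>(4 * T + 2) * L\<^sup>2 / \<theta> \<le> 1/2\<close>, which makes the estimate a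
        contraction for the weight \<open>exp (\<theta> * s)\<close>; the summand 1 keeps it
        positive for \<open>L = 0\<close>.\<close>
      define \<theta> where "\<theta> = 2 * ((4 * T + 2) * L\<^sup>2) + 1"
      have \<theta>: "0 < \<theta>" using T_pos by (auto simp: \<theta>_def intro!: add_nonneg_pos)
      \<comment> \<open>A bound \<open>a * exp (\<theta> * r)\<close> improves to half of itself.
        Iterated from the trivial bound \<open>(2 * real N)\<^sup>2\<close> this forces
        \<open>E2 (D s) = 0\<close>, without ever integrating \<open>E2 (D r)\<close> over
        \<open>r\<close>.\<close>
      have half: "E2 (D s) \<le> (a / 2) * exp (\<theta> * s)"
        if a: "0 \<le> a" "\<And>r. 0 \<le> r \<Longrightarrow> r \<le> T \<Longrightarrow> E2 (D r) \<le> a * exp (\<theta> * r)" and s: "0 \<le> s" "s \<le> T" for a s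
      proof -
        obtain I where I: "I \<in> borel_measurable M"
          "\<forall>\<epsilon>>0. (\<lambda>m. prob {\<omega>\<in>space M. norm (ito_sum W \<kappa> X s m \<omega> - I \<omega>) > \<epsilon>}) \<longlonglongrightarrow> 0"
          "AE \<omega> in M. X s \<omega> = x + integral {0..s} (\<lambda>r. b (X r \<omega>)) + I \<omega> + A s \<omega>"
          using X s unfolding solves_def by (meson atLeastAtMost_iff)
        obtain J where J: "J \<in> borel_measurable M"
          "\<forall>\<epsilon>>0. (\<lambda>m. prob {\<omega>\<in>space M. norm (ito_sum W \<kappa> Y s m \<omega> - J \<omega>) > \<epsilon>}) \<longlonglongrightarrow> 0"
          "AE \<omega> in M. Y s \<omega> = x + integral {0..s} (\<lambda>r. b (Y r \<omega>)) + J \<omega> + A s \<omega>"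
          using Y s unfolding solves_def by (meson atLeastAtMost_iff)
        have cI: "conv0 (\<lambda>m \<omega>. ito_sum W \<kappa> X s m \<omega> - I \<omega>)"
          by (rule prob_imp_conv0) (use I ito_sum_measurable[OF cX s] in auto)
        have cJ: "conv0 (\<lambda>m \<omega>. ito_sum W \<kappa> Y s m \<omega> - J \<omega>)"
          by (rule prob_imp_conv0) (use J ito_sum_measurable[OF cY s] in auto)
        from conv0_AE_subseq[OF conv0_add[OF cI conv0_uminus[OF cJ]]]
        obtain \<rho> where \<rho>: "strict_mono \<rho>" 
          "AE \<omega> in M. (\<lambda>n. (ito_sum W \<kappa> X s (\<rho> n) \<omega> - I \<omega>) + - (ito_sum W \<kappa> Y s (\<rho> n) \<omega> - J \<omega>)) \<longlonglongrightarrow> 0" by blast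
        define u where "u m k = s * real k / 2^m" for m k :: nat
        have u_mono: "mono (u m)" for m unfolding u_def[abs_def] by (rule grid_mono[OF s(1)])
        have u_bd: "0 \<le> u m k" "k \<le> 2^m \<Longrightarrow> u m k \<le> s" "k \<le> 2^m \<Longrightarrow> u m k \<le> T" for m k
          using grid_le[OF s(1), of k m] s by (auto simp: u_def)
        have u_end: "u m 0 = 0" "u m (2^m) = s" for m by (auto simp: u_def)
        have u_step: "u m (Suc k) - u m k = s / 2^m" for m k by (simp add: u_def field_simps)
        define V where "V m \<omega> = (\<Sum>k<2^m. (s / 2^m) *\<^sub>R b (X (u m k) \<omega>)) - (\<Sum>k<2^m. (s / 2^m) *\<^sub>R b (Y (u m k) \<omega>))
           + (ito_sum W \<kappa> X s m \<omega> - ito_sum W \<kappa> Y s m \<omega>)" for m \<omega>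
        have Vm: "V m \<in> borel_measurable M" for m
          unfolding V_def[abs_def] u_def
          by (intro borel_measurable_add borel_measurable_diff drift_sum_measurable ito_sum_measurable cX cY s)
        have V_eq: "V m \<omega> = 0 + (\<Sum>i<2^m. (u m (Suc i) - u m i) *\<^sub>R (b (X (u m i) \<omega>) - b (Y (u m i) \<omega>)))
           + (\<Sum>i<2^m. (\<kappa> (X (u m i) \<omega>) - \<kappa> (Y (u m i) \<omega>)) *v (W (u m (Suc i)) \<omega> - W (u m i) \<omega>))" for m \<omega>
          unfolding V_def ito_sum_def u_step
          by (simp add: u_def sum_subtractf scaleR_right_diff_distrib matrix_vector_mult_diff_rdistrib)
        have est: "L2 (\<lambda>\<omega>. indicator (B s) \<omega> *\<^sub>R V m \<omega>) \<and> E2 (\<lambda>\<omega>. indicator (B s) \<omega> *\<^sub>R V m \<omega>) \<le> (a / 2) * exp (\<theta> * s)" for m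
        proof -
          have cof: "L2 (\<lambda>\<omega>. indicator (B (u m i)) \<omega> *\<^sub>R (b (X (u m i) \<omega>) - b (Y (u m i) \<omega>)))"
            "E2 (\<lambda>\<omega>. indicator (B (u m i)) \<omega> *\<^sub>R (b (X (u m i) \<omega>) - b (Y (u m i) \<omega>))) \<le> L\<^sup>2 * E2 (D (u m i))"
            "L2 (\<lambda>\<omega>. indicator (B (u m i)) \<omega> *\<^sub>R (\<kappa> (X (u m i) \<omega>) - \<kappa> (Y (u m i) \<omega>)))"
            "E2 (\<lambda>\<omega>. indicator (B (u m i)) \<omega> *\<^sub>R (\<kappa> (X (u m i) \<omega>) - \<kappa> (Y (u m i) \<omega>))) \<le> L\<^sup>2 * E2 (D (u m i))"
            if i: "i < 2^m" for i
          proof -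
            have iT: "0 \<le> u m i" "u m i \<le> T" using u_bd[of m i] u_bd(3)[of i m] i by auto
            have [measurable]: "X (u m i) \<in> borel_measurable M" "Y (u m i) \<in> borel_measurable M" "B (u m i) \<in> sets M"
              using cadlag_adapted_measurable[OF cX iT] cadlag_adapted_measurable[OF cY iT] sets_F[OF BF[OF iT]] by auto
            have 1: "norm (indicator (B (u m i)) \<omega> *\<^sub>R (b (X (u m i) \<omega>) - b (Y (u m i) \<omega>))) \<le> L * norm (D (u m i) \<omega>)"
              "norm (indicator (B (u m i)) \<omega> *\<^sub>R (\<kappa> (X (u m i) \<omega>) - \<kappa> (Y (u m i) \<omega>))) \<le> L * norm (D (u m i) \<omega>)" for \<omega>
              using b_lip[of "X (u m i) \<omega>" "Y (u m i) \<omega>"] \<kappa>_lip[of "X (u m i) \<omega>" "Y (u m i) \<omega>"]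
              by (auto simp: D_def split: split_indicator)
            have 2: "(\<lambda>\<omega>. indicator (B (u m i)) \<omega> *\<^sub>R (b (X (u m i) \<omega>) - b (Y (u m i) \<omega>))) \<in> borel_measurable M"
              "(\<lambda>\<omega>. indicator (B (u m i)) \<omega> *\<^sub>R (\<kappa> (X (u m i) \<omega>) - \<kappa> (Y (u m i) \<omega>))) \<in> borel_measurable M" by measurable
            have 3: "norm (L *\<^sub>R D (u m i) \<omega>) = L * norm (D (u m i) \<omega>)" for \<omega> using L_nonneg by simp
            show "L2 (\<lambda>\<omega>. indicator (B (u m i)) \<omega> *\<^sub>R (b (X (u m i) \<omega>) - b (Y (u m i) \<omega>)))"
              "L2 (\<lambda>\<omega>. indicator (B (u m i)) \<omega> *\<^sub>R (\<kappa> (X (u m i) \<omega>) - \<kappa> (Y (u m i) \<omega>)))"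
              by (rule L2_mono[OF L2_scaleR[OF DL(1)[OF iT], of L] 2(1)], simp only: 3 1)
                 (rule L2_mono[OF L2_scaleR[OF DL(1)[OF iT], of L] 2(2)], simp only: 3 1)
            show "E2 (\<lambda>\<omega>. indicator (B (u m i)) \<omega> *\<^sub>R (b (X (u m i) \<omega>) - b (Y (u m i) \<omega>))) \<le> L\<^sup>2 * E2 (D (u m i))"
              "E2 (\<lambda>\<omega>. indicator (B (u m i)) \<omega> *\<^sub>R (\<kappa> (X (u m i) \<omega>) - \<kappa> (Y (u m i) \<omega>))) \<le> L\<^sup>2 * E2 (D (u m i))"
              by (rule E2_lip[OF DL(1)[OF iT] 2(1) 1(1) L_nonneg] E2_lip[OF DL(1)[OF iT] 2(2) 1(2) L_nonneg])+
          qed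
          define S where "S = (\<Sum>i<2^m. (s / 2^m) * (L\<^sup>2 * (a * exp (\<theta> * u m i))))"
          have S: "S \<le> L\<^sup>2 * (a * (exp (\<theta> * s) / \<theta>))"
          proof -
            have "S = L\<^sup>2 * (a * (\<Sum>i<2^m. (s / 2^m) * exp (\<theta> * (s * real i / 2^m))))"
              by (simp add: S_def u_def sum_distrib_left mult_ac)
            also have "\<dots> \<le> L\<^sup>2 * (a * (exp (\<theta> * s) / \<theta>))"
              using exp_left_sums[OF \<theta> s(1), of m] a(1) by (intro mult_left_mono) auto
            finally show ?thesis .
          qed
          have le: "(\<Sum>i<2^m. (u m (Suc i) - u m i) * e i) \<le> S" if "\<And>i. i < 2^m \<Longrightarrow> e i \<le> L\<^sup>2 * E2 (D (u m i))" for e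
            unfolding S_def u_step
          proof (intro sum_mono mult_left_mono)
            fix i assume "i \<in> {..<(2::nat)^m}"
            then have i: "i < 2^m" by simp
            have "L\<^sup>2 * E2 (D (u m i)) \<le> L\<^sup>2 * (a * exp (\<theta> * u m i))"
              using a(2)[of "u m i"] u_bd[of m i] u_bd(3)[of i m] i by (intro mult_left_mono) auto
            then show "e i \<le> L\<^sup>2 * (a * exp (\<theta> * u m i))" using that[OF i] by linarith
          qed (use s in auto)
          have S0: "0 \<le> S" unfolding S_def using s a(1) by (intro sum_nonneg mult_nonneg_nonneg) auto
          have BuF: "B (u m i) \<in> sets (F (u m i))" if "i \<le> 2^m" for i using BF u_bd that by auto
          have Bsub: "B (u m (2^m)) \<subseteq> B (u m i)" if "i \<le> 2^m" for i
            using Bdec[OF monoD[OF u_mono that]] .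
          have Hm: "(\<lambda>\<omega>. \<kappa> (X (u m i) \<omega>) - \<kappa> (Y (u m i) \<omega>)) \<in> borel_measurable (F (u m i))" if "i < 2^m" for i
          proof -
            have [measurable]: "X (u m i) \<in> borel_measurable (F (u m i))" "Y (u m i) \<in> borel_measurable (F (u m i))"
              using cadlag_adaptedD(1)[OF cX] cadlag_adaptedD(1)[OF cY] u_bd[of m i] u_bd(3)[of i m] that by auto
            show ?thesis by measurable
          qed
          have z: "L2 (\<lambda>\<omega>. indicator (B (u m (2^m))) \<omega> *\<^sub>R (0::real^'d))" by simp
          note loc = localized_L2_estimate[where t="u m" and j="2^m" and A="\<lambda>i. B (u m i)" and V="V m" and a="\<lambda>_. 0",
             OF u_mono u_bd(1) BuF Bsub V_eq Vm z cof(1) Hm cof(3)]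
          have "E2 (\<lambda>\<omega>. indicator (B (u m (2^m))) \<omega> *\<^sub>R V m \<omega>) \<le> 4 * E2 (\<lambda>\<omega>. indicator (B (u m (2^m))) \<omega> *\<^sub>R (0::real^'d))
            + 4 * ((u m (2^m) - u m 0) * (\<Sum>i<2^m. (u m (Suc i) - u m i) * E2 (\<lambda>\<omega>. indicator (B (u m i)) \<omega> *\<^sub>R (b (X (u m i) \<omega>) - b (Y (u m i) \<omega>)))))
            + 2 * (\<Sum>i<2^m. (u m (Suc i) - u m i) * E2 (\<lambda>\<omega>. indicator (B (u m i)) \<omega> *\<^sub>R (\<kappa> (X (u m i) \<omega>) - \<kappa> (Y (u m i) \<omega>))))"
            by (rule loc(2))
          also have "\<dots> \<le> 4 * (T * S) + 2 * S"
          proof -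
            have "(u m (2^m) - u m 0) * (\<Sum>i<2^m. (u m (Suc i) - u m i) * E2 (\<lambda>\<omega>. indicator (B (u m i)) \<omega> *\<^sub>R (b (X (u m i) \<omega>) - b (Y (u m i) \<omega>)))) \<le> T * S"
              by (intro mult_mono le[OF cof(2)]) (use s T_pos in \<open>auto simp: u_end u_step intro!: sum_nonneg\<close>)
            then show ?thesis using le[OF cof(4)] by simp
          qed
          also have "\<dots> = (4 * T + 2) * S" by (simp add: algebra_simps)
          also have "\<dots> \<le> (4 * T + 2) * (L\<^sup>2 * (a * (exp (\<theta> * s) / \<theta>)))"
            using S T_pos by (intro mult_left_mono) auto
          also have "\<dots> = ((4 * T + 2) * L\<^sup>2 / \<theta>) * (a * exp (\<theta> * s))" by simp
          also have "\<dots> \<le> (1/2) * (a * exp (\<theta> * s))"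
            using \<theta> a(1) by (intro mult_right_mono) (auto simp: \<theta>_def pos_divide_le_eq)
          finally show ?thesis using loc(1) unfolding u_end by simp
        qed
        \<comment> \<open>Along the subsequence the sums converge to the differences of drift and
          stochastic integrals. Both solutions share start and forcing, so the limit of
          \<open>V\<close> is exactly their difference.\<close>
        have "AE \<omega> in M. (\<lambda>n. indicator (B s) \<omega> *\<^sub>R V (\<rho> n) \<omega>) \<longlonglongrightarrow> D s \<omega>"
          using \<rho>(2) I(3) J(3) AE_space
        proof eventually_elim
          case (elim \<omega>)
          have sub: "filterlim \<rho> sequentially sequentially" using filterlim_subseq[OF \<rho>(1)] .
          have 1: "(\<lambda>n. \<Sum>k<2^\<rho> n. (s / 2^\<rho> n) *\<^sub>R b (X (u (\<rho> n) k) \<omega>)) \<longlonglongrightarrow> integral {0..s} (\<lambda>r. b (X r \<omega>))"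
            using filterlim_compose[OF drift_riemann[OF cX s elim(4)] sub] by (simp add: u_def)
          have 2: "(\<lambda>n. \<Sum>k<2^\<rho> n. (s / 2^\<rho> n) *\<^sub>R b (Y (u (\<rho> n) k) \<omega>)) \<longlonglongrightarrow> integral {0..s} (\<lambda>r. b (Y r \<omega>))"
            using filterlim_compose[OF drift_riemann[OF cY s elim(4)] sub] by (simp add: u_def)
          have 3: "(\<lambda>n. ito_sum W \<kappa> X s (\<rho> n) \<omega> - ito_sum W \<kappa> Y s (\<rho> n) \<omega>) \<longlonglongrightarrow> I \<omega> - J \<omega>"
            using tendsto_add[OF elim(1) tendsto_const[of "I \<omega> - J \<omega>"]] by simp
          have "(\<lambda>n. V (\<rho> n) \<omega>) \<longlonglongrightarrow> integral {0..s} (\<lambda>r. b (X r \<omega>)) - integral {0..s} (\<lambda>r. b (Y r \<omega>)) + (I \<omega> - J \<omega>)"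
            unfolding V_def by (intro tendsto_add tendsto_diff 1 2 3)
          also have "integral {0..s} (\<lambda>r. b (X r \<omega>)) - integral {0..s} (\<lambda>r. b (Y r \<omega>)) + (I \<omega> - J \<omega>) = X s \<omega> - Y s \<omega>"
            unfolding elim(2) elim(3) by simp
          finally show ?case unfolding D_def by (intro tendsto_scaleR tendsto_const)
        qed
        from L2_fatou(2)[OF conjunct1[OF est] conjunct2[OF est] this Dm[OF s]] show ?thesis .
      qed
      have dec: "E2 (D s) \<le> ((2 * real N)\<^sup>2 / 2^k) * exp (\<theta> * s)" if "0 \<le> s" "s \<le> T" for k s
        using that
      proof (induction k arbitrary: s)
        case 0
        have "(2 * real N)\<^sup>2 * 1 \<le> (2 * real N)\<^sup>2 * exp (\<theta> * s)" using \<theta> 0 by (intro mult_left_mono) auto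
        then show ?case using DL(2)[OF 0] by simp
      next
        case (Suc k)
        have "E2 (D s) \<le> ((2 * real N)\<^sup>2 / 2^k / 2) * exp (\<theta> * s)"
          by (rule half[OF _ Suc.IH Suc.prems]) auto
        then show ?case by (simp add: mult.commute)
      qed
      have "E2 (D s) \<le> 0"
      proof (rule LIMSEQ_le_const)
        have "(\<lambda>k. (2 * real N)\<^sup>2 * exp (\<theta> * s) * (1/2)^k) \<longlonglongrightarrow> (2 * real N)\<^sup>2 * exp (\<theta> * s) * 0"
          by (intro tendsto_mult_left LIMSEQ_realpow_zero) auto
        then show "(\<lambda>k. ((2 * real N)\<^sup>2 / 2^k) * exp (\<theta> * s)) \<longlonglongrightarrow> 0" by (simp add: power_divide)
      qed (use dec[OF s] in auto)
      then have "E2 (D s) = 0" using E2_nonneg[of "D s"] by linarith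
      then have "AE \<omega> in M. (norm (D s \<omega>))\<^sup>2 = 0"
        using integral_nonneg_eq_0_iff_AE[OF L2_integrable[OF DL(1)[OF s]]] by (simp add: E2_def)
      then show ?thesis using AE_space
        by eventually_elim (auto simp: D_def B_def)
    qed
    then have "AE \<omega> in M. \<forall>N::nat. (\<forall>r\<in>{0..s}. norm (X r \<omega>) \<le> real N) \<and> (\<forall>r\<in>{0..s}. norm (Y r \<omega>) \<le> real N) \<longrightarrow> X s \<omega> = Y s \<omega>"
      by (subst AE_all_countable) blast
    then show ?thesis using AE_space
    proof eventually_elim
      case (elim \<omega>)
      obtain C where C: "\<And>r. 0 \<le> r \<Longrightarrow> r \<le> T \<Longrightarrow> norm (X r \<omega>) \<le> C"
        using cadlag_bounded[OF cadlag_adaptedD(2)[OF cX elim(2)]] by blast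
      obtain C' where C': "\<And>r. 0 \<le> r \<Longrightarrow> r \<le> T \<Longrightarrow> norm (Y r \<omega>) \<le> C'"
        using cadlag_bounded[OF cadlag_adaptedD(2)[OF cY elim(2)]] by blast
      obtain N :: nat where N: "max C C' \<le> real N" using real_arch_simple by blast
      have "norm (X r \<omega>) \<le> real N" "norm (Y r \<omega>) \<le> real N" if "r \<in> {0..s}" for r
        using C[of r] C'[of r] N s that by auto
      then show ?case using elim(1) by blast
    qed
  qed
  \<comment> \<open>Equality holds almost surely at all these countably many times simultaneously;
    right-continuity extends it to every time below \<open>T\<close>, and \<open>T\<close> itself is
    included.\<close>
  let ?Q = "insert T ({0..T} \<inter> \<rat>)"
  have "countable ?Q" by (auto intro: countable_rat)
  moreover have "AE \<omega> in M. X q \<omega> = Y q \<omega>" if "q \<in> ?Q" for q using fixed_time[of q] that T_pos by auto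
  ultimately have "AE \<omega> in M. \<forall>q\<in>?Q. X q \<omega> = Y q \<omega>" by (simp add: AE_ball_countable)
  then show ?thesis using AE_space
  proof eventually_elim
    case (elim \<omega>)
    show ?case
    proof (rule ballI, rule ccontr)
      fix s assume s: "s \<in> {0..T}" "X s \<omega> \<noteq> Y s \<omega>"
      then have sT: "s < T" using elim by (cases "s = T") auto
      have "((\<lambda>r. X r \<omega> - Y r \<omega>) \<longlongrightarrow> X s \<omega> - Y s \<omega>) (at_right s)"
        using cadlag_adaptedD(2)[OF cX elim(2)] cadlag_adaptedD(2)[OF cY elim(2)] s sT
        by (intro tendsto_diff) (auto simp: cadlag_def continuous_within)
      then have "eventually (\<lambda>r. 0 < norm (X r \<omega> - Y r \<omega>)) (at_right s)"
        using s by (intro order_tendstoD(1)[OF tendsto_norm]) auto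
      then obtain d where d: "s < d" "\<And>q. s < q \<Longrightarrow> q < d \<Longrightarrow> 0 < norm (X q \<omega> - Y q \<omega>)"
        by (auto simp: eventually_at_right[OF sT])
      obtain q where q: "q \<in> \<rat>" "s < q" "q < min d T" using Rats_dense_in_real[of s "min d T"] d sT by auto
      then have "q \<in> ?Q" using s by auto
      then show False using elim(1) d(2)[of q] q by auto
    qed
  qed
qed

text \<open>By uniqueness an arbitrary solution is almost surely the limit of the schemes for the
  same forcing. This reaches in particular a solution picked by a choice operator.\<close>

lemma euler_approximates_solution:
  assumes "forcing A \<nu>" "solves A x X" "0 < \<epsilon>"
  obtains m0 where "\<And>m. m0 \<le> m \<Longrightarrow> \<exists>B\<in>sets M. prob B \<le> \<epsilon> \<and> (\<forall>\<omega>\<in>space M - B. \<forall>s\<in>{0..T}. norm (eulc A x m s \<omega> - X s \<omega>) \<le> \<epsilon>)"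
proof -
  obtain Y C B where Y: "solves A x Y" "0 \<le> C" "\<And>m. B m \<in> sets M" "\<And>m. prob (B m) \<le> C * (8/9)^m"
    "\<And>m \<omega> s. \<omega> \<in> space M - B m \<Longrightarrow> 0 \<le> s \<Longrightarrow> s \<le> T \<Longrightarrow> norm (eulc A x m s \<omega> - Y s \<omega>) \<le> 8 * (3/4)^m"
    using solution_exists[OF assms(1), of x] by blast
  have "AE \<omega> in M. \<forall>s\<in>{0..T}. X s \<omega> = Y s \<omega>" by (rule solution_unique[OF assms(2) Y(1)])
  then obtain N where N: "N \<in> null_sets M" "{\<omega>\<in>space M. \<not> (\<forall>s\<in>{0..T}. X s \<omega> = Y s \<omega>)} \<subseteq> N"
    by (auto elim: AE_E simp: null_sets_def)
  have l1: "(\<lambda>m. C * (8/9::real)^m) \<longlonglongrightarrow> C * 0" and l2: "(\<lambda>m. 8 * (3/4::real)^m) \<longlonglongrightarrow> 8 * 0"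
    by (intro tendsto_mult_left LIMSEQ_realpow_zero; simp)+
  have "eventually (\<lambda>m. C * (8/9::real)^m < \<epsilon>) sequentially" "eventually (\<lambda>m. 8 * (3/4::real)^m < \<epsilon>) sequentially"
    by (rule order_tendstoD(2)[OF l1], use assms(3) in simp) (rule order_tendstoD(2)[OF l2], use assms(3) in simp)
  then have "eventually (\<lambda>m. C * (8/9::real)^m < \<epsilon> \<and> 8 * (3/4::real)^m < \<epsilon>) sequentially" by eventually_elim auto
  then obtain m0 where m0: "\<And>m. m0 \<le> m \<Longrightarrow> C * (8/9::real)^m < \<epsilon> \<and> 8 * (3/4::real)^m < \<epsilon>"
    by (auto simp: eventually_sequentially)
  show thesis
  proof (rule that[of m0])
    fix m assume m: "m0 \<le> m"
    show "\<exists>B\<in>sets M. prob B \<le> \<epsilon> \<and> (\<forall>\<omega>\<in>space M - B. \<forall>s\<in>{0..T}. norm (eulc A x m s \<omega> - X s \<omega>) \<le> \<epsilon>)"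
    proof (intro bexI[of _ "B m \<union> N"] conjI ballI)
      have "prob (B m \<union> N) = prob (B m)" using N(1) Y(3) by (intro measure_Un_null_set) auto
      then show "prob (B m \<union> N) \<le> \<epsilon>" using Y(4)[of m] m0[OF m] by simp
      fix \<omega> s assume \<omega>: "\<omega> \<in> space M - (B m \<union> N)" and s: "s \<in> {0..T}"
      have "X s \<omega> = Y s \<omega>" using \<omega> s N(2) by blast
      then show "norm (eulc A x m s \<omega> - X s \<omega>) \<le> \<epsilon>" using Y(5)[of \<omega> m s] \<omega> s m0[OF m] by auto
    qed (use Y(3) N in auto)
  qed
qed

text \<open>Only the first moment of \<open>\<nu> S\<close> enters the bound, and \<open>m\<close>
  does not. Where \<open>\<nu> \<le> N\<close>, the squared forcing gap is at most
  \<open>\<gamma>\<^sup>2 * (N * \<nu> S)\<close>, whose mean is of order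
  \<open>\<gamma> * sqrt \<gamma>\<close> for \<open>N = 1 / sqrt \<gamma>\<close>. Gronwall
  preserves this order, Chebyshev at level \<open>sqrt \<gamma>\<close> divides by
  \<open>\<gamma>\<close>, and Markov bounds the excluded event by \<open>C1 / N\<close>.\<close>

lemma euler_stability:
  assumes A: "forcing A \<nu>" and A': "forcing A' \<nu>"
    and close: "\<And>\<omega> s. \<omega> \<in> space M \<Longrightarrow> 0 \<le> s \<Longrightarrow> s \<le> T \<Longrightarrow> norm (A s \<omega> - A' s \<omega>) \<le> \<gamma> * \<nu> s \<omega>"
    and S: "0 \<le> S" "S \<le> T" and \<gamma>: "0 < \<gamma>" and C1: "(\<integral>\<omega>. \<nu> S \<omega> \<partial>M) \<le> C1"
  shows "\<exists>B\<in>sets M. prob B \<le> ((T + T\<^sup>2) * L\<^sup>2 * (4 * C1 * exp ((4 * T + 2) * L\<^sup>2 * T)) + C1) * sqrt \<gamma> \<and>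
     (\<forall>\<omega>\<in>space M - B. \<forall>s\<in>{0..S}. norm (eulc A x m s \<omega> - eulc A' x m s \<omega>) \<le> 3 * sqrt \<gamma>)"
proof -
  define N where "N = 1 / sqrt \<gamma>"
  have N: "0 < N" "\<gamma> * N = sqrt \<gamma>" "N * sqrt \<gamma> = 1" using \<gamma> by (auto simp: N_def real_div_sqrt)
  have \<nu>L: "L2 (\<nu> s)" if "0 \<le> s" "s \<le> T" for s using forcing_L2(2)[OF A that] .
  have \<nu>i: "integrable M (\<nu> s)" if "0 \<le> s" "s \<le> T" for s
    by (rule square_integrable_imp_integrable[OF L2_measurable[OF \<nu>L[OF that]]])
       (use L2_integrable[OF \<nu>L[OF that]] in simp)
  have "0 \<le> (\<integral>\<omega>. \<nu> S \<omega> \<partial>M)" by (rule integral_nonneg_AE, rule AE_I2, rule forcing_bound(2)[OF A _ S])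
  then have C1n: "0 \<le> C1" using C1 by linarith
  \<comment> \<open>Empty beyond \<open>S\<close>, because the moment bound covers
    \<open>\<nu>\<close> only up to \<open>S\<close>. Later cells then drop out of all sums, while
    the family remains adapted and decreasing.\<close>
  define G where "G k = (if gr m k \<le> S then {\<omega>\<in>space M. \<nu> (gr m k) \<omega> \<le> N} else {})" for k
  have GF: "G k \<in> sets (F (gr m k))" if "k \<le> 2^m" for k
  proof -
    have "\<nu> (gr m k) \<in> borel_measurable (F (gr m k))" using forcingD(2)[OF A gr_nonneg gr_le_T[OF that]] .
    then have "{\<omega>\<in>space (F (gr m k)). \<nu> (gr m k) \<omega> \<le> N} \<in> sets (F (gr m k))" by (intro borel_measurable_le) auto
    then show ?thesis by (simp add: G_def)
  qed
  have Gdec: "G j \<subseteq> G i" if "i \<le> j" "j \<le> 2^m" for i j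
  proof
    fix \<omega> assume \<omega>: "\<omega> \<in> G j"
    have ij: "gr m i \<le> gr m j" using monoD[OF gr_mono that(1)] .
    have j: "gr m j \<le> S" "\<omega> \<in> space M" "\<nu> (gr m j) \<omega> \<le> N" using \<omega> by (auto simp: G_def split: if_splits)
    have "\<nu> (gr m i) \<omega> \<le> \<nu> (gr m j) \<omega>" by (rule forcing_mono[OF A j(2) gr_nonneg ij gr_le_T[OF that(2)]])
    then show "\<omega> \<in> G i" using j ij by (auto simp: G_def)
  qed
  define D where "D k \<omega> = indicator (G k) \<omega> *\<^sub>R (eul A x m k \<omega> - eul A' x m k \<omega>)" for k \<omega>
  have EL: "L2 (eul A x m k)" "L2 (eul A' x m k)" if "k \<le> 2^m" for k using eul_L2[OF A that] eul_L2[OF A' that] by auto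
  have DL: "L2 (D k)" if "k \<le> 2^m" for k
    unfolding D_def[abs_def] by (rule L2_indicator[OF L2_diff[OF EL[OF that]] sets_F[OF GF[OF that]]])
  define H where "H k \<omega> = indicator (G k) \<omega> *\<^sub>R (\<kappa> (eul A x m k \<omega>) - \<kappa> (eul A' x m k \<omega>))" for k \<omega>
  define B where "B k \<omega> = indicator (G k) \<omega> *\<^sub>R (b (eul A x m k \<omega>) - b (eul A' x m k \<omega>))" for k \<omega>
  have \<kappa>F: "(\<lambda>\<omega>. \<kappa> (eul A x m k \<omega>) - \<kappa> (eul A' x m k \<omega>)) \<in> borel_measurable (F (gr m k))" if "k \<le> 2^m" for k
    using eul_coeff(1)[OF A that] eul_coeff(1)[OF A' that] by (intro borel_measurable_diff)
  have HB: "H k \<in> borel_measurable (F (gr m k))" "L2 (H k)" "L2 (B k)" "E2 (H k) \<le> L\<^sup>2 * E2 (D k)" "E2 (B k) \<le> L\<^sup>2 * E2 (D k)" if k: "k \<le> 2^m" for k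
  proof -
    show "H k \<in> borel_measurable (F (gr m k))"
      unfolding H_def[abs_def] by (intro borel_measurable_scaleR borel_measurable_indicator GF[OF k] \<kappa>F[OF k])
    show HL: "L2 (H k)" unfolding H_def[abs_def] by (rule L2_indicator[OF coeff_diff_L2(1)[OF EL[OF k]] sets_F[OF GF[OF k]]])
    show BL: "L2 (B k)" unfolding B_def[abs_def] by (rule L2_indicator[OF coeff_diff_L2(2)[OF EL[OF k]] sets_F[OF GF[OF k]]])
    show "E2 (H k) \<le> L\<^sup>2 * E2 (D k)"
      by (rule E2_lip[OF DL[OF k] L2_measurable[OF HL] _ L_nonneg]) (use \<kappa>_lip in \<open>auto simp: H_def D_def split: split_indicator\<close>)
    show "E2 (B k) \<le> L\<^sup>2 * E2 (D k)"
      by (rule E2_lip[OF DL[OF k] L2_measurable[OF BL] _ L_nonneg]) (use b_lip in \<open>auto simp: B_def D_def split: split_indicator\<close>)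
  qed
  define \<alpha> where "\<alpha> = 4 * (\<gamma>\<^sup>2 * (N * C1))"
  define \<beta> where "\<beta> = (4 * T + 2) * L\<^sup>2"
  have \<alpha>\<beta>: "0 \<le> \<alpha>" "0 \<le> \<beta>" using N C1n T_pos by (auto simp: \<alpha>_def \<beta>_def)
  have step: "E2 (D j) \<le> \<alpha> + (\<Sum>i<j. (\<beta> * (T / 2^m)) * E2 (D i))" if j: "j \<le> 2^m" for j
  proof (cases "gr m j \<le> S")
    case False
    then have "D j = (\<lambda>\<omega>. 0)" by (auto simp: D_def G_def)
    then have "E2 (D j) = 0" by simp
    also have "0 \<le> \<alpha> + (\<Sum>i<j. (\<beta> * (T / 2^m)) * E2 (D i))" using \<alpha>\<beta> T_pos by (intro add_nonneg_nonneg sum_nonneg) auto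
    finally show ?thesis .
  next
    case True
    let ?a = "\<lambda>\<omega>. A (gr m j) \<omega> - A' (gr m j) \<omega>"
    have jT: "0 \<le> gr m j" "gr m j \<le> T" using gr_nonneg gr_le_T[OF j] by auto
    have aL: "L2 (\<lambda>\<omega>. indicator (G j) \<omega> *\<^sub>R ?a \<omega>)"
      by (rule L2_indicator[OF L2_diff[OF forcing_L2(1)[OF A jT] forcing_L2(1)[OF A' jT]] sets_F[OF GF[OF j]]])
    have aE: "E2 (\<lambda>\<omega>. indicator (G j) \<omega> *\<^sub>R ?a \<omega>) \<le> \<gamma>\<^sup>2 * (N * C1)"
    proof -
      have "E2 (\<lambda>\<omega>. indicator (G j) \<omega> *\<^sub>R ?a \<omega>) \<le> (\<integral>\<omega>. \<gamma>\<^sup>2 * (N * \<nu> S \<omega>) \<partial>M)"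
        unfolding E2_def
      proof (rule integral_mono)
        show "integrable M (\<lambda>\<omega>. (norm (indicator (G j) \<omega> *\<^sub>R ?a \<omega>))\<^sup>2)" by (rule L2_integrable[OF aL])
        show "integrable M (\<lambda>\<omega>. \<gamma>\<^sup>2 * (N * \<nu> S \<omega>))" using \<nu>i[OF S] by auto
        fix \<omega> assume \<omega>: "\<omega> \<in> space M"
        have n0: "0 \<le> \<nu> S \<omega>" "0 \<le> \<nu> (gr m j) \<omega>" "\<nu> (gr m j) \<omega> \<le> \<nu> S \<omega>"
          using forcing_bound(2)[OF A \<omega>] S jT forcing_mono[OF A \<omega> jT(1) True S(2)] by auto
        show "(norm (indicator (G j) \<omega> *\<^sub>R ?a \<omega>))\<^sup>2 \<le> \<gamma>\<^sup>2 * (N * \<nu> S \<omega>)"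
        proof (cases "\<omega> \<in> G j")
          case True
          then have "\<nu> (gr m j) \<omega> \<le> N" by (auto simp: G_def split: if_splits)
          then have "(\<nu> (gr m j) \<omega>)\<^sup>2 \<le> N * \<nu> S \<omega>" unfolding power2_eq_square using n0 by (intro mult_mono) auto
          moreover have "(norm (?a \<omega>))\<^sup>2 \<le> (\<gamma> * \<nu> (gr m j) \<omega>)\<^sup>2" using close[OF \<omega> jT] by (intro power_mono) auto
          ultimately have "(norm (?a \<omega>))\<^sup>2 \<le> \<gamma>\<^sup>2 * (N * \<nu> S \<omega>)"
            unfolding power_mult_distrib by (meson mult_left_mono order_trans zero_le_power2)
          then show ?thesis using True by simp
        qed (use N n0 in auto)
      qed
      also have "\<dots> = \<gamma>\<^sup>2 * (N * (\<integral>\<omega>. \<nu> S \<omega> \<partial>M))" by simp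
      also have "\<dots> \<le> \<gamma>\<^sup>2 * (N * C1)" using C1 N by (intro mult_left_mono) auto
      finally show ?thesis .
    qed
    have V: "eul A x m j \<omega> - eul A' x m j \<omega> = ?a \<omega> + (\<Sum>i<j. (gr m (Suc i) - gr m i) *\<^sub>R (b (eul A x m i \<omega>) - b (eul A' x m i \<omega>)))
       + (\<Sum>i<j. (\<kappa> (eul A x m i \<omega>) - \<kappa> (eul A' x m i \<omega>)) *v (W (gr m (Suc i)) \<omega> - W (gr m i) \<omega>))" for \<omega>
      unfolding eul_closed_form[of _ _ _ j]
      by (simp add: sum_subtractf scaleR_right_diff_distrib matrix_vector_mult_diff_rdistrib)
    have pre: "G i \<in> sets (F (gr m i))" "G j \<subseteq> G i" if "i \<le> j" for i using GF Gdec j that by auto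
    have pre2: "L2 (\<lambda>\<omega>. indicator (G i) \<omega> *\<^sub>R (b (eul A x m i \<omega>) - b (eul A' x m i \<omega>)))"
      "(\<lambda>\<omega>. \<kappa> (eul A x m i \<omega>) - \<kappa> (eul A' x m i \<omega>)) \<in> borel_measurable (F (gr m i))"
      "L2 (\<lambda>\<omega>. indicator (G i) \<omega> *\<^sub>R (\<kappa> (eul A x m i \<omega>) - \<kappa> (eul A' x m i \<omega>)))" if "i < j" for i
      using HB[of i] \<kappa>F[of i] that j unfolding H_def[abs_def] B_def[abs_def] by auto
    have "E2 (\<lambda>\<omega>. indicator (G j) \<omega> *\<^sub>R (eul A x m j \<omega> - eul A' x m j \<omega>)) \<le> 4 * E2 (\<lambda>\<omega>. indicator (G j) \<omega> *\<^sub>R ?a \<omega>)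
      + 4 * ((gr m j - gr m 0) * (\<Sum>i<j. (gr m (Suc i) - gr m i) * E2 (\<lambda>\<omega>. indicator (G i) \<omega> *\<^sub>R (b (eul A x m i \<omega>) - b (eul A' x m i \<omega>)))))
      + 2 * (\<Sum>i<j. (gr m (Suc i) - gr m i) * E2 (\<lambda>\<omega>. indicator (G i) \<omega> *\<^sub>R (\<kappa> (eul A x m i \<omega>) - \<kappa> (eul A' x m i \<omega>))))"
      by (rule localized_L2_estimate(2)[OF gr_mono gr_nonneg pre V L2_measurable[OF L2_diff[OF EL[OF j]]] aL pre2])
    then have "E2 (D j) \<le> 4 * (\<gamma>\<^sup>2 * (N * C1)) + 4 * (gr m j * (\<Sum>i<j. (T / 2^m) * E2 (B i))) + 2 * (\<Sum>i<j. (T / 2^m) * E2 (H i))"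
      using aE unfolding D_def[abs_def] B_def[abs_def] H_def[abs_def] gr_step by simp
    also have "\<dots> \<le> \<alpha> + 4 * (T * (\<Sum>i<j. (T / 2^m) * (L\<^sup>2 * E2 (D i)))) + 2 * (\<Sum>i<j. (T / 2^m) * (L\<^sup>2 * E2 (D i)))"
      unfolding \<alpha>_def using jT HB(4,5) j T_pos
      by (intro add_mono mult_mono sum_mono order_refl mult_left_mono) (auto intro!: sum_nonneg mult_nonneg_nonneg)
    also have "\<dots> = \<alpha> + (4 * T + 2) * (\<Sum>i<j. (T / 2^m) * (L\<^sup>2 * E2 (D i)))" by (simp only: distrib_right add.assoc mult.assoc)
    also have "(4 * T + 2) * (\<Sum>i<j. (T / 2^m) * (L\<^sup>2 * E2 (D i))) = (\<Sum>i<j. (\<beta> * (T / 2^m)) * E2 (D i))"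
      unfolding \<beta>_def sum_distrib_left by (intro sum.cong) auto
    finally show ?thesis .
  qed
  define \<Lambda> where "\<Lambda> = \<alpha> * exp (\<beta> * T)"
  have D\<Lambda>: "E2 (D k) \<le> \<Lambda>" if "k \<le> 2^m" for k
  proof -
    have "E2 (D k) \<le> \<alpha> * exp (\<beta> * (T / 2^m) * real (2^m))"
      by (rule discrete_gronwall[OF step _ _ that]) (use \<alpha>\<beta> T_pos in auto)
    then show ?thesis by (simp add: \<Lambda>_def)
  qed
  have L\<Lambda>: "E2 (H k) \<le> L\<^sup>2 * \<Lambda>" "L\<^sup>2 * E2 (D k) \<le> L\<^sup>2 * \<Lambda>" if "k \<le> 2^m" for k
    using HB(4)[OF that] mult_left_mono[OF D\<Lambda>[OF that], of "L\<^sup>2"] by auto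
  have sq\<gamma>: "0 < sqrt \<gamma>" using \<gamma> by simp
  obtain B1 where B1: "B1 \<in> sets M" "prob B1 \<le> (\<Sum>k<2^m. (gr m (Suc k) - gr m k) * E2 (H k)) / (sqrt \<gamma>)\<^sup>2"
    "\<And>\<omega> s. \<omega> \<in> space M - B1 \<Longrightarrow> 0 \<le> s \<Longrightarrow> s \<le> T \<Longrightarrow> norm (eint (gr m) (2^m) H s \<omega>) \<le> sqrt \<gamma>"
    by (rule maximal_ineq[OF gr_mono gr_simps(1) T_pos HB(1,2) sq\<gamma>, where n="2^m"]) auto
  have B1P: "prob B1 \<le> T * (L\<^sup>2 * \<Lambda>) / \<gamma>"
  proof -
    have "(\<Sum>k<2^m. (gr m (Suc k) - gr m k) * E2 (H k)) \<le> (\<Sum>k<(2::nat)^m. (T / 2^m) * (L\<^sup>2 * \<Lambda>))"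
      unfolding gr_step using L\<Lambda>(1) T_pos by (intro sum_mono mult_left_mono) auto
    then show ?thesis using B1(2) \<gamma> by (simp add: divide_right_mono order_trans)
  qed
  define R where "R \<omega> = (\<Sum>k<2^m. (T / 2^m) *\<^sub>R (L * norm (D k \<omega>)))" for \<omega>
  have RL0: "L2 (\<lambda>\<omega>. L * norm (D k \<omega>))" "E2 (\<lambda>\<omega>. L * norm (D k \<omega>)) = L\<^sup>2 * E2 (D k)" if "k < 2^m" for k
    using DL[of k] that by (auto simp: L2_def E2_def power_mult_distrib)
  have R: "L2 R" "E2 R \<le> T * (T * (L\<^sup>2 * \<Lambda>))"
  proof -
    show "L2 R" unfolding R_def[abs_def] by (intro L2_sum L2_scaleR RL0) auto
    have "E2 R \<le> (\<Sum>k<(2::nat)^m. T / 2^m) * (\<Sum>k<2^m. (T / 2^m) * E2 (\<lambda>\<omega>. L * norm (D k \<omega>)))"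
      unfolding R_def[abs_def] by (rule E2_weighted_sum) (use T_pos RL0 in auto)
    also have "\<dots> = T * (\<Sum>k<2^m. (T / 2^m) * (L\<^sup>2 * E2 (D k)))" using RL0 by simp
    also have "\<dots> \<le> T * (\<Sum>k<(2::nat)^m. (T / 2^m) * (L\<^sup>2 * \<Lambda>))"
      using D\<Lambda> T_pos by (intro mult_left_mono sum_mono) auto
    finally show "E2 R \<le> T * (T * (L\<^sup>2 * \<Lambda>))" by simp
  qed
  let ?B2 = "{\<omega>\<in>space M. sqrt \<gamma> < norm (R \<omega>)}"
  note B2 = L2_chebyshev[OF R(1) sq\<gamma>]
  have B2P: "prob ?B2 \<le> T * (T * (L\<^sup>2 * \<Lambda>)) / \<gamma>"
    using B2(2) R(2) \<gamma> by (simp add: divide_right_mono order_trans)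
  let ?B3 = "{\<omega>\<in>space M. N \<le> \<nu> S \<omega>}"
  have B3: "?B3 \<in> sets M" using L2_measurable[OF \<nu>L[OF S]] by (intro borel_measurable_le) auto
  have B3P: "prob ?B3 \<le> C1 * sqrt \<gamma>"
  proof -
    have "prob ?B3 \<le> (\<integral>\<omega>. \<nu> S \<omega> \<partial>M) / N"
      using \<nu>i[OF S] N forcing_bound(2)[OF A _ S] by (intro integral_Markov_inequality_measure[where A="space M"]) auto
    also have "\<dots> \<le> C1 / N" using C1 N by (intro divide_right_mono) auto
    finally show ?thesis by (simp add: N_def)
  qed
  show ?thesis
  proof (intro bexI[of _ "B1 \<union> ?B2 \<union> ?B3"] conjI ballI)
    show "B1 \<union> ?B2 \<union> ?B3 \<in> sets M" using B1(1) B2(1) B3 by auto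
    have "prob (B1 \<union> ?B2 \<union> ?B3) \<le> prob B1 + prob ?B2 + prob ?B3"
      using measure_Un_le[OF sets.Un[OF B1(1) B2(1)] B3] measure_Un_le[OF B1(1) B2(1)] by linarith
    also have "\<dots> \<le> T * (L\<^sup>2 * \<Lambda>) / \<gamma> + T * (T * (L\<^sup>2 * \<Lambda>)) / \<gamma> + C1 * sqrt \<gamma>" using B1P B2P B3P by linarith
    also have "\<dots> = (T + T\<^sup>2) * L\<^sup>2 * (\<Lambda> / \<gamma>) + C1 * sqrt \<gamma>" by (simp add: power2_eq_square distrib_right distrib_left add_divide_distrib mult_ac)
    also have "\<Lambda> / \<gamma> = 4 * C1 * exp (\<beta> * T) * sqrt \<gamma>"
    proof -
      have "\<gamma>\<^sup>2 * N / \<gamma> = sqrt \<gamma>" using \<gamma> N(2) by (simp add: power2_eq_square)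
      moreover have "\<Lambda> / \<gamma> = 4 * C1 * exp (\<beta> * T) * (\<gamma>\<^sup>2 * N / \<gamma>)" by (simp add: \<Lambda>_def \<alpha>_def mult_ac)
      ultimately show ?thesis by (simp only:)
    qed
    finally show "prob (B1 \<union> ?B2 \<union> ?B3) \<le> ((T + T\<^sup>2) * L\<^sup>2 * (4 * C1 * exp ((4 * T + 2) * L\<^sup>2 * T)) + C1) * sqrt \<gamma>"
      by (simp add: \<beta>_def algebra_simps)
    fix \<omega> s assume \<omega>: "\<omega> \<in> space M - (B1 \<union> ?B2 \<union> ?B3)" and "s \<in> {0..S}"
    then have s: "0 \<le> s" "s \<le> S" "s \<le> T" and \<omega>M: "\<omega> \<in> space M" and \<nu>N: "\<nu> S \<omega> < N" using S by auto
    \<comment> \<open>Off the exceptional set every cell that starts before \<open>s\<close> carries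
      the indicator 1, so up to \<open>s\<close> the localised coefficients are the true
      ones.\<close>
    have inG: "\<omega> \<in> G k" if "gr m k < s" "k < 2^m" for k
      using forcing_mono[OF A \<omega>M gr_nonneg _ S(2), of m k] that s \<omega>M \<nu>N by (auto simp: G_def)
    have eint_eq: "eint (gr m) (2^m) (\<lambda>k \<omega>. \<kappa> (eul A x m k \<omega>)) s \<omega> - eint (gr m) (2^m) (\<lambda>k \<omega>. \<kappa> (eul A' x m k \<omega>)) s \<omega>
       = eint (gr m) (2^m) H s \<omega>"
      unfolding eint_def sum_subtractf[symmetric] matrix_vector_mult_diff_rdistrib[symmetric]
    proof (intro sum.cong refl)
      fix k assume "k \<in> {..<(2::nat)^m}"
      then show "(\<kappa> (eul A x m k \<omega>) - \<kappa> (eul A' x m k \<omega>)) *v (W (clip (gr m k) (gr m (Suc k)) s) \<omega> - W (gr m k) \<omega>)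
        = H k \<omega> *v (W (clip (gr m k) (gr m (Suc k)) s) \<omega> - W (gr m k) \<omega>)"
        using inG[of k] by (cases "gr m k < s") (auto simp: H_def clip_lower[OF _ gr_le_Suc])
    qed
    have drift_le: "norm (drift A x m s \<omega> - drift A' x m s \<omega>) \<le> norm (R \<omega>)"
    proof -
      have "norm (drift A x m s \<omega> - drift A' x m s \<omega>) \<le> (\<Sum>k<2^m. (T / 2^m) * (L * norm (D k \<omega>)))"
        unfolding drift_def sum_subtractf[symmetric] scaleR_right_diff_distrib[symmetric]
      proof (rule order_trans[OF norm_sum], rule sum_mono)
        fix k assume "k \<in> {..<(2::nat)^m}"
        then have k: "k < 2^m" by simp
        show "norm ((clip (gr m k) (gr m (Suc k)) s - gr m k) *\<^sub>R (b (eul A x m k \<omega>) - b (eul A' x m k \<omega>))) \<le> (T / 2^m) * (L * norm (D k \<omega>))"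
        proof (cases "gr m k < s")
          case True
          have "\<bar>clip (gr m k) (gr m (Suc k)) s - gr m k\<bar> \<le> T / 2^m"
            using clip_bounds[OF gr_le_Suc, of m k s] gr_step[of m k] by simp
          then show ?thesis unfolding norm_scaleR using inG[OF True k] b_lip T_pos by (intro mult_mono) (auto simp: D_def)
        next
          case False
          then show ?thesis using T_pos L_nonneg by (simp add: clip_lower[OF _ gr_le_Suc])
        qed
      qed
      then show ?thesis by (simp add: R_def)
    qed
    have "norm (eulc A x m s \<omega> - eulc A' x m s \<omega>) \<le> norm (A s \<omega> - A' s \<omega>) + norm (drift A x m s \<omega> - drift A' x m s \<omega>) + norm (eint (gr m) (2^m) H s \<omega>)"
    proof -
      have eq: "eulc A x m s \<omega> - eulc A' x m s \<omega> = (A s \<omega> - A' s \<omega>) + (drift A x m s \<omega> - drift A' x m s \<omega>) + eint (gr m) (2^m) H s \<omega>"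
        unfolding eulc_def eint_eq[symmetric] by simp
      show ?thesis unfolding eq
        using norm_triangle_ineq[of "(A s \<omega> - A' s \<omega>) + (drift A x m s \<omega> - drift A' x m s \<omega>)" "eint (gr m) (2^m) H s \<omega>"]
          norm_triangle_ineq[of "A s \<omega> - A' s \<omega>" "drift A x m s \<omega> - drift A' x m s \<omega>"] by linarith
    qed
    moreover have "norm (A s \<omega> - A' s \<omega>) \<le> sqrt \<gamma>"
    proof -
      have "norm (A s \<omega> - A' s \<omega>) \<le> \<gamma> * \<nu> s \<omega>" by (rule close[OF \<omega>M s(1,3)])
      also have "\<dots> \<le> \<gamma> * N" using forcing_mono[OF A \<omega>M s(1,2) S(2)] \<nu>N \<gamma> by (intro mult_left_mono) auto
      finally show ?thesis by (simp add: N(2))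
    qed
    moreover have "norm (R \<omega>) \<le> sqrt \<gamma>" using \<omega> by auto
    moreover have "norm (eint (gr m) (2^m) H s \<omega>) \<le> sqrt \<gamma>" using B1(3)[of \<omega> s] \<omega> s by auto
    \<comment> \<open>One \<open>sqrt \<gamma>\<close> each from the forcing, the drift and the
      stochastic part.\<close>
    ultimately show "norm (eulc A x m s \<omega> - eulc A' x m s \<omega>) \<le> 3 * sqrt \<gamma>" using drift_le by linarith
  qed
qed

text \<open>Both solutions are replaced by schemes of a common level \<open>m\<close>, fine enough
  for accuracy \<open>sqrt \<gamma>\<close>. As the bound for the schemes is uniform in
  \<open>m\<close>, this costs two further \<open>sqrt \<gamma>\<close> in distance, hence 3 + 2 =
  5, and two in probability.\<close>

lemma solution_stability:
  assumes A: "forcing A \<nu>" and A': "forcing A' \<nu>" and X: "solves A x X" and X': "solves A' x X'"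
    and close: "\<And>\<omega> s. \<omega> \<in> space M \<Longrightarrow> 0 \<le> s \<Longrightarrow> s \<le> T \<Longrightarrow> norm (A s \<omega> - A' s \<omega>) \<le> \<gamma> * \<nu> s \<omega>"
    and S: "0 \<le> S" "S \<le> T" and \<gamma>: "0 < \<gamma>" and C1: "(\<integral>\<omega>. \<nu> S \<omega> \<partial>M) \<le> C1"
  shows "\<exists>B\<in>sets M. prob B \<le> ((T + T\<^sup>2) * L\<^sup>2 * (4 * C1 * exp ((4 * T + 2) * L\<^sup>2 * T)) + C1 + 2) * sqrt \<gamma> \<and>
     (\<forall>\<omega>\<in>space M - B. \<forall>s\<in>{0..S}. norm (X s \<omega> - X' s \<omega>) \<le> 5 * sqrt \<gamma>)"
proof -
  have sq: "0 < sqrt \<gamma>" using \<gamma> by simp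
  obtain m1 where m1: "\<And>m. m1 \<le> m \<Longrightarrow> \<exists>B\<in>sets M. prob B \<le> sqrt \<gamma> \<and> (\<forall>\<omega>\<in>space M - B. \<forall>s\<in>{0..T}. norm (eulc A x m s \<omega> - X s \<omega>) \<le> sqrt \<gamma>)"
    using euler_approximates_solution[OF A X sq] by blast
  obtain m2 where m2: "\<And>m. m2 \<le> m \<Longrightarrow> \<exists>B\<in>sets M. prob B \<le> sqrt \<gamma> \<and> (\<forall>\<omega>\<in>space M - B. \<forall>s\<in>{0..T}. norm (eulc A' x m s \<omega> - X' s \<omega>) \<le> sqrt \<gamma>)"
    using euler_approximates_solution[OF A' X' sq] by blast
  define m where "m = max m1 m2"
  obtain B1 where B1: "B1 \<in> sets M" "prob B1 \<le> sqrt \<gamma>" "\<And>\<omega> s. \<omega> \<in> space M - B1 \<Longrightarrow> s \<in> {0..T} \<Longrightarrow> norm (eulc A x m s \<omega> - X s \<omega>) \<le> sqrt \<gamma>"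
    using m1[of m] by (auto simp: m_def)
  obtain B2 where B2: "B2 \<in> sets M" "prob B2 \<le> sqrt \<gamma>" "\<And>\<omega> s. \<omega> \<in> space M - B2 \<Longrightarrow> s \<in> {0..T} \<Longrightarrow> norm (eulc A' x m s \<omega> - X' s \<omega>) \<le> sqrt \<gamma>"
    using m2[of m] by (auto simp: m_def)
  define K where "K = (T + T\<^sup>2) * L\<^sup>2 * (4 * C1 * exp ((4 * T + 2) * L\<^sup>2 * T)) + C1"
  obtain B3 where B3: "B3 \<in> sets M" "prob B3 \<le> K * sqrt \<gamma>" "\<And>\<omega> s. \<omega> \<in> space M - B3 \<Longrightarrow> s \<in> {0..S} \<Longrightarrow> norm (eulc A x m s \<omega> - eulc A' x m s \<omega>) \<le> 3 * sqrt \<gamma>"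
    using euler_stability[OF A A' close S \<gamma> C1, of x m] unfolding K_def by blast
  show ?thesis
  proof (intro bexI[of _ "B1 \<union> B2 \<union> B3"] conjI ballI)
    have "prob (B1 \<union> B2 \<union> B3) \<le> prob B1 + prob B2 + prob B3"
      using measure_Un_le[OF sets.Un[OF B1(1) B2(1)] B3(1)] measure_Un_le[OF B1(1) B2(1)] by linarith
    also have "\<dots> \<le> (K + 2) * sqrt \<gamma>" using B1(2) B2(2) B3(2) by (simp add: distrib_right)
    finally show "prob (B1 \<union> B2 \<union> B3) \<le> ((T + T\<^sup>2) * L\<^sup>2 * (4 * C1 * exp ((4 * T + 2) * L\<^sup>2 * T)) + C1 + 2) * sqrt \<gamma>"
      by (simp add: K_def)
    fix \<omega> s assume \<omega>: "\<omega> \<in> space M - (B1 \<union> B2 \<union> B3)" and s: "s \<in> {0..S}"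
    have 1: "norm (eulc A x m s \<omega> - X s \<omega>) \<le> sqrt \<gamma>" "norm (eulc A' x m s \<omega> - X' s \<omega>) \<le> sqrt \<gamma>" "norm (eulc A x m s \<omega> - eulc A' x m s \<omega>) \<le> 3 * sqrt \<gamma>"
      using B1(3)[of \<omega> s] B2(3)[of \<omega> s] B3(3)[of \<omega> s] \<omega> s S by auto
    have "norm (X s \<omega> - X' s \<omega>) \<le> norm (X s \<omega> - eulc A x m s \<omega>) + norm (eulc A x m s \<omega> - eulc A' x m s \<omega>) + norm (eulc A' x m s \<omega> - X' s \<omega>)"
      using norm_triangle_ineq[of "X s \<omega> - eulc A x m s \<omega>" "eulc A x m s \<omega> - X' s \<omega>"]
        norm_triangle_ineq[of "eulc A x m s \<omega> - eulc A' x m s \<omega>" "eulc A' x m s \<omega> - X' s \<omega>"] by simp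
    then show "norm (X s \<omega> - X' s \<omega>) \<le> 5 * sqrt \<gamma>" using 1 by (simp add: norm_minus_commute)
  qed (use B1(1) B2(1) B3(1) in auto)
qed

end

section \<open>Stieltjes measures of increasing paths and controls\<close>

text \<open>The pathwise conditions under which \<open>nu_dist\<close> is a distribution function.
  The horizon is a parameter so that paths can be restricted to shorter intervals.\<close>

definition inc_path :: "real \<Rightarrow> (real \<Rightarrow> 'a \<Rightarrow> real) \<Rightarrow> 'a \<Rightarrow> bool" where
  "inc_path T \<nu> \<omega> \<longleftrightarrow> 0 \<le> T \<and> 0 \<le> \<nu> 0 \<omega> \<and> mono_on {0..T} (\<lambda>s. \<nu> s \<omega>) \<and>
     (\<forall>s\<in>{0..<T}. continuous (at_right s) (\<lambda>r. \<nu> r \<omega>))"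

lemma inc_path_restrict: "inc_path T \<nu> \<omega> \<Longrightarrow> 0 \<le> s \<Longrightarrow> s \<le> T \<Longrightarrow> inc_path s \<nu> \<omega>"
  by (auto simp: inc_path_def intro: mono_on_subset)

lemma inc_path_mono: "inc_path T \<nu> \<omega> \<Longrightarrow> 0 \<le> u \<Longrightarrow> u \<le> v \<Longrightarrow> v \<le> T \<Longrightarrow> \<nu> u \<omega> \<le> \<nu> v \<omega>"
  by (auto simp: inc_path_def intro: mono_onD)

lemma inc_path_nonneg: "inc_path T \<nu> \<omega> \<Longrightarrow> 0 \<le> v \<Longrightarrow> v \<le> T \<Longrightarrow> 0 \<le> \<nu> v \<omega>"
  using inc_path_mono[of T \<nu> \<omega> 0 v] by (auto simp: inc_path_def)

context
  fixes T :: real and \<nu> :: "real \<Rightarrow> 'a \<Rightarrow> real" and \<omega> :: 'a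
  assumes inc: "inc_path T \<nu> \<omega>"
begin

lemma nu_dist_mono: "x \<le> y \<Longrightarrow> nu_dist T \<nu> \<omega> x \<le> nu_dist T \<nu> \<omega> y"
  using inc inc_path_nonneg[OF inc, of "min y T"] inc_path_mono[OF inc, of "min x T" "min y T"]
  by (auto simp: nu_dist_def inc_path_def)

lemma nu_dist_right_continuous: "continuous (at_right a) (nu_dist T \<nu> \<omega>)"
proof -
  have "(nu_dist T \<nu> \<omega> \<longlongrightarrow> nu_dist T \<nu> \<omega> a) (at_right a)"
  proof (cases "a < 0")
    case True
    then have "eventually (\<lambda>r. nu_dist T \<nu> \<omega> r = 0) (at_right a)"
      by (auto simp: eventually_at_right[OF True] nu_dist_def)
    then have "(nu_dist T \<nu> \<omega> \<longlongrightarrow> 0) (at_right a)" by (rule tendsto_eventually)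
    then show ?thesis using True by (simp add: nu_dist_def)
  next
    case False
    then have a0: "0 \<le> a" by simp
    show ?thesis
    proof (cases "a < T")
      case True
      then have "((\<lambda>r. \<nu> r \<omega>) \<longlongrightarrow> \<nu> a \<omega>) (at_right a)"
        using inc a0 by (auto simp: inc_path_def continuous_within)
      moreover have "eventually (\<lambda>r. \<nu> r \<omega> = nu_dist T \<nu> \<omega> r) (at_right a)"
        unfolding eventually_at_right[OF True] using True a0 by (intro exI[of _ T]) (auto simp: nu_dist_def)
      ultimately have "(nu_dist T \<nu> \<omega> \<longlongrightarrow> \<nu> a \<omega>) (at_right a)" by (rule Lim_transform_eventually)
      then show ?thesis using True a0 by (simp add: nu_dist_def)
    next
      case False
      have "eventually (\<lambda>r. nu_dist T \<nu> \<omega> r = \<nu> T \<omega>) (at_right a)"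
        unfolding eventually_at_right[OF less_add_one[of a]] using False a0 by (intro exI[of _ "a + 1"]) (auto simp: nu_dist_def)
      then have "(nu_dist T \<nu> \<omega> \<longlongrightarrow> \<nu> T \<omega>) (at_right a)" by (rule tendsto_eventually)
      then show ?thesis using False a0 by (simp add: nu_dist_def)
    qed
  qed
  then show ?thesis by (simp add: continuous_within)
qed

lemma nu_dist_at_bot: "(nu_dist T \<nu> \<omega> \<longlongrightarrow> 0) at_bot"
  by (rule tendsto_eventually) (auto simp: eventually_at_bot_dense nu_dist_def intro: exI[of _ 0])

lemma nu_dist_at_top: "(nu_dist T \<nu> \<omega> \<longlongrightarrow> \<nu> T \<omega>) at_top"
  using inc by (intro tendsto_eventually) (auto simp: eventually_at_top_linorder nu_dist_def inc_path_def intro!: exI[of _ T])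

lemma nu_T_nonneg: "0 \<le> \<nu> T \<omega>"
  using inc inc_path_nonneg[OF inc, of T] by (auto simp: inc_path_def)

lemma emeasure_nu_Iic: "emeasure (interval_measure (nu_dist T \<nu> \<omega>)) {..x} = nu_dist T \<nu> \<omega> x"
  by (rule emeasure_interval_measure_Iic[OF nu_dist_mono nu_dist_right_continuous nu_dist_at_bot])

lemma finite_borel_nu: "finite_borel_measure (interval_measure (nu_dist T \<nu> \<omega>))"
  by (rule finite_borel_measure_interval_measure[OF nu_dist_mono nu_dist_right_continuous nu_dist_at_bot nu_dist_at_top nu_T_nonneg])

lemma finite_nu: "finite_measure (interval_measure (nu_dist T \<nu> \<omega>))"
  using finite_borel_nu by (simp add: finite_borel_measure_def)

lemma measure_nu_Ioc: "u \<le> v \<Longrightarrow> 0 \<le> u \<Longrightarrow> v \<le> T \<Longrightarrow> measure (interval_measure (nu_dist T \<nu> \<omega>)) {u<..v} = \<nu> v \<omega> - \<nu> u \<omega>"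
  using measure_interval_measure_Ioc[OF _ nu_dist_mono nu_dist_right_continuous, of u v] by (simp add: nu_dist_def)

lemma nu_negative_null: "{..<0} \<in> null_sets (interval_measure (nu_dist T \<nu> \<omega>))"
proof -
  have "(\<Union>n. {..- inverse (real (Suc n))}) = {..<0::real}"
  proof (intro set_eqI iffI)
    fix x :: real assume "x \<in> {..<0}"
    then obtain n where "inverse (real (Suc n)) < - x" using reals_Archimedean[of "- x"] by auto
    then show "x \<in> (\<Union>n. {..- inverse (real (Suc n))})" by (auto intro!: exI[of _ n])
  next
    fix x :: real assume "x \<in> (\<Union>n. {..- inverse (real (Suc n))})"
    then obtain n where "x \<le> - inverse (real (Suc n))" by auto
    moreover have "0 < inverse (real (Suc n))" by simp
    ultimately have "x < 0" by linarith
    then show "x \<in> {..<0}" by simp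
  qed
  moreover have "(\<Union>n. {..- inverse (real (Suc n))}) \<in> null_sets (interval_measure (nu_dist T \<nu> \<omega>))"
  proof (rule null_sets_UN)
    fix n
    have "nu_dist T \<nu> \<omega> (- inverse (real (Suc n))) = 0" by (simp add: nu_dist_def)
    then show "{..- inverse (real (Suc n))} \<in> null_sets (interval_measure (nu_dist T \<nu> \<omega>))"
      by (auto simp: null_sets_def emeasure_nu_Iic)
  qed
  ultimately show ?thesis by simp
qed

text \<open>Both sides have the same distribution function. Up to time \<open>s\<close> the measure
  involves only the path of \<open>\<nu>\<close> up to \<open>s\<close>, and this is what makes its
  integrals adapted.\<close>

lemma nu_restrict_eq:
  assumes s: "0 \<le> s" "s \<le> T"
  shows "density (interval_measure (nu_dist T \<nu> \<omega>)) (indicator {..s}) = interval_measure (nu_dist s \<nu> \<omega>)"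
proof (rule cdf_unique')
  let ?N = "interval_measure (nu_dist T \<nu> \<omega>)"
  have e: "emeasure (density ?N (indicator {..s})) B = emeasure ?N (B \<inter> {..s})" if "B \<in> sets borel" for B
    using that by (subst emeasure_density) (auto simp: indicator_inter_arith[symmetric] Int_commute intro!: nn_integral_cong)
  have "finite_measure (density ?N (indicator {..s}))"
    using e[of UNIV] by (intro finite_measureI) (simp add: emeasure_nu_Iic)
  then show "finite_borel_measure (density ?N (indicator {..s}))"
    by (simp add: finite_borel_measure_def finite_borel_measure_axioms_def)
  have inc': "inc_path s \<nu> \<omega>" by (rule inc_path_restrict[OF inc s])
  show "finite_borel_measure (interval_measure (nu_dist s \<nu> \<omega>))" by (rule Submission.finite_borel_nu[OF inc'])
  show "cdf (density ?N (indicator {..s})) = cdf (interval_measure (nu_dist s \<nu> \<omega>))"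
  proof
    fix x
    have "{..x} \<inter> {..s} = {..min x s}" by auto
    then have "emeasure (density ?N (indicator {..s})) {..x} = ennreal (nu_dist T \<nu> \<omega> (min x s))"
      using e[of "{..x}"] by (simp add: emeasure_nu_Iic)
    also have "nu_dist T \<nu> \<omega> (min x s) = nu_dist s \<nu> \<omega> x" using s by (auto simp: nu_dist_def min_def)
    also have "ennreal \<dots> = emeasure (interval_measure (nu_dist s \<nu> \<omega>)) {..x}" by (rule Submission.emeasure_nu_Iic[OF inc', symmetric])
    finally show "cdf (density ?N (indicator {..s})) x = cdf (interval_measure (nu_dist s \<nu> \<omega>)) x"
      by (simp add: cdf_def measure_def)
  qed
qed

lemma nu_set_integral_restrict:
  fixes f :: "real \<Rightarrow> 'b::euclidean_space"
  assumes s: "0 \<le> s" "s \<le> T" and f: "f \<in> borel_measurable borel"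
  shows "set_lebesgue_integral (interval_measure (nu_dist T \<nu> \<omega>)) {0..s} f = set_lebesgue_integral (interval_measure (nu_dist s \<nu> \<omega>)) {0..s} f"
proof -
  let ?N = "interval_measure (nu_dist T \<nu> \<omega>)"
  have i: "density ?N (indicator {..s}) = density ?N (\<lambda>r. ennreal (indicator {..s} r))"
    by (intro density_cong) (auto split: split_indicator)
  have "set_lebesgue_integral (interval_measure (nu_dist s \<nu> \<omega>)) {0..s} f = (\<integral>r. indicator {0..s} r *\<^sub>R f r \<partial>density ?N (\<lambda>r. ennreal (indicator {..s} r)))"
    unfolding nu_restrict_eq[OF s, symmetric] i set_lebesgue_integral_def ..
  also have "\<dots> = (\<integral>r. indicator {..s} r *\<^sub>R (indicator {0..s} r *\<^sub>R f r) \<partial>?N)"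
    using f by (intro integral_density) auto
  also have "\<dots> = set_lebesgue_integral ?N {0..s} f"
    unfolding set_lebesgue_integral_def by (intro Bochner_Integration.integral_cong) (auto split: split_indicator)
  finally show ?thesis ..
qed

lemma nu_set_integrable_bounded:
  fixes f :: "real \<Rightarrow> 'b::euclidean_space"
  assumes "f \<in> borel_measurable borel" "B \<in> sets borel" "\<And>r. norm (f r) \<le> C"
  shows "set_integrable (interval_measure (nu_dist T \<nu> \<omega>)) B f"
proof -
  interpret finite_measure "interval_measure (nu_dist T \<nu> \<omega>)" by (rule finite_nu)
  have "0 \<le> C" using assms(3)[of 0] norm_ge_zero order_trans by blast
  then show ?thesis unfolding set_integrable_def
    by (intro integrable_const_bound[of _ C]) (use assms in \<open>auto split: split_indicator\<close>)
qed

lemma nu_integral_increment: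
  fixes f :: "real \<Rightarrow> 'b::euclidean_space"
  assumes f: "f \<in> borel_measurable borel" "\<And>r. norm (f r) \<le> C" and uv: "0 \<le> u" "u \<le> v" "v \<le> T"
  shows "norm (set_lebesgue_integral (interval_measure (nu_dist T \<nu> \<omega>)) {0..v} f - set_lebesgue_integral (interval_measure (nu_dist T \<nu> \<omega>)) {0..u} f)
      \<le> C * (\<nu> v \<omega> - \<nu> u \<omega>)"
proof -
  let ?N = "interval_measure (nu_dist T \<nu> \<omega>)"
  have i: "set_integrable ?N B f" if "B \<in> sets borel" for B by (rule nu_set_integrable_bounded[OF f(1) that f(2)])
  have un: "{0..v} = {0..u} \<union> {u<..v}" using uv by auto
  have "set_lebesgue_integral ?N {0..v} f = set_lebesgue_integral ?N {0..u} f + set_lebesgue_integral ?N {u<..v} f"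
    unfolding un by (rule set_integral_Un) (auto intro: i)
  then have "norm (set_lebesgue_integral ?N {0..v} f - set_lebesgue_integral ?N {0..u} f) = norm (set_lebesgue_integral ?N {u<..v} f)" by simp
  also have "\<dots> \<le> (\<integral>r. norm (indicator {u<..v} r *\<^sub>R f r) \<partial>?N)"
    unfolding set_lebesgue_integral_def by (rule integral_norm_bound)
  also have "\<dots> \<le> (\<integral>r. C * indicator {u<..v} r \<partial>?N)"
  proof (rule integral_mono)
    show "integrable ?N (\<lambda>r. norm (indicator {u<..v} r *\<^sub>R f r))" using integrable_norm[OF i[of "{u<..v}", unfolded set_integrable_def]] by simp
    interpret finite_measure ?N by (rule finite_nu)
    show "integrable ?N (\<lambda>r. C * indicator {u<..v} r)" by (intro integrable_mult_right integrable_real_indicator) (auto simp: emeasure_eq_measure)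
  qed (use f(2) in \<open>auto split: split_indicator\<close>)
  also have "\<dots> = C * (\<nu> v \<omega> - \<nu> u \<omega>)" using measure_nu_Ioc[of u v] uv by simp
  finally show ?thesis .
qed

text \<open>The closed interval contains the atom \<open>\<nu> 0\<close> at time 0, so its mass is
  the full value at \<open>s\<close> and not an increment.\<close>

lemma nu_measure_Icc:
  assumes "0 \<le> s" "s \<le> T" shows "emeasure (interval_measure (nu_dist T \<nu> \<omega>)) {0..s} = ennreal (\<nu> s \<omega>)"
proof -
  have "{..s} = {0..s} \<union> {..<0}" using assms by auto
  then have "emeasure (interval_measure (nu_dist T \<nu> \<omega>)) {..s} = emeasure (interval_measure (nu_dist T \<nu> \<omega>)) {0..s}"
    using emeasure_Un_null_set[OF _ nu_negative_null, of "{0..s}"] by simp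
  moreover have "nu_dist T \<nu> \<omega> s = \<nu> s \<omega>" using assms by (simp add: nu_dist_def)
  ultimately show ?thesis using emeasure_nu_Iic[of s] by simp
qed

lemma nu_integral_bound:
  fixes f :: "real \<Rightarrow> 'b::euclidean_space"
  assumes f: "f \<in> borel_measurable borel" "\<And>r. norm (f r) \<le> C" and s: "0 \<le> s" "s \<le> T"
  shows "norm (set_lebesgue_integral (interval_measure (nu_dist T \<nu> \<omega>)) {0..s} f) \<le> C * \<nu> s \<omega>"
proof -
  let ?N = "interval_measure (nu_dist T \<nu> \<omega>)"
  interpret finite_measure ?N by (rule finite_nu)
  have i: "set_integrable ?N {0..s} f" by (rule nu_set_integrable_bounded[OF f(1) _ f(2)]) simp
  have "norm (set_lebesgue_integral ?N {0..s} f) \<le> (\<integral>r. norm (indicator {0..s} r *\<^sub>R f r) \<partial>?N)"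
    unfolding set_lebesgue_integral_def by (rule integral_norm_bound)
  also have "\<dots> \<le> (\<integral>r. C * indicator {0..s} r \<partial>?N)"
  proof (rule integral_mono)
    show "integrable ?N (\<lambda>r. norm (indicator {0..s} r *\<^sub>R f r))" using integrable_norm[OF i[unfolded set_integrable_def]] .
    show "integrable ?N (\<lambda>r. C * indicator {0..s} r)" by (intro integrable_mult_right integrable_real_indicator) (auto simp: emeasure_eq_measure)
  qed (use f(2) in \<open>auto split: split_indicator\<close>)
  also have "\<dots> = C * \<nu> s \<omega>" using nu_measure_Icc[OF s] inc_path_nonneg[OF inc s] by (simp add: measure_def)
  finally show ?thesis .
qed

end

text \<open>The Stieltjes measure is normalised by \<open>1 / (1 + \<nu> s)\<close> because measurable kernels are only
  available as maps into subprobability measures.\<close>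
lemma nu_kernel_nn_integral:
  fixes N :: "'a measure"
  assumes s: "0 \<le> s" and inc: "\<And>\<omega>. \<omega> \<in> space N \<Longrightarrow> inc_path s \<nu> \<omega>"
    and \<nu>: "\<And>r. 0 \<le> r \<Longrightarrow> r \<le> s \<Longrightarrow> \<nu> r \<in> borel_measurable N"
    and f: "(\<lambda>(\<omega>, r). f \<omega> r) \<in> borel_measurable (N \<Otimes>\<^sub>M borel)"
  shows "(\<lambda>\<omega>. \<integral>\<^sup>+r. f \<omega> r \<partial>interval_measure (nu_dist s \<nu> \<omega>)) \<in> borel_measurable N"
proof -
  define c where "c \<omega> = ennreal (1 / (1 + \<nu> s \<omega>))" for \<omega>
  define K where "K \<omega> = scale_measure (c \<omega>) (interval_measure (nu_dist s \<nu> \<omega>))" for \<omega>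
  have [measurable]: "\<nu> s \<in> borel_measurable N" using \<nu> s by simp
  have dm: "(\<lambda>\<omega>. nu_dist s \<nu> \<omega> x) \<in> borel_measurable N" for x
    using \<nu>[of "min x s"] s by (cases "x < 0") (auto simp: nu_dist_def)
  have U: "emeasure (interval_measure (nu_dist s \<nu> \<omega>)) UNIV = ennreal (\<nu> s \<omega>)" if "\<omega> \<in> space N" for \<omega>
    by (rule interval_measure_UNIV[OF nu_dist_mono[OF inc[OF that]] nu_dist_right_continuous[OF inc[OF that]]
          nu_dist_at_bot[OF inc[OF that]] nu_dist_at_top[OF inc[OF that]] nu_T_nonneg[OF inc[OF that]]])
  have "K \<in> measurable N (subprob_algebra borel)"
  proof (rule measurable_subprob_algebra_generated[where \<Omega>=UNIV and G="range atMost"])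
    show "sets (borel::real measure) = sigma_sets UNIV (range atMost)" by (simp add: borel_eq_atMost)
    show "Int_stable (range (atMost :: real \<Rightarrow> _))" by (auto simp: Int_stable_def)
    show "subprob_space (K \<omega>)" if "\<omega> \<in> space N" for \<omega>
    proof (rule subprob_spaceI)
      have n: "0 \<le> \<nu> s \<omega>" using nu_T_nonneg[OF inc[OF that]] .
      have "emeasure (K \<omega>) (space (K \<omega>)) = ennreal (1 / (1 + \<nu> s \<omega>)) * ennreal (\<nu> s \<omega>)"
        using U[OF that] by (simp add: K_def c_def space_scale_measure)
      also have "\<dots> = ennreal (\<nu> s \<omega> / (1 + \<nu> s \<omega>))" using n by (simp add: ennreal_mult'[symmetric])
      also have "\<dots> \<le> 1" using n by (simp add: ennreal_le_1)
      finally show "emeasure (K \<omega>) (space (K \<omega>)) \<le> 1" .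
    qed (simp add: K_def space_scale_measure)
    show "sets (K \<omega>) = sets borel" for \<omega> by (simp add: K_def)
    show "(\<lambda>\<omega>. emeasure (K \<omega>) B) \<in> borel_measurable N" if B: "B \<in> range atMost" for B
    proof -
      obtain x where x: "B = {..x}" using B by auto
      have "(\<lambda>\<omega>. c \<omega> * ennreal (nu_dist s \<nu> \<omega> x)) \<in> borel_measurable N"
        unfolding c_def using dm by measurable
      then show ?thesis
        by (rule measurable_cong[THEN iffD1, rotated]) (simp add: x K_def emeasure_nu_Iic[OF inc])
    qed
    have "(\<lambda>\<omega>. c \<omega> * ennreal (\<nu> s \<omega>)) \<in> borel_measurable N" unfolding c_def by measurable
    then show "(\<lambda>\<omega>. emeasure (K \<omega>) UNIV) \<in> borel_measurable N"
      by (rule measurable_cong[THEN iffD1, rotated]) (simp add: K_def U)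
  qed auto
  from nn_integral_measurable_subprob_algebra2[OF f this]
  have "(\<lambda>\<omega>. ennreal (1 + \<nu> s \<omega>) * integral\<^sup>N (K \<omega>) (f \<omega>)) \<in> borel_measurable N" by measurable
  then show ?thesis
  proof (rule measurable_cong[THEN iffD1, rotated])
    fix \<omega> assume \<omega>: "\<omega> \<in> space N"
    have n: "0 \<le> \<nu> s \<omega>" using nu_T_nonneg[OF inc[OF \<omega>]] .
    have "(\<lambda>r. f \<omega> r) \<in> borel_measurable borel" using measurable_Pair2[OF f \<omega>] by simp
    then have "integral\<^sup>N (K \<omega>) (f \<omega>) = c \<omega> * (\<integral>\<^sup>+r. f \<omega> r \<partial>interval_measure (nu_dist s \<nu> \<omega>))"
      by (simp add: K_def nn_integral_scale_measure)
    moreover have "ennreal (1 + \<nu> s \<omega>) * c \<omega> = 1"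
    proof -
      have "ennreal (1 + \<nu> s \<omega>) * c \<omega> = ennreal ((1 + \<nu> s \<omega>) * (1 / (1 + \<nu> s \<omega>)))"
        unfolding c_def by (rule ennreal_mult[symmetric]) (use n in auto)
      then show ?thesis using n by simp
    qed
    ultimately show "ennreal (1 + \<nu> s \<omega>) * integral\<^sup>N (K \<omega>) (f \<omega>) = (\<integral>\<^sup>+r. f \<omega> r \<partial>interval_measure (nu_dist s \<nu> \<omega>))"
      by (simp add: mult.assoc[symmetric])
  qed
qed

lemma nu_kernel_integral:
  fixes N :: "'a measure" and f :: "'a \<Rightarrow> real \<Rightarrow> real"
  assumes s: "0 \<le> s" and inc: "\<And>\<omega>. \<omega> \<in> space N \<Longrightarrow> inc_path s \<nu> \<omega>"
    and \<nu>: "\<And>r. 0 \<le> r \<Longrightarrow> r \<le> s \<Longrightarrow> \<nu> r \<in> borel_measurable N"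
    and f: "(\<lambda>(\<omega>, r). f \<omega> r) \<in> borel_measurable (N \<Otimes>\<^sub>M borel)" and bd: "\<And>\<omega> r. \<bar>f \<omega> r\<bar> \<le> C"
  shows "(\<lambda>\<omega>. \<integral>r. f \<omega> r \<partial>interval_measure (nu_dist s \<nu> \<omega>)) \<in> borel_measurable N"
proof -
  have f1: "(\<lambda>(\<omega>, r). ennreal (f \<omega> r)) \<in> borel_measurable (N \<Otimes>\<^sub>M borel)" and f2: "(\<lambda>(\<omega>, r). ennreal (- f \<omega> r)) \<in> borel_measurable (N \<Otimes>\<^sub>M borel)"
    using f by (auto simp: split_beta')
  have "(\<lambda>\<omega>. enn2real (\<integral>\<^sup>+r. ennreal (f \<omega> r) \<partial>interval_measure (nu_dist s \<nu> \<omega>)) - enn2real (\<integral>\<^sup>+r. ennreal (- f \<omega> r) \<partial>interval_measure (nu_dist s \<nu> \<omega>))) \<in> borel_measurable N"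
    using nu_kernel_nn_integral[OF s inc \<nu> f1] nu_kernel_nn_integral[OF s inc \<nu> f2] by measurable
  then show ?thesis
  proof (rule measurable_cong[THEN iffD1, rotated])
    fix \<omega> assume \<omega>: "\<omega> \<in> space N"
    have "(\<lambda>r. f \<omega> r) \<in> borel_measurable borel" using measurable_Pair2[OF f \<omega>] by simp
    from nu_set_integrable_bounded[OF inc[OF \<omega>] this, of UNIV C] bd
    have "integrable (interval_measure (nu_dist s \<nu> \<omega>)) (f \<omega>)" by (simp add: set_integrable_def)
    then show "enn2real (\<integral>\<^sup>+r. ennreal (f \<omega> r) \<partial>interval_measure (nu_dist s \<nu> \<omega>)) - enn2real (\<integral>\<^sup>+r. ennreal (- f \<omega> r) \<partial>interval_measure (nu_dist s \<nu> \<omega>))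
        = (\<integral>r. f \<omega> r \<partial>interval_measure (nu_dist s \<nu> \<omega>))"
      by (rule real_lebesgue_integral_def[symmetric])
  qed
qed

text \<open>A control has norm one only almost surely; after truncation the bounds on its integrals hold for
  every \<open>\<omega>\<close>.\<close>
definition trunc :: "real^'d::finite \<Rightarrow> real^'d" where
  "trunc v = (1 / max 1 (norm v)) *\<^sub>R v"

lemma norm_trunc: "norm (trunc v) \<le> 1"
proof -
  have "0 < max 1 (norm v)" by (simp add: less_max_iff_disj)
  then show ?thesis by (simp add: trunc_def divide_le_eq_1)
qed

lemma trunc_eq: "norm v \<le> 1 \<Longrightarrow> trunc v = v"
  by (simp add: trunc_def max_absorb1)

lemma trunc_measurable [measurable]: "trunc \<in> borel_measurable borel"
  unfolding trunc_def[abs_def] by measurable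

lemma gscale_measurable [measurable]: "gscale D0 \<gamma> \<in> borel_measurable borel"
proof (rule borel_measurable_continuous_onI)
  show "continuous_on UNIV (gscale D0 \<gamma>)"
    unfolding gscale_def
  proof (rule continuous_on_vec_lambda)
    show "continuous_on UNIV (\<lambda>x. if i \<in> D0 then x $ i else \<gamma> * x $ i)" for i
      by (cases "i \<in> D0") (auto intro!: continuous_intros)
  qed
qed

lemma norm_le_componentwise:
  fixes v w :: "real^'d::finite"
  assumes "\<And>i. \<bar>v $ i\<bar> \<le> \<bar>w $ i\<bar>" shows "norm v \<le> norm w"
  unfolding norm_vec_def by (rule L2_set_mono) (use assms in auto)

lemma norm_gscale: "0 \<le> \<gamma> \<Longrightarrow> \<gamma> \<le> 1 \<Longrightarrow> norm (gscale D0 \<gamma> v) \<le> norm (v::real^'d::finite)"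
  by (rule norm_le_componentwise) (auto simp: gscale_def abs_mult intro: mult_left_le_one_le)

text \<open>Only coordinates outside \<open>D0\<close> differ, each by the factor
  \<open>\<gamma>\<close>. The gap of order \<open>\<gamma>\<close> between the two forcings
  originates here.\<close>

lemma norm_gscale_diff: "0 \<le> \<gamma> \<Longrightarrow> norm (gscale D0 \<gamma> v - gscale D0 0 v) \<le> \<gamma> * norm (v::real^'d::finite)"
proof -
  assume "0 \<le> \<gamma>"
  then have "norm (gscale D0 \<gamma> v - gscale D0 0 v) \<le> norm (\<gamma> *\<^sub>R v)"
    by (intro norm_le_componentwise) (auto simp: gscale_def)
  then show ?thesis using \<open>0 \<le> \<gamma>\<close> by simp
qed

lemma gscale_id: "(\<And>i. i \<notin> D0 \<Longrightarrow> v $ i = 0) \<Longrightarrow> gscale D0 \<gamma> v = v"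
  by (auto simp: gscale_def vec_eq_iff)

lemma gscale_1: "gscale D0 1 v = v"
  by (auto simp: gscale_def vec_eq_iff)

section \<open>Controls as forcings of the equation\<close>

context sde
begin

lemma controlsD:
  assumes "(n, \<nu>) \<in> controls M F T"
  shows "progressive F T n" "AE \<omega> in M. \<forall>s\<in>{0..T}. norm (n s \<omega>) = 1"
    "0 \<le> s \<Longrightarrow> s \<le> T \<Longrightarrow> \<nu> s \<in> borel_measurable (F s)" "\<omega> \<in> space M \<Longrightarrow> inc_path T \<nu> \<omega>"
    "integrable M (\<lambda>\<omega>. (\<nu> T \<omega>)\<^sup>2)"
  using assms T_pos by (auto simp: controls_def inc_path_def)

text \<open>Clipping time to \<open>{0..s}\<close> extends the control to the whole line while using
  only its values up to \<open>s\<close>; progressive measurability thereby becomes joint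
  measurability over \<open>F s\<close>.\<close>

lemma progressive_joint:
  fixes n :: "real \<Rightarrow> 'a \<Rightarrow> real^'d"
  assumes "progressive F T n" "0 \<le> s" "s \<le> T"
  shows "(\<lambda>(\<omega>, r). n (clip 0 s r) \<omega>) \<in> borel_measurable (F s \<Otimes>\<^sub>M borel)"
proof -
  have 1: "(\<lambda>(r, \<omega>). n r \<omega>) \<in> borel_measurable (restrict_space borel {0..s} \<Otimes>\<^sub>M F s)"
    using assms by (auto simp: progressive_def)
  have c: "(\<lambda>p. clip 0 s (snd p)) \<in> F s \<Otimes>\<^sub>M borel \<rightarrow>\<^sub>M restrict_space borel {0..s}"
    unfolding clip_def using assms by (intro measurable_restrict_space2) auto
  have "(\<lambda>p. (clip 0 s (snd p), fst p)) \<in> F s \<Otimes>\<^sub>M borel \<rightarrow>\<^sub>M restrict_space borel {0..s} \<Otimes>\<^sub>M F s"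
    by (intro measurable_Pair c measurable_fst)
  from measurable_compose[OF this 1] show ?thesis by (simp add: split_beta')
qed

lemma progressive_path:
  fixes n :: "real \<Rightarrow> 'a \<Rightarrow> real^'d"
  assumes "progressive F T n" "0 \<le> s" "s \<le> T" "\<omega> \<in> space M"
  shows "(\<lambda>r. n (clip 0 s r) \<omega>) \<in> borel_measurable borel"
  using measurable_Pair2[OF progressive_joint[OF assms(1-3)], of \<omega>] assms(4) by simp

text \<open>The map \<open>\<phi>\<close> is left open because three integrals of one control occur:
  that of the scaled direction, that of its projection, and that of the norm of the projection,
  which becomes a new intensity.\<close>

definition ctrl_int :: "(real^'d \<Rightarrow> 'b::euclidean_space) \<Rightarrow> (real \<Rightarrow> 'a \<Rightarrow> real^'d) \<Rightarrow> (real \<Rightarrow> 'a \<Rightarrow> real) \<Rightarrow> real \<Rightarrow> 'a \<Rightarrow> 'b" where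
  "ctrl_int \<phi> n \<nu> s \<omega> = set_lebesgue_integral (interval_measure (nu_dist T \<nu> \<omega>)) {0..s} (\<lambda>r. \<phi> (n r \<omega>))"

lemma ctrl_int_clip:
  assumes "s \<le> s'"
  shows "ctrl_int \<phi> n \<nu> s \<omega> = set_lebesgue_integral (interval_measure (nu_dist T \<nu> \<omega>)) {0..s} (\<lambda>r. \<phi> (n (clip 0 s' r) \<omega>))"
  unfolding ctrl_int_def set_lebesgue_integral_def using assms
  by (intro Bochner_Integration.integral_cong) (auto simp: clip_mid split: split_indicator)

context
  fixes n :: "real \<Rightarrow> 'a \<Rightarrow> real^'d" and \<nu> and \<phi> :: "real^'d \<Rightarrow> 'b::euclidean_space"
  assumes c: "(n, \<nu>) \<in> controls M F T" and \<phi>: "\<phi> \<in> borel_measurable borel" "\<And>v. norm (\<phi> v) \<le> 1"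
begin

lemma ctrl_path_measurable:
  assumes "0 \<le> s" "s \<le> T" "\<omega> \<in> space M"
  shows "(\<lambda>r. \<phi> (n (clip 0 s r) \<omega>)) \<in> borel_measurable borel"
  by (rule measurable_compose[OF progressive_path[OF controlsD(1)[OF c] assms] \<phi>(1)])

text \<open>Up to time \<open>s\<close> the measure may be replaced by that of the path stopped at
  \<open>s\<close>, and the integrand by its clipped version. Both depend measurably on
  \<open>\<omega>\<close> over \<open>F s\<close>, so the kernel lemma applies coordinate by
  coordinate.\<close>

lemma ctrl_int_adapted:
  assumes s: "0 \<le> s" "s \<le> T"
  shows "ctrl_int \<phi> n \<nu> s \<in> borel_measurable (F s)"
proof (subst borel_measurable_euclidean_space, rule ballI)
  fix e :: 'b assume e: "e \<in> Basis"
  let ?f = "\<lambda>\<omega> r. indicator {0..s} r * (\<phi> (n (clip 0 s r) \<omega>) \<bullet> e)"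
  have inc: "inc_path s \<nu> \<omega>" if "\<omega> \<in> space (F s)" for \<omega>
    using inc_path_restrict[OF controlsD(4)[OF c] s] that by simp
  have "(\<lambda>(\<omega>, r). \<phi> (n (clip 0 s r) \<omega>)) \<in> borel_measurable (F s \<Otimes>\<^sub>M borel)"
    using measurable_compose[OF progressive_joint[OF controlsD(1)[OF c] s] \<phi>(1)] by (simp add: split_beta')
  then have fm: "(\<lambda>(\<omega>, r). ?f \<omega> r) \<in> borel_measurable (F s \<Otimes>\<^sub>M borel)" by (auto simp: split_beta')
  have fb: "\<bar>?f \<omega> r\<bar> \<le> 1" for \<omega> r
    using Basis_le_norm[OF e, of "\<phi> (n (clip 0 s r) \<omega>)"] \<phi>(2)[of "n (clip 0 s r) \<omega>"] by (auto split: split_indicator)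
  have "(\<lambda>\<omega>. \<integral>r. ?f \<omega> r \<partial>interval_measure (nu_dist s \<nu> \<omega>)) \<in> borel_measurable (F s)"
  proof (rule nu_kernel_integral[OF s(1) inc _ fm fb])
    fix r assume "0 \<le> r" "r \<le> s"
    then show "\<nu> r \<in> borel_measurable (F s)" using controlsD(3)[OF c, of r] s measurable_F_mono[of r s] by auto
  qed
  then show "(\<lambda>\<omega>. ctrl_int \<phi> n \<nu> s \<omega> \<bullet> e) \<in> borel_measurable (F s)"
  proof (rule measurable_cong[THEN iffD1, rotated])
    fix \<omega> assume "\<omega> \<in> space (F s)"
    then have \<omega>: "\<omega> \<in> space M" by simp
    note m = ctrl_path_measurable[OF s \<omega>]
    have "ctrl_int \<phi> n \<nu> s \<omega> = set_lebesgue_integral (interval_measure (nu_dist s \<nu> \<omega>)) {0..s} (\<lambda>r. \<phi> (n (clip 0 s r) \<omega>))"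
      unfolding ctrl_int_clip[OF order_refl] by (rule nu_set_integral_restrict[OF controlsD(4)[OF c \<omega>] s m])
    moreover have "integrable (interval_measure (nu_dist s \<nu> \<omega>)) (\<lambda>r. indicator {0..s} r *\<^sub>R \<phi> (n (clip 0 s r) \<omega>))"
      using nu_set_integrable_bounded[OF inc_path_restrict[OF controlsD(4)[OF c \<omega>] s] m, of "{0..s}" 1] \<phi>(2) by (simp add: set_integrable_def)
    ultimately show "(\<integral>r. ?f \<omega> r \<partial>interval_measure (nu_dist s \<nu> \<omega>)) = ctrl_int \<phi> n \<nu> s \<omega> \<bullet> e"
      by (simp add: set_lebesgue_integral_def integral_inner_left[symmetric])
  qed
qed

lemma ctrl_int_increment:
  assumes "\<omega> \<in> space M" "0 \<le> u" "u \<le> v" "v \<le> T"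
  shows "norm (ctrl_int \<phi> n \<nu> v \<omega> - ctrl_int \<phi> n \<nu> u \<omega>) \<le> \<nu> v \<omega> - \<nu> u \<omega>"
proof -
  have uT: "u \<le> T" using assms by simp
  show ?thesis
    unfolding ctrl_int_clip[OF assms(4)] ctrl_int_clip[OF uT]
    using nu_integral_increment[OF controlsD(4)[OF c assms(1)] ctrl_path_measurable[OF _ order_refl assms(1)] \<phi>(2) assms(2-4)] T_pos by simp
qed

lemma ctrl_int_bound:
  assumes "\<omega> \<in> space M" "0 \<le> s" "s \<le> T"
  shows "norm (ctrl_int \<phi> n \<nu> s \<omega>) \<le> \<nu> s \<omega>"
  unfolding ctrl_int_clip[OF assms(3)]
  using nu_integral_bound[OF controlsD(4)[OF c assms(1)] ctrl_path_measurable[OF _ order_refl assms(1)] \<phi>(2) assms(2,3)] T_pos by simp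

end

lemma control_forcing:
  assumes c: "(n, \<nu>) \<in> controls M F T" and \<phi>: "\<phi> \<in> borel_measurable borel" "\<And>v. norm (\<phi> v) \<le> 1"
  shows "forcing (ctrl_int \<phi> n \<nu>) \<nu>"
  unfolding forcing_def
proof (intro conjI ballI allI impI)
  show "L2 (\<nu> T)" using controlsD(5)[OF c] measurable_F[OF controlsD(3)[OF c]] T_pos by (auto simp: L2_def)
qed (use ctrl_int_adapted[OF c \<phi>] ctrl_int_increment[OF c \<phi>] ctrl_int_bound[OF c \<phi>] controlsD[OF c] T_pos in \<open>auto simp: inc_path_def\<close>)

lemma ctrl_int_close:
  fixes \<phi> \<psi> :: "real^'d \<Rightarrow> real^'d"
  assumes c: "(n, \<nu>) \<in> controls M F T"
    and \<phi>: "\<phi> \<in> borel_measurable borel" "\<And>v. norm (\<phi> v) \<le> 1" and \<psi>: "\<psi> \<in> borel_measurable borel" "\<And>v. norm (\<psi> v) \<le> 1"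
    and d: "\<And>v. norm (\<phi> v - \<psi> v) \<le> \<gamma>" and s: "\<omega> \<in> space M" "0 \<le> s" "s \<le> T"
  shows "norm (ctrl_int \<phi> n \<nu> s \<omega> - ctrl_int \<psi> n \<nu> s \<omega>) \<le> \<gamma> * \<nu> s \<omega>"
proof -
  note inc = controlsD(4)[OF c s(1)]
  note m = ctrl_path_measurable[OF c \<phi> less_imp_le[OF T_pos] order_refl s(1)] ctrl_path_measurable[OF c \<psi> less_imp_le[OF T_pos] order_refl s(1)]
  have i: "set_integrable (interval_measure (nu_dist T \<nu> \<omega>)) {0..s} (\<lambda>r. \<phi> (n (clip 0 T r) \<omega>))"
    "set_integrable (interval_measure (nu_dist T \<nu> \<omega>)) {0..s} (\<lambda>r. \<psi> (n (clip 0 T r) \<omega>))"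
    using nu_set_integrable_bounded[OF inc m(1) _ \<phi>(2)] nu_set_integrable_bounded[OF inc m(2) _ \<psi>(2)] by auto
  show ?thesis
    unfolding ctrl_int_clip[OF s(3)] set_integral_diff(2)[OF i, symmetric]
    by (rule nu_integral_bound[OF inc borel_measurable_diff[OF m] d s(2,3)])
qed

lemma solves_cong:
  assumes "\<And>s. 0 \<le> s \<Longrightarrow> s \<le> T \<Longrightarrow> AE \<omega> in M. A s \<omega> = A' s \<omega>"
  shows "solves A x X \<longleftrightarrow> solves A' x X"
proof -
  have *: "solves A' x X" if eq: "\<And>s. 0 \<le> s \<Longrightarrow> s \<le> T \<Longrightarrow> AE \<omega> in M. A s \<omega> = A' s \<omega>" and sol: "solves A x X" for A A'
    unfolding solves_def
  proof (intro conjI ballI)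
    show "cadlag_adapted X" using sol by (simp add: solves_def)
    fix s assume s: "s \<in> {0..T}"
    then obtain I where I: "I \<in> borel_measurable M"
        "\<forall>\<epsilon>>0. (\<lambda>m. prob {\<omega>\<in>space M. norm (ito_sum W \<kappa> X s m \<omega> - I \<omega>) > \<epsilon>}) \<longlonglongrightarrow> 0"
        "AE \<omega> in M. X s \<omega> = x + integral {0..s} (\<lambda>r. b (X r \<omega>)) + I \<omega> + A s \<omega>"
      using sol unfolding solves_def by meson
    have "AE \<omega> in M. A s \<omega> = A' s \<omega>" using eq s by simp
    with I(3) have "AE \<omega> in M. X s \<omega> = x + integral {0..s} (\<lambda>r. b (X r \<omega>)) + I \<omega> + A' s \<omega>" by eventually_elim simp
    then show "\<exists>I. I \<in> borel_measurable M \<and>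
        (\<forall>\<epsilon>>0. (\<lambda>m. prob {\<omega>\<in>space M. norm (ito_sum W \<kappa> X s m \<omega> - I \<omega>) > \<epsilon>}) \<longlonglongrightarrow> 0) \<and>
        (AE \<omega> in M. X s \<omega> = x + integral {0..s} (\<lambda>r. b (X r \<omega>)) + I \<omega> + A' s \<omega>)"
      using I by blast
  qed
  have "AE \<omega> in M. A' s \<omega> = A s \<omega>" if "0 \<le> s" "s \<le> T" for s using assms[OF that] by eventually_elim simp
  then show ?thesis using *[of A A'] *[of A' A] assms by blast
qed

text \<open>Truncation affects the control only for \<open>\<omega>\<close> in a null set, and being
  a solution is insensitive to almost sure changes of the forcing at each time.\<close>

lemma is_solution_iff_solves:
  assumes c: "(n, \<nu>) \<in> controls M F T"
  shows "is_solution M F W T D0 b \<kappa> x n \<nu> \<gamma> X \<longleftrightarrow> solves (ctrl_int (\<lambda>v. gscale D0 \<gamma> (trunc v)) n \<nu>) x X"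
proof -
  have "is_solution M F W T D0 b \<kappa> x n \<nu> \<gamma> X \<longleftrightarrow> solves (ctrl_int (gscale D0 \<gamma>) n \<nu>) x X"
    by (simp add: is_solution_def solves_def cadlag_adapted_def ctrl_int_def)
  also have "\<dots> \<longleftrightarrow> solves (ctrl_int (\<lambda>v. gscale D0 \<gamma> (trunc v)) n \<nu>) x X"
  proof (rule solves_cong)
    fix s assume s: "0 \<le> s" "s \<le> T"
    show "AE \<omega> in M. ctrl_int (gscale D0 \<gamma>) n \<nu> s \<omega> = ctrl_int (\<lambda>v. gscale D0 \<gamma> (trunc v)) n \<nu> s \<omega>"
      using controlsD(2)[OF c]
    proof eventually_elim
      case (elim \<omega>)
      show ?case unfolding ctrl_int_def set_lebesgue_integral_def
        by (intro Bochner_Integration.integral_cong) (use elim s in \<open>auto simp: trunc_eq split: split_indicator\<close>)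
    qed
  qed
  finally show ?thesis .
qed

lemma gscale_trunc:
  assumes "0 \<le> \<gamma>" "\<gamma> \<le> 1"
  shows "(\<lambda>v. gscale D0 \<gamma> (trunc v)) \<in> borel_measurable borel" "norm (gscale D0 \<gamma> (trunc v)) \<le> 1"
proof -
  show "(\<lambda>v. gscale D0 \<gamma> (trunc v)) \<in> borel_measurable borel" by measurable
  show "norm (gscale D0 \<gamma> (trunc v)) \<le> 1" using norm_gscale[OF assms, of D0 "trunc v"] norm_trunc[of v] by linarith
qed

text \<open>\<open>state\<close> is a choice, so it acquires properties only through the existence
  of some solution.\<close>

lemma state_solves:
  assumes c: "(n, \<nu>) \<in> controls M F T" and \<gamma>: "0 \<le> \<gamma>" "\<gamma> \<le> 1"
  shows "solves (ctrl_int (\<lambda>v. gscale D0 \<gamma> (trunc v)) n \<nu>) x (state M F W T D0 b \<kappa> x n \<nu> \<gamma>)"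
proof -
  have f: "forcing (ctrl_int (\<lambda>v. gscale D0 \<gamma> (trunc v)) n \<nu>) \<nu>"
    by (rule control_forcing[OF c gscale_trunc[OF \<gamma>]])
  have "\<exists>Y. solves (ctrl_int (\<lambda>v. gscale D0 \<gamma> (trunc v)) n \<nu>) x Y"
  proof (rule solution_exists[OF f, of x])
    fix Y assume "solves (ctrl_int (\<lambda>v. gscale D0 \<gamma> (trunc v)) n \<nu>) x Y"
    then show "\<exists>Y. solves (ctrl_int (\<lambda>v. gscale D0 \<gamma> (trunc v)) n \<nu>) x Y" by (intro exI[of _ Y])
  qed
  then obtain Y where "is_solution M F W T D0 b \<kappa> x n \<nu> \<gamma> Y" using is_solution_iff_solves[OF c] by metis
  then have "is_solution M F W T D0 b \<kappa> x n \<nu> \<gamma> (state M F W T D0 b \<kappa> x n \<nu> \<gamma>)"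
    unfolding state_def by (rule someI[of "is_solution M F W T D0 b \<kappa> x n \<nu> \<gamma>" Y])
  then show ?thesis by (rule is_solution_iff_solves[OF c, THEN iffD1])
qed

end

definition proj :: "'d set \<Rightarrow> real^'d::finite \<Rightarrow> real^'d" where
  "proj D0 v = gscale D0 0 (trunc v)"

text \<open>Where the projection vanishes the direction is arbitrary, since \<^const>\<open>proj\<close> also weights the measure.\<close>
definition dir :: "'d set \<Rightarrow> 'd \<Rightarrow> real^'d::finite \<Rightarrow> real^'d" where
  "dir D0 i0 v = (if proj D0 v = 0 then axis i0 1 else (1 / norm (proj D0 v)) *\<^sub>R proj D0 v)"

lemma proj_measurable [measurable]: "proj D0 \<in> borel_measurable borel"
  unfolding proj_def[abs_def] by measurable

lemma dir_measurable [measurable]: "dir D0 i0 \<in> borel_measurable borel"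
  unfolding dir_def[abs_def] by measurable

lemma norm_proj: "norm (proj D0 v) \<le> 1"
  using norm_gscale[of 0 D0 "trunc v"] norm_trunc[of v] by (simp add: proj_def)

lemma norm_dir: "norm (dir D0 i0 v) = 1"
  by (simp add: dir_def)

lemma dir_proj: "norm (proj D0 v) *\<^sub>R dir D0 i0 v = proj D0 v"
  by (simp add: dir_def)

lemma dir_constrained: "i0 \<in> D0 \<Longrightarrow> i \<notin> D0 \<Longrightarrow> dir D0 i0 v $ i = 0"
  by (auto simp: dir_def proj_def gscale_def axis_def)

section \<open>Projection of controls onto the constrained directions\<close>

context sde
begin

text \<open>The intensity of the projected control: the length of the first-block displacement.
  Together with \<open>dir\<close> as direction it reproduces the forcing
  \<open>proj\<close>.\<close>

definition nubar :: "'d set \<Rightarrow> (real \<Rightarrow> 'a \<Rightarrow> real^'d) \<Rightarrow> (real \<Rightarrow> 'a \<Rightarrow> real) \<Rightarrow> real \<Rightarrow> 'a \<Rightarrow> real" where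
  "nubar D0 n \<nu> = ctrl_int (\<lambda>v. norm (proj D0 v)) n \<nu>"

context
  fixes D0 :: "'d set" and n :: "real \<Rightarrow> 'a \<Rightarrow> real^'d" and \<nu>
  assumes c: "(n, \<nu>) \<in> controls M F T"
begin

lemma normproj: "(\<lambda>v. norm (proj D0 v)) \<in> borel_measurable borel" "norm (norm (proj D0 v)) \<le> 1"
  using norm_proj by (measurable, auto)

lemma nubar_mono:
  assumes "\<omega> \<in> space M" "0 \<le> u" "u \<le> v" "v \<le> T"
  shows "nubar D0 n \<nu> u \<omega> \<le> nubar D0 n \<nu> v \<omega>"
proof -
  note inc = controlsD(4)[OF c assms(1)]
  have uT: "u \<le> T" using assms by simp
  have m: "(\<lambda>r. norm (proj D0 (n (clip 0 T r) \<omega>))) \<in> borel_measurable borel"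
    using ctrl_path_measurable[OF c normproj less_imp_le[OF T_pos] order_refl assms(1)] .
  have i: "set_integrable (interval_measure (nu_dist T \<nu> \<omega>)) B (\<lambda>r. norm (proj D0 (n (clip 0 T r) \<omega>)))" if "B \<in> sets borel" for B
    by (rule nu_set_integrable_bounded[OF inc m that normproj(2)])
  show ?thesis
    unfolding nubar_def ctrl_int_clip[OF assms(4)] ctrl_int_clip[OF uT] set_lebesgue_integral_def
    using i[of "{0..u}"] i[of "{0..v}"] assms unfolding set_integrable_def
    by (intro integral_mono) (auto split: split_indicator)
qed

text \<open>Right-continuity is inherited from \<open>\<nu>\<close>, whose increments dominate those
  of the new intensity.\<close>

lemma nubar_inc_path:
  assumes "\<omega> \<in> space M" shows "inc_path T (nubar D0 n \<nu>) \<omega>"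
  unfolding inc_path_def
proof (intro conjI ballI)
  show "0 \<le> T" using T_pos by simp
  show "0 \<le> nubar D0 n \<nu> 0 \<omega>" unfolding nubar_def ctrl_int_def set_lebesgue_integral_def
    by (rule integral_nonneg_AE) (auto split: split_indicator)
  show "mono_on {0..T} (\<lambda>s. nubar D0 n \<nu> s \<omega>)" using nubar_mono[OF assms] by (auto intro!: mono_onI)
  have f: "forcing (ctrl_int (proj D0) n \<nu>) \<nu>" by (rule control_forcing[OF c proj_measurable norm_proj])
  fix s assume s: "s \<in> {0..<T}"
  have "((\<lambda>r. \<nu> r \<omega>) \<longlongrightarrow> \<nu> s \<omega>) (at_right s)"
    using forcingD(5)[OF f assms] s by (simp add: continuous_within)
  then have "((\<lambda>r. \<nu> r \<omega> - \<nu> s \<omega>) \<longlongrightarrow> 0) (at_right s)" using LIM_zero by blast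
  moreover have "eventually (\<lambda>r. norm (nubar D0 n \<nu> r \<omega> - nubar D0 n \<nu> s \<omega>) \<le> \<nu> r \<omega> - \<nu> s \<omega>) (at_right s)"
  proof -
    have "eventually (\<lambda>r. r \<in> {s<..<T}) (at_right s)" using s by (intro eventually_at_right_real) auto
    then show ?thesis
      by eventually_elim (use ctrl_int_increment[OF c normproj assms] s in \<open>auto simp: nubar_def\<close>)
  qed
  ultimately have "((\<lambda>r. nubar D0 n \<nu> r \<omega> - nubar D0 n \<nu> s \<omega>) \<longlongrightarrow> 0) (at_right s)"
    by (rule Lim_null_comparison[rotated])
  then show "continuous (at_right s) (\<lambda>r. nubar D0 n \<nu> r \<omega>)"
    by (simp add: continuous_within LIM_zero_cancel)
qed

lemma nubar_le: "\<omega> \<in> space M \<Longrightarrow> 0 \<le> s \<Longrightarrow> s \<le> T \<Longrightarrow> nubar D0 n \<nu> s \<omega> \<le> \<nu> s \<omega>"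
  using ctrl_int_bound[OF c normproj, of \<omega> s] by (simp add: nubar_def)

lemma projected_control:
  assumes i0: "i0 \<in> D0"
  shows "(\<lambda>s \<omega>. dir D0 i0 (n s \<omega>), nubar D0 n \<nu>) \<in> constrained_controls M F T D0"
proof -
  have prog: "progressive F T (\<lambda>s \<omega>. dir D0 i0 (n s \<omega>))"
    unfolding progressive_def
  proof
    fix t assume "t \<in> {0..T}"
    then have "(\<lambda>(s, \<omega>). n s \<omega>) \<in> borel_measurable (restrict_space borel {0..t} \<Otimes>\<^sub>M F t)"
      using controlsD(1)[OF c] by (auto simp: progressive_def)
    from measurable_compose[OF this dir_measurable]
    show "(\<lambda>(s, \<omega>). dir D0 i0 (n s \<omega>)) \<in> borel_measurable (restrict_space borel {0..t} \<Otimes>\<^sub>M F t)" by (simp add: split_beta')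
  qed
  have ad: "nubar D0 n \<nu> s \<in> borel_measurable (F s)" if "0 \<le> s" "s \<le> T" for s
    unfolding nubar_def by (rule ctrl_int_adapted[OF c normproj that])
  have "L2 (nubar D0 n \<nu> T)"
  proof (rule L2_mono)
    show "L2 (\<nu> T)" using forcingD(3)[OF control_forcing[OF c proj_measurable norm_proj]] .
    show "nubar D0 n \<nu> T \<in> borel_measurable M" using measurable_F[OF ad] T_pos by auto
    show "norm (nubar D0 n \<nu> T \<omega>) \<le> norm (\<nu> T \<omega>)" if "\<omega> \<in> space M" for \<omega>
      using nubar_le[OF that, of T] inc_path_nonneg[OF nubar_inc_path[OF that], of T] T_pos by auto
  qed
  then have "integrable M (\<lambda>\<omega>. (nubar D0 n \<nu> T \<omega>)\<^sup>2)" by (simp add: L2_def)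
  then show ?thesis
    using prog ad nubar_inc_path i0
    by (auto simp: constrained_controls_def controls_def inc_path_def norm_dir dir_constrained)
qed

text \<open>Equality of distribution functions, since \<open>nubar\<close> is itself an integral
  against the measure of \<open>\<nu>\<close>. It allows integrals against the new intensity to be
  rewritten with the old one.\<close>

lemma nubar_measure:
  assumes \<omega>: "\<omega> \<in> space M"
  shows "interval_measure (nu_dist T (nubar D0 n \<nu>) \<omega>)
     = density (interval_measure (nu_dist T \<nu> \<omega>)) (\<lambda>r. ennreal (indicator {0..T} r * norm (proj D0 (n (clip 0 T r) \<omega>))))"
    (is "?L = density ?N (\<lambda>r. ennreal (?w r))")
proof (rule cdf_unique')
  note inc = controlsD(4)[OF c \<omega>]
  note inc' = nubar_inc_path[OF \<omega>]
  have m: "(\<lambda>r. norm (proj D0 (n (clip 0 T r) \<omega>))) \<in> borel_measurable borel"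
    using ctrl_path_measurable[OF c normproj less_imp_le[OF T_pos] order_refl \<omega>] .
  then have wm: "?w \<in> borel_measurable borel" by measurable
  have w: "0 \<le> ?w r" "norm (?w r) \<le> 1" for r using normproj(2) by (auto split: split_indicator)
  have iw: "integrable ?N (\<lambda>r. indicator B r * ?w r)" if "B \<in> sets borel" for B
    using nu_set_integrable_bounded[OF inc wm that w(2)] by (simp add: set_integrable_def)
  have e: "emeasure (density ?N (\<lambda>r. ennreal (?w r))) B = ennreal (\<integral>r. indicator B r * ?w r \<partial>?N)" if B: "B \<in> sets borel" for B
  proof -
    have "emeasure (density ?N (\<lambda>r. ennreal (?w r))) B = (\<integral>\<^sup>+r. ennreal (indicator B r * ?w r) \<partial>?N)"
      using B wm by (subst emeasure_density) (auto intro!: nn_integral_cong split: split_indicator)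
    also have "\<dots> = ennreal (\<integral>r. indicator B r * ?w r \<partial>?N)"
      by (rule nn_integral_eq_integral[OF iw[OF B]]) (use w in \<open>auto split: split_indicator\<close>)
    finally show ?thesis .
  qed
  show "finite_borel_measure ?L" by (rule finite_borel_nu[OF inc'])
  have "finite_measure (density ?N (\<lambda>r. ennreal (?w r)))" using e[of UNIV] by (intro finite_measureI) simp
  then show "finite_borel_measure (density ?N (\<lambda>r. ennreal (?w r)))"
    by (simp add: finite_borel_measure_def finite_borel_measure_axioms_def)
  show "cdf ?L = cdf (density ?N (\<lambda>r. ennreal (?w r)))"
  proof
    fix x
    have "emeasure (density ?N (\<lambda>r. ennreal (?w r))) {..x} = ennreal (\<integral>r. indicator {..x} r * ?w r \<partial>?N)" by (rule e) simp
    also have "(\<integral>r. indicator {..x} r * ?w r \<partial>?N) = nu_dist T (nubar D0 n \<nu>) \<omega> x"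
    proof (cases "x < 0")
      case True
      then have "(\<lambda>r. indicator {..x} r * ?w r) = (\<lambda>r. 0)" by (auto split: split_indicator)
      then show ?thesis using True by (simp add: nu_dist_def)
    next
      case False
      have mT: "min x T \<le> T" by simp
      have "(\<integral>r. indicator {..x} r * ?w r \<partial>?N) = nubar D0 n \<nu> (min x T) \<omega>"
        unfolding nubar_def ctrl_int_clip[OF mT] set_lebesgue_integral_def
        by (intro Bochner_Integration.integral_cong) (auto split: split_indicator)
      then show ?thesis using False by (simp add: nu_dist_def)
    qed
    also have "ennreal \<dots> = emeasure ?L {..x}" by (rule emeasure_nu_Iic[OF inc', symmetric])
    finally show "cdf ?L x = cdf (density ?N (\<lambda>r. ennreal (?w r))) x" by (simp add: cdf_def measure_def)
  qed
qed

lemma nubar_set_integral: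
  fixes f :: "real \<Rightarrow> 'b::euclidean_space"
  assumes \<omega>: "\<omega> \<in> space M" and s: "0 \<le> s" "s \<le> T" and f: "f \<in> borel_measurable borel"
  shows "set_lebesgue_integral (interval_measure (nu_dist T (nubar D0 n \<nu>) \<omega>)) {0..s} f
     = set_lebesgue_integral (interval_measure (nu_dist T \<nu> \<omega>)) {0..s} (\<lambda>r. norm (proj D0 (n r \<omega>)) *\<^sub>R f r)"
proof -
  let ?N = "interval_measure (nu_dist T \<nu> \<omega>)"
  let ?w = "\<lambda>r. indicator {0..T} r * norm (proj D0 (n (clip 0 T r) \<omega>))"
  have m: "(\<lambda>r. norm (proj D0 (n (clip 0 T r) \<omega>))) \<in> borel_measurable borel"
    using ctrl_path_measurable[OF c normproj less_imp_le[OF T_pos] order_refl \<omega>] .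
  then have wm: "?w \<in> borel_measurable borel" by measurable
  have "set_lebesgue_integral (interval_measure (nu_dist T (nubar D0 n \<nu>) \<omega>)) {0..s} f = (\<integral>r. ?w r *\<^sub>R (indicator {0..s} r *\<^sub>R f r) \<partial>?N)"
    unfolding nubar_measure[OF \<omega>] set_lebesgue_integral_def
    by (rule integral_density) (use f wm in \<open>auto split: split_indicator\<close>)
  also have "\<dots> = set_lebesgue_integral ?N {0..s} (\<lambda>r. norm (proj D0 (n r \<omega>)) *\<^sub>R f r)"
    unfolding set_lebesgue_integral_def
    by (intro Bochner_Integration.integral_cong) (use s in \<open>auto simp: clip_mid split: split_indicator\<close>)
  finally show ?thesis .
qed

text \<open>Density times direction is the projection,
  \<open>norm (proj D0 v) *\<^sub>R dir D0 i0 v = proj D0 v\<close>. Hence the state of the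
  projected control is driven by \<open>proj\<close> integrated against the original
  \<open>\<nu>\<close>, and can be compared with the original state under one dominating
  process.\<close>

lemma projected_state_solves:
  assumes i0: "i0 \<in> D0"
  shows "solves (ctrl_int (proj D0) n \<nu>) x (state M F W T D0 b \<kappa> x (\<lambda>s \<omega>. dir D0 i0 (n s \<omega>)) (nubar D0 n \<nu>) 1)"
proof -
  let ?n = "\<lambda>s \<omega>. dir D0 i0 (n s \<omega>)"
  have c': "(?n, nubar D0 n \<nu>) \<in> controls M F T" using projected_control[OF i0] by (auto simp: constrained_controls_def)
  have "solves (ctrl_int (\<lambda>v. gscale D0 1 (trunc v)) ?n (nubar D0 n \<nu>)) x (state M F W T D0 b \<kappa> x ?n (nubar D0 n \<nu>) 1)"
    by (rule state_solves[OF c']) auto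
  then show ?thesis
  proof (rule solves_cong[THEN iffD1, rotated])
    fix s assume s: "0 \<le> s" "s \<le> T"
    show "AE \<omega> in M. ctrl_int (\<lambda>v. gscale D0 1 (trunc v)) ?n (nubar D0 n \<nu>) s \<omega> = ctrl_int (proj D0) n \<nu> s \<omega>"
    proof (rule AE_I2)
      fix \<omega> assume \<omega>: "\<omega> \<in> space M"
      have m: "(\<lambda>r. dir D0 i0 (n (clip 0 T r) \<omega>)) \<in> borel_measurable borel"
        using measurable_compose[OF progressive_path[OF controlsD(1)[OF c] less_imp_le[OF T_pos] order_refl \<omega>] dir_measurable] .
      have "ctrl_int (\<lambda>v. gscale D0 1 (trunc v)) ?n (nubar D0 n \<nu>) s \<omega>
         = set_lebesgue_integral (interval_measure (nu_dist T (nubar D0 n \<nu>) \<omega>)) {0..s} (\<lambda>r. dir D0 i0 (n (clip 0 T r) \<omega>))"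
        unfolding ctrl_int_clip[OF s(2)] by (simp add: gscale_1 trunc_eq norm_dir)
      also have "\<dots> = set_lebesgue_integral (interval_measure (nu_dist T \<nu> \<omega>)) {0..s} (\<lambda>r. norm (proj D0 (n r \<omega>)) *\<^sub>R dir D0 i0 (n (clip 0 T r) \<omega>))"
        by (rule nubar_set_integral[OF \<omega> s m])
      also have "\<dots> = ctrl_int (proj D0) n \<nu> s \<omega>"
        unfolding ctrl_int_def set_lebesgue_integral_def
        by (intro Bochner_Integration.integral_cong) (use s in \<open>auto simp: clip_mid dir_proj split: split_indicator\<close>)
      finally show "ctrl_int (\<lambda>v. gscale D0 1 (trunc v)) ?n (nubar D0 n \<nu>) s \<omega> = ctrl_int (proj D0) n \<nu> s \<omega>" .
    qed
  qed
qed

end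

text \<open>Below \<open>T\<close> the time \<open>\<sigma>\<close> is approximated strictly from
  the right by grid times, and right-continuity gives the limit; the \<open>+ 1\<close> after the
  floor ensures strictness. Where \<open>\<sigma> \<omega> = T\<close> no such time exists, and the
  cap at \<open>2^m\<close> evaluates at \<open>T\<close> itself.\<close>

lemma cadlag_at_random_time:
  assumes X: "cadlag_adapted X" and \<sigma>: "\<sigma> \<in> borel_measurable M" "\<And>\<omega>. \<omega> \<in> space M \<Longrightarrow> 0 \<le> \<sigma> \<omega> \<and> \<sigma> \<omega> \<le> T"
  shows "(\<lambda>\<omega>. X (\<sigma> \<omega>) \<omega>) \<in> borel_measurable M"
proof -
  define k where "k m \<omega> = nat (\<lfloor>\<sigma> \<omega> * 2^m / T\<rfloor> + 1)" for m \<omega>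
  define Z where "Z m \<omega> = X (gr m (min (k m \<omega>) (2^m))) \<omega>" for m \<omega>
  have Zm: "Z m \<in> borel_measurable M" for m
    unfolding Z_def[abs_def]
  proof (rule measurable_compose_countable[where g="k m" and f="\<lambda>i \<omega>. X (gr m (min i (2^m))) \<omega>"])
    show "(\<lambda>\<omega>. X (gr m (min i (2^m))) \<omega>) \<in> borel_measurable M" for i
      using cadlag_adapted_measurable[OF X gr_nonneg gr_le_T] by auto
    show "k m \<in> M \<rightarrow>\<^sub>M count_space UNIV" unfolding k_def using \<sigma>(1) by measurable
  qed
  have lim: "(\<lambda>m. Z m \<omega>) \<longlonglongrightarrow> X (\<sigma> \<omega>) \<omega>" if \<omega>: "\<omega> \<in> space M" for \<omega>
  proof -
    have s: "0 \<le> \<sigma> \<omega>" "\<sigma> \<omega> \<le> T" using \<sigma>(2)[OF \<omega>] by auto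
    have fl: "0 \<le> \<lfloor>\<sigma> \<omega> * 2^m / T\<rfloor>" for m using s T_pos by simp
    have kr: "real (k m \<omega>) = real_of_int \<lfloor>\<sigma> \<omega> * 2^m / T\<rfloor> + 1" for m using fl[of m] by (simp add: k_def)
    have k1: "\<sigma> \<omega> * 2^m / T < real (k m \<omega>)" "real (k m \<omega>) \<le> \<sigma> \<omega> * 2^m / T + 1" for m unfolding kr by linarith+
    show ?thesis
    proof (cases "\<sigma> \<omega> < T")
      case False
      then have sT: "\<sigma> \<omega> = T" using s by simp
      have "2^m \<le> k m \<omega>" for m
      proof -
        have "(2::real)^m < real (k m \<omega>)" using k1(1)[of m] T_pos by (simp add: sT)
        then show ?thesis by (metis less_imp_le of_nat_le_iff of_nat_numeral of_nat_power)
      qed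
      then have "Z m \<omega> = X T \<omega>" for m by (simp add: Z_def min_absorb2)
      then show ?thesis by (simp add: sT)
    next
      case True
      have kle: "k m \<omega> \<le> 2^m" for m
      proof -
        have "\<sigma> \<omega> * 2^m / T < 2^m" using True T_pos by (simp add: pos_divide_less_eq)
        then have "\<lfloor>\<sigma> \<omega> * 2^m / T\<rfloor> < 2^m" by (simp add: floor_less_iff)
        then have "\<lfloor>\<sigma> \<omega> * 2^m / T\<rfloor> + 1 \<le> 2^m" by simp
        then have "real_of_int (\<lfloor>\<sigma> \<omega> * 2^m / T\<rfloor> + 1) \<le> real_of_int (2^m)" by (rule of_int_le_iff[THEN iffD2])
        then have "real (k m \<omega>) \<le> 2^m" unfolding kr by simp
        then show ?thesis by (metis of_nat_le_iff of_nat_numeral of_nat_power)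
      qed
      define y where "y m = gr m (k m \<omega>)" for m
      have y1: "\<sigma> \<omega> < y m" for m
      proof -
        have "\<sigma> \<omega> * 2^m < real (k m \<omega>) * T" using k1(1)[of m] T_pos by (simp add: pos_divide_less_eq)
        then show ?thesis by (simp add: y_def gr_def pos_less_divide_eq mult.commute)
      qed
      have y2: "y m \<le> \<sigma> \<omega> + T / 2^m" for m
      proof -
        have "T * real (k m \<omega>) \<le> T * (\<sigma> \<omega> * 2^m / T + 1)" using k1(2)[of m] T_pos by (intro mult_left_mono) auto
        also have "\<dots> = \<sigma> \<omega> * 2^m + T" using T_pos by (simp add: distrib_left)
        finally have "T * real (k m \<omega>) / 2^m \<le> (\<sigma> \<omega> * 2^m + T) / 2^m" by (intro divide_right_mono) auto
        then show ?thesis by (simp add: y_def gr_def add_divide_distrib)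
      qed
      have p: "(\<lambda>m. \<sigma> \<omega> + T / 2 ^ m :: real) \<longlonglongrightarrow> \<sigma> \<omega> + 0"
        using LIMSEQ_realpow_zero[of "1/2::real", THEN tendsto_mult_left, of T] by (intro tendsto_intros) (simp add: power_divide)
      have "y \<longlonglongrightarrow> \<sigma> \<omega>"
        by (rule tendsto_sandwich[OF _ _ tendsto_const p[simplified]]) (use y1 y2 in \<open>auto intro!: always_eventually less_imp_le\<close>)
      moreover have "continuous (at_right (\<sigma> \<omega>)) (\<lambda>r. X r \<omega>)"
        using cadlag_adaptedD(2)[OF X \<omega>] s True by (auto simp: cadlag_def)
      ultimately have "(\<lambda>m. X (y m) \<omega>) \<longlonglongrightarrow> X (\<sigma> \<omega>) \<omega>"
        using right_continuous_sequentially[of "\<sigma> \<omega>" "\<lambda>r. X r \<omega>" y, OF _ y1] by blast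
      moreover have "Z m \<omega> = X (y m) \<omega>" for m using kle by (simp add: Z_def y_def min_absorb1)
      ultimately show ?thesis by simp
    qed
  qed
  show ?thesis by (rule borel_measurable_LIMSEQ_metric[OF Zm lim])
qed

end

section \<open>The games\<close>

text \<open>The conditions on \<open>g\<close>, \<open>h\<close> and \<open>f\<close> are confined
  to times in \<open>{0..T}\<close>; outside this range the functions are arbitrary, and times are
  clipped before continuity or measurability is claimed.\<close>

locale game = sde M F W T L b \<kappa>
  for M :: "'a measure" and F :: "real \<Rightarrow> 'a measure" and W :: "real \<Rightarrow> 'a \<Rightarrow> real^'e::finite"
    and T L :: real and b :: "real^'d::finite \<Rightarrow> real^'d" and \<kappa> :: "real^'d \<Rightarrow> real^'e^'d" +
  fixes D0 :: "'d set" and r K R :: real and g h :: "real \<times> (real^'d) \<Rightarrow> real" and f :: "real \<Rightarrow> real"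
  assumes D0_ne: "D0 \<noteq> {}" and r_nonneg: "0 \<le> r" and K_pos: "0 < K"
    and g_nonneg: "\<And>t x. t \<in> {0..T} \<Longrightarrow> 0 \<le> g (t, x)" and h_nonneg: "\<And>t x. t \<in> {0..T} \<Longrightarrow> 0 \<le> h (t, x)"
    and supp: "\<And>t x. t \<in> {0..T} \<Longrightarrow> R \<le> norm x \<Longrightarrow> g (t, x) = 0 \<and> h (t, x) = 0"
    and f_pos: "\<And>t. t \<in> {0..T} \<Longrightarrow> 0 < f t" and f_noninc: "antimono_on {0..T} f"
    and lip: "\<And>s t x y. s \<in> {0..T} \<Longrightarrow> t \<in> {0..T} \<Longrightarrow>
        \<bar>g (t, x) - g (s, y)\<bar> + \<bar>h (t, x) - h (s, y)\<bar> \<le> K * (norm (x - y) + \<bar>t - s\<bar>)"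
begin

text \<open>A bound for \<open>g\<close> and \<open>h\<close>: a point of norm below
  \<open>R\<close> is compared, by the Lipschitz condition, with a point of norm
  \<open>max R 0\<close>, where both functions vanish, at distance at most twice that norm. The
  maximum accommodates a negative \<open>R\<close>.\<close>

definition Cb :: real where "Cb = K * (2 * max R 0)"

lemma gh_bound: "t \<in> {0..T} \<Longrightarrow> g (t, x) \<le> Cb" "t \<in> {0..T} \<Longrightarrow> h (t, x) \<le> Cb" "0 \<le> Cb"
proof -
  show Cb: "0 \<le> Cb" using K_pos by (simp add: Cb_def)
  have "g (t, x) + h (t, x) \<le> Cb" if t: "t \<in> {0..T}" for t
  proof (cases "R \<le> norm x")
    case True then show ?thesis using supp[OF t True] Cb by simp
  next
    case False
    define y :: "real^'d" where "y = max R 0 *\<^sub>R axis (SOME i. True) 1"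
    have y: "norm y = max R 0" by (simp add: y_def)
    then have "R \<le> norm y" by simp
    note z = supp[OF t this]
    have "\<bar>g (t, x) - g (t, y)\<bar> + \<bar>h (t, x) - h (t, y)\<bar> \<le> K * (norm (x - y) + \<bar>t - t\<bar>)" by (rule lip[OF t t])
    also have "\<dots> \<le> K * (2 * max R 0)"
      using norm_triangle_ineq4[of x y] y False K_pos by (intro mult_left_mono) auto
    finally show ?thesis using z g_nonneg[OF t, of x] h_nonneg[OF t, of x] by (simp add: Cb_def)
  qed
  then show "t \<in> {0..T} \<Longrightarrow> g (t, x) \<le> Cb" "t \<in> {0..T} \<Longrightarrow> h (t, x) \<le> Cb"
    using g_nonneg[of t x] h_nonneg[of t x] by force+
qed

lemma clip_0T: "clip 0 T s \<in> {0..T}"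
  using clip_bounds[of 0 T s] T_pos by auto

lemma gh_continuous: "continuous_on UNIV (\<lambda>p. g (clip 0 T (fst p), snd p))" "continuous_on UNIV (\<lambda>p. h (clip 0 T (fst p), snd p))"
proof -
  have cl: "\<bar>clip 0 T s - clip 0 T s'\<bar> \<le> \<bar>s - s'\<bar>" for s s' by (auto simp: clip_def min_def max_def)
  have *: "\<bar>g (clip 0 T (fst p), snd p) - g (clip 0 T (fst q), snd q)\<bar> + \<bar>h (clip 0 T (fst p), snd p) - h (clip 0 T (fst q), snd q)\<bar> \<le> (2 * K) * dist p q" for p q
  proof -
    have "\<bar>g (clip 0 T (fst p), snd p) - g (clip 0 T (fst q), snd q)\<bar> + \<bar>h (clip 0 T (fst p), snd p) - h (clip 0 T (fst q), snd q)\<bar>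
      \<le> K * (norm (snd p - snd q) + \<bar>clip 0 T (fst p) - clip 0 T (fst q)\<bar>)" by (rule lip[OF clip_0T clip_0T])
    also have "\<dots> \<le> K * (dist p q + dist p q)"
      using K_pos cl[of "fst p" "fst q"] dist_fst_le[of p q] dist_snd_le[of p q]
      by (intro mult_left_mono add_mono) (auto simp: dist_norm)
    finally show ?thesis by simp
  qed
  have "\<bar>g (clip 0 T (fst p), snd p) - g (clip 0 T (fst q), snd q)\<bar> \<le> (2 * K) * dist p q"
    "\<bar>h (clip 0 T (fst p), snd p) - h (clip 0 T (fst q), snd q)\<bar> \<le> (2 * K) * dist p q" for p q
    using *[of p q] by linarith+
  then have "(2 * K)-lipschitz_on UNIV (\<lambda>p. g (clip 0 T (fst p), snd p))" "(2 * K)-lipschitz_on UNIV (\<lambda>p. h (clip 0 T (fst p), snd p))"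
    using K_pos by (simp_all add: lipschitz_on_def dist_real_def)
  then show "continuous_on UNIV (\<lambda>p. g (clip 0 T (fst p), snd p))" "continuous_on UNIV (\<lambda>p. h (clip 0 T (fst p), snd p))"
    by (auto intro: lipschitz_on_continuous_on)
qed

text \<open>A common frame for \<open>f\<close> and all \<open>f_gamma f K \<gamma>\<close>:
  monotonicity yields measurability and the upper bound \<open>c 0\<close>, domination of
  \<open>f\<close> yields the lower bound \<open>f T\<close>.\<close>

definition good_cost :: "(real \<Rightarrow> real) \<Rightarrow> bool" where
  "good_cost c \<longleftrightarrow> antimono_on {0..T} c \<and> (\<forall>t\<in>{0..T}. f t \<le> c t)"

lemma good_cost_f: "good_cost f"
  using f_noninc by (simp add: good_cost_def)

lemma good_cost_f_gamma: "0 \<le> \<gamma> \<Longrightarrow> good_cost (f_gamma f K \<gamma>)"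
  unfolding good_cost_def
proof (intro conjI ballI)
  assume \<gamma>: "0 \<le> \<gamma>"
  show "antimono_on {0..T} (f_gamma f K \<gamma>)"
  proof (rule monotone_onI)
    fix s s' assume s: "s \<in> {0..T}" "s' \<in> {0..T}" "s \<le> s'"
    then have "f s' \<le> f s" using f_noninc by (auto simp: monotone_on_def)
    then have "(f s')\<^sup>2 \<le> (f s)\<^sup>2" using f_pos[OF s(2)] by (intro power_mono) auto
    then show "f_gamma f K \<gamma> s' \<le> f_gamma f K \<gamma> s" by (simp add: f_gamma_def)
  qed
  fix t assume "t \<in> {0..T}"
  then have "f t = sqrt ((f t)\<^sup>2)" using f_pos by (simp add: less_imp_le)
  also have "\<dots> \<le> f_gamma f K \<gamma> t" unfolding f_gamma_def using \<gamma> by (intro real_sqrt_le_mono) simp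
  finally show "f t \<le> f_gamma f K \<gamma> t" .
qed

lemma good_costD:
  assumes "good_cost c" "t \<in> {0..T}"
  shows "0 < c t" "c t \<le> c 0" "f T \<le> c t"
proof -
  have "f T \<le> f t" using f_noninc assms T_pos by (auto simp: monotone_on_def)
  moreover have "f t \<le> c t" using assms by (simp add: good_cost_def)
  ultimately show "f T \<le> c t" by simp
  show "0 < c t" using f_pos[OF assms(2)] \<open>f t \<le> c t\<close> by simp
  show "c t \<le> c 0" using assms T_pos by (auto simp: good_cost_def monotone_on_def)
qed

lemma good_cost_measurable: "good_cost c \<Longrightarrow> (\<lambda>s. c (clip 0 T s)) \<in> borel_measurable borel"
proof -
  assume "good_cost c"
  then have "mono (\<lambda>s. - c (clip 0 T s))"
    using clip_0T clip_mono unfolding good_cost_def mono_def monotone_on_def neg_le_iff_le by metis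
  then have "(\<lambda>s. - (- c (clip 0 T s))) \<in> borel_measurable borel" by (intro borel_measurable_uminus borel_measurable_mono)
  then show ?thesis by simp
qed

text \<open>The payoff is split because the terminal reward \<open>Gp\<close> and the running reward
  \<open>Hp\<close> depend on the control through the state only and are bounded independently of
  it, while the control cost \<open>Np\<close> grows with \<open>\<nu>\<close>.\<close>

definition Gp where "Gp t X \<tau> \<omega> = exp (- r * \<tau> \<omega>) * g (t + \<tau> \<omega>, X (\<tau> \<omega>) \<omega>)"
definition Hp where "Hp t X \<tau> \<omega> = integral {0..\<tau> \<omega>} (\<lambda>s. exp (- r * s) * h (t + s, X s \<omega>))"
definition Np where "Np t c \<nu> \<tau> \<omega> = set_lebesgue_integral (interval_measure (nu_dist T \<nu> \<omega>)) {0..\<tau> \<omega>} (\<lambda>s. exp (- r * s) * c (t + s))"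

lemma payoff_eq: "payoff M F W T D0 b \<kappa> r g h c \<gamma> t x n \<nu> \<tau>
   = (\<integral>\<omega>. Gp t (state M F W T D0 b \<kappa> x n \<nu> \<gamma>) \<tau> \<omega> + Hp t (state M F W T D0 b \<kappa> x n \<nu> \<gamma>) \<tau> \<omega> + Np t c \<nu> \<tau> \<omega> \<partial>M)"
  by (simp add: payoff_def Let_def Gp_def Hp_def Np_def)

lemma stop_timesD:
  assumes "\<tau> \<in> stop_times M F T t"
  shows "\<tau> \<in> borel_measurable M" "\<omega> \<in> space M \<Longrightarrow> 0 \<le> \<tau> \<omega>" "\<omega> \<in> space M \<Longrightarrow> \<tau> \<omega> \<le> T - t"
proof -
  have "stopping_time F \<tau>" using assms by (simp add: stop_times_def)
  then show "\<tau> \<in> borel_measurable M" by (rule measurable_stopping_time) (auto simp: sets_F)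
qed (use assms in \<open>auto simp: stop_times_def\<close>)

lemma exp_bounds: "0 \<le> s \<Longrightarrow> exp (- r * s) \<le> 1" "0 \<le> s \<Longrightarrow> s \<le> T \<Longrightarrow> exp (- r * T) \<le> exp (- r * s)"
  using r_nonneg by (auto intro: mult_left_mono)

section \<open>Measurability and bounds of the three parts of the payoff\<close>

context
  fixes t :: real and \<tau> assumes t: "t \<in> {0..T}" and \<tau>: "\<tau> \<in> stop_times M F T t"
begin

lemma tau: "\<tau> \<in> borel_measurable M" "\<omega> \<in> space M \<Longrightarrow> 0 \<le> \<tau> \<omega> \<and> \<tau> \<omega> \<le> T - t \<and> \<tau> \<omega> \<le> T"
  "\<omega> \<in> space M \<Longrightarrow> 0 \<le> s \<Longrightarrow> s \<le> \<tau> \<omega> \<Longrightarrow> t + s \<in> {0..T}"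
  using stop_timesD[OF \<tau>] t by force+

lemma Gp_props:
  assumes X: "cadlag_adapted X"
  shows "Gp t X \<tau> \<in> borel_measurable M" "\<omega> \<in> space M \<Longrightarrow> 0 \<le> Gp t X \<tau> \<omega>" "\<omega> \<in> space M \<Longrightarrow> Gp t X \<tau> \<omega> \<le> Cb"
proof -
  have [measurable]: "\<tau> \<in> borel_measurable M" by (rule tau)
  have Xm: "(\<lambda>\<omega>. X (\<tau> \<omega>) \<omega>) \<in> borel_measurable M" by (rule cadlag_at_random_time[OF X tau(1)]) (use tau(2) in auto)
  have "(\<lambda>\<omega>. (t + \<tau> \<omega>, X (\<tau> \<omega>) \<omega>)) \<in> borel_measurable M" using Xm by (intro borel_measurable_Pair) auto
  from measurable_compose[OF this borel_measurable_continuous_onI[OF gh_continuous(1)]]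
  have [measurable]: "(\<lambda>\<omega>. g (clip 0 T (t + \<tau> \<omega>), X (\<tau> \<omega>) \<omega>)) \<in> borel_measurable M" by simp
  have "(\<lambda>\<omega>. exp (- r * \<tau> \<omega>) * g (clip 0 T (t + \<tau> \<omega>), X (\<tau> \<omega>) \<omega>)) \<in> borel_measurable M" by measurable
  then show "Gp t X \<tau> \<in> borel_measurable M"
    by (rule measurable_cong[THEN iffD1, rotated]) (use tau in \<open>auto simp: Gp_def clip_mid\<close>)
  assume \<omega>: "\<omega> \<in> space M"
  have tt: "t + \<tau> \<omega> \<in> {0..T}" using tau(3)[OF \<omega>, of "\<tau> \<omega>"] tau(2)[OF \<omega>] by simp
  show "0 \<le> Gp t X \<tau> \<omega>" using g_nonneg[OF tt] by (simp add: Gp_def)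
  have "Gp t X \<tau> \<omega> \<le> 1 * Cb" unfolding Gp_def
    using exp_bounds(1)[of "\<tau> \<omega>"] tau(2)[OF \<omega>] gh_bound(1)[OF tt] g_nonneg[OF tt] by (intro mult_mono) auto
  then show "Gp t X \<tau> \<omega> \<le> Cb" by simp
qed

text \<open>Along a cadlag path the integrand is bounded and right-continuous, so left Riemann sums
  converge. They evaluate the state at finitely many random times and thus also give measurability
  of the integral in \<open>\<omega>\<close>.\<close>

lemma Hp_integrand:
  assumes X: "cadlag_adapted X" and \<omega>: "\<omega> \<in> space M"
  shows "set_integrable lborel {0..\<tau> \<omega>} (\<lambda>s. exp (- r * s) * h (t + s, X s \<omega>))"
    and "(\<lambda>m. \<Sum>k<2^m. (\<tau> \<omega> / 2^m) *\<^sub>R (exp (- r * (\<tau> \<omega> * real k / 2^m)) * h (clip 0 T (t + \<tau> \<omega> * real k / 2^m), X (\<tau> \<omega> * real k / 2^m) \<omega>))) \<longlonglongrightarrow> Hp t X \<tau> \<omega>"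
    and "s \<in> {0..\<tau> \<omega>} \<Longrightarrow> 0 \<le> exp (- r * s) * h (t + s, X s \<omega>)" "s \<in> {0..\<tau> \<omega>} \<Longrightarrow> exp (- r * s) * h (t + s, X s \<omega>) \<le> Cb"
proof -
  let ?q = "\<lambda>s. exp (- r * s) * h (clip 0 T (t + s), X s \<omega>)"
  have eq: "?q s = exp (- r * s) * h (t + s, X s \<omega>)" if "s \<in> {0..\<tau> \<omega>}" for s
    using tau(3)[OF \<omega>, of s] that by (simp add: clip_mid)
  have bd: "0 \<le> ?q s" "?q s \<le> Cb" if "0 \<le> s" for s
  proof -
    show "0 \<le> ?q s" using h_nonneg[OF clip_0T] by simp
    have "?q s \<le> 1 * Cb" using exp_bounds(1)[OF that] gh_bound(2)[OF clip_0T] h_nonneg[OF clip_0T] by (intro mult_mono) auto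
    then show "?q s \<le> Cb" by simp
  qed
  have rc: "continuous (at_right s) ?q" if "0 \<le> s" "s < \<tau> \<omega>" for s
  proof -
    have "((\<lambda>r. X r \<omega>) \<longlongrightarrow> X s \<omega>) (at_right s)"
      using cadlag_adaptedD(2)[OF X \<omega>] that tau(2)[OF \<omega>] by (auto simp: cadlag_def continuous_within)
    then have "((\<lambda>u. (t + u, X u \<omega>)) \<longlongrightarrow> (t + s, X s \<omega>)) (at_right s)" by (intro tendsto_intros)
    from continuous_on_tendsto_compose[OF gh_continuous(2) this]
    have "((\<lambda>u. h (clip 0 T (t + u), X u \<omega>)) \<longlongrightarrow> h (clip 0 T (t + s), X s \<omega>)) (at_right s)" by simp
    then show ?thesis unfolding continuous_within by (intro tendsto_intros)
  qed
  have t0: "0 \<le> \<tau> \<omega>" using tau(2)[OF \<omega>] by simp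
  have nb: "norm (?q s) \<le> Cb" if "0 \<le> s" "s \<le> \<tau> \<omega>" for s using bd[OF that(1)] by simp
  have L: "set_integrable lborel {0..\<tau> \<omega>} ?q"
    "(\<lambda>m. \<Sum>k<2^m. (\<tau> \<omega> / 2^m) *\<^sub>R ?q (\<tau> \<omega> * real k / 2^m)) \<longlonglongrightarrow> integral {0..\<tau> \<omega>} ?q"
    by (rule left_riemann_sums[of "\<tau> \<omega>" ?q Cb]; fact t0 rc nb)+
  show "set_integrable lborel {0..\<tau> \<omega>} (\<lambda>s. exp (- r * s) * h (t + s, X s \<omega>))"
    using L(1) eq by (subst (asm) set_integrable_cong[OF refl refl]) auto
  have "integral {0..\<tau> \<omega>} ?q = Hp t X \<tau> \<omega>" unfolding Hp_def by (rule integral_cong) (rule eq)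
  then show "(\<lambda>m. \<Sum>k<2^m. (\<tau> \<omega> / 2^m) *\<^sub>R (exp (- r * (\<tau> \<omega> * real k / 2^m)) * h (clip 0 T (t + \<tau> \<omega> * real k / 2^m), X (\<tau> \<omega> * real k / 2^m) \<omega>))) \<longlonglongrightarrow> Hp t X \<tau> \<omega>"
    using L(2) by simp
  show "s \<in> {0..\<tau> \<omega>} \<Longrightarrow> 0 \<le> exp (- r * s) * h (t + s, X s \<omega>)" "s \<in> {0..\<tau> \<omega>} \<Longrightarrow> exp (- r * s) * h (t + s, X s \<omega>) \<le> Cb"
    using bd[of s] eq[of s] by auto
qed

lemma Hp_props:
  assumes X: "cadlag_adapted X"
  shows "Hp t X \<tau> \<in> borel_measurable M" "\<omega> \<in> space M \<Longrightarrow> 0 \<le> Hp t X \<tau> \<omega>" "\<omega> \<in> space M \<Longrightarrow> Hp t X \<tau> \<omega> \<le> T * Cb"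
proof -
  have [measurable]: "\<tau> \<in> borel_measurable M" by (rule tau)
  show "Hp t X \<tau> \<in> borel_measurable M"
  proof (rule borel_measurable_LIMSEQ_metric[OF _ Hp_integrand(2)[OF X]])
    fix m
    show "(\<lambda>\<omega>. \<Sum>k<2^m. (\<tau> \<omega> / 2^m) *\<^sub>R (exp (- r * (\<tau> \<omega> * real k / 2^m)) * h (clip 0 T (t + \<tau> \<omega> * real k / 2^m), X (\<tau> \<omega> * real k / 2^m) \<omega>))) \<in> borel_measurable M"
    proof (intro borel_measurable_sum)
      fix k :: nat assume "k \<in> {..<2^m}"
      then have k: "k \<le> 2^m" by simp
      have Xm: "(\<lambda>\<omega>. X (\<tau> \<omega> * real k / 2^m) \<omega>) \<in> borel_measurable M"
      proof (rule cadlag_at_random_time[OF X])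
        fix \<omega> assume \<omega>: "\<omega> \<in> space M"
        show "0 \<le> \<tau> \<omega> * real k / 2^m \<and> \<tau> \<omega> * real k / 2^m \<le> T"
          using grid_le[OF _ k, of "\<tau> \<omega>"] tau(2)[OF \<omega>] by auto
      qed measurable
      have "(\<lambda>\<omega>. (t + \<tau> \<omega> * real k / 2^m, X (\<tau> \<omega> * real k / 2^m) \<omega>)) \<in> borel_measurable M" using Xm by (intro borel_measurable_Pair) auto
      from measurable_compose[OF this borel_measurable_continuous_onI[OF gh_continuous(2)]]
      have [measurable]: "(\<lambda>\<omega>. h (clip 0 T (t + \<tau> \<omega> * real k / 2^m), X (\<tau> \<omega> * real k / 2^m) \<omega>)) \<in> borel_measurable M" by simp
      show "(\<lambda>\<omega>. (\<tau> \<omega> / 2^m) *\<^sub>R (exp (- r * (\<tau> \<omega> * real k / 2^m)) * h (clip 0 T (t + \<tau> \<omega> * real k / 2^m), X (\<tau> \<omega> * real k / 2^m) \<omega>))) \<in> borel_measurable M"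
        by measurable
    qed
  qed
  assume \<omega>: "\<omega> \<in> space M"
  have int: "(\<lambda>s. exp (- r * s) * h (t + s, X s \<omega>)) integrable_on {0..\<tau> \<omega>}"
    using set_borel_integral_eq_integral(1)[OF Hp_integrand(1)[OF X \<omega>]] .
  show "0 \<le> Hp t X \<tau> \<omega>" unfolding Hp_def by (rule Henstock_Kurzweil_Integration.integral_nonneg[OF int Hp_integrand(3)[OF X \<omega>]])
  have "Hp t X \<tau> \<omega> \<le> integral {0..\<tau> \<omega>} (\<lambda>s. Cb)" unfolding Hp_def
    by (rule integral_le[OF int _ Hp_integrand(4)[OF X \<omega>]]) auto
  also have "\<dots> = \<tau> \<omega> * Cb" using tau(2)[OF \<omega>] by simp
  also have "\<dots> \<le> T * Cb" using tau(2)[OF \<omega>] gh_bound(3) by (intro mult_right_mono) auto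
  finally show "Hp t X \<tau> \<omega> \<le> T * Cb" .
qed

text \<open>The discounted cost density with clipped times is bounded and Borel on the whole line,
  as the kernel lemmas demand. On \<open>{0..\<tau> \<omega>}\<close> clipping changes
  nothing.\<close>

definition Nq where "Nq c s = exp (- r * clip 0 T s) * c (clip 0 T (t + s))"

lemma Nq_props:
  assumes "good_cost c"
  shows "Nq c \<in> borel_measurable borel" "0 \<le> Nq c s" "Nq c s \<le> c 0" "exp (- r * T) * f T \<le> Nq c s"
proof -
  have [measurable]: "clip 0 T \<in> borel_measurable borel" unfolding clip_def by measurable
  have "(\<lambda>s. c (clip 0 T (t + s))) \<in> borel_measurable borel"
    using measurable_compose[OF _ good_cost_measurable[OF assms], of "\<lambda>s. t + s" borel] by simp
  then show "Nq c \<in> borel_measurable borel" unfolding Nq_def[abs_def] by measurable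
  note cp = good_costD[OF assms clip_0T, of "t + s"]
  show "0 \<le> Nq c s" using cp by (simp add: Nq_def)
  have cl: "0 \<le> clip 0 T s" "clip 0 T s \<le> T" using clip_0T[of s] by auto
  have "Nq c s \<le> 1 * c 0" unfolding Nq_def using exp_bounds(1)[OF cl(1)] cp by (intro mult_mono) auto
  then show "Nq c s \<le> c 0" by simp
  have "0 < f T" using f_pos[of T] T_pos by simp
  then show "exp (- r * T) * f T \<le> Nq c s" unfolding Nq_def using exp_bounds(2)[OF cl] cp by (intro mult_mono) auto
qed

lemma Np_eq:
  assumes "\<omega> \<in> space M"
  shows "Np t c \<nu> \<tau> \<omega> = (\<integral>s. indicator {0..\<tau> \<omega>} s * Nq c s \<partial>interval_measure (nu_dist T \<nu> \<omega>))"
  unfolding Np_def set_lebesgue_integral_def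
proof (rule Bochner_Integration.integral_cong)
  fix s
  show "indicator {0..\<tau> \<omega>} s *\<^sub>R (exp (- r * s) * c (t + s)) = indicator {0..\<tau> \<omega>} s * Nq c s"
    using tau(3)[OF assms, of s] tau(2)[OF assms] by (auto simp: Nq_def clip_mid split: split_indicator)
qed simp

context
  fixes n :: "real \<Rightarrow> 'a \<Rightarrow> real^'d" and \<nu> assumes c: "(n, \<nu>) \<in> controls M F T"
begin

lemma Nq_integrable:
  assumes "good_cost c" "\<omega> \<in> space M"
  shows "integrable (interval_measure (nu_dist T \<nu> \<omega>)) (\<lambda>s. indicator {0..\<tau> \<omega>} s * Nq c s)"
  using nu_set_integrable_bounded[OF controlsD(4)[OF c assms(2)] Nq_props(1)[OF assms(1)], of "{0..\<tau> \<omega>}" "c 0"] Nq_props[OF assms(1)]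
  by (simp add: set_integrable_def)

lemma Np_props:
  assumes gc: "good_cost c"
  shows "Np t c \<nu> \<tau> \<in> borel_measurable M" "\<omega> \<in> space M \<Longrightarrow> 0 \<le> Np t c \<nu> \<tau> \<omega>"
    "\<omega> \<in> space M \<Longrightarrow> Np t c \<nu> \<tau> \<omega> \<le> c 0 * \<nu> T \<omega>"
proof -
  note [measurable] = Nq_props(1)[OF gc] tau(1)
  have "(\<lambda>\<omega>. \<integral>s. indicator {0..\<tau> \<omega>} s * Nq c s \<partial>interval_measure (nu_dist T \<nu> \<omega>)) \<in> borel_measurable M"
  proof (rule nu_kernel_integral[where C="c 0"])
    show "0 \<le> T" using T_pos by simp
    show "inc_path T \<nu> \<omega>" if "\<omega> \<in> space M" for \<omega> by (rule controlsD(4)[OF c that])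
    show "\<nu> s \<in> borel_measurable M" if "0 \<le> s" "s \<le> T" for s
      using controlsD(3)[OF c that] by (rule measurable_F)
    have "(\<lambda>(\<omega>, s). (if 0 \<le> s \<and> s \<le> \<tau> \<omega> then 1 else 0) * Nq c s) \<in> borel_measurable (M \<Otimes>\<^sub>M borel)" by measurable
    also have "(\<lambda>(\<omega>, s). (if 0 \<le> s \<and> s \<le> \<tau> \<omega> then 1 else 0) * Nq c s) = (\<lambda>(\<omega>, s). indicator {0..\<tau> \<omega>} s * Nq c s)"
      by (auto split: split_indicator)
    finally show "(\<lambda>(\<omega>, s). indicator {0..\<tau> \<omega>} s * Nq c s) \<in> borel_measurable (M \<Otimes>\<^sub>M borel)" .
    show "\<bar>indicator {0..\<tau> \<omega>} s * Nq c s\<bar> \<le> c 0" for \<omega> s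
      using Nq_props(2,3)[OF gc, of s] by (auto split: split_indicator)
  qed
  then show "Np t c \<nu> \<tau> \<in> borel_measurable M"
    by (rule measurable_cong[THEN iffD1, rotated]) (simp add: Np_eq)
  assume \<omega>: "\<omega> \<in> space M"
  show nn: "0 \<le> Np t c \<nu> \<tau> \<omega>" unfolding Np_eq[OF \<omega>] using Nq_props(2)[OF gc] by (intro Bochner_Integration.integral_nonneg) auto
  have "norm (set_lebesgue_integral (interval_measure (nu_dist T \<nu> \<omega>)) {0..\<tau> \<omega>} (Nq c)) \<le> c 0 * \<nu> (\<tau> \<omega>) \<omega>"
    by (rule nu_integral_bound[OF controlsD(4)[OF c \<omega>] Nq_props(1)[OF gc]]) (use Nq_props[OF gc] tau(2)[OF \<omega>] in auto)
  then have "Np t c \<nu> \<tau> \<omega> \<le> c 0 * \<nu> (\<tau> \<omega>) \<omega>" by (simp add: set_lebesgue_integral_def Np_eq[OF \<omega>])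
  also have "\<dots> \<le> c 0 * \<nu> T \<omega>"
    using inc_path_mono[OF controlsD(4)[OF c \<omega>]] tau(2)[OF \<omega>] good_costD(1)[OF gc, of 0] T_pos by (intro mult_left_mono) auto
  finally show "Np t c \<nu> \<tau> \<omega> \<le> c 0 * \<nu> T \<omega>" .
qed

lemma Np_mono:
  assumes c1: "good_cost c1" and c2: "good_cost c2" and le: "\<And>s. s \<in> {0..T} \<Longrightarrow> c1 s \<le> a * c2 s" and \<omega>: "\<omega> \<in> space M"
  shows "Np t c1 \<nu> \<tau> \<omega> \<le> a * Np t c2 \<nu> \<tau> \<omega>"
proof -
  have q: "Nq c1 s \<le> a * Nq c2 s" for s
    unfolding Nq_def using mult_left_mono[OF le[OF clip_0T, of "t + s"], of "exp (- r * clip 0 T s)"] by (simp add: mult_ac)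
  have "Np t c1 \<nu> \<tau> \<omega> \<le> (\<integral>s. a * (indicator {0..\<tau> \<omega>} s * Nq c2 s) \<partial>interval_measure (nu_dist T \<nu> \<omega>))"
    unfolding Np_eq[OF \<omega>]
    by (rule integral_mono[OF Nq_integrable[OF c1 \<omega>] integrable_mult_right[OF Nq_integrable[OF c2 \<omega>]]])
      (use q in \<open>auto split: split_indicator\<close>)
  then show ?thesis by (simp add: Np_eq[OF \<omega>])
qed

text \<open>The projected intensity has density at most one with respect to the original one, and
  the cost density is nonnegative.\<close>

lemma Np_projected:
  assumes gc: "good_cost c" and \<omega>: "\<omega> \<in> space M"
  shows "Np t c (nubar D0 n \<nu>) \<tau> \<omega> \<le> Np t c \<nu> \<tau> \<omega>"
proof -
  have t0: "0 \<le> \<tau> \<omega>" "\<tau> \<omega> \<le> T" using tau(2)[OF \<omega>] by auto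
  have m: "(\<lambda>s. norm (proj D0 (n (clip 0 T s) \<omega>))) \<in> borel_measurable borel"
    using ctrl_path_measurable[OF c normproj[OF c] less_imp_le[OF T_pos] order_refl \<omega>] .
  have i: "integrable (interval_measure (nu_dist T \<nu> \<omega>)) (\<lambda>s. indicator {0..\<tau> \<omega>} s * (norm (proj D0 (n (clip 0 T s) \<omega>)) * Nq c s))"
  proof (rule Bochner_Integration.integrable_bound[OF Nq_integrable[OF gc \<omega>]])
    show "(\<lambda>s. indicator {0..\<tau> \<omega>} s * (norm (proj D0 (n (clip 0 T s) \<omega>)) * Nq c s)) \<in> borel_measurable (interval_measure (nu_dist T \<nu> \<omega>))"
      using m Nq_props(1)[OF gc] by simp
  qed (use Nq_props(2)[OF gc] norm_proj in \<open>auto simp: abs_mult intro!: AE_I2 mult_left_le_one_le split: split_indicator\<close>)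
  have "Np t c (nubar D0 n \<nu>) \<tau> \<omega> = set_lebesgue_integral (interval_measure (nu_dist T (nubar D0 n \<nu>) \<omega>)) {0..\<tau> \<omega>} (Nq c)"
    unfolding Np_eq[OF \<omega>] set_lebesgue_integral_def by simp
  also have "\<dots> = set_lebesgue_integral (interval_measure (nu_dist T \<nu> \<omega>)) {0..\<tau> \<omega>} (\<lambda>s. norm (proj D0 (n s \<omega>)) *\<^sub>R Nq c s)"
    by (rule nubar_set_integral[OF c \<omega> t0 Nq_props(1)[OF gc]])
  also have "\<dots> = (\<integral>s. indicator {0..\<tau> \<omega>} s * (norm (proj D0 (n (clip 0 T s) \<omega>)) * Nq c s) \<partial>interval_measure (nu_dist T \<nu> \<omega>))"
    unfolding set_lebesgue_integral_def
    by (intro Bochner_Integration.integral_cong) (use t0 in \<open>auto simp: clip_mid split: split_indicator\<close>)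
  also have "\<dots> \<le> Np t c \<nu> \<tau> \<omega>" unfolding Np_eq[OF \<omega>]
    by (rule integral_mono[OF i Nq_integrable[OF gc \<omega>]])
      (use Nq_props(2)[OF gc] norm_proj in \<open>auto intro!: mult_left_le_one_le split: split_indicator\<close>)
  finally show ?thesis .
qed

text \<open>The cost density is at least \<open>exp (- r * T) * f T\<close>, and the interval has
  mass \<open>\<nu> (\<tau> \<omega>) \<omega>\<close>. Strict positivity of \<open>f\<close> thus
  turns a bound on the payoff into a bound on the control.\<close>

lemma Np_lower:
  assumes gc: "good_cost c" and \<omega>: "\<omega> \<in> space M"
  shows "exp (- r * T) * f T * \<nu> (\<tau> \<omega>) \<omega> \<le> Np t c \<nu> \<tau> \<omega>"
proof -
  let ?N = "interval_measure (nu_dist T \<nu> \<omega>)"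
  have t0: "0 \<le> \<tau> \<omega>" "\<tau> \<omega> \<le> T" using tau(2)[OF \<omega>] by auto
  note inc = controlsD(4)[OF c \<omega>]
  have e: "emeasure ?N {0..\<tau> \<omega>} = ennreal (\<nu> (\<tau> \<omega>) \<omega>)" by (rule nu_measure_Icc[OF inc t0])
  then have "exp (- r * T) * f T * \<nu> (\<tau> \<omega>) \<omega> = (\<integral>s. exp (- r * T) * f T * indicator {0..\<tau> \<omega>} s \<partial>?N)"
    using inc_path_nonneg[OF inc t0] by (simp add: measure_def)
  also have "\<dots> \<le> Np t c \<nu> \<tau> \<omega>" unfolding Np_eq[OF \<omega>]
  proof (rule integral_mono[OF _ Nq_integrable[OF gc \<omega>]])
    show "integrable ?N (\<lambda>s. exp (- r * T) * f T * indicator {0..\<tau> \<omega>} s)"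
      by (intro integrable_mult_right integrable_real_indicator) (simp_all add: e)
  qed (use Nq_props(4)[OF gc] in \<open>auto split: split_indicator\<close>)
  finally show ?thesis .
qed

end

end

section \<open>Comparison of the values\<close>

abbreviation (input) J where "J c \<gamma> t x n \<nu> \<tau> \<equiv> payoff M F W T D0 b \<kappa> r g h c \<gamma> t x n \<nu> \<tau>"
abbreviation (input) St where "St \<gamma> x n \<nu> \<equiv> state M F W T D0 b \<kappa> x n \<nu> \<gamma>"

text \<open>Bounds the terminal plus the running reward, hence the whole payoff of the zero
  control.\<close>

definition C0 :: real where "C0 = Cb + T * Cb"

lemma C0_nonneg: "0 \<le> C0"
  using gh_bound(3) T_pos by (simp add: C0_def)

lemma state_cadlag: "(n, \<nu>) \<in> controls M F T \<Longrightarrow> 0 \<le> \<gamma> \<Longrightarrow> \<gamma> \<le> 1 \<Longrightarrow> cadlag_adapted (St \<gamma> x n \<nu>)"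
  using state_solves[of n \<nu> \<gamma> D0 x] by (simp add: solves_def)

lemma nu_integrable:
  assumes c: "(n, \<nu>) \<in> controls M F T" and s: "0 \<le> s" "s \<le> T"
  shows "integrable M (\<nu> s)"
proof -
  have m: "\<nu> s' \<in> borel_measurable M" if "0 \<le> s'" "s' \<le> T" for s' using controlsD(3)[OF c that] by (rule measurable_F)
  have "integrable M (\<nu> T)"
    by (rule square_integrable_imp_integrable[OF m controlsD(5)[OF c]]) (use T_pos in auto)
  then show ?thesis
  proof (rule Bochner_Integration.integrable_bound[OF _ m[OF s]])
    show "AE \<omega> in M. norm (\<nu> s \<omega>) \<le> norm (\<nu> T \<omega>)"
    proof (rule AE_I2)
      fix \<omega> assume "\<omega> \<in> space M"
      note inc = controlsD(4)[OF c this]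
      show "norm (\<nu> s \<omega>) \<le> norm (\<nu> T \<omega>)"
        using inc_path_mono[OF inc s(1) s(2) order_refl] inc_path_nonneg[OF inc s] by simp
    qed
  qed
qed

lemma payoff_parts_integrable:
  fixes n :: "real \<Rightarrow> 'a \<Rightarrow> real^'d"
  assumes t: "t \<in> {0..T}" and \<tau>: "\<tau> \<in> stop_times M F T t" and c: "(n, \<nu>) \<in> controls M F T"
  shows "cadlag_adapted X \<Longrightarrow> integrable M (Gp t X \<tau>)" "cadlag_adapted X \<Longrightarrow> integrable M (Hp t X \<tau>)"
    "good_cost k \<Longrightarrow> integrable M (Np t k \<nu> \<tau>)"
proof -
  show "integrable M (Gp t X \<tau>)" if X: "cadlag_adapted X"
    by (rule integrable_const_bound[of _ Cb]) (use Gp_props[OF t \<tau> X] in \<open>auto intro!: AE_I2\<close>)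
  show "integrable M (Hp t X \<tau>)" if X: "cadlag_adapted X"
    by (rule integrable_const_bound[of _ "T * Cb"]) (use Hp_props[OF t \<tau> X] in \<open>auto intro!: AE_I2\<close>)
  assume gc: "good_cost k"
  have "integrable M (\<lambda>\<omega>. k 0 * \<nu> T \<omega>)" using nu_integrable[OF c, of T] T_pos by simp
  then show "integrable M (Np t k \<nu> \<tau>)"
  proof (rule Bochner_Integration.integrable_bound[OF _ Np_props(1)[OF t \<tau> c gc]])
    show "AE \<omega> in M. norm (Np t k \<nu> \<tau> \<omega>) \<le> norm (k 0 * \<nu> T \<omega>)"
      using Np_props(2,3)[OF t \<tau> c gc] by (intro AE_I2) fastforce
  qed
qed

lemma payoff_bounds:
  assumes t: "t \<in> {0..T}" and \<tau>: "\<tau> \<in> stop_times M F T t" and c: "(n, \<nu>) \<in> controls M F T"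
    and \<gamma>: "0 \<le> \<gamma>" "\<gamma> \<le> 1" and gc: "good_cost k"
  shows "0 \<le> J k \<gamma> t x n \<nu> \<tau>" "J k \<gamma> t x n \<nu> \<tau> \<le> C0 + k 0 * (\<integral>\<omega>. \<nu> T \<omega> \<partial>M)"
proof -
  define X where "X = St \<gamma> x n \<nu>"
  have X: "cadlag_adapted X" unfolding X_def by (rule state_cadlag[OF c \<gamma>])
  note i = payoff_parts_integrable(1,2)[OF t \<tau> c X] payoff_parts_integrable(3)[OF t \<tau> c gc]
  note p = Gp_props[OF t \<tau> X] Hp_props[OF t \<tau> X] Np_props[OF t \<tau> c gc]
  have J: "J k \<gamma> t x n \<nu> \<tau> = (\<integral>\<omega>. Gp t X \<tau> \<omega> + Hp t X \<tau> \<omega> + Np t k \<nu> \<tau> \<omega> \<partial>M)" by (simp add: payoff_eq X_def)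
  show "0 \<le> J k \<gamma> t x n \<nu> \<tau>" unfolding J using p by (intro integral_nonneg_AE AE_I2) auto
  have "J k \<gamma> t x n \<nu> \<tau> \<le> (\<integral>\<omega>. C0 + k 0 * \<nu> T \<omega> \<partial>M)" unfolding J
  proof (rule integral_mono)
    show "integrable M (\<lambda>\<omega>. Gp t X \<tau> \<omega> + Hp t X \<tau> \<omega> + Np t k \<nu> \<tau> \<omega>)" using i by simp
    show "integrable M (\<lambda>\<omega>. C0 + k 0 * \<nu> T \<omega>)" using nu_integrable[OF c, of T] T_pos by simp
    show "Gp t X \<tau> \<omega> + Hp t X \<tau> \<omega> + Np t k \<nu> \<tau> \<omega> \<le> C0 + k 0 * \<nu> T \<omega>" if "\<omega> \<in> space M" for \<omega>
      using p(3)[OF that] p(6)[OF that] p(9)[OF that] by (simp add: C0_def)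
  qed
  also have "\<dots> = C0 + k 0 * (\<integral>\<omega>. \<nu> T \<omega> \<partial>M)" using nu_integrable[OF c, of T] T_pos by (simp add: prob_space)
  finally show "J k \<gamma> t x n \<nu> \<tau> \<le> C0 + k 0 * (\<integral>\<omega>. \<nu> T \<omega> \<partial>M)" .
qed

lemma const_stop_time: "0 \<le> s \<Longrightarrow> s \<le> T - t \<Longrightarrow> (\<lambda>_. s) \<in> stop_times M F T t"
  by (simp add: stop_times_def stopping_time_const)

lemma zero_stop_time: "t \<in> {0..T} \<Longrightarrow> (\<lambda>_. 0) \<in> stop_times M F T t"
  by (rule const_stop_time) auto

text \<open>Stopping at the deterministic time \<open>s\<close> and dropping the two nonnegative
  rewards leaves the control cost.\<close>

lemma payoff_lower:
  assumes t: "t \<in> {0..T}" and c: "(n, \<nu>) \<in> controls M F T" and \<gamma>: "0 \<le> \<gamma>" "\<gamma> \<le> 1" and gc: "good_cost k"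
    and s: "0 \<le> s" "s \<le> T - t"
  shows "exp (- r * T) * f T * (\<integral>\<omega>. \<nu> s \<omega> \<partial>M) \<le> J k \<gamma> t x n \<nu> (\<lambda>_. s)"
proof -
  define X where "X = St \<gamma> x n \<nu>"
  let ?\<tau> = "\<lambda>_::'a. s"
  have X: "cadlag_adapted X" unfolding X_def by (rule state_cadlag[OF c \<gamma>])
  note \<tau> = const_stop_time[OF s]
  have sT: "s \<le> T" using s t by simp
  note i = payoff_parts_integrable(1,2)[OF t \<tau> c X] payoff_parts_integrable(3)[OF t \<tau> c gc]
  have "exp (- r * T) * f T * (\<integral>\<omega>. \<nu> s \<omega> \<partial>M) = (\<integral>\<omega>. exp (- r * T) * f T * \<nu> s \<omega> \<partial>M)" by simp
  also have "\<dots> \<le> (\<integral>\<omega>. Gp t X ?\<tau> \<omega> + Hp t X ?\<tau> \<omega> + Np t k \<nu> ?\<tau> \<omega> \<partial>M)"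
  proof (rule integral_mono)
    show "integrable M (\<lambda>\<omega>. Gp t X ?\<tau> \<omega> + Hp t X ?\<tau> \<omega> + Np t k \<nu> ?\<tau> \<omega>)" using i by simp
    show "integrable M (\<lambda>\<omega>. exp (- r * T) * f T * \<nu> s \<omega>)" using nu_integrable[OF c s(1) sT] by simp
    show "exp (- r * T) * f T * \<nu> s \<omega> \<le> Gp t X ?\<tau> \<omega> + Hp t X ?\<tau> \<omega> + Np t k \<nu> ?\<tau> \<omega>" if "\<omega> \<in> space M" for \<omega>
      using Gp_props(2)[OF t \<tau> X that] Hp_props(2)[OF t \<tau> X that] Np_lower[OF t \<tau> c gc that] by simp
  qed
  also have "\<dots> = J k \<gamma> t x n \<nu> ?\<tau>" by (simp add: payoff_eq X_def)
  finally show ?thesis .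
qed

text \<open>The norm condition asks for a unit direction even when the intensity vanishes; an axis
  in \<open>D0\<close> respects the constraint.\<close>

lemma zero_control: "i0 \<in> D0 \<Longrightarrow> (\<lambda>s \<omega>. axis i0 1, \<lambda>s \<omega>. 0) \<in> constrained_controls M F T D0"
  by (auto simp: constrained_controls_def controls_def progressive_def monotone_on_def) (auto simp: axis_def)

lemma constrained_subset: "constrained_controls M F T D0 \<subseteq> controls M F T"
  by (auto simp: constrained_controls_def)

lemma cheap_control:
  obtains n \<nu> where "(n, \<nu>) \<in> constrained_controls M F T D0"
    "\<And>k \<gamma> t x \<tau>. t \<in> {0..T} \<Longrightarrow> \<tau> \<in> stop_times M F T t \<Longrightarrow> 0 \<le> \<gamma> \<Longrightarrow> \<gamma> \<le> 1 \<Longrightarrow> good_cost k \<Longrightarrow> J k \<gamma> t x n \<nu> \<tau> \<le> C0"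
proof -
  obtain i0 where i0: "i0 \<in> D0" using D0_ne by blast
  note z = zero_control[OF i0]
  show ?thesis
  proof (rule that[OF z])
    fix k and \<gamma> :: real and t x \<tau> assume "t \<in> {0..T}" "\<tau> \<in> stop_times M F T t" "0 \<le> \<gamma>" "\<gamma> \<le> 1" "good_cost k"
    from payoff_bounds(2)[OF this(1,2) set_mp[OF constrained_subset z] this(3-), of x]
    show "J k \<gamma> t x (\<lambda>s \<omega>. axis i0 1) (\<lambda>s \<omega>. 0) \<tau> \<le> C0" by simp
  qed
qed

text \<open>Relative excess of the perturbed cost:
  \<open>sqrt (x\<^sup>2 + y\<^sup>2) \<le> x + y\<close> gives an absolute excess of
  \<open>K * sqrt \<gamma>\<close>, and dividing by the minimum \<open>f T\<close> makes it
  proportional to \<open>f\<close>.\<close>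

definition a0 :: real where "a0 = K / f T"

lemma fT_pos: "0 < f T"
  using f_pos[of T] T_pos by simp

lemma a0_nonneg: "0 \<le> a0"
  using fT_pos K_pos by (simp add: a0_def)

lemma f_gamma_le:
  assumes \<gamma>: "0 \<le> \<gamma>" and s: "s \<in> {0..T}"
  shows "f_gamma f K \<gamma> s \<le> (1 + a0 * sqrt \<gamma>) * f s"
proof -
  have fs: "f T \<le> f s" using s f_noninc T_pos by (auto simp: monotone_on_def)
  have "f_gamma f K \<gamma> s = sqrt ((f s)\<^sup>2 + (sqrt \<gamma> * K)\<^sup>2)" using \<gamma> by (simp add: f_gamma_def power_mult_distrib)
  also have "\<dots> \<le> f s + sqrt \<gamma> * K" using f_pos[OF s] \<gamma> K_pos by (intro sqrt_sum_squares_le_sum) auto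
  also have "sqrt \<gamma> * K = a0 * sqrt \<gamma> * f T" using fT_pos by (simp add: a0_def)
  also have "\<dots> \<le> a0 * sqrt \<gamma> * f s" using fs a0_nonneg \<gamma> by (intro mult_left_mono) auto
  finally show ?thesis by (simp add: distrib_right)
qed

text \<open>\<open>gscale\<close> fixes vectors without components outside \<open>D0\<close>, so the
  two solution predicates coincide and the choice operator returns literally the same
  process.\<close>

lemma constrained_state:
  assumes "(n, \<nu>) \<in> constrained_controls M F T D0" shows "St \<gamma> x n \<nu> = St 1 x n \<nu>"
proof -
  have "gscale D0 \<gamma> (n s \<omega>) = n s \<omega>" for s \<omega> \<gamma> using assms by (intro gscale_id) (auto simp: constrained_controls_def)
  then show ?thesis by (simp add: state_def is_solution_def)
qed

lemma constrained_payoff_le: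
  assumes t: "t \<in> {0..T}" and \<tau>: "\<tau> \<in> stop_times M F T t" and cc: "(n, \<nu>) \<in> constrained_controls M F T D0" and \<gamma>: "0 < \<gamma>"
  shows "J (f_gamma f K \<gamma>) \<gamma> t x n \<nu> \<tau> \<le> (1 + a0 * sqrt \<gamma>) * J f 1 t x n \<nu> \<tau>"
proof -
  have c: "(n, \<nu>) \<in> controls M F T" using cc constrained_subset by blast
  define X where "X = St 1 x n \<nu>"
  have X: "cadlag_adapted X" unfolding X_def by (rule state_cadlag[OF c]) auto
  have gg: "good_cost (f_gamma f K \<gamma>)" using \<gamma> by (intro good_cost_f_gamma) simp
  note i = payoff_parts_integrable(1,2)[OF t \<tau> c X] payoff_parts_integrable(3)[OF t \<tau> c]
  have "J (f_gamma f K \<gamma>) \<gamma> t x n \<nu> \<tau> = (\<integral>\<omega>. Gp t X \<tau> \<omega> + Hp t X \<tau> \<omega> + Np t (f_gamma f K \<gamma>) \<nu> \<tau> \<omega> \<partial>M)"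
    by (simp add: payoff_eq X_def constrained_state[OF cc, where \<gamma>=\<gamma>])
  also have "\<dots> \<le> (\<integral>\<omega>. (1 + a0 * sqrt \<gamma>) * (Gp t X \<tau> \<omega> + Hp t X \<tau> \<omega> + Np t f \<nu> \<tau> \<omega>) \<partial>M)"
  proof (rule integral_mono)
    show "integrable M (\<lambda>\<omega>. Gp t X \<tau> \<omega> + Hp t X \<tau> \<omega> + Np t (f_gamma f K \<gamma>) \<nu> \<tau> \<omega>)"
      using i(1,2) i(3)[OF gg] by simp
    show "integrable M (\<lambda>\<omega>. (1 + a0 * sqrt \<gamma>) * (Gp t X \<tau> \<omega> + Hp t X \<tau> \<omega> + Np t f \<nu> \<tau> \<omega>))"
      using i(1,2) i(3)[OF good_cost_f] by simp
    fix \<omega> assume \<omega>: "\<omega> \<in> space M"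
    have "Np t (f_gamma f K \<gamma>) \<nu> \<tau> \<omega> \<le> (1 + a0 * sqrt \<gamma>) * Np t f \<nu> \<tau> \<omega>"
      by (rule Np_mono[OF t \<tau> c gg good_cost_f f_gamma_le \<omega>]) (use \<gamma> in auto)
    moreover have "0 \<le> a0 * sqrt \<gamma> * (Gp t X \<tau> \<omega> + Hp t X \<tau> \<omega>)"
      using a0_nonneg \<gamma> Gp_props(2)[OF t \<tau> X \<omega>] Hp_props(2)[OF t \<tau> X \<omega>] by (intro mult_nonneg_nonneg) auto
    ultimately show "Gp t X \<tau> \<omega> + Hp t X \<tau> \<omega> + Np t (f_gamma f K \<gamma>) \<nu> \<tau> \<omega>
       \<le> (1 + a0 * sqrt \<gamma>) * (Gp t X \<tau> \<omega> + Hp t X \<tau> \<omega> + Np t f \<nu> \<tau> \<omega>)" by (simp add: distrib_left distrib_right)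
  qed
  also have "\<dots> = (1 + a0 * sqrt \<gamma>) * J f 1 t x n \<nu> \<tau>" by (simp add: payoff_eq X_def)
  finally show ?thesis .
qed

text \<open>For a fixed stopping time the infimum over the larger class is at most the one over the
  constrained class, where payoffs grow by the factor \<open>1 + a0 * sqrt \<gamma>\<close>. The
  factor becomes an additive error because the constrained infimum never exceeds
  \<open>C0\<close>.\<close>

lemma u_lower_le:
  assumes t: "t \<in> {0..T}" and \<gamma>: "0 < \<gamma>" "\<gamma> \<le> 1"
  shows "u_lower M F W T D0 b \<kappa> r g h f K \<gamma> t x \<le> v_lower M F W T D0 b \<kappa> r g h f t x + a0 * C0 * sqrt \<gamma>"
  unfolding u_lower_def
proof (rule cSUP_least)
  show "stop_times M F T t \<noteq> {}" using zero_stop_time[OF t] by blast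
  fix \<tau> assume \<tau>: "\<tau> \<in> stop_times M F T t"
  obtain n0 \<nu>0 where z: "(n0, \<nu>0) \<in> constrained_controls M F T D0"
    "\<And>k \<gamma> t x \<tau>. t \<in> {0..T} \<Longrightarrow> \<tau> \<in> stop_times M F T t \<Longrightarrow> 0 \<le> \<gamma> \<Longrightarrow> \<gamma> \<le> 1 \<Longrightarrow> good_cost k \<Longrightarrow> J k \<gamma> t x n0 \<nu>0 \<tau> \<le> C0"
    by (rule cheap_control; blast)
  define \<iota> where "\<iota> \<tau> = (INF c\<in>constrained_controls M F T D0. J f 1 t x (fst c) (snd c) \<tau>)" for \<tau>
  define I where "I = (INF c\<in>controls M F T. J (f_gamma f K \<gamma>) \<gamma> t x (fst c) (snd c) \<tau>)"
  have a: "0 < 1 + a0 * sqrt \<gamma>" using a0_nonneg \<gamma> by (simp add: add_pos_nonneg)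
  have gg: "good_cost (f_gamma f K \<gamma>)" using \<gamma> by (intro good_cost_f_gamma) simp
  have \<iota>C: "\<iota> \<sigma> \<le> C0" if \<sigma>: "\<sigma> \<in> stop_times M F T t" for \<sigma>
  proof -
    have "\<iota> \<sigma> \<le> J f 1 t x (fst (n0, \<nu>0)) (snd (n0, \<nu>0)) \<sigma>" unfolding \<iota>_def
      by (rule cINF_lower[OF _ z(1)], rule bdd_belowI2[of _ 0])
        (use payoff_bounds(1)[OF t \<sigma> _ _ _ good_cost_f] constrained_subset in force)
    also have "\<dots> \<le> C0" using z(2)[OF t \<sigma> _ _ good_cost_f] by simp
    finally show ?thesis .
  qed
  have "I / (1 + a0 * sqrt \<gamma>) \<le> \<iota> \<tau>" unfolding \<iota>_def
  proof (rule cINF_greatest)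
    show "constrained_controls M F T D0 \<noteq> {}" using z(1) by blast
    fix c assume c: "c \<in> constrained_controls M F T D0"
    then have c': "c \<in> controls M F T" using constrained_subset by blast
    have "I \<le> J (f_gamma f K \<gamma>) \<gamma> t x (fst c) (snd c) \<tau>" unfolding I_def
      by (rule cINF_lower[OF _ c'], rule bdd_belowI2[of _ 0])
        (use payoff_bounds(1)[OF t \<tau> _ _ _ gg] \<gamma> in force)
    also have "\<dots> \<le> (1 + a0 * sqrt \<gamma>) * J f 1 t x (fst c) (snd c) \<tau>"
      by (rule constrained_payoff_le[OF t \<tau> _ \<gamma>(1)]) (use c in simp)
    finally show "I / (1 + a0 * sqrt \<gamma>) \<le> J f 1 t x (fst c) (snd c) \<tau>" using a by (simp add: pos_divide_le_eq mult.commute)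
  qed
  then have "I \<le> \<iota> \<tau> + a0 * sqrt \<gamma> * \<iota> \<tau>" using a by (simp add: pos_divide_le_eq distrib_left mult.commute)
  also have "a0 * sqrt \<gamma> * \<iota> \<tau> \<le> a0 * sqrt \<gamma> * C0" using \<iota>C[OF \<tau>] a0_nonneg \<gamma> by (intro mult_left_mono) auto
  also have "\<iota> \<tau> \<le> v_lower M F W T D0 b \<kappa> r g h f t x"
    unfolding v_lower_def \<iota>_def[symmetric] by (rule cSUP_upper[OF \<tau>], rule bdd_aboveI2[of _ _ C0]) (rule \<iota>C)
  finally show "I \<le> v_lower M F W T D0 b \<kappa> r g h f t x + a0 * C0 * sqrt \<gamma>" by (simp add: mult_ac)
qed

lemma payoff_bdd_above:
  assumes t: "t \<in> {0..T}" and c: "(n, \<nu>) \<in> controls M F T" and \<gamma>: "0 \<le> \<gamma>" "\<gamma> \<le> 1" and gc: "good_cost k"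
  shows "bdd_above ((\<lambda>\<tau>. J k \<gamma> t x n \<nu> \<tau>) ` stop_times M F T t)"
  by (rule bdd_aboveI2[of _ _ "C0 + k 0 * (\<integral>\<omega>. \<nu> T \<omega> \<partial>M)"]) (rule payoff_bounds(2)[OF t _ c \<gamma> gc])

lemma v_upper_le:
  assumes t: "t \<in> {0..T}" and c: "(n, \<nu>) \<in> constrained_controls M F T D0"
  shows "v_upper M F W T D0 b \<kappa> r g h f t x \<le> (SUP \<tau>\<in>stop_times M F T t. J f 1 t x n \<nu> \<tau>)"
proof -
  have "v_upper M F W T D0 b \<kappa> r g h f t x \<le> (SUP \<tau>\<in>stop_times M F T t. J f 1 t x (fst (n, \<nu>)) (snd (n, \<nu>)) \<tau>)"
    unfolding v_upper_def
  proof (rule cINF_lower[OF _ c], rule bdd_belowI2[of _ 0])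
    fix c assume "c \<in> constrained_controls M F T D0"
    then have c: "(fst c, snd c) \<in> controls M F T" using constrained_subset by auto
    have "0 \<le> J f 1 t x (fst c) (snd c) (\<lambda>_. 0)" by (rule payoff_bounds(1)[OF t zero_stop_time[OF t] c _ _ good_cost_f]) auto
    also have "\<dots> \<le> (SUP \<tau>\<in>stop_times M F T t. J f 1 t x (fst c) (snd c) \<tau>)"
      by (rule cSUP_upper[OF zero_stop_time[OF t] payoff_bdd_above[OF t c _ _ good_cost_f]]) auto
    finally show "0 \<le> (SUP \<tau>\<in>stop_times M F T t. J f 1 t x (fst c) (snd c) \<tau>)" .
  qed
  then show ?thesis by simp
qed

lemma v_lower_le_v_upper:
  assumes t: "t \<in> {0..T}"
  shows "v_lower M F W T D0 b \<kappa> r g h f t x \<le> v_upper M F W T D0 b \<kappa> r g h f t x"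
  unfolding v_lower_def v_upper_def
proof (intro cSUP_least cINF_greatest)
  show "stop_times M F T t \<noteq> {}" using zero_stop_time[OF t] by blast
  show "constrained_controls M F T D0 \<noteq> {}" by (rule cheap_control) blast
  fix \<tau> c assume \<tau>: "\<tau> \<in> stop_times M F T t" and c: "c \<in> constrained_controls M F T D0"
  have c': "(fst c, snd c) \<in> controls M F T" using c constrained_subset by auto
  have "(INF c\<in>constrained_controls M F T D0. J f 1 t x (fst c) (snd c) \<tau>) \<le> J f 1 t x (fst c) (snd c) \<tau>"
    by (rule cINF_lower[OF _ c], rule bdd_belowI2[of _ 0])
      (use payoff_bounds(1)[OF t \<tau> _ _ _ good_cost_f] constrained_subset in force)
  also have "\<dots> \<le> (SUP \<tau>\<in>stop_times M F T t. J f 1 t x (fst c) (snd c) \<tau>)"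
    by (rule cSUP_upper[OF \<tau> payoff_bdd_above[OF t c' _ _ good_cost_f]]) auto
  finally show "(INF c\<in>constrained_controls M F T D0. J f 1 t x (fst c) (snd c) \<tau>) \<le> (SUP \<tau>\<in>stop_times M F T t. J f 1 t x (fst c) (snd c) \<tau>)" .
qed

text \<open>The spatial Lipschitz bound is used once for the terminal reward and integrated over a
  time of at most \<open>T\<close> for the running one, whence \<open>1 + T\<close>.\<close>

lemma GH_close:
  assumes t: "t \<in> {0..T}" and \<tau>: "\<tau> \<in> stop_times M F T t" and X: "cadlag_adapted X" and X': "cadlag_adapted X'"
    and \<omega>: "\<omega> \<in> space M" and \<delta>: "0 \<le> \<delta>" and cl: "\<And>s. s \<in> {0..T - t} \<Longrightarrow> norm (X s \<omega> - X' s \<omega>) \<le> \<delta>"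
  shows "Gp t X' \<tau> \<omega> + Hp t X' \<tau> \<omega> \<le> Gp t X \<tau> \<omega> + Hp t X \<tau> \<omega> + K * (1 + T) * \<delta>"
proof -
  have t0: "0 \<le> \<tau> \<omega>" "\<tau> \<omega> \<le> T - t" "\<tau> \<omega> \<le> T" using tau(2)[OF t \<tau> \<omega>] by auto
  have gh: "g (t + s, X' s \<omega>) \<le> g (t + s, X s \<omega>) + K * \<delta>" "h (t + s, X' s \<omega>) \<le> h (t + s, X s \<omega>) + K * \<delta>"
    if s: "0 \<le> s" "s \<le> \<tau> \<omega>" for s
  proof -
    have ts: "t + s \<in> {0..T}" by (rule tau(3)[OF t \<tau> \<omega> s])
    have "K * (norm (X s \<omega> - X' s \<omega>) + \<bar>(t + s) - (t + s)\<bar>) \<le> K * \<delta>" using cl[of s] s t0 K_pos by (intro mult_left_mono) auto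
    with lip[OF ts ts, of "X s \<omega>" "X' s \<omega>"]
    show "g (t + s, X' s \<omega>) \<le> g (t + s, X s \<omega>) + K * \<delta>" "h (t + s, X' s \<omega>) \<le> h (t + s, X s \<omega>) + K * \<delta>" by linarith+
  qed
  have e: "exp (- r * s) * y' \<le> exp (- r * s) * y + K * \<delta>" if "0 \<le> s" "y' \<le> y + K * \<delta>" for s y y'
  proof -
    have "exp (- r * s) * y' \<le> exp (- r * s) * (y + K * \<delta>)" using that by (intro mult_left_mono) auto
    moreover have "exp (- r * s) * (K * \<delta>) \<le> 1 * (K * \<delta>)" using exp_bounds(1)[OF that(1)] K_pos \<delta> by (intro mult_right_mono) auto
    ultimately show ?thesis by (simp add: distrib_left)
  qed
  have G: "Gp t X' \<tau> \<omega> \<le> Gp t X \<tau> \<omega> + K * \<delta>" unfolding Gp_def by (rule e[OF t0(1) gh(1)]) (use t0 in auto)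
  note i = set_borel_integral_eq_integral(1)[OF Hp_integrand(1)[OF t \<tau> X \<omega>]]
  note i' = set_borel_integral_eq_integral(1)[OF Hp_integrand(1)[OF t \<tau> X' \<omega>]]
  have "Hp t X' \<tau> \<omega> \<le> integral {0..\<tau> \<omega>} (\<lambda>s. exp (- r * s) * h (t + s, X s \<omega>) + K * \<delta>)"
    unfolding Hp_def by (rule integral_le[OF i']) (use i e gh(2) in \<open>auto intro!: integrable_add\<close>)
  also have "\<dots> = Hp t X \<tau> \<omega> + \<tau> \<omega> * (K * \<delta>)" unfolding Hp_def
    using t0 by (subst Henstock_Kurzweil_Integration.integral_add[OF i]) auto
  also have "\<tau> \<omega> * (K * \<delta>) \<le> T * (K * \<delta>)" using t0 K_pos \<delta> by (intro mult_right_mono) auto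
  finally show ?thesis using G by (simp add: algebra_simps)
qed

text \<open>Outside \<open>B\<close> the rewards differ by the Lipschitz bound; on \<open>B\<close>
  the new ones are at most \<open>C0\<close> and the old ones nonnegative; the control cost does not
  increase under projection. The stopping time is arbitrary because closeness holds at all times of
  \<open>{0..T - t}\<close> simultaneously.\<close>

lemma projected_payoff_le:
  assumes t: "t \<in> {0..T}" and \<tau>: "\<tau> \<in> stop_times M F T t" and c: "(n, \<nu>) \<in> controls M F T" and \<gamma>: "0 < \<gamma>" "\<gamma> \<le> 1"
    and i0: "i0 \<in> D0" and B: "B \<in> sets M"
    and cl: "\<And>\<omega> s. \<omega> \<in> space M - B \<Longrightarrow> s \<in> {0..T - t} \<Longrightarrow>
        norm (St \<gamma> x n \<nu> s \<omega> - St 1 x (\<lambda>s \<omega>. dir D0 i0 (n s \<omega>)) (nubar D0 n \<nu>) s \<omega>) \<le> \<delta>" and \<delta>: "0 \<le> \<delta>"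
  shows "J f 1 t x (\<lambda>s \<omega>. dir D0 i0 (n s \<omega>)) (nubar D0 n \<nu>) \<tau> \<le> J (f_gamma f K \<gamma>) \<gamma> t x n \<nu> \<tau> + K * (1 + T) * \<delta> + C0 * prob B"
proof -
  let ?n = "\<lambda>s \<omega>. dir D0 i0 (n s \<omega>)"
  let ?\<nu> = "nubar D0 n \<nu>"
  have c': "(?n, ?\<nu>) \<in> controls M F T" using projected_control[OF c i0] constrained_subset by blast
  define X where "X = St \<gamma> x n \<nu>"
  define X' where "X' = St 1 x ?n ?\<nu>"
  have X: "cadlag_adapted X" unfolding X_def by (rule state_cadlag[OF c]) (use \<gamma> in auto)
  have X': "cadlag_adapted X'" unfolding X'_def by (rule state_cadlag[OF c']) auto
  have gg: "good_cost (f_gamma f K \<gamma>)" using \<gamma> by (intro good_cost_f_gamma) simp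
  note i = payoff_parts_integrable(1,2)[OF t \<tau> c X] payoff_parts_integrable(3)[OF t \<tau> c gg]
  note i' = payoff_parts_integrable(1,2)[OF t \<tau> c' X'] payoff_parts_integrable(3)[OF t \<tau> c' good_cost_f]
  have "J f 1 t x ?n ?\<nu> \<tau> = (\<integral>\<omega>. Gp t X' \<tau> \<omega> + Hp t X' \<tau> \<omega> + Np t f ?\<nu> \<tau> \<omega> \<partial>M)" by (simp add: payoff_eq X'_def)
  also have "\<dots> \<le> (\<integral>\<omega>. (Gp t X \<tau> \<omega> + Hp t X \<tau> \<omega> + Np t (f_gamma f K \<gamma>) \<nu> \<tau> \<omega>) + (K * (1 + T) * \<delta> + C0 * indicator B \<omega>) \<partial>M)"
  proof (rule integral_mono)
    show "integrable M (\<lambda>\<omega>. Gp t X' \<tau> \<omega> + Hp t X' \<tau> \<omega> + Np t f ?\<nu> \<tau> \<omega>)" using i' by simp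
    show "integrable M (\<lambda>\<omega>. (Gp t X \<tau> \<omega> + Hp t X \<tau> \<omega> + Np t (f_gamma f K \<gamma>) \<nu> \<tau> \<omega>) + (K * (1 + T) * \<delta> + C0 * indicator B \<omega>))"
      using i B by (intro Bochner_Integration.integrable_add integrable_mult_right integrable_real_indicator) (auto simp: emeasure_eq_measure)
    fix \<omega> assume \<omega>: "\<omega> \<in> space M"
    have "Np t f ?\<nu> \<tau> \<omega> \<le> Np t f \<nu> \<tau> \<omega>" by (rule Np_projected[OF t \<tau> c good_cost_f \<omega>])
    also have "\<dots> \<le> 1 * Np t (f_gamma f K \<gamma>) \<nu> \<tau> \<omega>"
      by (rule Np_mono[OF t \<tau> c good_cost_f gg _ \<omega>]) (use gg in \<open>simp add: good_cost_def\<close>)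
    finally have N: "Np t f ?\<nu> \<tau> \<omega> \<le> Np t (f_gamma f K \<gamma>) \<nu> \<tau> \<omega>" by simp
    have "Gp t X' \<tau> \<omega> + Hp t X' \<tau> \<omega> \<le> Gp t X \<tau> \<omega> + Hp t X \<tau> \<omega> + K * (1 + T) * \<delta> + C0 * indicator B \<omega>"
    proof (cases "\<omega> \<in> B")
      case True
      have "0 \<le> K * (1 + T) * \<delta>" using K_pos T_pos \<delta> by simp
      then show ?thesis using True Gp_props(2)[OF t \<tau> X \<omega>] Hp_props(2)[OF t \<tau> X \<omega>] Gp_props(3)[OF t \<tau> X' \<omega>] Hp_props(3)[OF t \<tau> X' \<omega>]
        by (simp add: C0_def)
    next
      case False
      then show ?thesis using GH_close[OF t \<tau> X X' \<omega> \<delta>] cl[of \<omega>] \<omega> by (simp add: X_def X'_def)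
    qed
    with N show "Gp t X' \<tau> \<omega> + Hp t X' \<tau> \<omega> + Np t f ?\<nu> \<tau> \<omega>
       \<le> (Gp t X \<tau> \<omega> + Hp t X \<tau> \<omega> + Np t (f_gamma f K \<gamma>) \<nu> \<tau> \<omega>) + (K * (1 + T) * \<delta> + C0 * indicator B \<omega>)" by linarith
  qed
  also have "\<dots> = (\<integral>\<omega>. Gp t X \<tau> \<omega> + Hp t X \<tau> \<omega> + Np t (f_gamma f K \<gamma>) \<nu> \<tau> \<omega> \<partial>M) + (\<integral>\<omega>. K * (1 + T) * \<delta> + C0 * indicator B \<omega> \<partial>M)"
    using i B by (intro Bochner_Integration.integral_add Bochner_Integration.integrable_add integrable_mult_right integrable_real_indicator) (auto simp: emeasure_eq_measure)
  also have "(\<integral>\<omega>. K * (1 + T) * \<delta> + C0 * indicator B \<omega> \<partial>M) = K * (1 + T) * \<delta> + C0 * prob B"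
    using B sets.sets_into_space[OF B] by (subst Bochner_Integration.integral_add) (auto simp: emeasure_eq_measure prob_space Int_absorb2)
  also have "(\<integral>\<omega>. Gp t X \<tau> \<omega> + Hp t X \<tau> \<omega> + Np t (f_gamma f K \<gamma>) \<nu> \<tau> \<omega> \<partial>M) = J (f_gamma f K \<gamma>) \<gamma> t x n \<nu> \<tau>"
    by (simp add: payoff_eq X_def)
  finally show ?thesis by simp
qed

text \<open>\<open>C1\<close> bounds the mean of \<open>\<nu> (T - t)\<close> for controls whose
  worst payoff is at most \<open>C0\<close>, by inverting \<open>payoff_lower\<close>.
  \<open>C2\<close> is the resulting constant of \<open>solution_stability\<close>.
  \<open>C3\<close> adds the Lipschitz loss for the distance \<open>5 * sqrt \<gamma>\<close> and
  the loss \<open>C0\<close> on the exceptional event.\<close>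

definition C1 :: real where "C1 = C0 * exp (r * T) / f T"
definition C2 :: real where "C2 = (T + T\<^sup>2) * L\<^sup>2 * (4 * C1 * exp ((4 * T + 2) * L\<^sup>2 * T)) + C1 + 2"
definition C3 :: real where "C3 = 5 * K * (1 + T) + C0 * C2"

lemma C3_pos: "0 < C3"
proof -
  have "0 \<le> C1" using C0_nonneg fT_pos by (simp add: C1_def)
  then have "0 \<le> C2" using T_pos unfolding C2_def by (intro add_nonneg_nonneg mult_nonneg_nonneg) auto
  then show ?thesis using K_pos T_pos C0_nonneg unfolding C3_def by (intro add_pos_nonneg) auto
qed

lemma v_upper_le_u_upper:
  assumes t: "t \<in> {0..T}" and \<gamma>: "0 < \<gamma>" "\<gamma> \<le> 1"
  shows "v_upper M F W T D0 b \<kappa> r g h f t x \<le> u_upper M F W T D0 b \<kappa> r g h f K \<gamma> t x + C3 * sqrt \<gamma>"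
proof -
  have gg: "good_cost (f_gamma f K \<gamma>)" using \<gamma> by (intro good_cost_f_gamma) simp
  have "v_upper M F W T D0 b \<kappa> r g h f t x - C3 * sqrt \<gamma> \<le> u_upper M F W T D0 b \<kappa> r g h f K \<gamma> t x"
    unfolding u_upper_def
  proof (rule cINF_greatest)
    show "controls M F T \<noteq> ({} :: ((real \<Rightarrow> 'a \<Rightarrow> real^'d) \<times> _) set)" by (rule cheap_control) (use constrained_subset in blast)
    fix cc :: "(real \<Rightarrow> 'a \<Rightarrow> real^'d) \<times> (real \<Rightarrow> 'a \<Rightarrow> real)" assume cc: "cc \<in> controls M F T"
    obtain n \<nu> where nv: "cc = (n, \<nu>)" by (cases cc)
    have c: "(n, \<nu>) \<in> controls M F T" using cc nv by simp
    define U where "U = (SUP \<tau>\<in>stop_times M F T t. J (f_gamma f K \<gamma>) \<gamma> t x n \<nu> \<tau>)"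
    have le: "J (f_gamma f K \<gamma>) \<gamma> t x n \<nu> \<tau> \<le> U" if "\<tau> \<in> stop_times M F T t" for \<tau>
      unfolding U_def by (rule cSUP_upper[OF that payoff_bdd_above[OF t c _ _ gg]]) (use \<gamma> in auto)
    have "v_upper M F W T D0 b \<kappa> r g h f t x \<le> U + C3 * sqrt \<gamma>"
    proof (cases "C0 < U")
      case True
      obtain n0 \<nu>0 where z: "(n0, \<nu>0) \<in> constrained_controls M F T D0"
        "\<And>k \<gamma> t x \<tau>. t \<in> {0..T} \<Longrightarrow> \<tau> \<in> stop_times M F T t \<Longrightarrow> 0 \<le> \<gamma> \<Longrightarrow> \<gamma> \<le> 1 \<Longrightarrow> good_cost k \<Longrightarrow> J k \<gamma> t x n0 \<nu>0 \<tau> \<le> C0"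
        by (rule cheap_control; blast)
      have "v_upper M F W T D0 b \<kappa> r g h f t x \<le> (SUP \<tau>\<in>stop_times M F T t. J f 1 t x n0 \<nu>0 \<tau>)" by (rule v_upper_le[OF t z(1)])
      also have "\<dots> \<le> C0" by (rule cSUP_least) (use zero_stop_time[OF t] z(2)[OF t _ _ _ good_cost_f] in auto)
      also have "\<dots> \<le> U + C3 * sqrt \<gamma>" using True mult_nonneg_nonneg[OF less_imp_le[OF C3_pos], of "sqrt \<gamma>"] \<gamma> by simp
      finally show ?thesis .
    next
      case False
      obtain i0 where i0: "i0 \<in> D0" using D0_ne by blast
      \<comment> \<open>Stability is applied up to \<open>T - t\<close>: stopping happens no later,
        and the payoff of waiting until then bounds the control only up to that time.\<close>
      have S: "0 \<le> T - t" "T - t \<le> T" using t by auto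
      have "exp (- r * T) * f T * (\<integral>\<omega>. \<nu> (T - t) \<omega> \<partial>M) \<le> J (f_gamma f K \<gamma>) \<gamma> t x n \<nu> (\<lambda>_. T - t)"
        by (rule payoff_lower[OF t c _ _ gg S(1)]) (use \<gamma> in auto)
      also have "\<dots> \<le> C0" using le[OF const_stop_time[OF S(1) order_refl]] False by simp
      finally have "(\<integral>\<omega>. \<nu> (T - t) \<omega> \<partial>M) \<le> C0 / (exp (- r * T) * f T)" using fT_pos by (simp add: pos_le_divide_eq mult.commute)
      also have "\<dots> = C1" by (simp add: C1_def exp_minus field_simps)
      finally have E: "(\<integral>\<omega>. \<nu> (T - t) \<omega> \<partial>M) \<le> C1" .
      have \<gamma>0: "0 \<le> \<gamma>" using \<gamma> by simp
      have d: "norm (gscale D0 \<gamma> (trunc v) - proj D0 v) \<le> \<gamma>" for v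
        using norm_gscale_diff[OF \<gamma>0, of D0 "trunc v"] mult_left_mono[OF norm_trunc[of v] \<gamma>0] by (simp add: proj_def)
      obtain B where B: "B \<in> sets M" "prob B \<le> C2 * sqrt \<gamma>" "\<forall>\<omega>\<in>space M - B. \<forall>s\<in>{0..T - t}.
          norm (St \<gamma> x n \<nu> s \<omega> - St 1 x (\<lambda>s \<omega>. dir D0 i0 (n s \<omega>)) (nubar D0 n \<nu>) s \<omega>) \<le> 5 * sqrt \<gamma>"
        using solution_stability[OF control_forcing[OF c gscale_trunc[OF \<gamma>0 \<gamma>(2)]] control_forcing[OF c proj_measurable norm_proj]
          state_solves[OF c \<gamma>0 \<gamma>(2)] projected_state_solves[OF c i0]
          ctrl_int_close[OF c gscale_trunc[OF \<gamma>0 \<gamma>(2)] proj_measurable norm_proj d] S \<gamma>(1) E, folded C2_def] by blast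
      let ?n = "\<lambda>s \<omega>. dir D0 i0 (n s \<omega>)"
      have "v_upper M F W T D0 b \<kappa> r g h f t x \<le> (SUP \<tau>\<in>stop_times M F T t. J f 1 t x ?n (nubar D0 n \<nu>) \<tau>)"
        by (rule v_upper_le[OF t projected_control[OF c i0]])
      also have "\<dots> \<le> U + C3 * sqrt \<gamma>"
      proof (rule cSUP_least)
        show "stop_times M F T t \<noteq> {}" using zero_stop_time[OF t] by blast
        fix \<tau> assume \<tau>: "\<tau> \<in> stop_times M F T t"
        have "J f 1 t x ?n (nubar D0 n \<nu>) \<tau> \<le> J (f_gamma f K \<gamma>) \<gamma> t x n \<nu> \<tau> + K * (1 + T) * (5 * sqrt \<gamma>) + C0 * prob B"
          by (rule projected_payoff_le[OF t \<tau> c \<gamma> i0 B(1)]) (use B(3) \<gamma> in auto)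
        also have "C0 * prob B \<le> C0 * (C2 * sqrt \<gamma>)" using B(2) C0_nonneg by (rule mult_left_mono)
        finally show "J f 1 t x ?n (nubar D0 n \<nu>) \<tau> \<le> U + C3 * sqrt \<gamma>" using le[OF \<tau>] by (simp add: C3_def algebra_simps)
      qed
      finally show ?thesis .
    qed
    then show "v_upper M F W T D0 b \<kappa> r g h f t x - C3 * sqrt \<gamma> \<le> (SUP \<tau>\<in>stop_times M F T t. J (f_gamma f K \<gamma>) \<gamma> t x (fst cc) (snd cc) \<tau>)"
      by (simp add: U_def nv)
  qed
  then show ?thesis by simp
qed

end

theorem mainTheorem8:
  fixes M :: "'a measure" and F :: "real \<Rightarrow> 'a measure"
    and W :: "real \<Rightarrow> 'a \<Rightarrow> real^'e::finite"
    and T :: real and D0 :: "'d::finite set"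
    and b :: "real^'d \<Rightarrow> real^'d" and \<kappa> :: "real^'d \<Rightarrow> real^'e^'d"
    and r K D1 :: real
    and g h :: "real \<times> (real^'d) \<Rightarrow> real" and f :: "real \<Rightarrow> real"
  assumes space: "usual_filtered_space M F"
    and BM: "brownian_motion M F W"
    and T_pos: "0 < T"
    and D0_ne: "D0 \<noteq> {}" and D1_ne: "D0 \<noteq> UNIV"
    and dims: "CARD('d) \<le> CARD('e)"
    \<comment> \<open>Assumption A\<close>
    and D1_pos: "0 < D1"
    and b_C1: "\<exists>b'. continuous_on UNIV b' \<and>
        (\<forall>x. (b has_derivative blinfun_apply (b' x)) (at x) \<and> norm (b' x) \<le> D1)"
    and \<kappa>_C1: "\<exists>\<kappa>'. continuous_on UNIV \<kappa>' \<and>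
        (\<forall>x. (\<kappa> has_derivative blinfun_apply (\<kappa>' x)) (at x) \<and> norm (\<kappa>' x) \<le> D1)"
    and \<kappa>_rows: "\<forall>x y i. x $ i = y $ i \<longrightarrow> \<kappa> x $ i = \<kappa> y $ i"
    and \<kappa>_elliptic: "\<forall>B. bounded B \<longrightarrow> (\<exists>\<theta>>0. \<forall>x\<in>closure B. \<forall>\<zeta>.
        \<zeta> \<bullet> ((\<kappa> x ** transpose (\<kappa> x)) *v \<zeta>) \<ge> \<theta> * (norm \<zeta>)\<^sup>2)"
    \<comment> \<open>Assumption C\<close>
    and r_nonneg: "0 \<le> r"
    and K_pos: "0 < K"
    and h_smooth: "smooth_on_set ({0..T} \<times> UNIV) h"
    and g_nonneg: "\<forall>t\<in>{0..T}. \<forall>x. 0 \<le> g (t, x)"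
    and h_nonneg: "\<forall>t\<in>{0..T}. \<forall>x. 0 \<le> h (t, x)"
    and compact_supp: "\<exists>R. \<forall>t\<in>{0..T}. \<forall>x. R \<le> norm x \<longrightarrow> g (t, x) = 0 \<and> h (t, x) = 0"
    and f_smooth: "smooth_on_set {0..T} f"
    and f_pos: "\<forall>t\<in>{0..T}. 0 < f t"
    and f_noninc: "antimono_on {0..T} f"
    and lip: "\<forall>s\<in>{0..T}. \<forall>t\<in>{0..T}. \<forall>x y.
        \<bar>g (t, x) - g (s, y)\<bar> + \<bar>h (t, x) - h (s, y)\<bar> \<le> K * (norm (x - y) + \<bar>t - s\<bar>)"
    and g_smooth: "\<exists>G. smooth G \<and> (\<forall>z\<in>{0..T} \<times> UNIV. G z = g z) \<and>
        (\<forall>t\<in>{0..T}. \<forall>x. grad0_norm D0 G (t, x) \<le> f t) \<and>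
        (\<forall>t\<in>{0..T}. \<forall>x. h (t, x) + dt G (t, x) + generator b \<kappa> G (t, x) - r * g (t, x) \<ge> - K)"
    \<comment> \<open>the approximating games have a value\<close>
    and u_value: "\<forall>\<gamma>\<in>{0<..1}. \<forall>t\<in>{0..T}. \<forall>x.
        u_lower M F W T D0 b \<kappa> r g h f K \<gamma> t x = u_upper M F W T D0 b \<kappa> r g h f K \<gamma> t x"
  shows "\<exists>u. (\<forall>t\<in>{0..T}. \<forall>x.
              ((\<lambda>\<gamma>. u_upper M F W T D0 b \<kappa> r g h f K \<gamma> t x) \<longlongrightarrow> u t x) (at_right 0)) \<and>
            (\<forall>t\<in>{0..T}. \<forall>x. v_lower M F W T D0 b \<kappa> r g h f t x = v_upper M F W T D0 b \<kappa> r g h f t x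
                \<and> u t x = v_upper M F W T D0 b \<kappa> r g h f t x) \<and>
            (\<exists>C>0. \<forall>t\<in>{0..T}. \<forall>x. \<forall>\<gamma>\<in>{0<..<1}.
              \<bar>u_upper M F W T D0 b \<kappa> r g h f K \<gamma> t x - v_upper M F W T D0 b \<kappa> r g h f t x\<bar>
                \<le> C * (1 + norm x) * sqrt \<gamma>)"
proof -
  obtain R where R: "\<forall>t\<in>{0..T}. \<forall>x. R \<le> norm x \<longrightarrow> g (t, x) = 0 \<and> h (t, x) = 0" using compact_supp by blast
  \<comment> \<open>Mean value inequality: the bound \<open>D1\<close> on the derivative becomes the
    Lipschitz constant \<open>L\<close> of the locale.\<close>
  have b_lip: "norm (b x - b y) \<le> D1 * norm (x - y)" for x y
  proof -
    obtain b' where b': "\<And>x. (b has_derivative blinfun_apply (b' x)) (at x)" "\<And>x. norm (b' x) \<le> D1" using b_C1 by blast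
    show ?thesis by (rule differentiable_bound[where S=UNIV and f'="\<lambda>x. blinfun_apply (b' x)"])
      (use b' in \<open>auto simp: norm_blinfun.rep_eq[symmetric]\<close>)
  qed
  have \<kappa>_lip: "norm (\<kappa> x - \<kappa> y) \<le> D1 * norm (x - y)" for x y
  proof -
    obtain \<kappa>' where \<kappa>': "\<And>x. (\<kappa> has_derivative blinfun_apply (\<kappa>' x)) (at x)" "\<And>x. norm (\<kappa>' x) \<le> D1" using \<kappa>_C1 by blast
    show ?thesis by (rule differentiable_bound[where S=UNIV and f'="\<lambda>x. blinfun_apply (\<kappa>' x)"])
      (use \<kappa>' in \<open>auto simp: norm_blinfun.rep_eq[symmetric]\<close>)
  qed
  interpret game M F W T D1 b \<kappa> D0 r K R g h f
    by unfold_locales (use assms R b_lip \<kappa>_lip in auto)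
  let ?vl = "\<lambda>t x. v_lower M F W T D0 b \<kappa> r g h f t x"
  let ?vu = "\<lambda>t x. v_upper M F W T D0 b \<kappa> r g h f t x"
  let ?u = "\<lambda>\<gamma> t x. u_upper M F W T D0 b \<kappa> r g h f K \<gamma> t x"
  define C where "C = a0 * C0 + C3"
  have C: "0 < C" "a0 * C0 \<le> C" "C3 \<le> C" using C3_pos a0_nonneg C0_nonneg by (auto simp: C_def add_nonneg_pos)
  \<comment> \<open>The existence of the value enters here: the estimate from above concerns the
    lower value, the estimate from below the upper value, and \<open>u_value\<close> identifies the
    two.\<close>
  have up: "?u \<gamma> t x \<le> ?vl t x + C * sqrt \<gamma>" and lo: "?vu t x \<le> ?u \<gamma> t x + C * sqrt \<gamma>"
    if "t \<in> {0..T}" "0 < \<gamma>" "\<gamma> \<le> 1" for t x \<gamma>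
  proof -
    have s: "0 \<le> sqrt \<gamma>" using that by simp
    have "?u \<gamma> t x = u_lower M F W T D0 b \<kappa> r g h f K \<gamma> t x" using u_value that by simp
    then show "?u \<gamma> t x \<le> ?vl t x + C * sqrt \<gamma>" using u_lower_le[OF that, of x] mult_right_mono[OF C(2) s] by linarith
    show "?vu t x \<le> ?u \<gamma> t x + C * sqrt \<gamma>" using v_upper_le_u_upper[OF that, of x] mult_right_mono[OF C(3) s] by linarith
  qed
  have sq0: "((\<lambda>\<gamma>. c * sqrt \<gamma>) \<longlongrightarrow> 0) (at_right 0)" for c :: real
    by (rule tendsto_eq_intros refl | simp)+
  have small: "eventually (\<lambda>\<gamma>::real. 0 < \<gamma> \<and> \<gamma> \<le> 1) (at_right 0)"
    unfolding eventually_at_right[OF zero_less_one] by (intro exI[of _ 1]) auto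
  \<comment> \<open>Chaining both bounds through the same \<open>?u \<gamma> t x\<close> gives a gap
    of at most \<open>2 * C * sqrt \<gamma>\<close> for every small \<gamma>; letting \<gamma> tend
    to 0 closes it.\<close>
  have eq: "?vl t x = ?vu t x" if t: "t \<in> {0..T}" for t x
  proof (rule antisym[OF v_lower_le_v_upper[OF t]])
    have "eventually (\<lambda>\<gamma>. ?vu t x - ?vl t x \<le> (2 * C) * sqrt \<gamma>) (at_right 0)"
      using small
    proof eventually_elim
      case (elim \<gamma>)
      then show ?case using up[OF t, of \<gamma> x] lo[OF t, of \<gamma> x] by simp
    qed
    then have "?vu t x - ?vl t x \<le> 0" by (rule tendsto_lowerbound[OF sq0]) simp
    then show "?vu t x \<le> ?vl t x" by simp
  qed
  have dist: "\<bar>?u \<gamma> t x - ?vu t x\<bar> \<le> C * sqrt \<gamma>" if "t \<in> {0..T}" "0 < \<gamma>" "\<gamma> \<le> 1" for t x \<gamma>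
    using up[OF that, of x] lo[OF that, of x] eq[OF that(1), of x] by simp
  show ?thesis
  proof (intro exI[of _ ?vu] conjI ballI allI exI[of _ C])
    fix t x assume t: "t \<in> {0..T}"
    show "?vl t x = ?vu t x" "?vu t x = ?vu t x" using eq[OF t] by simp_all
    have "((\<lambda>\<gamma>. ?u \<gamma> t x - ?vu t x) \<longlongrightarrow> 0) (at_right 0)"
    proof (rule Lim_null_comparison[OF _ sq0[of C]])
      show "eventually (\<lambda>\<gamma>. norm (?u \<gamma> t x - ?vu t x) \<le> C * sqrt \<gamma>) (at_right 0)"
        using small by eventually_elim (use dist[OF t] in simp)
    qed
    then show "((\<lambda>\<gamma>. ?u \<gamma> t x) \<longlongrightarrow> ?vu t x) (at_right 0)" by (simp add: LIM_zero_iff)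
  next
    fix t x and \<gamma> :: real assume t: "t \<in> {0..T}" and \<gamma>: "\<gamma> \<in> {0<..<1}"
    have "\<bar>?u \<gamma> t x - ?vu t x\<bar> \<le> C * sqrt \<gamma> * 1" using dist[OF t] \<gamma> by simp
    \<comment> \<open>The bound obtained is uniform in \<open>x\<close>, and
      \<open>1 + norm x\<close> is at least 1.\<close>
    also have "\<dots> \<le> C * sqrt \<gamma> * (1 + norm x)" using C(1) \<gamma> by (intro mult_left_mono) auto
    finally show "\<bar>?u \<gamma> t x - ?vu t x\<bar> \<le> C * (1 + norm x) * sqrt \<gamma>" by (simp add: mult_ac)
  qed (rule C(1))
qed

end
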